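(* Let $\mathcal{F}$ be either of the symbols $\mathcal{A}$ or $\mathcal{S}$ (the assertion holds for both). Let $k$ be an odd integer with $k\ge3$, and let $r,i,j$ be integers with $1\le i\le j\le r\le k-2$. Put $i''=r-j+1$ and $k'=k-r-2$. Let \[ I_{k,r,i,j}=\begin{cases}\{(k_1,\dots,k_r)\in\mathbb{Z}_{\ge1}^r\mid k_1+\dots+k_r=k,\ k_i\ge3\}&\text{if } i=j,\\ \{(k_1,\dots,k_r)\in\mathbb{Z}_{\ge1}^r\mid k_1+\dots+k_r=k,\ k_i\ge2,\ k_j\ge2\}&\text{if } i<j,\end{cases} \] and \[ S_{k,r,i,j}=\sum_{\boldsymbol{k}\in I_{k,r,i,j}}\zeta_{\mathcal{F}}(\boldsymbol{k}),\qquad S^{\star}_{k,r,i,j}=\sum_{\boldsymbol{k}\in I_{k,r,i,j}}\zeta^{\star}_{\mathcal{F}}(\boldsymbol{k}). \] Then \[ S_{k,r,i,j}=(-1)^rS^{\star}_{k,r,i,j}=\tfrac12 N_{k,r,i,j}\,\mathfrak{Z}_{\mathcal{F}}(k), \] where $N_{k,r,i,j}$ is the integer \begin{align*} N_{k,r,i,j}&=(k'+i+1)\biggl(\genfrac{[}{]}{0pt}{}{k-1}{k'+i}-\genfrac{[}{]}{0pt}{}{k-1}{i-1}\biggr)-(k'+i''+1)\biggl(\genfrac{[}{]}{0pt}{}{k-1}{k'+i''}-\genfrac{[}{]}{0pt}{}{k-1}{i''-1}\biggr)\\ &\quad+k\biggl(\genfrac{[}{]}{0pt}{}{k-2}{k'+i-1}-\genfrac{[}{]}{0pt}{}{k-2}{i-2}-\genfrac{[}{]}{0pt}{}{k-2}{k'+i''-1}+\genfrac{[}{]}{0pt}{}{k-2}{i''-2}\biggr).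 \end{align*}
   Context: For $a\in\mathbb{Z}_{\ge0}$ and $b\in\mathbb{Z}$, $\genfrac{[}{]}{0pt}{}{a}{b}=(-1)^b\binom{a}{b}$, with the convention $\binom{a}{b}=0$ if $b\notin\{0,\dots,a\}$. Finite values: let $\mathcal{A}=\prod_p\mathbb{F}_p/\bigoplus_p\mathbb{F}_p$, $p$ running over all primes; this is a $\mathbb{Q}$-algebra, and an element is determined by its components at all but finitely many $p$. For $k_1,\dots,k_r\in\mathbb{Z}_{\ge1}$, \[ \zeta_{\mathcal{A}}(k_1,\dots,k_r)=\Bigl(\sum_{p>m_1>\dots>m_r\ge1}\tfrac{1}{m_1^{k_1}\cdots m_r^{k_r}}\bmod p\Bigr)_p,\qquad \zeta_{\mathcal{A}}^{\star}(k_1,\dots,k_r)=\Bigl(\sum_{p>m_1\ge\dots\ge m_r\ge1}\tfrac{1}{m_1^{k_1}\cdots m_r^{k_r}}\bmod p\Bigr)_p\in\mathcal{A}. \] Symmetric values: for $k_1\ge2$ the multiple zeta(-star) values are $\zeta(k_1,\dots,k_r)=\sum_{m_1>\dots>m_r\ge1}m_1^{-k_1}\cdots m_r^{-k_r}$ and $\zeta^{\star}(k_1,\dots,k_r)=\sum_{m_1\ge\dots\ge m_r\ge1}m_1^{-k_1}\cdots m_r^{-k_r}$, with $\zeta(\emptyset)=\zeta^{\star}(\emptyset)=1$; let $\mathcal{Z}$ be the $\mathbb{Q}$-linear subspace of $\mathbb{R}$ spanned by the multiple zeta values (including $\zeta(\emptyset)=1$). If $k_1=1$, $\zeta(k_1,\dots,k_r)\in\mathcal{Z}$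 denotes the (say harmonic) regularised value: the regularised $\zeta$ is the unique extension of $\zeta$ to all indices that is multiplicative for the harmonic (stuffle) product and satisfies $\zeta(1)=0$; and the regularised $\zeta^{\star}(k_1,\dots,k_r)$ is the sum of the regularised $\zeta(\boldsymbol{l})$ over the $2^{r-1}$ indices $\boldsymbol{l}$ obtained from $(k_1,\dots,k_r)$ by replacing some (possibly none) of the commas by plus signs. (Using the shuffle regularisation instead gives the same symmetric values below.) For $k_1,\dots,k_r\in\mathbb{Z}_{\ge1}$, \[ \zeta_{\mathcal{S}}(k_1,\dots,k_r)=\sum_{j=0}^{r}(-1)^{k_1+\dots+k_j}\zeta(k_j,\dots,k_1)\zeta(k_{j+1},\dots,k_r)\bmod\zeta(2)\in\mathcal{Z}/\zeta(2)\mathcal{Z}, \] and $\zeta_{\mathcal{S}}^{\star}(k_1,\dots,k_r)\in\mathcal{Z}/\zeta(2)\mathcal{Z}$ is defined by the same formula with $\zeta$ replaced by $\zeta^{\star}$. For $k\in\mathbb{Z}_{\ge2}$, $\mathfrak{Z}_{\mathcal{A}}(k)=(B_{p-k}/k\bmod p)_p\in\mathcal{A}$ (defined for all sufficiently large $p$), where $B_n$ is the $n$-th Bernoulli number, and $\mathfrak{Z}_{\mathcal{S}}(k)=\zeta(k)\bmod\zeta(2)\in\mathcal{Z}/\zeta(2)\mathcal{Z}$. *)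

theory Defs
  imports "HOL-Analysis.Analysis" "HOL-Number_Theory.Number_Theory"
begin

subsection \<open>Indices and sums over indices\<close>

definition is_index :: "nat list \<Rightarrow> bool" where
  "is_index ks \<longleftrightarrow> (\<forall>k\<in>set ks. 1 \<le> k)"

definition harmonic_term :: "nat list \<Rightarrow> nat list \<Rightarrow> 'a::field_char_0" where
  "harmonic_term ks ms = (\<Prod>l<length ks. 1 / of_nat (ms ! l) ^ (ks ! l))"

text \<open>The sequences \<open>m\<^sub>1 > \<dots> > m\<^sub>r \<ge> 1\<close> and \<open>m\<^sub>1 \<ge> \<dots> \<ge> m\<^sub>r \<ge> 1\<close>. For \<open>r = 0\<close> there is exactly one,
  the empty one.\<close>

definition strict_seqs :: "nat \<Rightarrow> nat list set" where
  "strict_seqs r = {ms. length ms = r \<and> sorted_wrt (>) ms \<and> (\<forall>m\<in>set ms. 1 \<le> m)}"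

definition weak_seqs :: "nat \<Rightarrow> nat list set" where
  "weak_seqs r = {ms. length ms = r \<and> sorted_wrt (\<ge>) ms \<and> (\<forall>m\<in>set ms. 1 \<le> m)}"


subsection \<open>The \<open>\<rat>\<close>-algebra \<open>\<A>\<close>\<close>

text \<open>The reduction modulo \<open>p\<close> of a rational number; only meaningful if \<open>p\<close> does not divide the
  denominator. As \<^const>\<open>modular_inverse\<close> is total, other primes get a dummy value.\<close>

definition rat_mod :: "nat \<Rightarrow> rat \<Rightarrow> int" where
  "rat_mod p q = fst (quotient_of q) * modular_inverse (int p) (snd (quotient_of q)) mod int p"

text \<open>A family in \<open>\<Prod>\<^sub>p \<F>\<^sub>p\<close> is represented by integers \<open>f p\<close>, read modulo \<open>p\<close>; the values of \<open>f\<close> at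
  non-primes are ignored. Two families are identified if they agree at all but finitely many
  primes, that is, if they differ by an element of \<open>\<Oplus>\<^sub>p \<F>\<^sub>p\<close>.\<close>

definition finite_adele_rel :: "(nat \<Rightarrow> int) \<Rightarrow> (nat \<Rightarrow> int) \<Rightarrow> bool" where
  "finite_adele_rel f g \<longleftrightarrow> finite {p. prime p \<and> \<not> [f p = g p] (mod int p)}"

lemma finite_adele_relI:
  assumes "finite_adele_rel f f'" "finite_adele_rel g g'"
    and "\<And>p. [f p = f' p] (mod int p) \<Longrightarrow> [g p = g' p] (mod int p) \<Longrightarrow> [h p = h' p] (mod int p)"
  shows "finite_adele_rel h h'"
proof -
  have "finite ({p. prime p \<and> \<not> [f p = f' p] (mod int p)} \<union>
                {p. prime p \<and> \<not> [g p = g' p] (mod int p)})"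
    using assms(1,2) by (simp add: finite_adele_rel_def)
  then show ?thesis
    unfolding finite_adele_rel_def
    by (rule rev_finite_subset) (use assms(3) in blast)
qed

lemma finite_adele_rel_refl: "finite_adele_rel f f"
  by (simp add: finite_adele_rel_def)

lemma equivp_finite_adele_rel: "equivp finite_adele_rel"
proof (rule equivpI)
  show "reflp finite_adele_rel"
    by (rule reflpI) (rule finite_adele_rel_refl)
  show "symp finite_adele_rel"
    by (rule sympI) (simp add: finite_adele_rel_def cong_sym_eq)
  show "transp finite_adele_rel"
    by (rule transpI) (erule (1) finite_adele_relI, rule cong_trans)
qed

quotient_type finite_adele = "nat \<Rightarrow> int" / finite_adele_rel
  morphisms rep_finite_adele abs_finite_adele
  by (rule equivp_finite_adele_rel)

instantiation finite_adele :: comm_ring_1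
begin

lift_definition zero_finite_adele :: finite_adele is "\<lambda>p. 0" .

lift_definition one_finite_adele :: finite_adele is "\<lambda>p. 1" .

lift_definition plus_finite_adele :: "finite_adele \<Rightarrow> finite_adele \<Rightarrow> finite_adele"
  is "\<lambda>f g p. f p + g p"
  by (erule (1) finite_adele_relI) (rule cong_add)

lift_definition minus_finite_adele :: "finite_adele \<Rightarrow> finite_adele \<Rightarrow> finite_adele"
  is "\<lambda>f g p. f p - g p"
  by (erule (1) finite_adele_relI) (rule cong_diff)

lift_definition uminus_finite_adele :: "finite_adele \<Rightarrow> finite_adele"
  is "\<lambda>f p. - f p"
  by (erule finite_adele_relI[OF _ finite_adele_rel_refl]) (simp add: cong_minus_minus_iff)

lift_definition times_finite_adele :: "finite_adele \<Rightarrow> finite_adele \<Rightarrow> finite_adele"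
  is "\<lambda>f g p. f p * g p"
  by (erule (1) finite_adele_relI) (rule cong_mult)

instance
proof
  show "(0::finite_adele) \<noteq> 1"
  proof transfer
    have "{p::nat. prime p \<and> \<not> [0 = 1] (mod int p)} = {p. prime p}"
      by (auto simp: cong_def dest: prime_gt_1_nat)
    then show "\<not> finite_adele_rel (\<lambda>p. 0) (\<lambda>p. 1)"
      using primes_infinite by (simp add: finite_adele_rel_def)
  qed
qed (transfer; simp add: algebra_simps finite_adele_rel_refl)+

end

lift_definition scale_finite_adele :: "rat \<Rightarrow> finite_adele \<Rightarrow> finite_adele"
  is "\<lambda>q f p. rat_mod p q * f p"
  by (erule finite_adele_relI[OF _ finite_adele_rel_refl]) (rule cong_mult[OF cong_refl])

lemma rat_mod_cong:
  assumes p: "prime p" and b: "\<not> int p dvd b" and q: "q = of_int a / of_int b"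
  shows "[b * rat_mod p q = a] (mod int p)"
proof -
  obtain n d where nd: "quotient_of q = (n, d)" by force
  have d0: "d > 0" and cop: "coprime n d"
    using quotient_of_denom_pos[OF nd] quotient_of_coprime[OF nd] by auto
  have b0: "b \<noteq> 0" using b by auto
  have "(of_int (a * d) :: rat) = of_int (n * b)"
    using q quotient_of_div[OF nd] d0 b0 by (simp add: field_simps)
  then have eq: "a * d = n * b" by (simp only: of_int_eq_iff)
  have "d dvd b"
    using eq cop by (metis coprime_commute coprime_dvd_mult_right_iff dvd_triv_right)
  then have "\<not> int p dvd d" using b dvd_trans by blast
  then have "coprime d (int p)"
    using p by (metis coprime_commute prime_imp_coprime prime_int_nat_transfer nat_int of_nat_0_le_iff)
  from cong_modular_inverse1[OF this]
  have inv: "[d * modular_inverse (int p) d = 1] (mod int p)" .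
  obtain e where e: "b = d * e" using \<open>d dvd b\<close> by blast
  have a: "a = n * e" using eq d0 by (simp add: e)
  have "[b * rat_mod p q = b * (n * modular_inverse (int p) d)] (mod int p)"
    by (rule cong_mult[OF cong_refl]) (simp add: rat_mod_def nd cong_def)
  also have "b * (n * modular_inverse (int p) d) = (n * e) * (d * modular_inverse (int p) d)"
    by (simp add: e)
  also have "[\<dots> = (n * e) * 1] (mod int p)"
    by (rule cong_mult[OF cong_refl inv])
  finally show ?thesis by (simp add: a)
qed

lemma finite_prime_divisors_int:
  assumes "(b::int) \<noteq> 0"
  shows "finite {p::nat. prime p \<and> int p dvd b}"
proof (rule finite_subset)
  show "{p::nat. prime p \<and> int p dvd b} \<subseteq> {..nat \<bar>b\<bar>}"
    using assms by (auto dest!: dvd_imp_le_int)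
qed simp

lemma finite_adele_rel_cofiniteI:
  assumes "(b::int) \<noteq> 0"
    and "\<And>p. prime p \<Longrightarrow> \<not> int p dvd b \<Longrightarrow> [b * f p = b * g p] (mod int p)"
  shows "finite_adele_rel f g"
  unfolding finite_adele_rel_def
proof (rule finite_subset[OF _ finite_prime_divisors_int[OF assms(1)]], safe)
  fix p :: nat assume p: "prime p" and nc: "\<not> [f p = g p] (mod int p)"
  show "int p dvd b"
  proof (rule ccontr)
    assume nd: "\<not> int p dvd b"
    then have "coprime b (int p)"
      using p by (metis coprime_commute prime_imp_coprime prime_int_nat_transfer nat_int of_nat_0_le_iff)
    then show False
      using assms(2)[OF p nd] nc by (simp add: cong_mult_lcancel)
  qed
qed

global_interpretation finite_adele: vector_space scale_finite_adele
proof
  have rep: "\<exists>a b. b \<noteq> 0 \<and> q = of_int a / of_int b" for q :: rat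
    by (metis quotient_of_denom_pos quotient_of_div surj_pair less_irrefl)
  fix q s :: rat and x y :: finite_adele
  obtain a b where b: "b \<noteq> 0" and q: "q = of_int a / of_int b" using rep by blast
  obtain c d where d: "d \<noteq> 0" and s: "s = of_int c / of_int d" using rep by blast
  have bd: "b * d \<noteq> 0" using b d by simp
  show "scale_finite_adele q (x + y) = scale_finite_adele q x + scale_finite_adele q y"
    by transfer (simp add: algebra_simps finite_adele_rel_refl)
  show "scale_finite_adele (q + s) x = scale_finite_adele q x + scale_finite_adele s x"
  proof (transfer fixing: q s, rule finite_adele_rel_cofiniteI[OF bd])
    fix f :: "nat \<Rightarrow> int" and p :: nat
    assume p: "prime p" and nd: "\<not> int p dvd b * d"
    have qs: "q + s = of_int (a * d + c * b) / of_int (b * d)"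
      using b d by (simp add: q s field_simps)
    have ndb: "\<not> int p dvd b" and ndd: "\<not> int p dvd d" using nd by auto
    have 1: "[b * d * rat_mod p (q + s) = a * d + c * b] (mod int p)"
      by (rule rat_mod_cong[OF p nd qs])
    have 2: "[(b * rat_mod p q) * d + (d * rat_mod p s) * b = a * d + c * b] (mod int p)"
      by (intro cong_add cong_mult cong_refl rat_mod_cong[OF p ndb q] rat_mod_cong[OF p ndd s])
    from cong_mult[OF cong_trans[OF 1 cong_sym[OF 2]] cong_refl[of "f p"]]
    show "[b * d * (rat_mod p (q + s) * f p) =
           b * d * (rat_mod p q * f p + rat_mod p s * f p)] (mod int p)"
      by (simp add: algebra_simps)
  qed
  show "scale_finite_adele q (scale_finite_adele s x) = scale_finite_adele (q * s) x"
  proof (transfer fixing: q s, rule finite_adele_rel_cofiniteI[OF bd])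
    fix f :: "nat \<Rightarrow> int" and p :: nat
    assume p: "prime p" and nd: "\<not> int p dvd b * d"
    have qs: "q * s = of_int (a * c) / of_int (b * d)"
      by (simp add: q s)
    have ndb: "\<not> int p dvd b" and ndd: "\<not> int p dvd d" using nd by auto
    have 1: "[b * d * rat_mod p (q * s) = a * c] (mod int p)"
      by (rule rat_mod_cong[OF p nd qs])
    have 2: "[(b * rat_mod p q) * (d * rat_mod p s) = a * c] (mod int p)"
      by (intro cong_mult rat_mod_cong[OF p ndb q] rat_mod_cong[OF p ndd s])
    from cong_mult[OF cong_trans[OF 2 cong_sym[OF 1]] cong_refl[of "f p"]]
    show "[b * d * (rat_mod p q * (rat_mod p s * f p)) =
           b * d * (rat_mod p (q * s) * f p)] (mod int p)"
      by (simp add: algebra_simps)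
  qed
  show "scale_finite_adele 1 x = x"
  proof (transfer, rule finite_adele_rel_cofiniteI[of 1])
    fix f :: "nat \<Rightarrow> int" and p :: nat
    assume p: "prime p" and nd: "\<not> int p dvd 1"
    have "[1 * rat_mod p 1 = 1] (mod int p)" by (rule rat_mod_cong[OF p nd]) simp
    from cong_mult[OF this cong_refl[of "f p"]]
    show "[1 * (rat_mod p 1 * f p) = 1 * f p] (mod int p)" by simp
  qed simp
qed


subsection \<open>Finite multiple zeta values\<close>

text \<open>The sums are formed in \<open>\<rat>\<close> and then reduced; their denominators are prime to \<open>p\<close>
  because all the \<open>m\<^sub>l\<close> are smaller than \<open>p\<close>.\<close>

definition zeta_A :: "nat list \<Rightarrow> finite_adele" where
  "zeta_A ks = abs_finite_adele (\<lambda>p. rat_mod p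
     (\<Sum>ms\<in>{ms\<in>strict_seqs (length ks). \<forall>m\<in>set ms. m < p}. harmonic_term ks ms))"

definition zeta_star_A :: "nat list \<Rightarrow> finite_adele" where
  "zeta_star_A ks = abs_finite_adele (\<lambda>p. rat_mod p
     (\<Sum>ms\<in>{ms\<in>weak_seqs (length ks). \<forall>m\<in>set ms. m < p}. harmonic_term ks ms))"

fun bernoulli :: "nat \<Rightarrow> rat" where
  "bernoulli 0 = 1"
| "bernoulli (Suc n) = - (\<Sum>l\<le>n. of_nat (Suc (Suc n) choose l) * bernoulli l) / of_nat (Suc (Suc n))"

declare bernoulli.simps(2) [simp del]

text \<open>For \<open>p \<le> k\<close> the component below is a dummy value; only finitely many primes are affected.
  For \<open>p > k \<ge> 2\<close> the denominator of \<open>B\<^bsub>p-k\<^esub>/k\<close> is prime to \<open>p\<close> by von Staudt--Clausen.\<close>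

definition Zfrak_A :: "nat \<Rightarrow> finite_adele" where
  "Zfrak_A k = abs_finite_adele (\<lambda>p. rat_mod p (bernoulli (p - k) / of_nat k))"


subsection \<open>Multiple zeta values and their harmonic regularisation\<close>

definition admissible :: "nat list \<Rightarrow> bool" where
  "admissible ks \<longleftrightarrow> is_index ks \<and> (ks = [] \<or> 2 \<le> hd ks)"

definition mzv :: "nat list \<Rightarrow> real" where
  "mzv ks = (\<Sum>\<^sub>\<infinity>ms\<in>strict_seqs (length ks). harmonic_term ks ms)"

definition mzv_star :: "nat list \<Rightarrow> real" where
  "mzv_star ks = (\<Sum>\<^sub>\<infinity>ms\<in>weak_seqs (length ks). harmonic_term ks ms)"

text \<open>The harmonic product of two indices, as the list (with multiplicities) of its terms.\<close>

fun stuffle :: "nat list \<Rightarrow> nat list \<Rightarrow> nat list list" where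
  "stuffle [] ls = [ls]"
| "stuffle (k # ks) [] = [k # ks]"
| "stuffle (k # ks) (l # ls) =
     map ((#) k) (stuffle ks (l # ls)) @ map ((#) l) (stuffle (k # ks) ls) @
     map ((#) (k + l)) (stuffle ks ls)"

text \<open>The first condition only fixes the values at lists that are not indices, so that the
  function is unique as a function on all lists.\<close>

definition is_harmonic_regularisation :: "(nat list \<Rightarrow> real) \<Rightarrow> bool" where
  "is_harmonic_regularisation f \<longleftrightarrow>
     (\<forall>ks. \<not> is_index ks \<longrightarrow> f ks = 0) \<and>
     (\<forall>ks. admissible ks \<longrightarrow> f ks = mzv ks) \<and>
     (\<forall>ks ls. is_index ks \<longrightarrow> is_index ls \<longrightarrow> f ks * f ls = sum_list (map f (stuffle ks ls))) \<and>
     f [1] = 0"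

definition mzv_reg :: "nat list \<Rightarrow> real" where
  "mzv_reg = (THE f. is_harmonic_regularisation f)"

text \<open>The \<open>2\<^bsup>r-1\<^esup>\<close> indices obtained by replacing some of the commas by plus signs.\<close>

fun contractions :: "nat list \<Rightarrow> nat list list" where
  "contractions [] = [[]]"
| "contractions [k] = [[k]]"
| "contractions (k # l # ks) = map ((#) k) (contractions (l # ks)) @ contractions ((k + l) # ks)"

definition mzv_star_reg :: "nat list \<Rightarrow> real" where
  "mzv_star_reg ks =
     (if admissible ks then mzv_star ks else sum_list (map mzv_reg (contractions ks)))"


subsection \<open>The space \<open>\<Z>/\<zeta>(2)\<Z>\<close>\<close>

global_interpretation rat_real: vector_space "\<lambda>(q::rat) (x::real). of_rat q * x"
  by standard (simp_all add: algebra_simps of_rat_add of_rat_mult)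

definition mzv_space :: "real set" where
  "mzv_space = rat_real.span (mzv ` {ks. admissible ks})"

definition mzv_quot_rel :: "real \<Rightarrow> real \<Rightarrow> bool" where
  "mzv_quot_rel x y \<longleftrightarrow> x \<in> mzv_space \<and> y \<in> mzv_space \<and> (\<exists>z\<in>mzv_space. x - y = mzv [2] * z)"

lemma mzv_space_0: "0 \<in> mzv_space"
  unfolding mzv_space_def by (rule rat_real.span_zero)

lemma mzv_space_add: "x \<in> mzv_space \<Longrightarrow> y \<in> mzv_space \<Longrightarrow> x + y \<in> mzv_space"
  unfolding mzv_space_def by (rule rat_real.span_add)

lemma mzv_space_diff: "x \<in> mzv_space \<Longrightarrow> y \<in> mzv_space \<Longrightarrow> x - y \<in> mzv_space"
  unfolding mzv_space_def by (rule rat_real.span_diff)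

lemma mzv_space_uminus: "x \<in> mzv_space \<Longrightarrow> - x \<in> mzv_space"
  unfolding mzv_space_def by (rule rat_real.span_neg)

lemma mzv_space_scale: "x \<in> mzv_space \<Longrightarrow> of_rat q * x \<in> mzv_space"
  unfolding mzv_space_def by (rule rat_real.span_scale)

lemma mzv_quot_rel_refl: "x \<in> mzv_space \<Longrightarrow> mzv_quot_rel x x"
  unfolding mzv_quot_rel_def using mzv_space_0 by force

lemma mzv_quot_rel_add:
  "mzv_quot_rel x x' \<Longrightarrow> mzv_quot_rel y y' \<Longrightarrow> mzv_quot_rel (x + y) (x' + y')"
  unfolding mzv_quot_rel_def
  by (auto simp: add_diff_add distrib_left[symmetric] intro!: mzv_space_add)

lemma mzv_quot_rel_scale: "mzv_quot_rel x y \<Longrightarrow> mzv_quot_rel (of_rat q * x) (of_rat q * y)"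
  unfolding mzv_quot_rel_def
  by (auto simp: right_diff_distrib[symmetric] mult.left_commute intro!: mzv_space_scale)

lemma mzv_quot_rel_uminus: "mzv_quot_rel x y \<Longrightarrow> mzv_quot_rel (- x) (- y)"
  using mzv_quot_rel_scale[of x y "-1"] by (simp add: of_rat_minus)

lemma mzv_quot_rel_diff:
  "mzv_quot_rel x x' \<Longrightarrow> mzv_quot_rel y y' \<Longrightarrow> mzv_quot_rel (x - y) (x' - y')"
  using mzv_quot_rel_add[OF _ mzv_quot_rel_uminus, of x x' y y'] by simp

lemma part_equivp_mzv_quot_rel: "part_equivp mzv_quot_rel"
proof (rule part_equivpI)
  show "\<exists>x. mzv_quot_rel x x"
    using mzv_quot_rel_refl mzv_space_0 by blast
  show "symp mzv_quot_rel"
  proof (rule sympI)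
    fix x y assume "mzv_quot_rel x y"
    then obtain z where "x \<in> mzv_space" "y \<in> mzv_space" "z \<in> mzv_space" "x - y = mzv [2] * z"
      by (auto simp: mzv_quot_rel_def)
    moreover from this have "y - x = mzv [2] * (- z)" by simp
    ultimately show "mzv_quot_rel y x"
      unfolding mzv_quot_rel_def by (blast intro: mzv_space_uminus)
  qed
  show "transp mzv_quot_rel"
  proof (rule transpI)
    fix x y z assume xy: "mzv_quot_rel x y" and yz: "mzv_quot_rel y z"
    from mzv_quot_rel_add[OF xy yz]
    have "\<exists>w\<in>mzv_space. x - z = mzv [2] * w" by (simp add: mzv_quot_rel_def)
    with xy yz show "mzv_quot_rel x z" by (simp add: mzv_quot_rel_def)
  qed
qed

text \<open>The representatives range over \<open>\<Z>\<close> only, hence the partial quotient. \<open>mod_zeta2\<close>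
  sends \<open>x \<in> \<Z>\<close> to its class; it is only meaningful on \<open>\<Z>\<close>.\<close>

quotient_type mzv_quot = real / partial: mzv_quot_rel
  morphisms rep_mzv_quot mod_zeta2
  by (rule part_equivp_mzv_quot_rel)

instantiation mzv_quot :: ab_group_add
begin

lift_definition zero_mzv_quot :: mzv_quot is 0
  by (rule mzv_quot_rel_refl[OF mzv_space_0])

lift_definition plus_mzv_quot :: "mzv_quot \<Rightarrow> mzv_quot \<Rightarrow> mzv_quot" is "(+)"
  by (rule mzv_quot_rel_add)

lift_definition minus_mzv_quot :: "mzv_quot \<Rightarrow> mzv_quot \<Rightarrow> mzv_quot" is "(-)"
  by (rule mzv_quot_rel_diff)

lift_definition uminus_mzv_quot :: "mzv_quot \<Rightarrow> mzv_quot" is uminus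
  by (rule mzv_quot_rel_uminus)

instance
proof
  fix a b c :: mzv_quot
  show "a + b + c = a + (b + c)"
    by transfer (auto simp: add.assoc mzv_quot_rel_def intro!: mzv_space_add mzv_space_0)
  show "a + b = b + a"
    by transfer (auto simp: add.commute mzv_quot_rel_def intro!: mzv_space_add mzv_space_0)
  show "0 + a = a"
    by transfer simp
  show "- a + a = 0"
    by transfer (auto simp: mzv_quot_rel_def mzv_space_0)
  show "a - b = a + - b"
    by transfer (metis add_uminus_conv_diff mzv_quot_rel_diff)
qed

end

lift_definition scale_mzv_quot :: "rat \<Rightarrow> mzv_quot \<Rightarrow> mzv_quot" is "\<lambda>q x. of_rat q * x"
  by (rule mzv_quot_rel_scale)

global_interpretation mzv_quot: vector_space scale_mzv_quot
proof
  fix q s :: rat and x y :: mzv_quot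
  show "scale_mzv_quot q (x + y) = scale_mzv_quot q x + scale_mzv_quot q y"
    by transfer (metis distrib_left mzv_quot_rel_add mzv_quot_rel_scale)
  show "scale_mzv_quot (q + s) x = scale_mzv_quot q x + scale_mzv_quot s x"
    by transfer (metis distrib_right of_rat_add mzv_quot_rel_scale)
  show "scale_mzv_quot q (scale_mzv_quot s x) = scale_mzv_quot (q * s) x"
    by transfer (metis mult.assoc of_rat_mult mzv_quot_rel_scale)
  show "scale_mzv_quot 1 x = x"
    by transfer simp
qed


subsection \<open>Symmetric multiple zeta values\<close>

definition zeta_S :: "nat list \<Rightarrow> mzv_quot" where
  "zeta_S ks = mod_zeta2 (\<Sum>j\<le>length ks.
     (-1) ^ sum_list (take j ks) * mzv_reg (rev (take j ks)) * mzv_reg (drop j ks))"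

definition zeta_star_S :: "nat list \<Rightarrow> mzv_quot" where
  "zeta_star_S ks = mod_zeta2 (\<Sum>j\<le>length ks.
     (-1) ^ sum_list (take j ks) * mzv_star_reg (rev (take j ks)) * mzv_star_reg (drop j ks))"

definition Zfrak_S :: "nat \<Rightarrow> mzv_quot" where
  "Zfrak_S k = mod_zeta2 (mzv [k])"


subsection \<open>The index sets and the coefficients\<close>

definition signed_binomial :: "nat \<Rightarrow> int \<Rightarrow> int" where
  "signed_binomial a b = (if 0 \<le> b \<and> b \<le> int a then (-1) ^ nat b * int (a choose nat b) else 0)"

text \<open>Positions are counted from 1, so \<open>k\<^sub>i\<close> is \<open>ks ! (i - 1)\<close>.\<close>

definition index_set :: "nat \<Rightarrow> nat \<Rightarrow> nat \<Rightarrow> nat \<Rightarrow> nat list set" where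
  "index_set k r i j =
     (if i = j
      then {ks. length ks = r \<and> is_index ks \<and> sum_list ks = k \<and> 3 \<le> ks ! (i - 1)}
      else {ks. length ks = r \<and> is_index ks \<and> sum_list ks = k \<and> 2 \<le> ks ! (i - 1) \<and> 2 \<le> ks ! (j - 1)})"

definition N_coeff :: "int \<Rightarrow> int \<Rightarrow> int \<Rightarrow> int \<Rightarrow> int" where
  "N_coeff k r i j =
     (let i'' = r - j + 1; k' = k - r - 2;
          br1 = signed_binomial (nat (k - 1)); br2 = signed_binomial (nat (k - 2))
      in (k' + i + 1) * (br1 (k' + i) - br1 (i - 1))
         - (k' + i'' + 1) * (br1 (k' + i'') - br1 (i'' - 1))
         + k * (br2 (k' + i - 1) - br2 (i - 2) - br2 (k' + i'' - 1) + br2 (i'' - 2)))"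

end

theory Submission
  imports Defs "HOL-Computational_Algebra.Formal_Power_Series"
begin

text \<open>Both cases come from one argument about lists \<open>X\<^sub>n\<close> of numbers: \<open>p - 1, \<dots>, 1\<close> modulo \<open>p\<close> for
  \<open>\<F> = \<A>\<close>, and \<open>-1, \<dots>, -N, N, \<dots>, 1\<close> in the limit modulo \<open>\<zeta>(2)\<close> for \<open>\<F> = \<S>\<close>; the cancellation of
  divergences makes the limit of the sums over the latter list equal to the symmetric value. The power
  sums of \<open>X\<^sub>n\<close> are null, hence so are the elementary symmetric functions. The restricted sum is a
  coefficient of a generating function in \<open>t\<close>; multiplied by \<open>\<Prod>(1 - t / x)\<close>, which is trivial modulo
  null elements, it only involves the values at \<open>(1, \<dots>, 1, 3, 1, \<dots>, 1)\<close> and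
  \<open>(1, \<dots>, 1, 2, 1, \<dots>, 1, 2, 1, \<dots>, 1)\<close>. The antipode relation gives the star version.

  Those extremal values are multiples of \<open>\<zeta>(k)\<close> or of its finite analogue. For \<open>\<A>\<close> this follows from
  Hoffman's duality, which turns them into star sums of depth three and so into sums of depth two, and
  from Faulhaber's formula.
  For \<open>\<S>\<close> they are congruent to series over \<open>n\<close> of complete sums up to \<open>n\<close> times strict sums below \<open>n\<close>;
  connected sums evaluate these as combinations of double zeta values, and the double shuffle
  relations determine the double zeta values of odd weight modulo \<open>\<zeta>(2)\<close>.\<close>

section \<open>Nested sums over lists\<close>

text \<open>Reversing an index changes its value, modulo null elements, by the sign of the weight.
  In odd weight this makes the answer antisymmetric under the exchange of i and r - j + 1, which is
  visible in N. After the multiplication by the product, the sums that define N are k-th alternating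
  differences of a polynomial of degree below k. The whole difference vanishes, and the closed form
  of N is what the boundary terms m = 0, k - 1, k leave behind.

  The two symbols part ways at the extremal values because the duality is proved from the congruence
  of C(p - 1, j) and (-1)^j modulo p. It then trades long runs of ones for depth three, where parity
  applies. For S the runs of ones have to be removed analytically, and the generating function of
  complete sums is what the connected sums deliver.

  A further obstacle for S is that regularised values are given only by a uniqueness property. They
  are realised as limits of nested sums over finite lists, because stuffle, antipode and reversal
  hold for every finite list and so pass to the limit.\<close>

fun strict_sum :: "'x list \<Rightarrow> ('x \<Rightarrow> 'b::comm_ring_1) list \<Rightarrow> 'b" where
  "strict_sum X [] = 1"
| "strict_sum [] (f # fs) = 0"
| "strict_sum (x # X) (f # fs) = strict_sum X (f # fs) + f x * strict_sum X fs"

fun weak_sum :: "'x list \<Rightarrow> ('x \<Rightarrow> 'b::comm_ring_1) list \<Rightarrow> 'b" where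
  "weak_sum X [] = 1"
| "weak_sum [] (f # fs) = 0"
| "weak_sum (x # X) (f # fs) = weak_sum X (f # fs) + f x * weak_sum (x # X) fs"

lemma strict_sum_Nil: "strict_sum [] fs = (if fs = [] then 1 else 0)"
  by (cases fs) auto

lemma weak_sum_Nil: "weak_sum [] fs = (if fs = [] then 1 else 0)"
  by (cases fs) auto

lemma strict_sum_append:
  "strict_sum (X @ Y) fs = (\<Sum>j\<le>length fs. strict_sum X (take j fs) * strict_sum Y (drop j fs))"
proof (induction X arbitrary: fs)
  case Nil
  show ?case
    by (cases fs) (simp_all add: sum.atMost_Suc_shift del: sum.atMost_Suc)
next
  case (Cons x X)
  show ?case
  proof (cases fs)
    case (Cons f gs)
    then show ?thesis
      by (simp add: Cons.IH sum.atMost_Suc_shift sum.distrib sum_distrib_left algebra_simps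
          del: sum.atMost_Suc)
  qed simp
qed

lemma weak_sum_append:
  "weak_sum (X @ Y) fs = (\<Sum>j\<le>length fs. weak_sum X (take j fs) * weak_sum Y (drop j fs))"
proof (induction X arbitrary: fs)
  case Nil
  show ?case
    by (cases fs) (simp_all add: sum.atMost_Suc_shift del: sum.atMost_Suc)
next
  case (Cons x X)
  note IH = Cons.IH
  show ?case
  proof (induction fs)
    case (Cons f gs)
    have "weak_sum ((x # X) @ Y) (f # gs) = weak_sum (X @ Y) (f # gs) + f x * weak_sum ((x # X) @ Y) gs"
      by simp
    then show ?case
      unfolding Cons.IH IH[of "f # gs"]
      by (simp add: sum.atMost_Suc_shift sum.distrib sum_distrib_left algebra_simps
          del: sum.atMost_Suc)
  qed simp
qed

lemma strict_sum_snoc: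
  "strict_sum (X @ [x]) (fs @ [f]) = strict_sum X (fs @ [f]) + f x * strict_sum X fs"
proof (induction X arbitrary: fs)
  case Nil
  show ?case by (cases fs) (simp_all add: strict_sum_Nil)
next
  case (Cons y X)
  show ?case
  proof (cases fs)
    case Nil
    then show ?thesis using Cons.IH[of "[]"] by (simp add: algebra_simps)
  next
    case (Cons g gs)
    then show ?thesis
      using Cons.IH[of "g # gs"] Cons.IH[of gs] by (simp add: algebra_simps)
  qed
qed

lemma strict_sum_rev: "strict_sum (rev X) (rev fs) = strict_sum X fs"
proof (induction X arbitrary: fs)
  case Nil
  show ?case by (simp add: strict_sum_Nil)
next
  case (Cons x X)
  show ?case
  proof (cases fs)
    case (Cons f gs)
    then show ?thesis using Cons.IH[of "f # gs"] Cons.IH[of gs] by (simp add: strict_sum_snoc)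
  qed simp
qed

text \<open>The antipode of the quasi-shuffle algebra. The letters are arbitrary ring-valued
  functions so that it serves both for \<open>1 / x ^ k\<close> and, in \<open>antipode_N\<close>,
  for power series that collect all exponents at once.\<close>

lemma antipode_sum:
  assumes "fs \<noteq> []"
  shows "(\<Sum>j\<le>length fs. (-1) ^ j * strict_sum X (rev (take j fs)) * weak_sum X (drop j fs)) = 0"
proof (induction X)
  case Nil
  show ?case using assms by (intro sum.neutral) (auto simp: strict_sum_Nil weak_sum_Nil)
next
  case (Cons x X)
  define M W W' where "M j = strict_sum X (rev (take j fs))"
    and "W j = weak_sum X (drop j fs)" and "W' j = weak_sum (x # X) (drop j fs)" for j
  define r where "r = length fs"
  have W': "W' j = W j + (fs ! j) x * W' (Suc j)" if "j < r" for j
    using that by (simp add: W'_def W_def r_def Cons_nth_drop_Suc[symmetric])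
  have M': "strict_sum (x # X) (rev (take (Suc j) fs)) = M (Suc j) + (fs ! j) x * M j" if "j < r" for j
    using that by (simp add: M_def r_def take_Suc_conv_app_nth)
  have W'r: "W' r = W r" by (simp add: W'_def W_def r_def)
  obtain n where r: "r = Suc n" using assms r_def by (cases fs) auto
  have "(\<Sum>j\<le>length fs. (-1) ^ j * strict_sum (x # X) (rev (take j fs)) * weak_sum (x # X) (drop j fs))
      = W' 0 + (\<Sum>j\<le>n. (-1) ^ Suc j * (M (Suc j) + (fs ! j) x * M j) * W' (Suc j))"
    unfolding r_def[symmetric] r sum.atMost_Suc_shift
    using M' r by (auto simp: W'_def intro!: sum.cong)
  also have "\<dots> = (W' 0 + (\<Sum>j\<le>n. (-1) ^ Suc j * M (Suc j) * W' (Suc j)))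
      - (\<Sum>j\<le>n. (-1) ^ j * M j * ((fs ! j) x * W' (Suc j)))"
    by (simp add: algebra_simps sum.distrib sum_negf sum_subtractf)
  also have "W' 0 + (\<Sum>j\<le>n. (-1) ^ Suc j * M (Suc j) * W' (Suc j)) = (\<Sum>j\<le>Suc n. (-1) ^ j * M j * W' j)"
    by (simp add: sum.atMost_Suc_shift M_def del: sum.atMost_Suc)
  \<comment> \<open>The recursion \<open>W'\<close> read backwards: what the new point adds to the
    strict factor at \<open>j + 1\<close> is removed by the weak factor at \<open>j\<close>, and the
    identity for \<open>X\<close> remains.\<close>
  also have "(\<Sum>j\<le>n. (-1) ^ j * M j * ((fs ! j) x * W' (Suc j))) = (\<Sum>j\<le>n. (-1) ^ j * M j * (W' j - W j))"
    using W' r by (intro sum.cong) auto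
  also have "(\<Sum>j\<le>Suc n. (-1) ^ j * M j * W' j) - \<dots> = (\<Sum>j\<le>Suc n. (-1) ^ j * M j * W j)"
    using W'r r by (simp add: algebra_simps sum_subtractf)
  also have "\<dots> = 0"
    using Cons.IH unfolding r_def[symmetric] r M_def W_def .
  finally show ?case .
qed

text \<open>The summation variables are ordered by their position in the list and not by size. This
  admits lists such as -1, ..., -N, N, ..., 1.\<close>

definition mhs :: "'a::field list \<Rightarrow> nat list \<Rightarrow> 'a" where
  "mhs X ks = strict_sum X (map (\<lambda>k x. 1 / x ^ k) ks)"

definition mhs_star :: "'a::field list \<Rightarrow> nat list \<Rightarrow> 'a" where
  "mhs_star X ks = weak_sum X (map (\<lambda>k x. 1 / x ^ k) ks)"

lemma mhs_simps [simp]: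
  "mhs X [] = 1" "mhs [] (k # ks) = 0"
  "mhs (x # X) (k # ks) = mhs X (k # ks) + mhs X ks / x ^ k"
  by (simp_all add: mhs_def)

lemma mhs_star_simps [simp]:
  "mhs_star X [] = 1" "mhs_star [] (k # ks) = 0"
  "mhs_star (x # X) (k # ks) = mhs_star X (k # ks) + mhs_star (x # X) ks / x ^ k"
  by (simp_all add: mhs_star_def)

lemma mhs_append: "mhs (X @ Y) ks = (\<Sum>j\<le>length ks. mhs X (take j ks) * mhs Y (drop j ks))"
  by (simp add: mhs_def strict_sum_append take_map drop_map)

lemma mhs_star_append: "mhs_star (X @ Y) ks = (\<Sum>j\<le>length ks. mhs_star X (take j ks) * mhs_star Y (drop j ks))"
  by (simp add: mhs_star_def weak_sum_append take_map drop_map)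

lemma mhs_rev: "mhs (rev X) ks = mhs X (rev ks)"
  using strict_sum_rev[of X "map (\<lambda>k x. 1 / x ^ k) (rev ks)"] by (simp add: mhs_def rev_map)

lemma mhs_uminus: "mhs (map uminus X) ks = (-1) ^ sum_list ks * mhs X ks"
proof (induction X arbitrary: ks)
  case Nil then show ?case by (cases ks) auto
next
  case (Cons x X)
  show ?case
  proof (cases ks)
    case (Cons k ls)
    have "1 / (- x) ^ k = (-1) ^ k / x ^ k"
      by (cases "even k") auto
    then have "mhs (map uminus X) ls / (- x) ^ k = (-1) ^ k * mhs (map uminus X) ls / x ^ k"
      by (metis (no_types) divide_divide_eq_right mult.commute mult.right_neutral times_divide_eq_left times_divide_eq_right)
    then show ?thesis by (simp add: Cons Cons.IH power_add algebra_simps)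
  qed simp
qed

lemma mhs_antipode:
  assumes "ks \<noteq> []"
  shows "(\<Sum>j\<le>length ks. (-1) ^ j * mhs X (rev (take j ks)) * mhs_star X (drop j ks)) = 0"
  using antipode_sum[of "map (\<lambda>k x. 1 / x ^ k) ks" X] assms
  by (simp add: mhs_def mhs_star_def take_map drop_map rev_map)

lemma mhs_Cons_map:
  "sum_list (map (mhs (x # X)) (map ((#) k) cs))
     = sum_list (map (mhs X) (map ((#) k) cs)) + sum_list (map (mhs X) cs) / x ^ k"
  by (induction cs) (auto simp: add_divide_distrib)

text \<open>Exact for every finite list, so any limit of such sums is multiplicative for the
  harmonic product. The existence of the regularisation rests on this.\<close>

lemma mhs_stuffle: "mhs X ks * mhs X ls = sum_list (map (mhs X) (stuffle ks ls))"
proof (induction X arbitrary: ks ls)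
  case Nil
  show ?case by (cases "(ks, ls)" rule: stuffle.cases) (auto simp: o_def)
next
  case (Cons x X)
  show ?case
  proof (cases "(ks, ls)" rule: stuffle.cases)
    case (3 k ks' l ls')
    have "sum_list (map (mhs (x # X)) (stuffle (k # ks') (l # ls'))) =
       (sum_list (map (mhs X) (map ((#) k) (stuffle ks' (l # ls')))) +
        sum_list (map (mhs X) (map ((#) l) (stuffle (k # ks') ls'))) +
        sum_list (map (mhs X) (map ((#) (k + l)) (stuffle ks' ls'))))
       + (sum_list (map (mhs X) (stuffle ks' (l # ls'))) / x ^ k +
          sum_list (map (mhs X) (stuffle (k # ks') ls')) / x ^ l +
          sum_list (map (mhs X) (stuffle ks' ls')) / x ^ (k + l))"
      by (simp only: stuffle.simps map_append sum_list_append mhs_Cons_map add_ac)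
    also have "\<dots> = mhs X (k # ks') * mhs X (l # ls') + (mhs X ks' * mhs X (l # ls') / x ^ k
       + mhs X (k # ks') * mhs X ls' / x ^ l + mhs X ks' * mhs X ls' / x ^ (k + l))"
      by (simp only: Cons.IH stuffle.simps map_append sum_list_append add_ac)
    also have "\<dots> = mhs (x # X) (k # ks') * mhs (x # X) (l # ls')"
      by (simp add: algebra_simps power_add)
    finally show ?thesis using 3 by simp
  qed auto
qed

text \<open>Equal neighbouring variables merge their exponents. Again exact for every list, which is
  why regularised star values are limits too.\<close>

lemma mhs_star_contractions: "mhs_star X ks = sum_list (map (mhs X) (contractions ks))"
proof (induction X arbitrary: ks)
  case Nil
  have "sum_list (map (mhs []) (contractions (k # ks))) = (0::'a)" for k ks
    by (induction "k # ks" arbitrary: k ks rule: contractions.induct) (auto simp: o_def)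
  then show ?case by (cases ks) auto
next
  case (Cons x X)
  have step: "sum_list (map (mhs (x # X)) (contractions (k # ks))) =
      sum_list (map (mhs X) (contractions (k # ks))) + sum_list (map (mhs (x # X)) (contractions ks)) / x ^ k" for k ks
  proof (induction ks arbitrary: k)
    case (Cons l ls)
    show ?case
      by (simp only: contractions.simps map_append sum_list_append mhs_Cons_map Cons)
        (simp add: power_add add_divide_distrib mult.commute)
  qed simp
  note IH = Cons.IH
  show ?case
  proof (induction ks)
    case (Cons k ks)
    then show ?case by (simp add: step IH)
  qed simp
qed

section \<open>Generating functions of restricted sums\<close>

declare One_nat_def [simp del]

text \<open>The index sets of the theorem have this form, with one 3 or two entries 2 in
  \<open>cs\<close> and ones elsewhere. So do all the pieces into which the antipode relation cuts
  them.\<close>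

definition dominating :: "nat list \<Rightarrow> nat \<Rightarrow> nat list set" where
  "dominating cs k = {ks. list_all2 (\<le>) cs ks \<and> sum_list ks = k}"

lemma dominating_Nil: "dominating [] k = (if k = 0 then {[]} else {})"
  by (auto simp: dominating_def)

lemma dominating_Cons: "dominating (c # cs) k = (\<Union>m\<in>{c..k}. (#) m ` dominating cs (k - m))"
proof -
  have "ks \<in> dominating (c # cs) k \<longleftrightarrow> (\<exists>m ls. ks = m # ls \<and> c \<le> m \<and> m \<le> k \<and> ls \<in> dominating cs (k - m))" for ks
    by (cases ks) (auto simp: dominating_def)
  then show ?thesis by (auto simp: image_iff)
qed

lemma finite_dominating: "finite (dominating cs k)"
  by (induction cs arbitrary: k) (auto simp: dominating_Nil dominating_Cons)

lemma sum_dominating_Cons: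
  "(\<Sum>ks\<in>dominating (c # cs) k. \<phi> ks) = (\<Sum>m\<in>{c..k}. \<Sum>ls\<in>dominating cs (k - m). \<phi> (m # ls))"
  unfolding dominating_Cons
  by (subst sum.UNION_disjoint) (auto simp: finite_dominating sum.reindex)

text \<open>The series (t/x)^c / (1 - t/x): one letter with every exponent from c on, graded by
  weight.\<close>

definition geom_fps :: "nat \<Rightarrow> 'a::field \<Rightarrow> 'a fps" where
  "geom_fps c x = Abs_fps (\<lambda>n. if c \<le> n then 1 / x ^ n else 0)"

lemma geom_fps_mult_nth: "fps_nth (geom_fps c x * g) k = (\<Sum>m\<in>{c..k}. fps_nth g (k - m) / x ^ m)"
  unfolding fps_mult_nth geom_fps_def
  by (intro sum.mono_neutral_cong_right) auto

lemma strict_sum_geom_nth: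
  "fps_nth (strict_sum L (map geom_fps cs)) k = (\<Sum>ks\<in>dominating cs k. mhs L ks)"
proof (induction L arbitrary: cs k)
  case Nil
  have "[] \<notin> dominating (c # cs) k" for c cs k by (simp add: dominating_def)
  then have "mhs [] ks = (0::'a)" if "ks \<in> dominating (c # cs) k" for c cs k ks
    using that by (cases ks) auto
  then show ?case by (cases cs) (auto simp: dominating_Nil)
next
  case (Cons x L)
  show ?case
  proof (cases cs)
    case Nil then show ?thesis by (simp add: dominating_Nil)
  next
    case cs: (Cons c ds)
    have "fps_nth (strict_sum (x # L) (map geom_fps cs)) k =
       fps_nth (strict_sum L (map geom_fps cs)) k + (\<Sum>m\<in>{c..k}. fps_nth (strict_sum L (map geom_fps ds)) (k - m) / x ^ m)"
      by (simp add: cs geom_fps_mult_nth)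
    also have "\<dots> = (\<Sum>ks\<in>dominating cs k. mhs (x # L) ks)"
      unfolding Cons.IH by (simp add: cs sum_dominating_Cons sum.distrib sum_divide_distrib)
    finally show ?thesis .
  qed
qed

lemma weak_sum_geom_nth:
  "fps_nth (weak_sum L (map geom_fps cs)) k = (\<Sum>ks\<in>dominating cs k. mhs_star L ks)"
proof (induction L arbitrary: cs k)
  case Nil
  have "[] \<notin> dominating (c # cs) k" for c cs k by (simp add: dominating_def)
  then have "mhs_star [] ks = (0::'a)" if "ks \<in> dominating (c # cs) k" for c cs k ks
    using that by (cases ks) auto
  then show ?case by (cases cs) (auto simp: dominating_Nil)
next
  case (Cons x L)
  note IH = Cons.IH
  show ?case
  proof (induction cs arbitrary: k)
    case Nil then show ?case by (simp add: dominating_Nil)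
  next
    case (Cons c ds)
    have "fps_nth (weak_sum (x # L) (map geom_fps (c # ds))) k =
       fps_nth (weak_sum L (map geom_fps (c # ds))) k + (\<Sum>m\<in>{c..k}. fps_nth (weak_sum (x # L) (map geom_fps ds)) (k - m) / x ^ m)"
      by (simp add: geom_fps_mult_nth)
    also have "\<dots> = (\<Sum>ks\<in>dominating (c # ds) k. mhs_star (x # L) ks)"
      unfolding Cons.IH IH
      by (simp add: sum_dominating_Cons sum.distrib sum_divide_distrib)
    finally show ?case .
  qed
qed

text \<open>Over 1, -1, ..., N, -N this product tends to sin(pi t) / (pi t), and over the nonzero
  residues modulo p it is 1 - t^(p-1). Either way it is 1 up to null coefficients in any fixed
  weight.\<close>

definition sin_fps :: "'a::field list \<Rightarrow> 'a fps" where
  "sin_fps L = prod_list (map (\<lambda>x. 1 - fps_const (1 / x) * fps_X) L)"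

lemma lin_fps_mult_nth:
  "fps_nth ((1 - fps_const (1 / x) * fps_X) * g) k = fps_nth g k - (if k = 0 then 0 else fps_nth g (k - 1) / (x::'a::field))"
  by (simp add: left_diff_distrib mult.assoc)

lemma lin_fps_geom:
  assumes "(x::'a::field) \<noteq> 0"
  shows "(1 - fps_const (1 / x) * fps_X) * geom_fps c x = fps_const (1 / x ^ c) * fps_X ^ c"
proof (rule fps_ext)
  fix k
  show "fps_nth ((1 - fps_const (1 / x) * fps_X) * geom_fps c x) k = fps_nth (fps_const (1 / x ^ c) * fps_X ^ c) k"
    unfolding lin_fps_mult_nth using assms
    by (cases k) (auto simp: geom_fps_def not_less_eq_eq le_Suc_eq divide_simps)
qed

text \<open>The coefficient of alpha^a in (alpha - 1)^u; the recursion in the rules below is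
  multiplication by alpha - 1.\<close>

definition alt_binom :: "nat \<Rightarrow> nat \<Rightarrow> 'a::comm_ring_1" where
  "alt_binom a u = (-1) ^ (u + a) * of_nat (u choose a)"

lemma alt_binom_simps [simp]:
  "alt_binom 0 0 = 1" "alt_binom (Suc a) 0 = 0" "alt_binom 0 (Suc u) = - alt_binom 0 u"
  "alt_binom (Suc a) (Suc u) = alt_binom a u - alt_binom (Suc a) u"
  by (simp_all add: alt_binom_def algebra_simps)

text \<open>A nested sum of u ones and one letter of exponent c, followed by any functional of the
  remaining list. Keeping the functional free lets the treatment of one marked letter be
  iterated.\<close>

fun marked :: "nat \<Rightarrow> nat \<Rightarrow> ('a::field list \<Rightarrow> 'a) \<Rightarrow> 'a list \<Rightarrow> 'a" where
  "marked u c \<psi> [] = 0"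
| "marked 0 c \<psi> (x # L) = marked 0 c \<psi> L + \<psi> L / x ^ c"
| "marked (Suc u) c \<psi> (x # L) = marked (Suc u) c \<psi> L + marked u c \<psi> L / x"

lemma marked_mhs: "marked u c (\<lambda>B. mhs B ls) L = mhs L (replicate u 1 @ c # ls)"
proof (induction L arbitrary: u)
  case (Cons x L)
  then show ?case by (cases u) auto
qed (simp add: mhs_def strict_sum_Nil)

lemma marked_lincomb:
  "marked u c (\<lambda>B. \<Sum>i\<in>I. a i * \<psi> i B) L = (\<Sum>i\<in>I. a i * marked u c (\<psi> i) L)"
proof (induction L arbitrary: u)
  case (Cons x L)
  then show ?case
    by (cases u) (auto simp: sum.distrib algebra_simps sum_distrib_left sum_divide_distrib)
qed simp

lemma marked_cmult: "marked u c (\<lambda>B. a * \<psi> B) L = a * marked u c \<psi> L"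
  using marked_lincomb[where I = "{()}"] by simp

text \<open>Multiplication by \<open>\<Prod> (1 - t / x)\<close> turns an unmarked run of the generating function into a
  polynomial in elementary symmetric functions: \<open>\<Prod> (1 - t / x + a t / x) = \<Prod> (1 + (a - 1) t / x)\<close>.\<close>

lemma sin_fps_run_nth:
  assumes "0 \<notin> set L"
  shows "fps_nth (sin_fps L * strict_sum L (map geom_fps (replicate a 1))) u = alt_binom a u * mhs L (replicate u 1)"
  using assms
proof (induction L arbitrary: a u)
  case Nil
  show ?case by (cases a; cases u) (auto simp: sin_fps_def)
next
  case (Cons x L)
  define P where "P a = sin_fps L * strict_sum L (map geom_fps (replicate a 1))" for a
  define l where "l = 1 - fps_const (1 / x) * fps_X"
  have x: "x \<noteq> 0" and IH: "fps_nth (P a) u = alt_binom a u * mhs L (replicate u 1)" for a u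
    using Cons by (auto simp: P_def)
  show ?case
  proof (cases a)
    case 0
    have eq: "sin_fps (x # L) * strict_sum (x # L) (map geom_fps (replicate a 1)) = l * P 0"
      by (simp add: sin_fps_def P_def l_def mult_ac 0)
    show ?thesis unfolding eq unfolding l_def lin_fps_mult_nth IH 0
      by (cases u) (auto simp: algebra_simps)
  next
    case (Suc a')
    have "sin_fps (x # L) * strict_sum (x # L) (map geom_fps (replicate a 1)) = l * P a + (l * geom_fps 1 x) * P a'"
      by (simp add: sin_fps_def P_def l_def Suc algebra_simps)
    also have "l * geom_fps 1 x = fps_const (1 / x) * fps_X"
      using lin_fps_geom[OF x, of 1] by (simp add: l_def)
    finally have eq: "sin_fps (x # L) * strict_sum (x # L) (map geom_fps (replicate a 1)) =
      l * P a + fps_const (1 / x) * fps_X * P a'" .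
    show ?thesis unfolding eq unfolding l_def fps_add_nth lin_fps_mult_nth IH mult.assoc Suc
      by (cases u) (auto simp: IH algebra_simps)
  qed
qed

text \<open>The factor 1 - t/x at the marked point cancels the denominator of
  \<open>geom_fps c x\<close> and leaves (t/x)^c. The factors at earlier points act on the run as in
  \<open>sin_fps_run_nth\<close>, those at later points stay with the rest of the index.\<close>

lemma sin_fps_marked_nth:
  assumes "0 \<notin> set L"
  shows "fps_nth (sin_fps L * strict_sum L (map geom_fps (replicate a 1 @ c # cs))) k =
    (if k < c then 0 else \<Sum>u\<le>k - c. alt_binom a u *
       marked u c (\<lambda>B. fps_nth (sin_fps B * strict_sum B (map geom_fps cs)) (k - c - u)) L)"
  using assms
proof (induction L arbitrary: a k)
  case Nil
  show ?case by (simp add: strict_sum_Nil)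
next
  case (Cons x L)
  define P where "P a = sin_fps L * strict_sum L (map geom_fps (replicate a 1 @ c # cs))" for a
  define T where "T B = sin_fps B * strict_sum B (map geom_fps cs)" for B :: "'a list"
  define l where "l = 1 - fps_const (1 / x) * fps_X"
  have x: "x \<noteq> 0" and IH: "fps_nth (P a) k = (if k < c then 0 else \<Sum>u\<le>k - c. alt_binom a u *
       marked u c (\<lambda>B. fps_nth (T B) (k - c - u)) L)" for a k
    using Cons by (auto simp: P_def T_def)
  have prev: "(if c + K = 0 then 0 else fps_nth (P a) (c + K - 1) / x) =
      (if K = 0 then 0 else \<Sum>u\<le>K - 1. alt_binom a u * marked u c (\<lambda>B. fps_nth (T B) (K - 1 - u)) L / x)" for a K
    by (cases K) (auto simp: IH sum_divide_distrib)
  have R: "(\<Sum>u\<le>K. alt_binom a u * marked u c (\<lambda>B. fps_nth (T B) (K - u)) (x # L)) =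
      (\<Sum>u\<le>K. alt_binom a u * marked u c (\<lambda>B. fps_nth (T B) (K - u)) L) + alt_binom a 0 * fps_nth (T L) K / x ^ c +
      (if K = 0 then 0 else \<Sum>u\<le>K - 1. alt_binom a (Suc u) * marked u c (\<lambda>B. fps_nth (T B) (K - 1 - u)) L / x)" for a K
    by (cases K) (simp_all add: sum.atMost_Suc_shift sum.distrib algebra_simps del: sum.atMost_Suc alt_binom_simps(3,4))
  show ?case
  proof (cases a)
    case 0
    have "sin_fps (x # L) * strict_sum (x # L) (map geom_fps (replicate a 1 @ c # cs)) = l * P 0 + (l * geom_fps c x) * T L"
      by (simp add: sin_fps_def P_def l_def T_def 0 algebra_simps)
    also have "l * geom_fps c x = fps_const (1 / x ^ c) * fps_X ^ c"
      unfolding l_def by (rule lin_fps_geom[OF x])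
    finally have "fps_nth (sin_fps (x # L) * strict_sum (x # L) (map geom_fps (replicate a 1 @ c # cs))) k =
      fps_nth (P 0) k - (if k = 0 then 0 else fps_nth (P 0) (k - 1) / x) + (if k < c then 0 else fps_nth (T L) (k - c) / x ^ c)"
      by (simp add: l_def lin_fps_mult_nth mult.assoc fps_X_power_mult_nth)
    also have "\<dots> = (if k < c then 0 else \<Sum>u\<le>k - c. alt_binom a u * marked u c (\<lambda>B. fps_nth (T B) (k - c - u)) (x # L))"
    proof (cases "k < c")
      case False
      then obtain K where k: "k = c + K" by (metis le_add_diff_inverse not_less)
      show ?thesis unfolding k prev R unfolding IH 0 by (simp add: sum_negf)
    qed (simp add: IH)
    finally show ?thesis unfolding T_def .
  next
    case (Suc a')
    have "sin_fps (x # L) * strict_sum (x # L) (map geom_fps (replicate a 1 @ c # cs)) = l * P a + (l * geom_fps 1 x) * P a'"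
      by (simp add: sin_fps_def P_def l_def Suc algebra_simps)
    also have "l * geom_fps 1 x = fps_const (1 / x) * fps_X"
      using lin_fps_geom[OF x, of 1] by (simp add: l_def)
    finally have "fps_nth (sin_fps (x # L) * strict_sum (x # L) (map geom_fps (replicate a 1 @ c # cs))) k =
      fps_nth (P a) k - (if k = 0 then 0 else fps_nth (P a) (k - 1) / x) + (if k = 0 then 0 else fps_nth (P a') (k - 1) / x)"
      by (simp add: l_def lin_fps_mult_nth mult.assoc)
    also have "\<dots> = (if k < c then 0 else \<Sum>u\<le>k - c. alt_binom a u * marked u c (\<lambda>B. fps_nth (T B) (k - c - u)) (x # L))"
    proof (cases "k < c")
      case False
      then obtain K where k: "k = c + K" by (metis le_add_diff_inverse not_less)
      show ?thesis unfolding k prev R unfolding IH Suc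
        by (simp add: sum_subtractf left_diff_distrib diff_divide_distrib)
    qed (simp add: IH)
    finally show ?thesis unfolding T_def .
  qed
qed

lemma marked_cong:
  assumes "\<And>B. set B \<subseteq> set L \<Longrightarrow> \<psi> B = \<psi>' B"
  shows "marked u c \<psi> L = marked u c \<psi>' L"
  using assms
proof (induction L arbitrary: u)
  case (Cons x L)
  have "marked u c \<psi> L = marked u c \<psi>' L" for u
    by (rule Cons.IH) (use Cons.prems in auto)
  moreover have "\<psi> L = \<psi>' L" by (rule Cons.prems) auto
  ultimately show ?case by (cases u) auto
qed simp

text \<open>All exponents above the minimal ones have disappeared: of the weight k, the part beyond
  c is filled up with ones only.\<close>

lemma sin_fps_marked1_nth:
  assumes "0 \<notin> set L"
  shows "fps_nth (sin_fps L * strict_sum L (map geom_fps (replicate a 1 @ c # replicate b 1))) k =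
    (if k < c then 0 else \<Sum>u\<le>k - c. alt_binom a u * alt_binom b (k - c - u) *
       mhs L (replicate u 1 @ c # replicate (k - c - u) 1))"
proof -
  have "marked u c (\<lambda>B. fps_nth (sin_fps B * strict_sum B (map geom_fps (replicate b 1))) n) L =
      alt_binom b n * mhs L (replicate u 1 @ c # replicate n 1)" for u n
  proof -
    have "marked u c (\<lambda>B. fps_nth (sin_fps B * strict_sum B (map geom_fps (replicate b 1))) n) L =
      marked u c (\<lambda>B. alt_binom b n * mhs B (replicate n 1)) L"
      using assms by (intro marked_cong sin_fps_run_nth) auto
    then show ?thesis by (simp add: marked_cmult marked_mhs)
  qed
  then show ?thesis unfolding sin_fps_marked_nth[OF assms] by (simp add: mult.assoc)
qed

text \<open>The one-mark lemma used twice: the functional behind the first mark is the coefficient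
  belonging to the second.\<close>

lemma sin_fps_marked2_nth:
  assumes "0 \<notin> set L"
  shows "fps_nth (sin_fps L * strict_sum L (map geom_fps (replicate a 1 @ 2 # replicate b 1 @ 2 # replicate e 1))) k =
    (if k < 4 then 0 else \<Sum>u\<le>k - 4. \<Sum>v\<le>k - 4 - u. alt_binom a u * alt_binom b v * alt_binom e (k - 4 - u - v) *
       mhs L (replicate u 1 @ 2 # replicate v 1 @ 2 # replicate (k - 4 - u - v) 1))"
proof -
  define F where "F B = sin_fps B * strict_sum B (map geom_fps (replicate b 1 @ 2 # replicate e 1))" for B :: "'a list"
  have F: "marked u 2 (\<lambda>B. fps_nth (F B) n) L =
      (if n < 2 then 0 else \<Sum>v\<le>n - 2. alt_binom b v * alt_binom e (n - 2 - v) *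
         mhs L (replicate u 1 @ 2 # replicate v 1 @ 2 # replicate (n - 2 - v) 1))" for u n
  proof (cases "n < 2")
    case True
    have "fps_nth (F B) n = 0 * 0" if "set B \<subseteq> set L" for B
      using that assms True unfolding F_def by (subst sin_fps_marked1_nth) auto
    then have "marked u 2 (\<lambda>B. fps_nth (F B) n) L = marked u 2 (\<lambda>B. 0 * 0) L"
      by (rule marked_cong)
    then show ?thesis using True by (subst (asm) marked_cmult) simp
  next
    case False
    have "marked u 2 (\<lambda>B. fps_nth (F B) n) L =
      marked u 2 (\<lambda>B. \<Sum>v\<le>n - 2. (alt_binom b v * alt_binom e (n - 2 - v)) * mhs B (replicate v 1 @ 2 # replicate (n - 2 - v) 1)) L"
      using assms False unfolding F_def by (intro marked_cong) (subst sin_fps_marked1_nth, auto)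
    then show ?thesis using False by (simp add: marked_lincomb marked_mhs)
  qed
  have "fps_nth (sin_fps L * strict_sum L (map geom_fps (replicate a 1 @ 2 # replicate b 1 @ 2 # replicate e 1))) k =
     (if k < 2 then 0 else \<Sum>u\<le>k - 2. alt_binom a u * marked u 2 (\<lambda>B. fps_nth (F B) (k - 2 - u)) L)"
    using sin_fps_marked_nth[OF assms, of a 2 "replicate b 1 @ 2 # replicate e 1" k] by (simp add: F_def)
  \<comment> \<open>The second mark takes at least two powers of t, so the range of u shrinks from k
    - 2 to k - 4.\<close>
  also have "\<dots> = (if k < 4 then 0 else \<Sum>u\<le>k - 4. alt_binom a u * marked u 2 (\<lambda>B. fps_nth (F B) (k - 2 - u)) L)"
  proof (cases "k < 4")
    case True
    then have "k - 2 - u < 2" for u by linarith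
    then show ?thesis using True by (simp only: F if_True mult_zero_right sum.neutral_const) simp
  next
    case False
    have "(\<Sum>u\<le>k - 2. alt_binom a u * marked u 2 (\<lambda>B. fps_nth (F B) (k - 2 - u)) L) =
       (\<Sum>u\<le>k - 4. alt_binom a u * marked u 2 (\<lambda>B. fps_nth (F B) (k - 2 - u)) L)"
    proof (rule sum.mono_neutral_right, goal_cases)
      case 3
      show ?case
      proof
        fix u assume "u \<in> {..k - 2} - {..k - 4}"
        then have "k - 2 - u < 2" by auto
        then show "alt_binom a u * marked u 2 (\<lambda>B. fps_nth (F B) (k - 2 - u)) L = 0"
          by (simp only: F if_True mult_zero_right)
      qed
    qed auto
    then show ?thesis using False by simp
  qed
  also have "\<dots> = (if k < 4 then 0 else \<Sum>u\<le>k - 4. \<Sum>v\<le>k - 4 - u. alt_binom a u * alt_binom b v * alt_binom e (k - 4 - u - v) *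
       mhs L (replicate u 1 @ 2 # replicate v 1 @ 2 # replicate (k - 4 - u - v) 1))"
  proof -
    have "alt_binom a u * marked u 2 (\<lambda>B. fps_nth (F B) (k - 2 - u)) L =
       (\<Sum>v\<le>k - 4 - u. alt_binom a u * alt_binom b v * alt_binom e (k - 4 - u - v) *
         mhs L (replicate u 1 @ 2 # replicate v 1 @ 2 # replicate (k - 4 - u - v) 1))" if "\<not> k < 4" "u \<le> k - 4" for u
    proof -
      have "\<not> k - 2 - u < 2" "k - 2 - u - 2 = k - 4 - u" using that by auto
      then show ?thesis unfolding F by (simp add: sum_distrib_left mult.assoc)
    qed
    then show ?thesis by (auto intro!: sum.cong)
  qed
  finally show ?thesis .
qed

lemma sin_fps_nth:
  assumes "0 \<notin> set L"
  shows "fps_nth (sin_fps L) u = (-1) ^ u * mhs L (replicate u 1)"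
  using sin_fps_run_nth[OF assms, of 0 u] by (simp add: alt_binom_def)

text \<open>Newton's identities. With P = \<open>sin_fps L\<close> and S the generating series of
  the power sums, the logarithmic derivative gives P' = - S P; compare coefficients.\<close>

lemma newton_identity:
  assumes "0 \<notin> set L"
  shows "of_nat (Suc n) * fps_nth (sin_fps L) (Suc n) = - (\<Sum>i\<le>n. fps_nth (sin_fps L) (n - i) * mhs L [Suc i])"
proof -
  define S where "S L = Abs_fps (\<lambda>i. mhs L [Suc i])" for L :: "'a list"
  have "fps_deriv (sin_fps L) = - (S L * sin_fps L)"
    using assms
  proof (induction L)
    case Nil
    have "S [] = 0" by (rule fps_ext) (simp add: S_def)
    then show ?case by (simp add: sin_fps_def)
  next
    case (Cons x L)
    define l where "l = 1 - fps_const (1 / x) * fps_X"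
    have x: "x \<noteq> 0" using Cons by auto
    have "S (x # L) = S L + fps_const (1 / x) * geom_fps 0 x"
      by (rule fps_ext) (simp add: S_def geom_fps_def)
    moreover have "l * geom_fps 0 x = 1" using lin_fps_geom[OF x, of 0] by (simp add: l_def)
    moreover have "sin_fps (x # L) = l * sin_fps L" by (simp add: sin_fps_def l_def)
    moreover have "(S L + fps_const (1 / x) * geom_fps 0 x) * (l * sin_fps L) =
        l * (S L * sin_fps L) + fps_const (1 / x) * (l * geom_fps 0 x) * sin_fps L"
      by (simp add: algebra_simps)
    ultimately have "S (x # L) * sin_fps (x # L) = l * (S L * sin_fps L) + fps_const (1 / x) * sin_fps L"
      by simp
    moreover have "fps_deriv (sin_fps (x # L)) = l * fps_deriv (sin_fps L) - fps_const (1 / x) * sin_fps L"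
    proof -
      have "fps_deriv l = - fps_const (1 / x)" by (simp add: l_def flip: fps_const_neg)
      moreover have "sin_fps (x # L) = l * sin_fps L" by (simp add: sin_fps_def l_def)
      ultimately show ?thesis by (simp add: fps_deriv_mult del: fps_const_neg)
    qed
    ultimately show ?case using Cons by simp
  qed
  then have "fps_nth (fps_deriv (sin_fps L)) n = - fps_nth (sin_fps L * S L) n"
    by (simp add: mult.commute)
  also have "fps_nth (sin_fps L * S L) n = (\<Sum>i\<le>n. fps_nth (sin_fps L) (n - i) * mhs L [Suc i])"
    unfolding fps_mult_nth atLeast0AtMost
    by (rule sum.reindex_bij_witness[of _ "\<lambda>i. n - i" "\<lambda>i. n - i"]) (auto simp: S_def)
  finally show ?thesis by (simp add: fps_deriv_nth flip: Suc_eq_plus1)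
qed

section \<open>The binomial identity for the coefficient\<close>

text \<open>Count the subsets of {0..n} with b + e + 1 elements by the element v that has b elements
  below it and e above.\<close>

lemma sum_choose_convolution: "(\<Sum>v\<le>n. (v choose b) * ((n - v) choose e)) = Suc n choose Suc (b + e)"
proof (induction n arbitrary: e)
  case 0
  show ?case by (cases b; cases e) auto
next
  case (Suc n)
  show ?case
  proof (cases e)
    case 0
    then show ?thesis using sum_choose_upper[of b "Suc n"] by simp
  next
    case (Suc e')
    have "(\<Sum>v\<le>Suc n. (v choose b) * ((Suc n - v) choose e)) = (\<Sum>v\<le>n. (v choose b) * (Suc (n - v) choose Suc e'))"
      by (simp add: Suc Suc_diff_le)
    also have "\<dots> = (\<Sum>v\<le>n. (v choose b) * ((n - v) choose e')) + (\<Sum>v\<le>n. (v choose b) * ((n - v) choose Suc e'))"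
      by (simp add: algebra_simps sum.distrib)
    also have "\<dots> = Suc (Suc n) choose Suc (b + e)"
      by (simp only: Suc.IH Suc) simp
    finally show ?thesis .
  qed
qed

text \<open>The k-th difference of a polynomial of degree below k vanishes. A single difference
  keeps the product shape and lowers one of the two degrees, which drives the induction. Generalised
  binomials are used because at the boundary the arguments become negative.\<close>

lemma alternating_sum_gchoose:
  fixes x y :: "'a::field_char_0"
  assumes "a + c < k"
  shows "(\<Sum>m\<le>k. (-1) ^ m * of_nat (k choose m) * ((x + of_nat m) gchoose a) * ((y - of_nat m) gchoose c)) = 0"
  using assms
proof (induction k arbitrary: a c x y)
  case (Suc k)
  define f where "f m = ((x + of_nat m) gchoose a) * ((y - of_nat m) gchoose c)" for m
  have diff: "f m - f (Suc m) =
      (if c = 0 then 0 else (((x + 1) + of_nat m) gchoose a) * (((y - 1) - of_nat m) gchoose (c - 1)))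
      - (if a = 0 then 0 else ((x + of_nat m) gchoose (a - 1)) * ((y - of_nat m) gchoose c))" for m
  proof -
    let ?A = "if a = 0 then 0 else (x + of_nat m) gchoose (a - 1)"
    let ?C = "if c = 0 then 0 else (y - 1 - of_nat m) gchoose (c - 1)"
    have A: "(x + of_nat (Suc m)) gchoose a = (if a = 0 then 0 else (x + of_nat m) gchoose (a - 1)) + ((x + of_nat m) gchoose a)"
      using gbinomial_Suc_Suc[of "x + of_nat m" "a - 1"] by (cases a) (auto simp: algebra_simps)
    have C: "(y - of_nat m) gchoose c = (if c = 0 then 0 else (y - 1 - of_nat m) gchoose (c - 1)) + ((y - of_nat (Suc m)) gchoose c)"
      using gbinomial_Suc_Suc[of "y - 1 - of_nat m" "c - 1"] by (cases c) (auto simp: algebra_simps)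
    have "A * C - A' * C' = A' * q - p * C" if "A' = p + A" "C = q + C'" for A A' C C' p q :: 'a
      using that by (simp add: algebra_simps)
    from this[OF A C] have "f m - f (Suc m) = ((x + of_nat (Suc m)) gchoose a) * ?C - ?A * ((y - of_nat m) gchoose c)"
      unfolding f_def .
    then show ?thesis by (auto simp: algebra_simps)
  qed
  have "(\<Sum>m\<le>Suc k. (-1) ^ m * of_nat (Suc k choose m) * f m)
      = (\<Sum>m\<le>k. (-1) ^ m * of_nat (k choose m) * (f m - f (Suc m)))"
  proof -
    have "(\<Sum>m\<le>Suc k. (-1) ^ m * of_nat (Suc k choose m) * f m)
       = (\<Sum>m\<le>Suc k. (-1) ^ m * of_nat (k choose m) * f m) + (\<Sum>m\<le>k. (-1) ^ Suc m * of_nat (k choose m) * f (Suc m))"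
      unfolding sum.atMost_Suc_shift[of _ k] by (simp add: algebra_simps sum.distrib sum_subtractf sum_negf)
    moreover have "(\<Sum>m\<le>Suc k. (-1) ^ m * of_nat (k choose m) * f m) = (\<Sum>m\<le>k. (-1) ^ m * of_nat (k choose m) * f m)"
      by simp
    ultimately show ?thesis by (simp only:) (simp add: right_diff_distrib sum_subtractf sum_negf)
  qed
  also have "\<dots> = (\<Sum>m\<le>k. (-1) ^ m * of_nat (k choose m) * (
      (if c = 0 then 0 else (((x + 1) + of_nat m) gchoose a) * (((y - 1) - of_nat m) gchoose (c - 1)))
      - (if a = 0 then 0 else ((x + of_nat m) gchoose (a - 1)) * ((y - of_nat m) gchoose c))))"
    unfolding diff ..
  also have "\<dots> = (if c = 0 then 0 else \<Sum>m\<le>k. (-1) ^ m * of_nat (k choose m) * (((x + 1) + of_nat m) gchoose a) * (((y - 1) - of_nat m) gchoose (c - 1)))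
      - (if a = 0 then 0 else \<Sum>m\<le>k. (-1) ^ m * of_nat (k choose m) * ((x + of_nat m) gchoose (a - 1)) * ((y - of_nat m) gchoose c))"
    by (simp add: algebra_simps sum_subtractf)
  also have "\<dots> = 0"
    using Suc.IH[of a "c - 1" "x + 1" "y - 1"] Suc.IH[of "a - 1" c x y] Suc.prems by auto
  finally show ?case by (simp add: f_def mult.assoc)
qed simp

lemma gchoose_minus_one: "(- 1 :: 'a::field_char_0) gchoose n = (-1) ^ n"
  by (simp add: gbinomial_minus flip: binomial_gbinomial)

lemma gchoose_minus_two: "(- 2 :: 'a::field_char_0) gchoose n = (-1) ^ n * of_nat (Suc n)"
  using gbinomial_minus[of "2::'a" n] binomial_gbinomial[of "Suc n" n, where ?'a = 'a] by (simp add: add.commute)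

definition binom_sum :: "nat \<Rightarrow> nat \<Rightarrow> nat \<Rightarrow> int" where
  "binom_sum k a c = (\<Sum>u\<le>k - 3. (-1) ^ u * int (k choose Suc u) * int (u choose a) * int ((k - 3 - u) choose c))"

text \<open>Take x = -1 and y = k - 2 in the vanishing alternating sum. The terms m = 1, ..., k - 2
  form \<open>binom_sum\<close> with u = m - 1; the terms m = 0, k - 1, k have an argument -1, -1,
  -2 respectively and give the three terms of the closed form.\<close>

lemma binom_sum_eq:
  assumes "odd k" "3 \<le> k" "a + c + 3 \<le> k"
  shows "binom_sum k a c = (-1) ^ a * int ((k - 2) choose c) + (-1) ^ c * int k * int ((k - 2) choose a)
    - (-1) ^ c * int (Suc c) * int ((k - 1) choose a)"
proof -
  define f :: "nat \<Rightarrow> rat" where "f m = (-1) ^ m * of_nat (k choose m) * ((-1 + of_nat m) gchoose a) * ((of_nat (k - 2) - of_nat m) gchoose c)" for m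
  have "(\<Sum>m\<le>k. f m) = 0"
    unfolding f_def by (rule alternating_sum_gchoose) (use assms in auto)
  moreover obtain n where n: "k = Suc (Suc (Suc n))" using assms(2) 
    by (intro that[of "k - 3"]) simp
  ultimately have "f 0 + (\<Sum>u\<le>k - 3. f (Suc u)) + f (k - 1) + f k = 0"
  proof -
    have "(\<Sum>m\<le>k. f m) = f 0 + (\<Sum>u\<le>Suc (Suc n). f (Suc u))" unfolding n by (rule sum.atMost_Suc_shift)
    also have "(\<Sum>u\<le>Suc (Suc n). f (Suc u)) = (\<Sum>u\<le>n. f (Suc u)) + f (Suc (Suc n)) + f (Suc (Suc (Suc n)))" by simp
    finally show ?thesis using \<open>(\<Sum>m\<le>k. f m) = 0\<close> by (simp add: n add_ac)
  qed
  moreover have "f 0 = (-1) ^ a * of_nat ((k - 2) choose c)"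
    by (simp add: f_def gchoose_minus_one binomial_gbinomial)
  moreover have "f (k - 1) = (-1) ^ c * of_nat k * of_nat ((k - 2) choose a)"
  proof -
    have "(-1 + of_nat (k - 1) :: rat) = of_nat (k - 2)" "(of_nat (k - 2) - of_nat (k - 1) :: rat) = -1" "even (k - 1)"
      using assms by (auto simp: n)
    then show ?thesis unfolding f_def using assms by (simp add: gchoose_minus_one binomial_gbinomial n)
  qed
  moreover have "f k = - ((-1) ^ c * of_nat (Suc c) * of_nat ((k - 1) choose a))"
  proof -
    have "(-1 + of_nat k :: rat) = of_nat (k - 1)" "(of_nat (k - 2) - of_nat k :: rat) = -2"
      using assms by (auto simp: n)
    then show ?thesis unfolding f_def using assms by (simp add: gchoose_minus_two binomial_gbinomial)
  qed
  moreover have "f (Suc u) = - of_int ((-1) ^ u * int (k choose Suc u) * int (u choose a) * int ((k - 3 - u) choose c))" if "u \<le> k - 3" for u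
  proof -
    have "(of_nat (k - 2) - of_nat (Suc u) :: rat) = of_nat (k - 3 - u)" "(-1 + of_nat (Suc u) :: rat) = of_nat u"
      using that assms by (auto simp: n of_nat_diff)
    then have "f (Suc u) = (-1) ^ Suc u * of_nat (k choose Suc u) * (of_nat u gchoose a) * (of_nat (k - 3 - u) gchoose c)"
      unfolding f_def by (simp only:)
    then show ?thesis by (simp flip: binomial_gbinomial)
  qed
  then have "(\<Sum>u\<le>k - 3. f (Suc u)) = - of_int (binom_sum k a c)"
    by (simp add: binom_sum_def sum_negf)
  ultimately have "(of_int (binom_sum k a c) :: rat) = of_int ((-1) ^ a * int ((k - 2) choose c) + (-1) ^ c * int k * int ((k - 2) choose a)
    - (-1) ^ c * int (Suc c) * int ((k - 1) choose a))"
    by simp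
  then show ?thesis by (simp only: of_int_eq_iff)
qed

text \<open>N is a difference g(i) - g(i'') of one expression at two places, and each half is a
  \<open>binom_sum\<close> after the binomials are brought to lower entries independent of
  k.\<close>

lemma N_coeff_binom_sum:
  assumes k: "odd k" "3 \<le> k" and "1 \<le> i" "i \<le> j" "j \<le> r" "r \<le> k - 2"
  shows "N_coeff (int k) (int r) (int i) (int j) =
    (-1) ^ r * (binom_sum k (i - 1) (r - i) - binom_sum k (r - j) (j - 1))"
proof -
  define g where "g i = (int k - int r - 2 + i + 1) * (signed_binomial (k - 1) (int k - int r - 2 + i) - signed_binomial (k - 1) (i - 1))
    + int k * (signed_binomial (k - 2) (int k - int r - 2 + i - 1) - signed_binomial (k - 2) (i - 2))" for i
  have g: "g (int (Suc a)) = (-1) ^ r * binom_sum k a c" if r: "r = a + c + 1" for a c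
  proof -
    obtain n where n: "k = Suc (Suc n)" and n0: "a + c + 1 \<le> n" and "odd n"
    proof
      show "k = Suc (Suc (k - 2))" "a + c + 1 \<le> k - 2" "odd (k - 2)" using k assms(6) r by auto
    qed
    have s1: "signed_binomial (k - 1) (int k - int r - 2 + int (Suc a)) = - ((-1) ^ c * int (Suc n choose Suc c))"
    proof -
      have e: "int k - int r - 2 + int (Suc a) = int (n - c)" using n n0 r by simp
      have "(Suc n choose (n - c)) = (Suc n choose Suc c)"
        using binomial_symmetric[of "Suc c" "Suc n"] n0 by simp
      moreover have "(-1) ^ (n - c) = (- ((-1) ^ c) :: int)"
        using \<open>odd n\<close> n0 by (simp add: minus_one_power_iff)
      moreover have "int (n - c) \<le> 1 + int n" using n0 by linarith
      ultimately show ?thesis unfolding e signed_binomial_def using n by simp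
    qed
    have s2: "signed_binomial (k - 2) (int k - int r - 2 + int (Suc a) - 1) = (-1) ^ c * int (n choose Suc c)"
    proof -
      have e: "int k - int r - 2 + int (Suc a) - 1 = int (n - Suc c)" using n n0 r by simp
      have "(n choose (n - Suc c)) = (n choose Suc c)"
        using binomial_symmetric[of "Suc c" n] n0 by simp
      moreover have "(-1) ^ (n - Suc c) = ((-1) ^ c :: int)"
        using \<open>odd n\<close> n0 by (simp add: minus_one_power_iff)
      ultimately show ?thesis unfolding e signed_binomial_def using n by simp
    qed
    have s3: "signed_binomial (k - 1) (int (Suc a) - 1) = (-1) ^ a * int (Suc n choose a)"
      using n n0 by (simp add: signed_binomial_def)
    have s4: "signed_binomial (k - 2) (int (Suc a) - 2) = (-1) ^ a * (int (n choose a) - int (Suc n choose a))"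
      using n n0 by (cases a) (auto simp: signed_binomial_def algebra_simps)
    have b1: "int (Suc n choose Suc c) = int (n choose c) + int (n choose Suc c)" by simp
    \<comment> \<open>With k = n + 2 the outer factor k' + i + 1 is n - c + 1. Absorption then lets
      all terms with \<open>Suc c\<close> collapse to a single binomial of n over c.\<close>
    have b2: "(int n - int c) * int (Suc n choose Suc c) = int (Suc n) * int (n choose Suc c)"
    proof -
      have "(Suc n - Suc c) * (Suc n choose Suc c) = Suc n * (n choose Suc c)"
        using binomial_absorb_comp[of "Suc n" "Suc c"] by simp
      then have "int ((Suc n - Suc c) * (Suc n choose Suc c)) = int (Suc n * (n choose Suc c))" by (rule arg_cong)
      then show ?thesis using n0 by (simp only: of_nat_mult) (simp add: of_nat_diff)
    qed
    have "g (int (Suc a)) = (int n - int c + 1) * (- ((-1) ^ c * int (Suc n choose Suc c)) - (-1) ^ a * int (Suc n choose a))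
      + int k * ((-1) ^ c * int (n choose Suc c) - (-1) ^ a * (int (n choose a) - int (Suc n choose a)))"
      unfolding g_def s1 s2 s3 s4 using n r by simp
    also have "\<dots> = - ((-1) ^ c * ((int n - int c) * int (Suc n choose Suc c) + int (Suc n choose Suc c))) - (-1) ^ a * (int n - int c + 1) * int (Suc n choose a)
      + int k * ((-1) ^ c * int (n choose Suc c) - (-1) ^ a * (int (n choose a) - int (Suc n choose a)))"
      by (simp only: algebra_simps)
    also have "\<dots> = - ((-1) ^ c * int (n choose c)) - (-1) ^ a * int k * int (n choose a) + (-1) ^ a * int (Suc c) * int (Suc n choose a)"
      unfolding b2 unfolding b1 using n by (simp add: algebra_simps)
    also have "\<dots> = (-1) ^ r * binom_sum k a c"
    proof -
      have e: "(-1) ^ r * (-1) ^ a = - ((-1) ^ c :: int)" "(-1) ^ r * (-1) ^ c = - ((-1) ^ a :: int)"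
        by (simp_all add: r minus_one_power_iff)
      have "(-1) ^ r * binom_sum k a c = ((-1) ^ r * (-1) ^ a) * int (n choose c) + ((-1) ^ r * (-1) ^ c) * int k * int (n choose a)
         - ((-1) ^ r * (-1) ^ c) * int (Suc c) * int (Suc n choose a)"
      proof -
        have b: "binom_sum k a c = (-1) ^ a * int (n choose c) + (-1) ^ c * int k * int (n choose a)
          - (-1) ^ c * int (Suc c) * int (Suc n choose a)"
          using binom_sum_eq[of k a c] k n n0 by simp
        show ?thesis unfolding b by (simp only: algebra_simps)
      qed
      then show ?thesis unfolding e by simp
    qed
    finally show ?thesis .
  qed
  have "N_coeff (int k) (int r) (int i) (int j) = g (int i) - g (int (r - j + 1))"
  proof -
    have e: "nat (int k - 1) = k - 1" "nat (int k - 2) = k - 2" "int (r - j + 1) = int r - int j + 1"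
      using assms by auto
    show ?thesis unfolding N_coeff_def Let_def g_def e by (simp only: algebra_simps)
  qed
  also have "g (int i) = (-1) ^ r * binom_sum k (i - 1) (r - i)"
    using g[of "i - 1" "r - i"] assms by simp
  also have "g (int (r - j + 1)) = (-1) ^ r * binom_sum k (r - j) (j - 1)"
    using g[of "r - j" "j - 1"] assms 
    by (simp add: algebra_simps)
  finally show ?thesis by (simp add: algebra_simps)
qed

section \<open>Families of lists with vanishing power sums\<close>

lemma of_int_alt_binom: "(of_int (alt_binom a u) :: 'a::comm_ring_1) = alt_binom a u"
  by (simp add: alt_binom_def)

text \<open>The two halves of an extremal value are exchanged by reflecting u at k - 3, so they
  yield \<open>binom_sum\<close> with a and e interchanged. The sign is constant since k - 3 is
  even.\<close>

lemma alt_binom_sum1: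
  assumes "odd k" "a + e + 3 \<le> k"
  shows "(\<Sum>u\<le>k - 3. alt_binom a u * alt_binom e (k - 3 - u) *
      ((-1) ^ (k - 3 - u) * int (k choose Suc (k - 3 - u)) - (-1) ^ u * int (k choose Suc u)))
    = (-1) ^ (a + e + 1) * (binom_sum k a e - binom_sum k e a)"
proof -
  define g where "g a e u = (-1) ^ u * int (k choose Suc u) * int (u choose a) * int ((k - 3 - u) choose e)" for a e u
  have "(\<Sum>u\<le>k - 3. alt_binom a u * alt_binom e (k - 3 - u) *
      ((-1) ^ (k - 3 - u) * int (k choose Suc (k - 3 - u)) - (-1) ^ u * int (k choose Suc u)))
    = (\<Sum>u\<le>k - 3. (-1) ^ (a + e) * (g e a (k - 3 - u) - g a e u))"
  proof (rule sum.cong)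
    fix u assume u: "u \<in> {..k - 3}"
    have "(-1) ^ (u + a) * (-1) ^ (k - 3 - u + e) = ((-1) ^ (a + e) :: int)"
    proof -
      obtain w where w: "k - 3 - u = w" by simp
      then have "k = u + w + 3" using u assms by auto
      then have "even (u + w)" using assms(1) by simp
      then show ?thesis unfolding w by (auto simp: minus_one_power_iff)
    qed
    then have "alt_binom a u * alt_binom e (k - 3 - u) = (-1) ^ (a + e) * (int (u choose a) * int ((k - 3 - u) choose e))"
      by (simp add: alt_binom_def algebra_simps)
    moreover have "k - 3 - (k - 3 - u) = u" using u by simp
    ultimately show "alt_binom a u * alt_binom e (k - 3 - u) *
      ((-1) ^ (k - 3 - u) * int (k choose Suc (k - 3 - u)) - (-1) ^ u * int (k choose Suc u))
      = (-1) ^ (a + e) * (g e a (k - 3 - u) - g a e u)"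
      unfolding g_def by (simp only:) (simp only: algebra_simps)
  qed simp
  also have "\<dots> = (-1) ^ (a + e) * ((\<Sum>u\<le>k - 3. g e a (k - 3 - u)) - (\<Sum>u\<le>k - 3. g a e u))"
    by (simp add: sum_subtractf sum_distrib_left right_diff_distrib)
  also have "(\<Sum>u\<le>k - 3. g e a (k - 3 - u)) = (\<Sum>u\<le>k - 3. g e a u)"
    by (rule sum.reindex_bij_witness[of _ "\<lambda>u. k - 3 - u" "\<lambda>u. k - 3 - u"]) auto
  also have "(\<Sum>u\<le>k - 3. g e a u) = binom_sum k e a" by (simp add: g_def binom_sum_def)
  also have "(\<Sum>u\<le>k - 3. g a e u) = binom_sum k a e" by (simp add: g_def binom_sum_def)
  also have "(-1) ^ (a + e) * (binom_sum k e a - binom_sum k a e) = (-1) ^ (a + e + 1) * (binom_sum k a e - binom_sum k e a)"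
    by (simp add: algebra_simps power_add)
  finally show ?thesis .
qed

lemma sum_two_minus:
  fixes m :: "nat \<Rightarrow> 'a::comm_ring_1"
  shows "2 * (\<Sum>u\<in>S. of_int (c u) * m u) - of_int (\<Sum>u\<in>S. c u * q u) * z =
    (\<Sum>u\<in>S. of_int (c u) * (2 * m u - of_int (q u) * z))"
  by (simp add: sum_distrib_left sum_distrib_right sum_subtractf[symmetric] algebra_simps)

lemma sum_sum_two_minus:
  fixes m :: "nat \<Rightarrow> nat \<Rightarrow> 'a::comm_ring_1"
  shows "2 * (\<Sum>u\<in>S. \<Sum>v\<in>T u. of_int (c u v) * m u v) - of_int (\<Sum>u\<in>S. \<Sum>v\<in>T u. c u v * q u v) * z =
    (\<Sum>u\<in>S. \<Sum>v\<in>T u. of_int (c u v) * (2 * m u v - of_int (q u v) * z))"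
  by (simp add: sum_distrib_left sum_distrib_right sum_subtractf[symmetric] algebra_simps)

text \<open>The extremal value depends on the outer run lengths only, so the middle sum is a pure
  convolution of binomials and raises the second argument of \<open>binom_sum\<close> to b + e +
  1.\<close>

lemma alt_binom_sum2:
  assumes "odd k" "a + b + e + 4 \<le> k"
  shows "(\<Sum>u\<le>k - 4. \<Sum>v\<le>k - 4 - u. alt_binom a u * alt_binom b v * alt_binom e (k - 4 - u - v) *
      ((-1) ^ (k - 4 - u - v) * int (k choose Suc (k - 4 - u - v)) - (-1) ^ u * int (k choose Suc u)))
    = (-1) ^ (a + b + e + 2) * (binom_sum k a (b + e + 1) - binom_sum k e (a + b + 1))"
proof -
  define K where "K = k - 4"
  define g where "g a e u v = (-1) ^ u * int (k choose Suc u) * int (u choose a) * (int (v choose b) * int ((K - u - v) choose e))" for a e u v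
  define A where "A = (SIGMA u:{..K}. {..K - u})"
  have inner: "(\<Sum>(u, v)\<in>A. g a e u v) = binom_sum k a (b + e + 1)" for a e
  proof -
    have "(\<Sum>(u, v)\<in>A. g a e u v) = (\<Sum>u\<le>K. \<Sum>v\<le>K - u. g a e u v)"
      unfolding A_def by (simp add: sum.Sigma)
    also have "\<dots> = (\<Sum>u\<le>K. (-1) ^ u * int (k choose Suc u) * int (u choose a) * int (Suc (K - u) choose Suc (b + e)))"
      unfolding g_def sum_distrib_left[symmetric] sum_choose_convolution[symmetric] by simp
    also have "\<dots> = (\<Sum>u\<le>K. (-1) ^ u * int (k choose Suc u) * int (u choose a) * int ((k - 3 - u) choose (b + e + 1)))"
    proof (rule sum.cong)
      fix u assume "u \<in> {..K}"
      then have "Suc (K - u) = k - 3 - u" using assms by (auto simp: K_def)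
      then show "(-1) ^ u * int (k choose Suc u) * int (u choose a) * int (Suc (K - u) choose Suc (b + e))
        = (-1) ^ u * int (k choose Suc u) * int (u choose a) * int ((k - 3 - u) choose (b + e + 1))"
        by (simp only: Suc_eq_plus1)
    qed simp
    \<comment> \<open>\<open>binom_sum\<close> runs one step further, to u = k - 3, where the factor
      0 choose (b + e + 1) is zero.\<close>
    also have "\<dots> = binom_sum k a (b + e + 1)"
    proof -
      have "k - 3 = Suc K" using assms by (auto simp: K_def)
      then show ?thesis unfolding binom_sum_def by (simp only: sum.atMost_Suc) simp
    qed
    finally show ?thesis .
  qed
  have "(\<Sum>u\<le>k - 4. \<Sum>v\<le>k - 4 - u. alt_binom a u * alt_binom b v * alt_binom e (k - 4 - u - v) *
      ((-1) ^ (k - 4 - u - v) * int (k choose Suc (k - 4 - u - v)) - (-1) ^ u * int (k choose Suc u)))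
    = (\<Sum>(u, v)\<in>A. alt_binom a u * alt_binom b v * alt_binom e (K - u - v) *
      ((-1) ^ (K - u - v) * int (k choose Suc (K - u - v)) - (-1) ^ u * int (k choose Suc u)))"
    unfolding A_def K_def by (simp add: sum.Sigma)
  also have "\<dots> = (\<Sum>(u, v)\<in>A. (-1) ^ (a + b + e) * (g a e u v - g e a (K - u - v) v))"
  proof (rule sum.cong)
    fix x assume "x \<in> A"
    then obtain u v where x: "x = (u, v)" and uv: "u \<le> K" "v \<le> K - u" by (auto simp: A_def)
    have sgn: "(-1) ^ (u + a) * (-1) ^ (v + b) * (-1) ^ (K - u - v + e) = (- ((-1) ^ (a + b + e)) :: int)"
    proof -
      obtain w where w: "K - u - v = w" by simp
      then have "k = u + v + w + 4" using uv assms by (auto simp: K_def)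
      then have "odd (u + v + w)" using assms(1) by simp
      then show ?thesis unfolding w by (auto simp: minus_one_power_iff)
    qed
    have "alt_binom a u * alt_binom b v * alt_binom e (K - u - v)
       = - ((-1) ^ (a + b + e)) * (int (u choose a) * int (v choose b) * int ((K - u - v) choose e))"
    proof -
      have "alt_binom a u * alt_binom b v * alt_binom e (K - u - v) = ((-1) ^ (u + a) * (-1) ^ (v + b) * (-1) ^ (K - u - v + e)) *
        (int (u choose a) * int (v choose b) * int ((K - u - v) choose e))"
        by (simp only: alt_binom_def mult_ac)
      then show ?thesis by (simp only: sgn)
    qed
    moreover have "K - (K - u - v) - v = u" using uv by simp
    ultimately show "(case x of (u, v) \<Rightarrow> alt_binom a u * alt_binom b v * alt_binom e (K - u - v) *
      ((-1) ^ (K - u - v) * int (k choose Suc (K - u - v)) - (-1) ^ u * int (k choose Suc u)))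
      = (case x of (u, v) \<Rightarrow> (-1) ^ (a + b + e) * (g a e u v - g e a (K - u - v) v))"
      unfolding g_def x prod.case by (simp only:) (simp only: algebra_simps)
  qed simp
  also have "\<dots> = (-1) ^ (a + b + e) * ((\<Sum>(u, v)\<in>A. g a e u v) - (\<Sum>(u, v)\<in>A. g e a (K - u - v) v))"
    by (simp add: sum_subtractf sum_distrib_left right_diff_distrib case_prod_unfold)
  also have "(\<Sum>(u, v)\<in>A. g e a (K - u - v) v) = (\<Sum>(u, v)\<in>A. g e a u v)"
    by (rule sum.reindex_bij_witness[of _ "\<lambda>(u, v). (K - u - v, v)" "\<lambda>(u, v). (K - u - v, v)"]) (auto simp: A_def)
  finally show ?thesis unfolding inner by (simp add: add_ac)
qed

section \<open>Index sets as sets of dominating lists\<close>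

lemma is_index_simps [simp]:
  "is_index []" "is_index (k # ks) \<longleftrightarrow> 1 \<le> k \<and> is_index ks"
  "is_index (ks @ ls) \<longleftrightarrow> is_index ks \<and> is_index ls" "is_index (rev ks) \<longleftrightarrow> is_index ks"
  "is_index (replicate m 1)"
  by (auto simp: is_index_def)

lemma is_index_take_drop: "is_index ks \<Longrightarrow> is_index (take j ks)" "is_index ks \<Longrightarrow> is_index (drop j ks)"
  by (auto simp: is_index_def dest: in_set_takeD in_set_dropD)

lemma is_index_dominating:
  assumes "is_index cs" "ks \<in> dominating cs k"
  shows "is_index ks"
  unfolding is_index_def all_set_conv_all_nth
proof (intro allI impI)
  fix l assume "l < length ks"
  then have "cs ! l \<le> ks ! l" "cs ! l \<in> set cs"
    using assms(2) by (auto simp: dominating_def list_all2_conv_all_nth)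
  then show "1 \<le> ks ! l" using assms(1) by (auto simp: is_index_def)
qed

lemma dominating_0: "is_index cs \<Longrightarrow> cs \<noteq> [] \<Longrightarrow> dominating cs 0 = {}"
  by (cases cs) (auto simp: dominating_Cons)

lemma contractions_index: "is_index ks \<Longrightarrow> ls \<in> set (contractions ks) \<Longrightarrow> is_index ls"
proof (induction ks arbitrary: ls rule: contractions.induct)
  case (3 k l ks)
  have ix: "is_index (l # ks)" "is_index ((k + l) # ks)" "1 \<le> k" using "3.prems" by auto
  show ?case
  proof (cases "ls \<in> set (contractions ((k + l) # ks))")
    case True
    then show ?thesis using "3.IH"(2) ix by blast
  next
    case False
    then obtain ms where "ls = k # ms" "ms \<in> set (contractions (l # ks))"
      using "3.prems" by auto
    then show ?thesis using "3.IH"(1)[OF ix(1)] ix(3) by simp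
  qed
qed simp_all

lemma index_set_eq:
  assumes "1 \<le> i" "i \<le> j" "j \<le> r"
  shows "index_set k r i j = (if i = j then dominating (replicate (i - 1) 1 @ 3 # replicate (r - i) 1) k
    else dominating (replicate (i - 1) 1 @ 2 # replicate (j - i - 1) 1 @ 2 # replicate (r - j) 1) k)"
proof -
  have len: "list_all2 (\<le>) cs ks \<longleftrightarrow> length ks = length cs \<and> (\<forall>l<length cs. cs ! l \<le> ks ! l)" for cs ks :: "nat list"
    by (auto simp: list_all2_conv_all_nth)
  have one: "is_index ks \<longleftrightarrow> (\<forall>l<length ks. 1 \<le> ks ! l)" for ks
    by (auto simp: is_index_def all_set_conv_all_nth)
  have nth1: "(replicate (i - 1) 1 @ 3 # replicate (r - i) 1) ! l = (if l \<in> {i - 1} then 3 else 1 :: nat)" if "l < r" for l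
    using that assms by (auto simp: nth_append nth_Cons' not_less)
  have nth2: "(replicate (i - 1) 1 @ 2 # replicate (j - i - 1) 1 @ 2 # replicate (r - j) 1) ! l = (if l \<in> {i - 1, j - 1} then 2 else 1 :: nat)"
    if "l < r" "i < j" for l
    using that assms by (auto simp: nth_append nth_Cons' not_less)
  have bound: "((\<forall>l<r. 1 \<le> f l) \<and> (\<forall>l\<in>S. c \<le> f l)) \<longleftrightarrow> (\<forall>l<r. (if l \<in> S then c else 1) \<le> f l)"
    if "S \<subseteq> {..<r}" "1 \<le> c" for r S c and f :: "nat \<Rightarrow> nat"
  proof -
    have "(\<forall>l<r. 1 \<le> f l) \<and> (\<forall>l\<in>S. c \<le> f l)" if H: "\<forall>l<r. (if l \<in> S then c else 1) \<le> f l"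
    proof (intro conjI allI impI ballI)
      fix l assume "l < r"
      then show "1 \<le> f l" using H \<open>1 \<le> c\<close> by (cases "l \<in> S") (auto intro: le_trans)
    next
      fix l assume "l \<in> S"
      then show "c \<le> f l" using H \<open>S \<subseteq> {..<r}\<close> by auto
    qed
    moreover have "(if l \<in> S then c else 1) \<le> f l" if "(\<forall>l<r. 1 \<le> f l) \<and> (\<forall>l\<in>S. c \<le> f l)" "l < r" for l
      using that by (cases "l \<in> S") simp_all
    ultimately show ?thesis by blast
  qed
  have key: "(length ks = r \<and> is_index ks \<and> (\<forall>l\<in>S. c \<le> ks ! l)) \<longleftrightarrow> list_all2 (\<le>) cs ks"
    if "length cs = r" "\<And>l. l < r \<Longrightarrow> cs ! l = (if l \<in> S then c else 1)" "S \<subseteq> {..<r}" "1 \<le> c" for ks cs S c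
  proof (cases "length ks = r")
    case True
    have "(\<forall>l<r. (if l \<in> S then c else 1) \<le> ks ! l) \<longleftrightarrow> (\<forall>l<r. cs ! l \<le> ks ! l)"
      by (intro all_cong) (simp only: that(2))
    then have 1: "(\<forall>l<r. 1 \<le> ks ! l) \<and> (\<forall>l\<in>S. c \<le> ks ! l) \<longleftrightarrow> (\<forall>l<r. cs ! l \<le> ks ! l)"
      using bound[OF that(3,4), of "(!) ks"] by (simp only:)
    show ?thesis unfolding len one True that(1) 1 by simp
  qed (use that in \<open>auto simp: len\<close>)
  show ?thesis
  proof (cases "i = j")
    case True
    have "{i - 1} \<subseteq> {..<r}" using assms by auto
    from key[OF _ nth1 this] show ?thesis
      using True assms by (auto simp: index_set_def dominating_def)
  next
    case False
    then have ij: "i < j" using assms by simp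
    have "{i - 1, j - 1} \<subseteq> {..<r}" using assms by auto
    moreover have "length (replicate (i - 1) 1 @ 2 # replicate (j - i - 1) 1 @ 2 # replicate (r - j) (1::nat)) = r"
      using ij assms by simp
    ultimately have "(length ks = r \<and> is_index ks \<and> (\<forall>l\<in>{i - 1, j - 1}. 2 \<le> ks ! l)) \<longleftrightarrow>
      list_all2 (\<le>) (replicate (i - 1) 1 @ 2 # replicate (j - i - 1) 1 @ 2 # replicate (r - j) 1) ks" for ks
      using key[OF _ nth2[OF _ ij]] by simp
    then show ?thesis
      using False by (auto simp: index_set_def dominating_def)
  qed
qed

lemma finite_index_set:
  assumes "1 \<le> i" "i \<le> j" "j \<le> r"
  shows "finite (index_set k r i j)"
  unfolding index_set_eq[OF assms] by (simp add: finite_dominating)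

lemma is_index_index_set: "ks \<in> index_set k r i j \<Longrightarrow> is_index ks"
  by (auto simp: index_set_def split: if_splits)

text \<open>\<open>N\<close> is an ideal of the algebra \<open>I\<close>. For A these are the
  families divisible by p and integral at p for almost all p; for S, the sequences with limit in
  zeta(2) Z and in Z. The rational constants in \<open>I\<close> permit division by integers. The
  reversal axiom reflects m -> p - m in the first case and x -> -x in the second.\<close>

locale mhs_family =
  fixes X :: "nat \<Rightarrow> 'a::field_char_0 list" and I N :: "(nat \<Rightarrow> 'a) set"
  assumes nonzero: "0 \<notin> set (X n)"
    and N_subset: "a \<in> N \<Longrightarrow> a \<in> I"
    and I_add: "a \<in> I \<Longrightarrow> b \<in> I \<Longrightarrow> (\<lambda>n. a n + b n) \<in> I"
    and I_mult: "a \<in> I \<Longrightarrow> b \<in> I \<Longrightarrow> (\<lambda>n. a n * b n) \<in> I"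
    and I_rat: "(\<lambda>n. of_rat q) \<in> I"
    and N_add: "a \<in> N \<Longrightarrow> b \<in> N \<Longrightarrow> (\<lambda>n. a n + b n) \<in> N"
    and N_mult: "a \<in> N \<Longrightarrow> b \<in> I \<Longrightarrow> (\<lambda>n. a n * b n) \<in> N"
    and mhs_I: "is_index ks \<Longrightarrow> (\<lambda>n. mhs (X n) ks) \<in> I"
    and power_sum_N: "1 \<le> k \<Longrightarrow> (\<lambda>n. mhs (X n) [k]) \<in> N"
    and reversal_N: "is_index ks \<Longrightarrow> (\<lambda>n. mhs (X n) (rev ks) - (-1) ^ sum_list ks * mhs (X n) ks) \<in> N"
begin

lemma N_mult_left: "b \<in> I \<Longrightarrow> a \<in> N \<Longrightarrow> (\<lambda>n. b n * a n) \<in> N"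
  using N_mult[of a b] by (simp add: mult.commute)

lemma I_int: "(\<lambda>n. of_int q) \<in> I"
  using I_rat[of "of_int q"] by simp

lemma N_scale: "a \<in> N \<Longrightarrow> (\<lambda>n. of_rat q * a n) \<in> N"
  by (rule N_mult_left[OF I_rat])

lemma N_scale_int: "a \<in> N \<Longrightarrow> (\<lambda>n. of_int q * a n) \<in> N"
  by (rule N_mult_left[OF I_int])

lemma N_uminus: "a \<in> N \<Longrightarrow> (\<lambda>n. - a n) \<in> N"
  using N_scale_int[of a "-1"] by simp

lemma N_diff: "a \<in> N \<Longrightarrow> b \<in> N \<Longrightarrow> (\<lambda>n. a n - b n) \<in> N"
  using N_add[OF _ N_uminus] by simp

lemma N_0: "(\<lambda>n. 0) \<in> N"
  using N_scale[OF power_sum_N[of 1], of 0] by simp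

lemma N_sum: "(\<And>i. i \<in> S \<Longrightarrow> a i \<in> N) \<Longrightarrow> (\<lambda>n. \<Sum>i\<in>S. a i n) \<in> N"
  by (induction S rule: infinite_finite_induct) (auto intro: N_0 N_add)

lemma I_sum: "(\<And>i. i \<in> S \<Longrightarrow> a i \<in> I) \<Longrightarrow> (\<lambda>n. \<Sum>i\<in>S. a i n) \<in> I"
  by (induction S rule: infinite_finite_induct) (auto intro: N_subset[OF N_0] I_add)

lemma I_sum_list: "(\<And>c. c \<in> set cs \<Longrightarrow> (\<lambda>n. f n c) \<in> I) \<Longrightarrow> (\<lambda>n. sum_list (map (f n) cs)) \<in> I"
  by (induction cs) (auto intro: N_subset[OF N_0] I_add)

lemma mhs_star_I: "is_index ks \<Longrightarrow> (\<lambda>n. mhs_star (X n) ks) \<in> I"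
  unfolding mhs_star_contractions by (intro I_sum_list mhs_I) (rule contractions_index)

text \<open>Newton's identities solved for the elementary symmetric function of degree m, which
  requires the division by m.\<close>

lemma ones_N: "1 \<le> m \<Longrightarrow> (\<lambda>n. mhs (X n) (replicate m 1)) \<in> N"
proof (induction m rule: less_induct)
  case (less m)
  obtain l where m: "m = Suc l" using less.prems by (cases m) auto
  have "(\<lambda>n. fps_nth (sin_fps (X n)) (l - i) * mhs (X n) [Suc i]) \<in> N" for i
  proof -
    have "(\<lambda>n. of_int ((-1) ^ (l - i)) * mhs (X n) (replicate (l - i) 1)) \<in> I"
      by (intro I_mult I_int mhs_I is_index_simps)
    then show ?thesis
      using N_mult_left[OF _ power_sum_N[of "Suc i"]] by (simp add: sin_fps_nth[OF nonzero])
  qed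
  then have "(\<lambda>n. - (\<Sum>i\<le>l. fps_nth (sin_fps (X n)) (l - i) * mhs (X n) [Suc i])) \<in> N"
    by (intro N_uminus N_sum)
  then have "(\<lambda>n. of_nat (Suc l) * fps_nth (sin_fps (X n)) (Suc l)) \<in> N"
    by (simp only: newton_identity[OF nonzero])
  then have "(\<lambda>n. of_rat ((-1) ^ Suc l / of_nat (Suc l)) * (of_nat (Suc l) * fps_nth (sin_fps (X n)) (Suc l))) \<in> N"
    by (rule N_scale)
  moreover have "of_rat ((-1) ^ Suc l / of_nat (Suc l)) * (of_nat (Suc l) * fps_nth (sin_fps (X n)) (Suc l)) = mhs (X n) (replicate m 1)" for n
  proof -
    have "(of_nat (Suc l) :: 'a) \<noteq> 0" by (rule of_nat_neq_0)
    then show ?thesis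
      by (simp add: sin_fps_nth[OF nonzero] m of_rat_mult of_rat_divide of_rat_power of_rat_minus del: of_nat_Suc replicate.simps)
  qed
  ultimately show ?case by simp
qed

section \<open>Restricted sums and their star versions modulo null families\<close>

definition W :: "nat list \<Rightarrow> nat \<Rightarrow> nat \<Rightarrow> 'a" where
  "W cs k n = (\<Sum>ks\<in>dominating cs k. mhs (X n) ks)"

definition Wstar :: "nat list \<Rightarrow> nat \<Rightarrow> nat \<Rightarrow> 'a" where
  "Wstar cs k n = (\<Sum>ks\<in>dominating cs k. mhs_star (X n) ks)"

lemma W_I: "is_index cs \<Longrightarrow> W cs k \<in> I"
  unfolding W_def by (intro I_sum mhs_I) (rule is_index_dominating)

lemma Wstar_I: "is_index cs \<Longrightarrow> Wstar cs k \<in> I"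
  unfolding Wstar_def by (intro I_sum mhs_star_I) (rule is_index_dominating)

text \<open>By \<open>ones_N\<close> every coefficient of the product except the constant 1 is
  null.\<close>

lemma W_cong_sin_fps:
  assumes "is_index cs"
  shows "(\<lambda>n. fps_nth (sin_fps (X n) * strict_sum (X n) (map geom_fps cs)) k - W cs k n) \<in> N"
proof -
  have "fps_nth (sin_fps (X n) * strict_sum (X n) (map geom_fps cs)) k - W cs k n
     = (\<Sum>s\<in>{1..k}. (of_int ((-1) ^ s) * mhs (X n) (replicate s 1)) * W cs (k - s) n)" for n
    by (simp add: fps_mult_nth strict_sum_geom_nth sin_fps_nth[OF nonzero] sum.atLeast_Suc_atMost W_def One_nat_def)
  moreover have "(\<lambda>n. \<Sum>s\<in>{1..k}. (of_int ((-1) ^ s) * mhs (X n) (replicate s 1)) * W cs (k - s) n) \<in> N"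
    by (intro N_sum N_mult N_scale_int ones_N W_I assms) auto
  ultimately show ?thesis by simp
qed

lemma W_N_if_sin_fps:
  assumes "is_index cs" "(\<lambda>n. fps_nth (sin_fps (X n) * strict_sum (X n) (map geom_fps cs)) k) \<in> N"
  shows "W cs k \<in> N"
  using N_diff[OF assms(2) W_cong_sin_fps[OF assms(1), of k]] by simp

lemma W_unrestricted_N:
  assumes "1 \<le> a \<or> 1 \<le> k"
  shows "W (replicate a 1) k \<in> N"
proof (cases "k = 0")
  case True
  then have "dominating (replicate a 1) k = {}"
    using assms by (auto intro!: dominating_0)
  then have "W (replicate a 1) k = (\<lambda>n. 0)" by (simp add: W_def fun_eq_iff)
  then show ?thesis using N_0 by simp
next
  case False
  then have "(\<lambda>n. of_int ((-1) ^ (k + a) * int (k choose a)) * mhs (X n) (replicate k 1)) \<in> N"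
    by (intro N_scale_int ones_N) simp
  then show ?thesis
    by (intro W_N_if_sin_fps) (simp_all only: is_index_simps sin_fps_run_nth[OF nonzero] alt_binom_def of_int_mult of_int_power of_int_minus of_int_1 of_int_of_nat_eq)
qed

lemma W_single_N:
  assumes "\<And>u v. u + v + c = k \<Longrightarrow> (\<lambda>n. mhs (X n) (replicate u 1 @ c # replicate v 1)) \<in> N" "1 \<le> c"
  shows "W (replicate a 1 @ c # replicate b 1) k \<in> N"
proof (rule W_N_if_sin_fps)
  define q where "q u = (-1) ^ (u + a) * int (u choose a) * ((-1) ^ (k - c - u + b) * int ((k - c - u) choose b))" for u
  have q: "alt_binom a u * alt_binom b (k - c - u) = (of_int (q u) :: 'a)" for u
    by (simp add: q_def alt_binom_def)
  have "(\<lambda>n. \<Sum>u\<le>k - c. of_int (q u) * mhs (X n) (replicate u 1 @ c # replicate (k - c - u) 1)) \<in> N" if "c \<le> k"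
    by (intro N_sum N_scale_int assms) (use that in auto)
  then show "(\<lambda>n. fps_nth (sin_fps (X n) * strict_sum (X n) (map geom_fps (replicate a 1 @ c # replicate b 1))) k) \<in> N"
    unfolding sin_fps_marked1_nth[OF nonzero] q
    by (cases "k < c") (simp_all add: N_0)
qed (use assms(2) in simp)

text \<open>The antipode relation at the level of generating functions. The last hypothesis puts a
  null factor into every proper cut, so only the two trivial cuts survive.\<close>

lemma antipode_N:
  assumes "is_index cs" "cs \<noteq> []"
    and "\<And>j l. 0 < j \<Longrightarrow> j < length cs \<Longrightarrow> l \<le> k \<Longrightarrow> W (rev (take j cs)) l \<in> N \<or> Wstar (drop j cs) (k - l) \<in> N"
  shows "(\<lambda>n. Wstar cs k n + (-1) ^ length cs * W (rev cs) k n) \<in> N"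
proof -
  define r where "r = length cs"
  have r0: "r \<noteq> 0" using assms(2) by (simp add: r_def)
  define T where "T j n = (\<Sum>l\<le>k. W (rev (take j cs)) l n * Wstar (drop j cs) (k - l) n)" for j n
  have "(\<Sum>j\<le>r. (-1) ^ j * T j n) = 0" for n
  proof -
    define f where "f j = strict_sum (X n) (rev (take j (map geom_fps cs))) * weak_sum (X n) (drop j (map geom_fps cs))" for j
    have "(\<Sum>j\<le>r. (-1) ^ j * f j) = 0"
      using antipode_sum[of "map geom_fps cs" "X n"] assms(2) by (simp add: f_def r_def mult.assoc)
    then have "0 = fps_nth (\<Sum>j\<le>r. (-1) ^ j * f j) k" by simp
    also have "\<dots> = (\<Sum>j\<le>r. (-1) ^ j * fps_nth (f j) k)"
    proof -
      have "fps_nth ((-1) ^ j * f j) k = (-1) ^ j * fps_nth (f j) k" for j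
        by (cases "even j") auto
      then show ?thesis by (simp add: fps_sum_nth)
    qed
    finally have "0 = (\<Sum>j\<le>r. (-1) ^ j * fps_nth (f j) k)" .
    moreover have "fps_nth (f j) k = T j n" for j
    proof -
      have "f j = strict_sum (X n) (map geom_fps (rev (take j cs))) * weak_sum (X n) (map geom_fps (drop j cs))"
        by (simp add: f_def take_map drop_map rev_map)
      then show ?thesis
        by (simp add: T_def fps_mult_nth strict_sum_geom_nth weak_sum_geom_nth W_def Wstar_def atLeast0AtMost)
    qed
    ultimately show ?thesis by simp
  qed
  then have eq: "T 0 n + (-1) ^ r * T r n = - (\<Sum>j\<in>{0<..<r}. (-1) ^ j * T j n)" for n
  proof -
    have "{..r} = insert 0 (insert r {0<..<r})" using r0 by auto
    then show ?thesis using \<open>(\<Sum>j\<le>r. (-1) ^ j * T j n) = 0\<close> r0 by (simp add: add.assoc eq_neg_iff_add_eq_0)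
  qed
  have "(\<lambda>n. - (\<Sum>j\<in>{0<..<r}. of_int ((-1) ^ j) * T j n)) \<in> N"
  proof (intro N_uminus N_sum N_scale_int)
    fix j assume j: "j \<in> {0<..<r}"
    have "(\<lambda>n. W (rev (take j cs)) l n * Wstar (drop j cs) (k - l) n) \<in> N" if "l \<le> k" for l
    proof -
      have ix: "is_index (rev (take j cs))" "is_index (drop j cs)"
        using assms(1) is_index_take_drop[of cs j] by auto
      have "W (rev (take j cs)) l \<in> N \<or> Wstar (drop j cs) (k - l) \<in> N"
        using assms(3)[of j l] j that by (simp add: r_def)
      then show ?thesis
        using N_mult[OF _ Wstar_I[OF ix(2)]] N_mult_left[OF W_I[OF ix(1)]] by blast
    qed
    then show "T j \<in> N" unfolding T_def by (intro N_sum) auto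
  qed
  then have "(\<lambda>n. T 0 n + (-1) ^ r * T r n) \<in> N"
    by (simp add: eq)
  moreover have "T 0 n = Wstar cs k n" for n
  proof -
    have "T 0 n = (\<Sum>l\<le>k. if l = 0 then Wstar cs k n else 0)"
      unfolding T_def by (intro sum.cong) (auto simp: W_def dominating_Nil)
    then show ?thesis by simp
  qed
  moreover have "T r n = W (rev cs) k n" for n
  proof -
    have "T r n = (\<Sum>l\<le>k. if l = k then W (rev cs) k n else 0)"
      unfolding T_def by (intro sum.cong) (auto simp: Wstar_def dominating_Nil r_def)
    then show ?thesis by simp
  qed
  ultimately show ?thesis by (simp add: r_def)
qed

lemma W_rev_N:
  assumes "is_index cs"
  shows "(\<lambda>n. W (rev cs) k n - (-1) ^ k * W cs k n) \<in> N"
proof -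
  have "bij_betw rev (dominating cs k) (dominating (rev cs) k)"
    by (rule bij_betwI[where g = rev]) (auto simp: dominating_def list_all2_rev1)
  then have "W (rev cs) k n = (\<Sum>ks\<in>dominating cs k. mhs (X n) (rev ks))" for n
    unfolding W_def by (rule sum.reindex_bij_betw[symmetric])
  then have "W (rev cs) k n - (-1) ^ k * W cs k n = (\<Sum>ks\<in>dominating cs k. mhs (X n) (rev ks) - (-1) ^ sum_list ks * mhs (X n) ks)" for n
    by (simp add: W_def sum_subtractf sum_distrib_left dominating_def)
  moreover have "(\<lambda>n. \<Sum>ks\<in>dominating cs k. mhs (X n) (rev ks) - (-1) ^ sum_list ks * mhs (X n) ks) \<in> N"
    by (intro N_sum reversal_N is_index_dominating[OF assms])
  ultimately show ?thesis by simp
qed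

lemma Wstar_unrestricted_N:
  assumes "1 \<le> b"
  shows "Wstar (replicate b 1) k \<in> N"
  using assms
proof (induction b arbitrary: k rule: less_induct)
  case (less b)
  have "(\<lambda>n. Wstar (replicate b 1) k n + (-1) ^ length (replicate b (1::nat)) * W (rev (replicate b 1)) k n) \<in> N"
    by (rule antipode_N) (use less.prems in \<open>auto intro!: disjI1 W_unrestricted_N\<close>)
  moreover have "(\<lambda>n. of_int ((-1) ^ b) * W (replicate b 1) k n) \<in> N"
    using less.prems by (intro N_scale_int W_unrestricted_N) auto
  ultimately have "(\<lambda>n. (Wstar (replicate b 1) k n + (-1) ^ b * W (replicate b 1) k n) - of_int ((-1) ^ b) * W (replicate b 1) k n) \<in> N"
    by (intro N_diff) simp_all
  then show ?case by simp
qed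

text \<open>A proper cut leaves a non-empty unrestricted run alone on one side of the cut, and
  unrestricted sums are null.\<close>

lemma star_single_N:
  assumes "1 \<le> c"
  shows "(\<lambda>n. Wstar (replicate a 1 @ c # replicate b 1) k n
      + (-1) ^ (a + b + 1) * W (replicate b 1 @ c # replicate a 1) k n) \<in> N"
proof -
  let ?cs = "replicate a 1 @ c # replicate b 1"
  have "(\<lambda>n. Wstar ?cs k n + (-1) ^ length ?cs * W (rev ?cs) k n) \<in> N"
  proof (rule antipode_N)
    fix j l assume j: "0 < j" "j < length ?cs"
    show "W (rev (take j ?cs)) l \<in> N \<or> Wstar (drop j ?cs) (k - l) \<in> N"
    proof (cases "j \<le> a")
      case True
      then show ?thesis using j W_unrestricted_N[of j l] by simp
    next
      case False
      define m where "m = j - a - 1"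
      have m: "j = Suc (a + m)" "m < b" using False j by (auto simp: m_def)
      then have "drop j ?cs = replicate (b - m) 1" by simp
      then show ?thesis using m Wstar_unrestricted_N[of "b - m" "k - l"] by simp
    qed
  qed (use assms in auto)
  moreover have "length ?cs = a + b + 1" "rev ?cs = replicate b 1 @ c # replicate a 1" by simp_all
  ultimately show ?thesis by (simp only:)
qed

text \<open>In odd weight reversal is the sign -1, which undoes the reversal of \<open>cs\<close>
  produced by the antipode.\<close>

lemma star_single_cong:
  assumes "1 \<le> c" "odd k"
  shows "(\<lambda>n. Wstar (replicate a 1 @ c # replicate b 1) k n
      - (-1) ^ (a + b + 1) * W (replicate a 1 @ c # replicate b 1) k n) \<in> N"
proof -
  let ?cs = "replicate a 1 @ c # replicate b 1"
  have "(\<lambda>n. W (rev ?cs) k n - (-1) ^ k * W ?cs k n) \<in> N"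
    by (rule W_rev_N) (use assms in auto)
  then have "(\<lambda>n. W (replicate b 1 @ c # replicate a 1) k n + W ?cs k n) \<in> N"
    using assms by simp
  from N_diff[OF star_single_N[OF assms(1), of a b k] N_scale_int[OF this, of "(-1) ^ (a + b + 1)"]]
  show ?thesis by (simp add: algebra_simps)
qed

text \<open>Besides unrestricted runs, a cut may separate the two marked letters. Then each side has
  one entry 2, and since the total weight is odd one of the two sides has even weight, where such
  sums are null by \<open>even_N\<close>.\<close>

lemma star_double_cong:
  assumes "odd k"
    and even_N: "\<And>u v. even (u + v) \<Longrightarrow> (\<lambda>n. mhs (X n) (replicate u 1 @ 2 # replicate v 1)) \<in> N"
  shows "(\<lambda>n. Wstar (replicate a 1 @ 2 # replicate b 1 @ 2 # replicate e 1) k n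
      - (-1) ^ (a + b + e + 2) * W (replicate a 1 @ 2 # replicate b 1 @ 2 # replicate e 1) k n) \<in> N"
proof -
  let ?cs = "replicate a 1 @ 2 # replicate b 1 @ 2 # replicate e 1 :: nat list"
  have W2: "W (replicate u 1 @ 2 # replicate v 1) l \<in> N" if "even l" for u v l
    by (rule W_single_N) (use that in \<open>auto intro!: even_N\<close>)
  have Wstar2: "Wstar (replicate u 1 @ 2 # replicate v 1) l \<in> N" if "even l" for u v l
    using N_diff[OF star_single_N[of 2 u v l] N_scale_int[OF W2[OF that, of v u], of "(-1) ^ (u + v + 1)"]] by simp
  have A: "(\<lambda>n. Wstar ?cs k n + (-1) ^ length ?cs * W (rev ?cs) k n) \<in> N"
  proof (rule antipode_N)
    fix j l assume j: "0 < j" "j < length ?cs" and l: "l \<le> k"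
    consider "j \<le> a" | "a < j" "j \<le> a + 1 + b" | "a + 1 + b < j" by linarith
    then show "W (rev (take j ?cs)) l \<in> N \<or> Wstar (drop j ?cs) (k - l) \<in> N"
    proof cases
      case 1
      then show ?thesis using j W_unrestricted_N[of j l] by simp
    next
      case 2
      define m where "m = j - a - 1"
      have j: "j = Suc (a + m)" "m \<le> b" using 2 by (auto simp: m_def)
      have "take j ?cs = replicate a 1 @ 2 # replicate m 1"
        using j by (simp add: min_def)
      then have "rev (take j ?cs) = replicate m 1 @ 2 # replicate a 1" by simp
      moreover have "drop j ?cs = replicate (b - m) 1 @ 2 # replicate e 1"
        using j by simp
      moreover have "even l \<or> even (k - l)" using assms(1) l by auto
      ultimately show ?thesis using W2 Wstar2 by metis
    next
      case 3
      define m where "m = j - (a + b + 2)"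
      have m: "j = a + b + 2 + m" "m < e" using 3 j by (auto simp: m_def)
      then have "drop j ?cs = replicate (e - m) 1" by simp
      then show ?thesis using m Wstar_unrestricted_N[of "e - m" "k - l"] by simp
    qed
  qed auto
  have "(\<lambda>n. W (rev ?cs) k n - (-1) ^ k * W ?cs k n) \<in> N"
    by (rule W_rev_N) auto
  then have "(\<lambda>n. W (rev ?cs) k n + W ?cs k n) \<in> N"
    using assms by simp
  from N_diff[OF A N_scale_int[OF this, of "(-1) ^ (a + b + e + 2)"]]
  show ?thesis by (simp add: algebra_simps)
qed

text \<open>The values at \<open>(1, \<dots>, 1, 2, 1, \<dots>, 1, 2, 1, \<dots>, 1)\<close> and \<open>(1, \<dots>, 1, 3, 1, \<dots>, 1)\<close> do not depend on
  the length of the middle run; the second shape plays the role of a middle run of length \<open>-1\<close>.\<close>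

definition extremal_values :: "nat \<Rightarrow> (nat \<Rightarrow> 'a) \<Rightarrow> bool" where
  "extremal_values k z \<longleftrightarrow>
    (\<forall>u v w. u + v + w + 4 = k \<longrightarrow> (\<lambda>n. 2 * mhs (X n) (replicate u 1 @ 2 # replicate v 1 @ 2 # replicate w 1)
       - of_int ((-1) ^ w * int (k choose Suc w) - (-1) ^ u * int (k choose Suc u)) * z n) \<in> N) \<and>
    (\<forall>u w. u + w + 3 = k \<longrightarrow> (\<lambda>n. 2 * mhs (X n) (replicate u 1 @ 3 # replicate w 1)
       - of_int ((-1) ^ w * int (k choose Suc w) - (-1) ^ u * int (k choose Suc u)) * z n) \<in> N)"

lemma star_N:
  assumes "odd k" "1 \<le> i" "i \<le> j" "j \<le> r"
    and even_N: "\<And>u v. even (u + v) \<Longrightarrow> (\<lambda>n. mhs (X n) (replicate u 1 @ 2 # replicate v 1)) \<in> N"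
  shows "(\<lambda>n. (\<Sum>ks\<in>index_set k r i j. mhs_star (X n) ks) - (-1) ^ r * (\<Sum>ks\<in>index_set k r i j. mhs (X n) ks)) \<in> N"
proof (cases "i = j")
  case True
  have "i - 1 + (r - i) + 1 = r" using assms by simp
  then show ?thesis
    using star_single_cong[of 3 k "i - 1" "r - i"] assms True
    by (simp add: index_set_eq W_def Wstar_def)
next
  case False
  have "i - 1 + (j - i - 1) + (r - j) + 2 = r" using assms False by simp
  then show ?thesis
    using star_double_cong[OF assms(1) even_N, of "i - 1" "j - i - 1" "r - j"] assms False
    by (simp only: index_set_eq W_def Wstar_def if_False)
qed

text \<open>The extremal values enter with the weights \<open>alt_binom\<close>; the same weights
  applied to their integer coefficients give N by \<open>alt_binom_sum1\<close> and
  \<open>alt_binom_sum2\<close>.\<close>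

lemma value_N:
  assumes "odd k" "3 \<le> k" "1 \<le> i" "i \<le> j" "j \<le> r" "r \<le> k - 2"
    and ext: "extremal_values k z"
  shows "(\<lambda>n. 2 * (\<Sum>ks\<in>index_set k r i j. mhs (X n) ks) - of_int (N_coeff (int k) (int r) (int i) (int j)) * z n) \<in> N"
proof -
  define q where "q u w = (-1) ^ w * int (k choose Suc w) - (-1) ^ u * int (k choose Suc u)" for u w
  have E1: "(\<lambda>n. 2 * mhs (X n) (replicate u 1 @ 3 # replicate w 1) - of_int (q u w) * z n) \<in> N"
    if "u + w + 3 = k" for u w
    using ext that unfolding extremal_values_def q_def by blast
  have E2: "(\<lambda>n. 2 * mhs (X n) (replicate u 1 @ 2 # replicate v 1 @ 2 # replicate w 1) - of_int (q u w) * z n) \<in> N"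
    if "u + v + w + 4 = k" for u v w
    using ext that unfolding extremal_values_def q_def by blast
  have fin: "(\<lambda>n. 2 * W cs k n - c * z n) \<in> N"
    if "is_index cs" "(\<lambda>n. 2 * fps_nth (sin_fps (X n) * strict_sum (X n) (map geom_fps cs)) k - c * z n) \<in> N" for cs c
    using N_diff[OF that(2) N_scale_int[OF W_cong_sin_fps[OF that(1), of k], of 2]] by (simp add: algebra_simps)
  show ?thesis
  proof (cases "i = j")
    case True
    define a e where "a = i - 1" and "e = r - i"
    have ae: "r = a + e + 1" "a + e + 3 \<le> k" "i - 1 = a" "r - i = e" "r - j = e" "j - 1 = a" using assms True by (auto simp: a_def e_def)
    have "(\<lambda>n. 2 * fps_nth (sin_fps (X n) * strict_sum (X n) (map geom_fps (replicate a 1 @ 3 # replicate e 1))) k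
        - of_int (N_coeff (int k) (int r) (int i) (int j)) * z n) \<in> N"
    proof -
      have "2 * fps_nth (sin_fps (X n) * strict_sum (X n) (map geom_fps (replicate a 1 @ 3 # replicate e 1))) k
          - of_int (N_coeff (int k) (int r) (int i) (int j)) * z n
        = (\<Sum>u\<le>k - 3. of_int (alt_binom a u * alt_binom e (k - 3 - u)) *
           (2 * mhs (X n) (replicate u 1 @ 3 # replicate (k - 3 - u) 1) - of_int (q u (k - 3 - u)) * z n))" for n
      proof -
        have "N_coeff (int k) (int r) (int i) (int j) = (\<Sum>u\<le>k - 3. alt_binom a u * alt_binom e (k - 3 - u) * q u (k - 3 - u))"
          unfolding q_def N_coeff_binom_sum[OF assms(1-6)] alt_binom_sum1[OF assms(1) ae(2)] ae(3-6)
          by (simp only: ae(1))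
        moreover have "\<not> k < 3" using assms by simp
        then have "fps_nth (sin_fps (X n) * strict_sum (X n) (map geom_fps (replicate a 1 @ 3 # replicate e 1))) k
          = (\<Sum>u\<le>k - 3. of_int (alt_binom a u * alt_binom e (k - 3 - u)) * mhs (X n) (replicate u 1 @ 3 # replicate (k - 3 - u) 1))"
          by (simp only: sin_fps_marked1_nth[OF nonzero] if_False of_int_mult of_int_alt_binom)
        ultimately show ?thesis
          by (simp only: sum_two_minus)
      qed
      then show ?thesis
        using assms(2) by (simp only:) (intro N_sum N_scale_int E1, simp)
    qed
    then show ?thesis
      using fin[of "replicate a 1 @ 3 # replicate e 1"] assms True by (simp add: index_set_eq W_def a_def e_def)
  next
    case False
    define a b e where "a = i - 1" and "b = j - i - 1" and "e = r - j"
    have abe: "r = a + b + e + 2" "a + b + e + 4 \<le> k" "i - 1 = a" "r - i = b + e + 1" "r - j = e" "j - 1 = a + b + 1" using assms False by (auto simp: a_def b_def e_def)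
    let ?cs = "replicate a 1 @ 2 # replicate b 1 @ 2 # replicate e 1"
    have "(\<lambda>n. 2 * fps_nth (sin_fps (X n) * strict_sum (X n) (map geom_fps ?cs)) k
        - of_int (N_coeff (int k) (int r) (int i) (int j)) * z n) \<in> N"
    proof -
      have "2 * fps_nth (sin_fps (X n) * strict_sum (X n) (map geom_fps ?cs)) k
          - of_int (N_coeff (int k) (int r) (int i) (int j)) * z n
        = (\<Sum>u\<le>k - 4. \<Sum>v\<le>k - 4 - u. of_int (alt_binom a u * alt_binom b v * alt_binom e (k - 4 - u - v)) *
           (2 * mhs (X n) (replicate u 1 @ 2 # replicate v 1 @ 2 # replicate (k - 4 - u - v) 1)
            - of_int (q u (k - 4 - u - v)) * z n))" for n
      proof -
        have "N_coeff (int k) (int r) (int i) (int j) = (\<Sum>u\<le>k - 4. \<Sum>v\<le>k - 4 - u.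
            alt_binom a u * alt_binom b v * alt_binom e (k - 4 - u - v) * q u (k - 4 - u - v))"
          unfolding q_def N_coeff_binom_sum[OF assms(1-6)] alt_binom_sum2[OF assms(1) abe(2)] abe(3-6)
          by (simp only: abe(1))
        moreover have "\<not> k < 4" using abe by simp
        then have "fps_nth (sin_fps (X n) * strict_sum (X n) (map geom_fps ?cs)) k
          = (\<Sum>u\<le>k - 4. \<Sum>v\<le>k - 4 - u. of_int (alt_binom a u * alt_binom b v * alt_binom e (k - 4 - u - v)) *
             mhs (X n) (replicate u 1 @ 2 # replicate v 1 @ 2 # replicate (k - 4 - u - v) 1))"
          by (simp only: sin_fps_marked2_nth[OF nonzero] if_False of_int_mult of_int_alt_binom)
        ultimately show ?thesis
          by (simp only: sum_sum_two_minus)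
      qed
      then show ?thesis
        using abe(2) by (simp only:) (intro N_sum N_scale_int E2, simp)
    qed
    then show ?thesis
      using fin[of ?cs] assms False by (simp add: index_set_eq W_def a_def b_def e_def)
  qed
qed

end

section \<open>The finite case\<close>

definition p_int :: "nat \<Rightarrow> rat \<Rightarrow> bool" where
  "p_int p q \<longleftrightarrow> (\<exists>a b. \<not> int p dvd b \<and> q = of_int a / of_int b)"

definition p_null :: "nat \<Rightarrow> rat \<Rightarrow> bool" where
  "p_null p q \<longleftrightarrow> (\<exists>r. p_int p r \<and> q = of_nat p * r)"

context
  fixes p :: nat
  assumes p: "prime p"
begin

lemma not_dvd_1: "\<not> int p dvd 1"
  using p prime_gt_1_nat[OF p] by (auto dest: zdvd_imp_le)

lemma not_dvd_mult: "\<not> int p dvd b \<Longrightarrow> \<not> int p dvd d \<Longrightarrow> \<not> int p dvd b * d"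
  using p by (simp add: prime_dvd_mult_iff)

lemma p_int_of_int [simp]: "p_int p (of_int a)"
  unfolding p_int_def by (rule exI[of _ a], rule exI[of _ 1]) (use not_dvd_1 in simp)

lemma p_int_of_nat [simp]: "p_int p (of_nat a)"
  using p_int_of_int[of "int a"] by simp

lemma p_int_simps [simp]: "p_int p 0" "p_int p 1" "p_int p (-1)" "p_int p (numeral n)"
  using p_int_of_int[of 0] p_int_of_int[of 1] p_int_of_int[of "-1"] p_int_of_int[of "numeral n"] by simp_all

lemma p_int_inverse: "\<not> p dvd n \<Longrightarrow> p_int p (1 / of_nat n)"
  unfolding p_int_def by (rule exI[of _ 1], rule exI[of _ "int n"]) simp

lemma p_int_add: "p_int p x \<Longrightarrow> p_int p y \<Longrightarrow> p_int p (x + y)"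
proof -
  assume "p_int p x" "p_int p y"
  then obtain a b c d where "\<not> int p dvd b" "x = of_int a / of_int b" "\<not> int p dvd d" "y = of_int c / of_int d"
    by (auto simp: p_int_def)
  moreover from this have "b \<noteq> 0" "d \<noteq> 0" by auto
  ultimately show ?thesis unfolding p_int_def
    by (intro exI[of _ "a * d + c * b"] exI[of _ "b * d"]) (simp add: not_dvd_mult field_simps)
qed

lemma p_int_mult: "p_int p x \<Longrightarrow> p_int p y \<Longrightarrow> p_int p (x * y)"
proof -
  assume "p_int p x" "p_int p y"
  then obtain a b c d where "\<not> int p dvd b" "x = of_int a / of_int b" "\<not> int p dvd d" "y = of_int c / of_int d"
    by (auto simp: p_int_def)
  then show ?thesis unfolding p_int_def
    by (intro exI[of _ "a * c"] exI[of _ "b * d"]) (simp add: not_dvd_mult)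
qed

lemma p_int_power: "p_int p x \<Longrightarrow> p_int p (x ^ n)"
  by (induction n) (auto intro: p_int_mult)

lemma p_int_minus: "p_int p x \<Longrightarrow> p_int p (- x)"
  using p_int_mult[of "-1" x] by simp

lemma p_int_sum: "(\<And>i. i \<in> S \<Longrightarrow> p_int p (f i)) \<Longrightarrow> p_int p (\<Sum>i\<in>S. f i)"
  by (induction S rule: infinite_finite_induct) (auto intro: p_int_add)

lemma p_null_imp_int: "p_null p x \<Longrightarrow> p_int p x"
  unfolding p_null_def by (auto intro: p_int_mult)

lemma p_null_0 [simp]: "p_null p 0"
  unfolding p_null_def by (rule exI[of _ 0]) simp

lemma p_null_mult: "p_null p x \<Longrightarrow> p_int p y \<Longrightarrow> p_null p (x * y)"
  unfolding p_null_def using p_int_mult by (metis mult.assoc)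

lemma p_null_mult_left: "p_int p y \<Longrightarrow> p_null p x \<Longrightarrow> p_null p (y * x)"
  using p_null_mult by (simp add: mult.commute)

lemma p_null_add: "p_null p x \<Longrightarrow> p_null p y \<Longrightarrow> p_null p (x + y)"
  unfolding p_null_def using p_int_add by (metis distrib_left)

lemma p_null_minus: "p_null p x \<Longrightarrow> p_null p (- x)"
  using p_null_mult_left[of "-1" x] by simp

lemma p_null_diff: "p_null p x \<Longrightarrow> p_null p y \<Longrightarrow> p_null p (x - y)"
  using p_null_add[OF _ p_null_minus] by simp

lemma p_null_sum: "(\<And>i. i \<in> S \<Longrightarrow> p_null p (f i)) \<Longrightarrow> p_null p (\<Sum>i\<in>S. f i)"
  by (induction S rule: infinite_finite_induct) (auto intro: p_null_add)

lemma p_null_of_nat: "p dvd n \<Longrightarrow> p_null p (of_nat n)"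
  unfolding p_null_def by (auto elim!: dvdE intro: exI[of _ "of_nat _"])

lemma p_null_of_int: "int p dvd n \<Longrightarrow> p_null p (of_int n)"
  unfolding p_null_def by (auto elim!: dvdE intro: exI[of _ "of_int _"])

lemma p_null_mult_diff:
  assumes "p_int p y" "p_int p x'" "p_null p (x - x')" "p_null p (y - y')"
  shows "p_null p (x * y - x' * y')"
proof -
  have "x * y - x' * y' = (x - x') * y + x' * (y - y')" by (simp add: algebra_simps)
  then show ?thesis using assms by (auto intro: p_null_add p_null_mult p_null_mult_left)
qed

lemma p_null_power_diff:
  assumes "p_int p x" "p_int p x'" "p_null p (x - x')"
  shows "p_null p (x ^ n - x' ^ n)"
  using assms by (induction n) (auto intro: p_null_mult_diff p_int_power)

lemma rat_mod_cong_int: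
  assumes "\<not> int p dvd b" "q = of_int a / of_int b"
  shows "[x = rat_mod p q] (mod int p) \<longleftrightarrow> [b * x = a] (mod int p)"
proof -
  have c: "coprime b (int p)"
    using p assms(1) by (metis coprime_commute prime_imp_coprime prime_int_nat_transfer nat_int of_nat_0_le_iff)
  have "[b * rat_mod p q = a] (mod int p)" by (rule rat_mod_cong[OF p assms])
  then have "[b * x = a] (mod int p) \<longleftrightarrow> [b * x = b * rat_mod p q] (mod int p)"
    using cong_trans cong_sym by blast
  then show ?thesis using c by (simp add: cong_mult_lcancel)
qed

lemma rat_mod_add:
  assumes "p_int p x" "p_int p y"
  shows "[rat_mod p (x + y) = rat_mod p x + rat_mod p y] (mod int p)"
proof -
  obtain a b c d where b: "\<not> int p dvd b" "x = of_int a / of_int b" and d: "\<not> int p dvd d" "y = of_int c / of_int d"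
    using assms by (auto simp: p_int_def)
  have bd: "x + y = of_int (a * d + c * b) / of_int (b * d)"
  proof -
    have "b \<noteq> 0" "d \<noteq> 0" using b d by auto
    then show ?thesis by (simp add: b d field_simps)
  qed
  have "[(b * rat_mod p x) * d + (d * rat_mod p y) * b = a * d + c * b] (mod int p)"
    by (intro cong_add cong_mult cong_refl rat_mod_cong[OF p b] rat_mod_cong[OF p d])
  then have "[b * d * (rat_mod p x + rat_mod p y) = a * d + c * b] (mod int p)"
    by (simp add: algebra_simps)
  then show ?thesis
    using rat_mod_cong_int[OF not_dvd_mult[OF b(1) d(1)] bd] cong_sym by blast
qed

lemma rat_mod_mult:
  assumes "p_int p x" "p_int p y"
  shows "[rat_mod p (x * y) = rat_mod p x * rat_mod p y] (mod int p)"
proof -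
  obtain a b c d where b: "\<not> int p dvd b" "x = of_int a / of_int b" and d: "\<not> int p dvd d" "y = of_int c / of_int d"
    using assms by (auto simp: p_int_def)
  have bd: "x * y = of_int (a * c) / of_int (b * d)" by (simp add: b d)
  have "[(b * rat_mod p x) * (d * rat_mod p y) = a * c] (mod int p)"
    by (intro cong_mult rat_mod_cong[OF p b] rat_mod_cong[OF p d])
  then have "[b * d * (rat_mod p x * rat_mod p y) = a * c] (mod int p)"
    by (simp add: algebra_simps)
  then show ?thesis
    using rat_mod_cong_int[OF not_dvd_mult[OF b(1) d(1)] bd] cong_sym by blast
qed

lemma rat_mod_null:
  assumes "p_null p x"
  shows "[rat_mod p x = 0] (mod int p)"
proof -
  obtain r where r: "p_int p r" "x = of_nat p * r"
    using assms by (auto simp: p_null_def)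
  then obtain a b where b: "\<not> int p dvd b" "r = of_int a / of_int b"
    by (auto simp: p_int_def)
  then have b: "\<not> int p dvd b" "x = of_int (int p * a) / of_int b" by (simp_all add: r)
  have "[b * 0 = int p * a] (mod int p)" by (simp add: cong_def)
  then show ?thesis using rat_mod_cong_int[OF b] cong_sym by blast
qed

lemma p_int_mhs: "(\<And>x. x \<in> set L \<Longrightarrow> p_int p (1 / x)) \<Longrightarrow> p_int p (mhs L ks)"
proof (induction L arbitrary: ks)
  case Nil then show ?case by (cases ks) auto
next
  case (Cons x L)
  show ?case
  proof (cases ks)
    case (Cons k ls)
    have "p_int p (mhs L ls * (1 / x) ^ k)"
      by (intro p_int_mult p_int_power Cons.IH Cons.prems) simp_all
    moreover have "p_int p (mhs L (k # ls))" using Cons.IH Cons.prems by simp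
    ultimately show ?thesis using p_int_add by (simp add: Cons power_divide)
  qed simp
qed

lemma p_null_mhs_diff:
  assumes "\<And>i. i \<in> set L \<Longrightarrow> p_int p (1 / g i) \<and> p_int p (1 / h i) \<and> p_null p (1 / g i - 1 / h i)"
  shows "p_null p (mhs (map g L) ks - mhs (map h L) ks)"
  using assms
proof (induction L arbitrary: ks)
  case Nil then show ?case by simp
next
  case (Cons i L)
  show ?case
  proof (cases ks)
    case (Cons k ls)
    have IH: "p_null p (mhs (map g L) ks - mhs (map h L) ks)" for ks
      using Cons.IH Cons.prems by simp
    have i: "p_int p (1 / g i)" "p_int p (1 / h i)" "p_null p (1 / g i - 1 / h i)"
      using Cons.prems by auto
    have "p_int p (mhs (map h L) ls)"
      by (rule p_int_mhs) (use Cons.prems in auto)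
    then have "p_null p (mhs (map g L) ls * (1 / g i) ^ k - mhs (map h L) ls * (1 / h i) ^ k)"
      by (intro p_null_mult_diff p_null_power_diff p_int_power i IH)
    from p_null_add[OF IH[of "k # ls"] this] show ?thesis by (simp add: Cons power_divide algebra_simps)
  qed simp
qed

text \<open>The easy part of von Staudt-Clausen: up to l = p - 2 the recursion divides only by
  numbers smaller than p.\<close>

lemma p_int_bernoulli: "l + 2 \<le> p \<Longrightarrow> p_int p (bernoulli l)"
proof (induction l rule: less_induct)
  case (less l)
  show ?case
  proof (cases l)
    case (Suc n)
    have "\<not> p dvd Suc (Suc n)" using less.prems Suc by (auto dest: dvd_imp_le)
    then have "p_int p (- (\<Sum>l\<le>n. of_nat (Suc (Suc n) choose l) * bernoulli l) * (1 / of_nat (Suc (Suc n))))"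
      by (intro p_int_mult p_int_minus p_int_sum p_int_of_nat p_int_inverse less.IH) (use less.prems Suc in auto)
    then show ?thesis by (simp only: Suc bernoulli.simps) simp
  qed simp
qed

end

section \<open>Faulhaber's formula\<close>

lemma bernoulli_sum: "(\<Sum>l\<le>n. of_nat (Suc n choose l) * bernoulli l) = (if n = 0 then 1 else 0)"
proof (cases n)
  case (Suc m)
  have "of_nat (Suc (Suc m)) * bernoulli (Suc m) = - (\<Sum>l\<le>m. of_nat (Suc (Suc m) choose l) * bernoulli l)"
    unfolding bernoulli.simps(2) by (simp del: of_nat_Suc binomial_Suc_Suc)
  moreover have "Suc n choose Suc m = Suc (Suc m)" using Suc by simp
  ultimately show ?thesis by (simp add: Suc del: of_nat_Suc binomial_Suc_Suc)
qed simp

text \<open>The sum stops at n - 1, which fits the convention that B_1 is -1/2. The induction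
  reduces to showing that the right-hand side increases by (e + 1) n^e.\<close>

lemma faulhaber:
  "of_nat (Suc e) * (\<Sum>m<n. of_nat m ^ e :: rat) = (\<Sum>l\<le>e. of_nat (Suc e choose l) * bernoulli l * of_nat n ^ (Suc e - l))"
proof (induction n)
  case 0
  show ?case by (simp add: Suc_diff_le)
next
  case (Suc n)
  define x :: rat where "x = of_nat n"
  have "(\<Sum>l\<le>e. of_nat (Suc e choose l) * bernoulli l * (x + 1) ^ (Suc e - l))
     - (\<Sum>l\<le>e. of_nat (Suc e choose l) * bernoulli l * x ^ (Suc e - l))
     = (\<Sum>l\<le>e. \<Sum>j\<le>e - l. of_nat (Suc e choose l) * bernoulli l * of_nat (Suc e - l choose j) * x ^ j)"
  proof -
    have "(x + 1) ^ (Suc e - l) - x ^ (Suc e - l) = (\<Sum>j\<le>e - l. of_nat (Suc e - l choose j) * x ^ j)" if "l \<le> e" for l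
    proof -
      have "Suc e - l = Suc (e - l)" using that by simp
      then show ?thesis using binomial_ring[of x 1 "Suc (e - l)"]
        by (simp del: binomial_Suc_Suc power_Suc)
    qed
    then show ?thesis
      by (simp add: sum_subtractf[symmetric] right_diff_distrib[symmetric] sum_distrib_left mult.assoc del: binomial_Suc_Suc)
  qed
  also have "\<dots> = (\<Sum>j\<le>e. \<Sum>l\<le>e - j. of_nat (Suc e choose l) * bernoulli l * of_nat (Suc e - l choose j) * x ^ j)"
    unfolding sum.Sigma[OF finite_atMost ballI[OF finite_atMost]]
    by (rule sum.reindex_bij_witness[of _ "\<lambda>(j, l). (l, j)" "\<lambda>(l, j). (j, l)"]) auto
  \<comment> \<open>Trinomial revision moves j outside, and the inner sum becomes the defining
    recursion of the Bernoulli numbers. It vanishes except for j = e.\<close>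
  also have "\<dots> = (\<Sum>j\<le>e. of_nat (Suc e choose j) * x ^ j * (\<Sum>l\<le>e - j. of_nat (Suc (e - j) choose l) * bernoulli l))"
  proof (intro sum.cong refl)
    fix j assume j: "j \<in> {..e}"
    have "of_nat (Suc e choose l) * bernoulli l * of_nat (Suc e - l choose j) * x ^ j
       = of_nat (Suc e choose j) * x ^ j * (of_nat (Suc (e - j) choose l) * bernoulli l)" if l: "l \<in> {..e - j}" for l
    proof -
      have "(Suc e choose l) * (Suc e - l choose j) = (Suc e choose j) * (Suc e - j choose l)"
      proof -
        have "(Suc e choose l) * (Suc e - l choose j) = (Suc e choose (l + j)) * (l + j choose l)"
          using choose_mult[of l "l + j" "Suc e"] l j by simp
        moreover have "(Suc e choose j) * (Suc e - j choose l) = (Suc e choose (l + j)) * (l + j choose j)"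
          using choose_mult[of j "l + j" "Suc e"] l j by simp
        moreover have "l + j choose l = l + j choose j" using binomial_symmetric[of l "l + j"] by simp
        ultimately show ?thesis by simp
      qed
      moreover have "Suc e - j = Suc (e - j)" using j by simp
      ultimately have "(of_nat ((Suc e choose l) * (Suc e - l choose j)) :: rat) = of_nat ((Suc e choose j) * (Suc (e - j) choose l))"
        by simp
      then have eq: "(of_nat (Suc e choose l) * of_nat (Suc e - l choose j) :: rat) = of_nat (Suc e choose j) * of_nat (Suc (e - j) choose l)"
        by (simp only: of_nat_mult)
      have "of_nat (Suc e choose l) * bernoulli l * of_nat (Suc e - l choose j) * x ^ j
        = (of_nat (Suc e choose l) * of_nat (Suc e - l choose j)) * (bernoulli l * x ^ j)"
        by (simp only: mult_ac)
      also have "\<dots> = of_nat (Suc e choose j) * x ^ j * (of_nat (Suc (e - j) choose l) * bernoulli l)"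
        unfolding eq by (simp only: mult_ac)
      finally show ?thesis .
    qed
    then show "(\<Sum>l\<le>e - j. of_nat (Suc e choose l) * bernoulli l * of_nat (Suc e - l choose j) * x ^ j)
       = of_nat (Suc e choose j) * x ^ j * (\<Sum>l\<le>e - j. of_nat (Suc (e - j) choose l) * bernoulli l)"
      unfolding sum_distrib_left by (intro sum.cong) auto
  qed
  also have "\<dots> = (\<Sum>j\<le>e. if j = e then of_nat (Suc e) * x ^ e else 0)"
    unfolding bernoulli_sum by (intro sum.cong) auto
  also have "\<dots> = of_nat (Suc e) * x ^ e" by simp
  finally show ?case
    using Suc by (simp add: x_def distrib_left algebra_simps del: binomial_Suc_Suc)
qed


section \<open>Families over the primes\<close>

definition adele_integral :: "(nat \<Rightarrow> rat) set" where
  "adele_integral = {f. finite {p. prime p \<and> \<not> p_int p (f p)}}"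

definition adele_null :: "(nat \<Rightarrow> rat) set" where
  "adele_null = {f. finite {p. prime p \<and> \<not> p_null p (f p)}}"

definition interval_list :: "nat \<Rightarrow> 'a::field_char_0 list" where
  "interval_list p = map of_nat (rev [1..<p])"

lemma adele_integralI:
  assumes "\<And>p. prime p \<Longrightarrow> n < p \<Longrightarrow> p_int p (f p)"
  shows "f \<in> adele_integral"
  unfolding adele_integral_def mem_Collect_eq
  by (rule finite_subset[of _ "{..n}"]) (use assms in \<open>auto simp: not_less[symmetric]\<close>)

lemma adele_nullI:
  assumes "\<And>p. prime p \<Longrightarrow> n < p \<Longrightarrow> p_null p (f p)"
  shows "f \<in> adele_null"
  unfolding adele_null_def mem_Collect_eq
  by (rule finite_subset[of _ "{..n}"]) (use assms in \<open>auto simp: not_less[symmetric]\<close>)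

lemma adele_integral_binop:
  assumes "f \<in> adele_integral" "g \<in> adele_integral"
    and "\<And>p. prime p \<Longrightarrow> p_int p (f p) \<Longrightarrow> p_int p (g p) \<Longrightarrow> p_int p (h p)"
  shows "h \<in> adele_integral"
proof -
  have "finite ({p. prime p \<and> \<not> p_int p (f p)} \<union> {p. prime p \<and> \<not> p_int p (g p)})"
    using assms(1,2) by (simp add: adele_integral_def)
  then show ?thesis unfolding adele_integral_def mem_Collect_eq
    by (rule rev_finite_subset) (use assms(3) in blast)
qed

lemma adele_rat_integral: "(\<lambda>p. q) \<in> adele_integral"
proof -
  obtain a b where q: "quotient_of q = (a, b)" by force
  have b: "b > 0" "q = of_int a / of_int b"
    using quotient_of_denom_pos[OF q] quotient_of_div[OF q] by auto
  show ?thesis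
  proof (rule adele_integralI[of "nat b"])
    fix p assume "prime p" "nat b < p"
    then have "\<not> int p dvd b" using b(1) by (auto dest: zdvd_imp_le)
    then show "p_int p q" using b(2) by (auto simp: p_int_def)
  qed
qed

lemma p_int_interval: "prime p \<Longrightarrow> x \<in> set (interval_list p) \<Longrightarrow> p_int p (1 / x)"
  unfolding interval_list_def by (auto intro!: p_int_inverse dest: dvd_imp_le)

lemma mhs_interval_Cons:
  "mhs (interval_list p) (k # ks) = (\<Sum>m\<in>{1..<p}. mhs (interval_list m) ks / of_nat m ^ k)"
proof (induction p)
  case (Suc p)
  then show ?case by (cases "p = 0") (auto simp: interval_list_def One_nat_def)
qed (simp add: interval_list_def)

text \<open>Every term of Faulhaber's formula at n = p contains a factor p, and the Bernoulli
  numbers up to index p - 2 are integral at p.\<close>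

lemma power_sum_pos_null:
  assumes p: "prime p" and e: "1 \<le> e" "e + 2 \<le> p"
  shows "p_null p (\<Sum>m\<in>{1..<p}. of_nat m ^ e)"
proof -
  have "p_null p (of_nat (Suc e choose l) * bernoulli l * of_nat p ^ (Suc e - l))" if "l \<le> e" for l
  proof -
    have "of_nat (Suc e choose l) * bernoulli l * of_nat p ^ (Suc e - l) =
      of_nat p * (of_nat (Suc e choose l) * bernoulli l * of_nat p ^ (e - l))"
      using that by (simp add: Suc_diff_le mult_ac del: binomial_Suc_Suc)
    moreover have "p_int p (of_nat (Suc e choose l) * bernoulli l * of_nat p ^ (e - l))"
      by (intro p_int_mult[OF p] p_int_power[OF p] p_int_of_nat[OF p] p_int_bernoulli[OF p]) (use that e in simp)
    ultimately show ?thesis unfolding p_null_def by blast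
  qed
  then have "p_null p (\<Sum>l\<le>e. of_nat (Suc e choose l) * bernoulli l * of_nat p ^ (Suc e - l))"
    by (intro p_null_sum[OF p]) simp
  then have "p_null p (of_nat (Suc e) * (\<Sum>m<p. of_nat m ^ e))"
    by (simp only: faulhaber)
  moreover have "\<not> p dvd Suc e" using e by (auto dest: dvd_imp_le)
  then have "p_int p (1 / of_nat (Suc e))" by (rule p_int_inverse[OF p])
  ultimately have "p_null p (1 / of_nat (Suc e) * (of_nat (Suc e) * (\<Sum>m<p. of_nat m ^ e)))"
    using p_null_mult_left[OF p] by blast
  moreover have "(1 / of_nat (Suc e)) * (of_nat (Suc e) * (\<Sum>m<p. of_nat m ^ e)) = (\<Sum>m\<in>{1..<p}. of_nat m ^ e :: rat)"
  proof -
    have "{..<p} = insert 0 {1..<p}" using prime_gt_0_nat[OF p] by auto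
    then show ?thesis using e(1) by (simp add: field_simps power_0_left del: of_nat_Suc)
  qed
  ultimately show ?thesis by simp
qed

text \<open>Fermat's theorem trades negative exponents for positive ones, to which Faulhaber's
  formula applies.\<close>

lemma fermat_inverse:
  assumes p: "prime p" and m: "m \<in> {1..<p}" and k: "k < p"
  shows "p_null p (1 / of_nat m ^ k - of_nat m ^ (p - 1 - k))"
proof -
  have nd: "\<not> p dvd m" using m by (auto dest: dvd_imp_le)
  have "[m ^ (p - 1) = 1] (mod p)" by (rule fermat_theorem[OF p nd])
  then have "[int (m ^ (p - 1)) = int 1] (mod int p)" by (simp only: cong_int_iff)
  then have "int p dvd 1 - int (m ^ (p - 1))"
    by (simp add: cong_iff_dvd_diff dvd_diff_commute)
  then have "p_null p (of_int (1 - int (m ^ (p - 1))) * (1 / of_nat m) ^ k)"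
    by (intro p_null_mult[OF p] p_null_of_int[OF p] p_int_power[OF p] p_int_inverse[OF p nd])
  moreover have "of_int (1 - int (m ^ (p - 1))) * (1 / of_nat m) ^ k = (1 / of_nat m ^ k - of_nat m ^ (p - 1 - k) :: rat)"
  proof -
    have "m \<noteq> 0" "p - 1 = p - 1 - k + k" using m k by auto
    then have "of_nat m ^ (p - 1) = (of_nat m ^ (p - 1 - k) * of_nat m ^ k :: rat)" by (metis power_add)
    then show ?thesis using \<open>m \<noteq> 0\<close> by (simp add: field_simps power_divide)
  qed
  ultimately show ?thesis by simp
qed

lemma power_sum_null:
  assumes p: "prime p" and k: "1 \<le> k" "k + 1 < p"
  shows "p_null p (mhs (interval_list p) [k])"
proof -
  have "p_null p (\<Sum>m\<in>{1..<p}. 1 / of_nat m ^ k - of_nat m ^ (p - 1 - k))"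
    by (intro p_null_sum[OF p] fermat_inverse[OF p]) (use k in auto)
  moreover have "p_null p (\<Sum>m\<in>{1..<p}. of_nat m ^ (p - 1 - k))"
    by (rule power_sum_pos_null[OF p]) (use k in auto)
  ultimately show ?thesis
    using p_null_add[OF p] by (fastforce simp: mhs_interval_Cons sum_subtractf)
qed

global_interpretation A: mhs_family interval_list adele_integral adele_null
proof
  show "0 \<notin> set (interval_list n :: rat list)" for n
    by (auto simp: interval_list_def)
  show "a \<in> adele_integral" if "a \<in> adele_null" for a
    using that unfolding adele_null_def adele_integral_def mem_Collect_eq
    by (rule rev_finite_subset) (auto dest: p_null_imp_int)
  show "(\<lambda>n. a n + b n) \<in> adele_integral" "(\<lambda>n. a n * b n) \<in> adele_integral"
    if "a \<in> adele_integral" "b \<in> adele_integral" for a b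
    by (rule adele_integral_binop[OF that], erule (2) p_int_add p_int_mult)+
  show "(\<lambda>n. of_rat q :: rat) \<in> adele_integral" for q
    using adele_rat_integral[of q] by (simp add: of_rat_eq_id)
  show "(\<lambda>n. a n + b n) \<in> adele_null" if "a \<in> adele_null" "b \<in> adele_null" for a b
  proof -
    have "finite ({p. prime p \<and> \<not> p_null p (a p)} \<union> {p. prime p \<and> \<not> p_null p (b p)})"
      using that by (simp add: adele_null_def)
    then show ?thesis unfolding adele_null_def mem_Collect_eq
      by (rule rev_finite_subset) (auto intro: p_null_add)
  qed
  show "(\<lambda>n. a n * b n) \<in> adele_null" if "a \<in> adele_null" "b \<in> adele_integral" for a b
  proof -
    have "finite ({p. prime p \<and> \<not> p_null p (a p)} \<union> {p. prime p \<and> \<not> p_int p (b p)})"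
      using that by (simp add: adele_null_def adele_integral_def)
    then show ?thesis unfolding adele_null_def mem_Collect_eq
      by (rule rev_finite_subset) (auto intro: p_null_mult)
  qed
  show "(\<lambda>n. mhs (interval_list n) ks) \<in> adele_integral" for ks
    by (rule adele_integralI[of 0]) (auto intro: p_int_mhs p_int_interval)
  show "(\<lambda>n. mhs (interval_list n) [k]) \<in> adele_null" if "1 \<le> k" for k
    by (rule adele_nullI[of "k + 1"]) (use that in \<open>auto intro: power_sum_null\<close>)
  show "(\<lambda>n. mhs (interval_list n) (rev ks) - (-1) ^ sum_list ks * mhs (interval_list n) ks) \<in> adele_null" for ks
  proof (rule adele_nullI[of 0])
    fix p :: nat assume p: "prime p"
    \<comment> \<open>The list p - 1, ..., 1 read as p - m with m increasing: modulo p it is the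
      negated and reversed list, which is the reversal relation.\<close>
    have e1: "interval_list p = map (\<lambda>m. of_nat (p - m) :: rat) [1..<p]"
      by (rule nth_equalityI) (auto simp: interval_list_def rev_nth Suc_diff_Suc)
    have e2: "mhs (interval_list p) (rev ks) = (-1) ^ sum_list ks * mhs (map (\<lambda>m. - of_nat m :: rat) [1..<p]) ks"
    proof -
      have "map (\<lambda>m. - of_nat m :: rat) [1..<p] = map uminus (rev (interval_list p))"
        by (simp add: interval_list_def rev_map o_def)
      then show ?thesis by (simp add: mhs_uminus mhs_rev flip: power_mult_distrib mult.assoc)
    qed
    have "p_null p (mhs (map (\<lambda>m. - of_nat m :: rat) [1..<p]) ks - mhs (map (\<lambda>m. of_nat (p - m)) [1..<p]) ks)"
    proof (rule p_null_mhs_diff[OF p])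
      fix m assume "m \<in> set [1..<p]"
      then have m: "1 \<le> m" "m < p" by auto
      have nd: "\<not> p dvd m" "\<not> p dvd (p - m)" using m by (auto dest: dvd_imp_le)
      have "1 / (- of_nat m) - 1 / of_nat (p - m) = - (of_nat p * (1 / of_nat m * (1 / of_nat (p - m))) :: rat)"
        using m by (simp add: of_nat_diff field_simps)
      moreover have "p_int p (1 / of_nat m * (1 / of_nat (p - m)))"
        by (intro p_int_mult[OF p] p_int_inverse[OF p] nd)
      then have "p_null p (- (of_nat p * (1 / of_nat m * (1 / of_nat (p - m)))))"
        by (intro p_null_minus[OF p]) (auto simp: p_null_def)
      ultimately show "p_int p (1 / (- of_nat m)) \<and> p_int p (1 / of_nat (p - m)) \<and>
          p_null p (1 / (- of_nat m) - 1 / of_nat (p - m))"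
        using p_int_minus[OF p p_int_inverse[OF p nd(1)]] p_int_inverse[OF p nd(2)] by simp
    qed
    then have "p_null p ((-1) ^ sum_list ks * (mhs (map (\<lambda>m. - of_nat m :: rat) [1..<p]) ks - mhs (interval_list p) ks))"
      unfolding e1[symmetric] by (intro p_null_mult_left[OF p] p_int_power[OF p] p_int_simps[OF p])
    then show "p_null p (mhs (interval_list p) (rev ks) - (-1) ^ sum_list ks * mhs (interval_list p) ks)"
      unfolding e2 by (simp add: right_diff_distrib)
  qed
qed

text \<open>Lets congruences between restricted sums be read as congruences for a single index, by
  taking the smallest possible weight.\<close>

lemma dominating_self: "dominating cs (sum_list cs) = {cs}"
proof -
  have "sum_list cs \<le> sum_list ks \<and> (sum_list ks = sum_list cs \<longrightarrow> ks = cs)" if "list_all2 (\<le>) cs ks" for cs ks :: "nat list"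
    using that by (induction rule: list_all2_induct) auto
  then show ?thesis by (auto simp: dominating_def list_all2_refl)
qed

section \<open>Parity in depth two and three, and the use of duality\<close>

context mhs_family
begin

lemma N_eqI: "a \<in> N \<Longrightarrow> (\<And>n. b n = a n) \<Longrightarrow> b \<in> N"
  by (metis ext)

lemma N_half: "(\<lambda>n. 2 * a n) \<in> N \<Longrightarrow> a \<in> N"
  using N_scale[of "\<lambda>n. 2 * a n" "1/2"] by (simp add: of_rat_divide)

text \<open>In even weight reversal identifies (a, b) with (b, a), while the stuffle product makes
  their sum null.\<close>

lemma double_even_N:
  assumes "1 \<le> a" "1 \<le> b" "even (a + b)"
  shows "(\<lambda>n. mhs (X n) [a, b]) \<in> N"
proof (rule N_half)
  have "(\<lambda>n. mhs (X n) [a] * mhs (X n) [b]) \<in> N"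
    using assms by (intro N_mult power_sum_N mhs_I) auto
  then have "(\<lambda>n. mhs (X n) [a, b] + mhs (X n) [b, a] + mhs (X n) [a + b]) \<in> N"
    by (simp add: mhs_stuffle add.assoc)
  then have 1: "(\<lambda>n. mhs (X n) [a, b] + mhs (X n) [b, a] + mhs (X n) [a + b] - mhs (X n) [a + b]) \<in> N"
    using assms by (intro N_diff power_sum_N) auto
  have 2: "(\<lambda>n. mhs (X n) (rev [a, b]) - (-1) ^ sum_list [a, b] * mhs (X n) [a, b]) \<in> N"
    using assms by (intro reversal_N) auto
  show "(\<lambda>n. 2 * mhs (X n) [a, b]) \<in> N"
    by (rule N_eqI[OF N_diff[OF 1 2]]) (use assms(3) in simp)
qed

text \<open>Parity result in depth three. The antipode relates the star value to the reversed strict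
  value up to null products, and reversal turns the latter into minus the strict value. Expanding
  the star value into strict ones then leaves only depth two.\<close>

lemma triple_star_N:
  assumes "1 \<le> a" "1 \<le> b" "1 \<le> c" "odd (a + b + c)"
  shows "(\<lambda>n. 2 * mhs_star (X n) [a, b, c] - (mhs (X n) [a + b, c] + mhs (X n) [a, b + c])) \<in> N"
proof -
  have anti: "mhs_star (X n) [a, b, c] - mhs (X n) [c, b, a] =
      mhs (X n) [a] * mhs_star (X n) [b, c] - mhs (X n) [b, a] * mhs (X n) [c]" for n
    using mhs_antipode[of "[a, b, c]" "X n"]
    by (simp add: atMost_Suc mhs_star_contractions[of "X n" "[c]"] numeral_eq_Suc algebra_simps add_eq_0_iff)
  have 1: "(\<lambda>n. mhs_star (X n) [a, b, c] - mhs (X n) [c, b, a]) \<in> N"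
    unfolding anti using assms by (intro N_diff N_mult N_mult_left power_sum_N mhs_star_I mhs_I) auto
  have 2: "(\<lambda>n. mhs (X n) (rev [a, b, c]) - (-1) ^ sum_list [a, b, c] * mhs (X n) [a, b, c]) \<in> N"
    using assms by (intro reversal_N) auto
  have 3: "(\<lambda>n. mhs (X n) [a + b + c]) \<in> N"
    using assms by (intro power_sum_N) auto
  have e: "mhs_star (X n) [a, b, c] = mhs (X n) [a, b, c] + mhs (X n) [a, b + c] + mhs (X n) [a + b, c] + mhs (X n) [a + b + c]" for n
    by (simp add: mhs_star_contractions add_ac)
  have s: "(-1::'a) ^ (a + (b + c)) = -1" using assms(4) by (simp add: add.assoc)
  show ?thesis
    by (rule N_eqI[OF N_add[OF N_add[OF 1 2] 3]]) (simp add: e s)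
qed

text \<open>Duality leads to a star value of depth two and even weight, which is null.\<close>

lemma even_N_of_duality:
  assumes dual: "\<And>u v. (\<lambda>n. mhs_star (X n) (replicate u 1 @ 2 # replicate v 1) + mhs_star (X n) [Suc u, Suc v]) \<in> N"
    and "even (u + v)"
  shows "(\<lambda>n. mhs (X n) (replicate u 1 @ 2 # replicate v 1)) \<in> N"
proof -
  let ?cs = "\<lambda>u v. replicate u 1 @ 2 # replicate v 1 :: nat list"
  have sum: "sum_list (?cs u v) = u + v + 2" "sum_list (?cs v u) = u + v + 2" by (simp_all add: sum_list_replicate)
  have 1: "(\<lambda>n. Wstar (?cs v u) (u + v + 2) n + (-1) ^ (v + u + 1) * W (?cs u v) (u + v + 2) n) \<in> N"
    by (rule star_single_N) simp
  have A: "(\<lambda>n. mhs_star (X n) (?cs v u) - mhs (X n) (?cs u v)) \<in> N"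
  proof (rule N_eqI[OF 1])
    have ds: "dominating (?cs v u) (u + v + 2) = {?cs v u}" "dominating (?cs u v) (u + v + 2) = {?cs u v}"
      using dominating_self[of "?cs v u"] dominating_self[of "?cs u v"] by (simp_all only: sum)
    show "mhs_star (X n) (?cs v u) - mhs (X n) (?cs u v)
        = Wstar (?cs v u) (u + v + 2) n + (-1) ^ (v + u + 1) * W (?cs u v) (u + v + 2) n" for n
      unfolding W_def Wstar_def ds using assms(2) by simp
  qed
  have B: "(\<lambda>n. mhs_star (X n) [Suc v, Suc u]) \<in> N"
  proof -
    have "mhs_star (X n) [Suc v, Suc u] = mhs (X n) [Suc v, Suc u] + mhs (X n) [Suc v + Suc u]" for n
      by (simp add: mhs_star_contractions)
    moreover have "(\<lambda>n. mhs (X n) [Suc v, Suc u] + mhs (X n) [Suc v + Suc u]) \<in> N"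
      using assms(2) by (intro N_add double_even_N power_sum_N) auto
    ultimately show ?thesis by simp
  qed
  show ?thesis
    using N_eqI[OF N_diff[OF N_diff[OF dual[of v u] A] B], of "\<lambda>n. mhs (X n) (?cs u v)"] by simp
qed

text \<open>Duality turns the extremal star values into depth three, with middle entry v + 2 for two
  entries 2 and middle entry 1 for a single 3. The parity result reduces these to depth two.\<close>

lemma extremal_values_of_duality:
  assumes "odd k"
    and dual1: "\<And>u v. (\<lambda>n. mhs_star (X n) (replicate u 1 @ 2 # replicate v 1) + mhs_star (X n) [Suc u, Suc v]) \<in> N"
    and dual2: "\<And>u v w. (\<lambda>n. mhs_star (X n) (replicate u 1 @ 2 # replicate v 1 @ 2 # replicate w 1)
        + mhs_star (X n) [Suc u, Suc (Suc v), Suc w]) \<in> N"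
    and dual3: "\<And>u w. (\<lambda>n. mhs_star (X n) (replicate u 1 @ 3 # replicate w 1) + mhs_star (X n) [Suc u, 1, Suc w]) \<in> N"
    and depth2: "\<And>a b. 1 \<le> a \<Longrightarrow> 1 \<le> b \<Longrightarrow> a + b = k \<Longrightarrow>
        (\<lambda>n. mhs (X n) [a, b] - of_int ((-1) ^ a * int (k choose a)) * z n) \<in> N"
  shows "extremal_values k z"
proof -
  have main: "(\<lambda>n. 2 * mhs (X n) ks - of_int ((-1) ^ w * int (k choose Suc w) - (-1) ^ u * int (k choose Suc u)) * z n) \<in> N"
    if k: "u + m + w + 2 = k" and m: "1 \<le> m"
      and star: "(\<lambda>n. mhs_star (X n) ks + mhs (X n) ks) \<in> N"
      and dual: "(\<lambda>n. mhs_star (X n) ks + mhs_star (X n) [Suc u, m, Suc w]) \<in> N" for u m w ks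
  proof -
    have 1: "(\<lambda>n. 2 * mhs_star (X n) [Suc u, m, Suc w] - (mhs (X n) [Suc u + m, Suc w] + mhs (X n) [Suc u, m + Suc w])) \<in> N"
      by (rule triple_star_N) (use k m assms(1) in auto)
    have 3: "(\<lambda>n. mhs (X n) [Suc u, m + Suc w] - of_int ((-1) ^ Suc u * int (k choose Suc u)) * z n) \<in> N"
      by (rule depth2) (use k in auto)
    \<comment> \<open>Here the middle entry drops out: \<open>Suc u + m\<close> and
      \<open>Suc w\<close> are complementary in k.\<close>
    have b: "k choose (Suc u + m) = k choose Suc w"
    proof -
      have e: "Suc u + m = k - Suc w" using k by simp
      show ?thesis unfolding e using binomial_symmetric[of "Suc w" k] k by simp
    qed
    have "even (u + m + w + 1)" using k assms(1) by auto
    then have s: "(-1) ^ (Suc u + m) = ((-1) ^ w :: int)" by (auto simp: minus_one_power_iff)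
    have "(\<lambda>n. mhs (X n) [Suc u + m, Suc w] - of_int ((-1) ^ (Suc u + m) * int (k choose (Suc u + m))) * z n) \<in> N"
      by (rule depth2) (use k in auto)
    then have 2: "(\<lambda>n. mhs (X n) [Suc u + m, Suc w] - of_int ((-1) ^ w * int (k choose Suc w)) * z n) \<in> N"
      unfolding b s .
    have 4: "(\<lambda>n. of_int 2 * (mhs_star (X n) ks + mhs (X n) ks)) \<in> N" "(\<lambda>n. of_int 2 * (mhs_star (X n) ks + mhs_star (X n) [Suc u, m, Suc w])) \<in> N"
      by (intro N_scale_int star dual)+
    show ?thesis
      by (rule N_eqI[OF N_add[OF N_diff[OF 4] N_add[OF 1 N_add[OF 2 3]]]])
        (simp add: algebra_simps)
  qed
  show ?thesis unfolding extremal_values_def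
  proof (intro conjI allI impI)
    fix u v w assume k: "u + v + w + 4 = k"
    let ?cs = "replicate u 1 @ 2 # replicate v 1 @ 2 # replicate w 1 :: nat list"
    have sum: "sum_list ?cs = k" using k by (simp add: sum_list_replicate)
    have "(\<lambda>n. Wstar ?cs k n - (-1) ^ (u + v + w + 2) * W ?cs k n) \<in> N"
      by (rule star_double_cong[OF assms(1) even_N_of_duality[OF dual1]])
    moreover have "odd (u + v + w + 2)" using k assms(1) by auto
    ultimately have "(\<lambda>n. mhs_star (X n) ?cs + mhs (X n) ?cs) \<in> N"
      unfolding W_def Wstar_def using dominating_self[of ?cs] sum by simp
    then show "(\<lambda>n. 2 * mhs (X n) ?cs - of_int ((-1) ^ w * int (k choose Suc w) - (-1) ^ u * int (k choose Suc u)) * z n) \<in> N"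
      by (rule main[rotated 2, OF _ dual2]) (use k in auto)
  next
    fix u w assume k: "u + w + 3 = k"
    let ?cs = "replicate u 1 @ 3 # replicate w 1 :: nat list"
    have sum: "sum_list ?cs = k" using k by (simp add: sum_list_replicate)
    have "(\<lambda>n. Wstar ?cs k n - (-1) ^ (u + w + 1) * W ?cs k n) \<in> N"
      by (rule star_single_cong) (use assms(1) in auto)
    moreover have "odd (u + w + 1)" using k assms(1) by auto
    ultimately have "(\<lambda>n. mhs_star (X n) ?cs + mhs (X n) ?cs) \<in> N"
      unfolding W_def Wstar_def using dominating_self[of ?cs] sum by simp
    then show "(\<lambda>n. 2 * mhs (X n) ?cs - of_int ((-1) ^ w * int (k choose Suc w) - (-1) ^ u * int (k choose Suc u)) * z n) \<in> N"
      by (rule main[rotated 2, OF _ dual3]) (use k in auto)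
  qed
qed

end

text \<open>Hoffman's duality: the binomial transform \<open>f \<mapsto> (n \<mapsto> \<Sum> (-1)\<^bsup>j-1\<^esup> (n choose j) f j)\<close> interchanges
  division by the argument with \<open>f \<mapsto> (n \<mapsto> \<Sum>\<^sub>m f m / m)\<close>, and at \<open>n = p - 1\<close> it reduces to
  \<open>- \<Sum> f j\<close> modulo \<open>p\<close>.\<close>

definition div_arg :: "(nat \<Rightarrow> rat) \<Rightarrow> nat \<Rightarrow> rat" where
  "div_arg f n = f n / of_nat n"

definition sum_div :: "(nat \<Rightarrow> rat) \<Rightarrow> nat \<Rightarrow> rat" where
  "sum_div f n = (\<Sum>m\<in>{1..n}. f m / of_nat m)"

definition binom_transform :: "(nat \<Rightarrow> rat) \<Rightarrow> nat \<Rightarrow> rat" where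
  "binom_transform f n = (\<Sum>j\<in>{1..n}. (-1) ^ Suc j * of_nat (n choose j) * f j)"

lemma binom_transform_atMost: "binom_transform f n = (\<Sum>j<n. (-1) ^ j * of_nat (n choose Suc j) * f (Suc j))"
  unfolding binom_transform_def
  by (simp add: One_nat_def sum.atLeast1_atMost_eq)

lemma sum_div_atMost: "sum_div f n = (\<Sum>m<n. f (Suc m) / of_nat (Suc m))"
  unfolding sum_div_def
  by (simp add: One_nat_def sum.atLeast1_atMost_eq)

lemma binomial_absorb: "of_nat (n choose j) / of_nat (Suc j) = (of_nat (Suc n choose Suc j) / of_nat (Suc n) :: rat)"
proof -
  have "of_nat (Suc j * (Suc n choose Suc j)) = (of_nat (Suc n * (n choose j)) :: rat)"
    by (simp only: Suc_times_binomial)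
  then show ?thesis by (simp only: of_nat_mult) (simp add: field_simps del: of_nat_Suc binomial_Suc_Suc)
qed

text \<open>By Pascal's rule the increment in n is a sum with C(n, j) / (j + 1), and absorption
  turns it into the transform at n + 1 divided by n + 1.\<close>

lemma binom_transform_div_arg: "binom_transform (div_arg f) n = sum_div (binom_transform f) n"
proof (induction n)
  case 0
  show ?case by (simp add: binom_transform_def sum_div_def)
next
  case (Suc n)
  have "binom_transform (div_arg f) (Suc n) = (\<Sum>j<Suc n. (-1) ^ j * of_nat (n choose Suc j) * div_arg f (Suc j))
     + (\<Sum>j<Suc n. (-1) ^ j * of_nat (n choose j) * div_arg f (Suc j))"
    by (simp add: binom_transform_atMost sum.distrib algebra_simps del: sum.lessThan_Suc)
  also have "(\<Sum>j<Suc n. (-1) ^ j * of_nat (n choose Suc j) * div_arg f (Suc j)) = binom_transform (div_arg f) n"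
    by (simp add: binom_transform_atMost)
  also have "(\<Sum>j<Suc n. (-1) ^ j * of_nat (n choose j) * div_arg f (Suc j)) = binom_transform f (Suc n) / of_nat (Suc n)"
  proof -
    have "(-1) ^ j * of_nat (n choose j) * div_arg f (Suc j) = (-1) ^ j * of_nat (Suc n choose Suc j) * f (Suc j) / of_nat (Suc n)" for j
    proof -
      have "(-1) ^ j * of_nat (n choose j) * div_arg f (Suc j) = (-1) ^ j * f (Suc j) * (of_nat (n choose j) / of_nat (Suc j))"
        by (simp add: div_arg_def)
      then show ?thesis unfolding binomial_absorb by (simp del: of_nat_Suc binomial_Suc_Suc)
    qed
    then show ?thesis unfolding binom_transform_atMost sum_divide_distrib by (intro sum.cong) auto
  qed
  finally show ?case using Suc by (simp add: sum_div_atMost)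
qed

text \<open>With g the partial sums, f j is j times the backward difference of g. Absorption
  extracts the factor n, and Pascal's rule reassembles the transform of g.\<close>

lemma binom_transform_sum_div: "binom_transform (sum_div f) n = div_arg (binom_transform f) n"
proof (cases n)
  case 0
  then show ?thesis by (simp add: binom_transform_def div_arg_def)
next
  case (Suc n')
  define g where "g = sum_div f"
  have f: "f (Suc j) = of_nat (Suc j) * (g (Suc j) - g j)" for j
    by (simp add: g_def sum_div_atMost del: of_nat_Suc)
  have "binom_transform f n = of_nat n * (\<Sum>j<n. (-1) ^ j * of_nat (n' choose j) * (g (Suc j) - g j))"
  proof -
    have "of_nat (n choose Suc j) * of_nat (Suc j) = (of_nat n * of_nat (n' choose j) :: rat)" for j
      using Suc_times_binomial[of j n'] Suc by (metis mult.commute of_nat_mult)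
    note eq = this
    have "(-1) ^ j * of_nat (n choose Suc j) * f (Suc j) = of_nat n * ((-1) ^ j * of_nat (n' choose j) * (g (Suc j) - g j))" for j
    proof -
      have "(-1) ^ j * of_nat (n choose Suc j) * f (Suc j) = (of_nat (n choose Suc j) * of_nat (Suc j)) * ((-1) ^ j * (g (Suc j) - g j))"
        unfolding f by (simp only: mult_ac)
      then show ?thesis unfolding eq by (simp only: mult_ac)
    qed
    then show ?thesis unfolding binom_transform_atMost sum_distrib_left by (simp only:)
  qed
  also have "(\<Sum>j<n. (-1) ^ j * of_nat (n' choose j) * (g (Suc j) - g j))
      = (\<Sum>j<n. (-1) ^ j * of_nat (n' choose j) * g (Suc j)) + (\<Sum>j<n. (-1) ^ j * of_nat (n' choose Suc j) * g (Suc j))"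
  proof -
    have "(\<Sum>j<n. (-1) ^ j * of_nat (n' choose j) * g j) = - (\<Sum>j<n. (-1) ^ j * of_nat (n' choose Suc j) * g (Suc j))"
    proof -
      have "(\<Sum>j<n. (-1) ^ j * of_nat (n' choose j) * g j) = g 0 + (\<Sum>j<n'. (-1) ^ Suc j * of_nat (n' choose Suc j) * g (Suc j))"
        unfolding Suc by (subst sum.lessThan_Suc_shift) simp
      moreover have "g 0 = 0" by (simp add: g_def sum_div_def)
      ultimately show ?thesis by (simp add: Suc sum_negf)
    qed
    then show ?thesis by (simp add: right_diff_distrib sum_subtractf)
  qed
  also have "\<dots> = binom_transform g n"
    unfolding binom_transform_atMost by (simp add: Suc sum.distrib[symmetric] algebra_simps del: sum.lessThan_Suc)
  finally show ?thesis using Suc by (simp add: div_arg_def g_def)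
qed

lemma binom_transform_div_arg_pow: "binom_transform ((div_arg ^^ u) f) = (sum_div ^^ u) (binom_transform f)"
proof (induction u)
  case (Suc u)
  have "binom_transform (div_arg g) = sum_div (binom_transform g)" for g
    by (rule ext) (rule binom_transform_div_arg)
  with Suc show ?case by simp
qed simp

lemma binom_transform_sum_div_ext: "binom_transform (sum_div f) = div_arg (binom_transform f)"
  by (rule ext) (rule binom_transform_sum_div)

abbreviation star_at :: "nat list \<Rightarrow> nat \<Rightarrow> rat" where
  "star_at ks n \<equiv> mhs_star (interval_list (Suc n)) ks"

lemma star_at_Cons: "star_at (k # ks) n = (\<Sum>m\<in>{1..n}. star_at ks m / of_nat m ^ k)"
proof (induction n)
  case (Suc n)
  have "star_at (k # ks) (Suc n) = star_at (k # ks) n + star_at ks (Suc n) / of_nat (Suc n) ^ k"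
    by (simp add: interval_list_def)
  then show ?case by (simp add: Suc)
qed (simp add: interval_list_def)

lemma div_arg_pow: "(div_arg ^^ c) f n = f n / of_nat n ^ c"
  by (induction c) (auto simp: div_arg_def)

text \<open>Encodes an index as a word in two operators: an entry c + 1 is one summation after c
  divisions. Interchanging the two letters is Hoffman's dual.\<close>

lemma star_at_sum_div: "star_at (Suc c # ks) = sum_div ((div_arg ^^ c) (star_at ks))"
  by (auto simp: fun_eq_iff star_at_Cons sum_div_def div_arg_pow mult.commute)

lemma star_at_ones: "star_at (replicate u 1 @ ks) = (sum_div ^^ u) (star_at ks)"
proof (induction u)
  case (Suc u)
  have "star_at (replicate (Suc u) 1 @ ks) = sum_div (star_at (replicate u 1 @ ks))"
    using star_at_sum_div[of 0 "replicate u 1 @ ks"] by (simp add: One_nat_def)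
  then show ?case by (simp add: Suc)
qed simp


text \<open>At n = 0 the transform is 0 and not 1. The congruence lemmas that follow pass over this
  single argument, since \<open>sum_div\<close> never evaluates its function there.\<close>

lemma binom_transform_one: "1 \<le> n \<Longrightarrow> binom_transform (\<lambda>_. 1) n = 1"
proof -
  assume "1 \<le> n"
  then obtain m where n: "n = Suc m" by (cases n) auto
  have "(\<Sum>j\<le>n. (-1) ^ j * of_nat (n choose j) :: rat) = 0"
    by (rule choose_alternating_sum) (use n in simp)
  moreover have "(\<Sum>j\<le>n. (-1) ^ j * of_nat (n choose j) :: rat) = 1 - binom_transform (\<lambda>_. 1) n"
    unfolding binom_transform_atMost n lessThan_Suc_atMost by (subst sum.atMost_Suc_shift) (simp add: sum_negf)
  ultimately show ?thesis by simp
qed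

lemma sum_div_cong: "(\<And>m. 1 \<le> m \<Longrightarrow> f m = g m) \<Longrightarrow> sum_div f = sum_div g"
  by (auto simp: sum_div_def fun_eq_iff intro!: sum.cong)

lemma sum_div_pow_cong: "(\<And>m. 1 \<le> m \<Longrightarrow> f m = g m) \<Longrightarrow> 1 \<le> n \<Longrightarrow> (sum_div ^^ u) f n = (sum_div ^^ u) g n"
  by (cases u) (auto simp: funpow_Suc_right sum_div_cong[of f g] simp del: funpow.simps(2))

lemma star_at_ones_transform:
  "1 \<le> n \<Longrightarrow> (sum_div ^^ u) (binom_transform (\<lambda>_. 1)) n = star_at (replicate u 1) n"
  using sum_div_pow_cong[of "binom_transform (\<lambda>_. 1)" "star_at []" n u] binom_transform_one fun_cong[OF star_at_ones[of u "[]"], of n]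
  by simp

lemma choose_prime_minus_one:
  assumes p: "prime p" and j: "j < p"
  shows "[int ((p - 1) choose j) = (-1) ^ j] (mod int p)"
  using j
proof (induction j)
  case (Suc j)
  have "p dvd (p choose Suc j)"
    by (rule dvd_choose_prime) (use Suc.prems p in auto)
  moreover have "p choose Suc j = ((p - 1) choose j) + ((p - 1) choose Suc j)"
    using prime_gt_0_nat[OF p] by (cases p) auto
  ultimately have "int p dvd int ((p - 1) choose j) + int ((p - 1) choose Suc j)"
    by (metis int_dvd_int_iff of_nat_add)
  then have "[int ((p - 1) choose Suc j) = - int ((p - 1) choose j)] (mod int p)"
    by (simp add: cong_iff_dvd_diff add.commute)
  also have "[- int ((p - 1) choose j) = - ((-1) ^ j)] (mod int p)"
    using Suc by (simp add: cong_minus_minus_iff)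
  finally show ?case by simp
qed simp

text \<open>The plain sum of f is written as \<open>sum_div\<close> of j * f j so that the factor j
  can cancel one \<open>div_arg\<close> in the next step of the duality.\<close>

lemma binom_transform_prime:
  assumes p: "prime p" and f: "\<And>j. 1 \<le> j \<Longrightarrow> j < p \<Longrightarrow> p_int p (f j)"
  shows "p_null p (binom_transform f (p - 1) + sum_div (\<lambda>j. of_nat j * f j) (p - 1))"
proof -
  have "sum_div (\<lambda>j. of_nat j * f j) (p - 1) = (\<Sum>j\<in>{1..p - 1}. f j)"
    unfolding sum_div_def by (intro sum.cong) auto
  then have "binom_transform f (p - 1) + sum_div (\<lambda>j. of_nat j * f j) (p - 1)
     = (\<Sum>j\<in>{1..p - 1}. of_int (1 - (-1) ^ j * int ((p - 1) choose j)) * f j)"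
    unfolding binom_transform_def by (simp add: sum.distrib[symmetric] algebra_simps)
  moreover have "p_null p (\<Sum>j\<in>{1..p - 1}. of_int (1 - (-1) ^ j * int ((p - 1) choose j)) * f j)"
  proof (intro p_null_sum[OF p] p_null_mult[OF p] p_null_of_int[OF p] f)
    fix j assume j: "j \<in> {1..p - 1}"
    then show "1 \<le> j" "j < p" by auto
    then have "[(-1) ^ j * int ((p - 1) choose j) = (-1) ^ j * (-1) ^ j] (mod int p)"
      by (intro cong_mult cong_refl choose_prime_minus_one[OF p])
    then show "int p dvd 1 - (-1) ^ j * int ((p - 1) choose j)"
      by (simp add: cong_iff_dvd_diff dvd_diff_commute flip: power_mult_distrib)
  qed
  ultimately show ?thesis by simp
qed

lemma p_int_div_arg_pow:
  assumes p: "prime p" and "\<And>j. 1 \<le> j \<Longrightarrow> j < p \<Longrightarrow> p_int p (f j)" and j: "1 \<le> j" "j < p"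
  shows "p_int p ((div_arg ^^ u) f j)"
proof -
  have "\<not> p dvd j" using j by (auto dest: dvd_imp_le)
  then have "p_int p (f j * (1 / of_nat j) ^ u)"
    by (intro p_int_mult[OF p] p_int_power[OF p] p_int_inverse[OF p] assms j)
  then show ?thesis by (simp add: div_arg_pow power_divide)
qed

lemma p_int_star_at:
  assumes p: "prime p" and n: "n < p"
  shows "p_int p (star_at ks n)"
proof -
  have "p_int p (mhs (interval_list (Suc n)) ls)" for ls
    by (rule p_int_mhs[OF p]) (use n in \<open>auto simp: interval_list_def intro!: p_int_inverse[OF p] dest: dvd_imp_le\<close>)
  moreover have "p_int p (sum_list (map f xs))" if "\<And>x. p_int p (f x)" for f :: "nat list \<Rightarrow> rat" and xs
    by (induction xs) (auto intro: p_int_add[OF p] that simp: p_int_simps[OF p])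
  ultimately show ?thesis unfolding mhs_star_contractions by blast
qed

text \<open>Here \<open>g\<close> is \<open>star_at\<close> of the tail of an index and \<open>h\<close> is \<open>star_at\<close> of its dual.\<close>

lemma hoffman_step:
  assumes p: "prime p" and g: "\<And>j. 1 \<le> j \<Longrightarrow> j < p \<Longrightarrow> p_int p (g j)"
    and h: "binom_transform g = div_arg h"
  shows "p_null p ((sum_div ^^ Suc u) (div_arg h) (p - 1) + sum_div ((div_arg ^^ u) g) (p - 1))"
proof -
  have "p_null p (binom_transform ((div_arg ^^ Suc u) g) (p - 1) + sum_div (\<lambda>j. of_nat j * (div_arg ^^ Suc u) g j) (p - 1))"
    by (intro binom_transform_prime[OF p] p_int_div_arg_pow[OF p] g)
  moreover have "sum_div (\<lambda>j. of_nat j * (div_arg ^^ Suc u) g j) = sum_div ((div_arg ^^ u) g)"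
    by (rule sum_div_cong) (simp add: div_arg_def)
  ultimately show ?thesis
    unfolding binom_transform_div_arg_pow h by simp
qed

lemma star_at_interval: "prime p \<Longrightarrow> mhs_star (interval_list p) ks = star_at ks (p - 1)"
  using prime_gt_0_nat[of p] by simp

lemma hoffman_duality_1:
  "(\<lambda>p. mhs_star (interval_list p) (replicate u 1 @ 2 # replicate v 1)
      + mhs_star (interval_list p) [Suc u, Suc v]) \<in> adele_null"
proof (rule adele_nullI[of 0])
  fix p :: nat assume p: "prime p"
  \<comment> \<open>The tail of \<open>[Suc u, Suc v]\<close> as an operator word. Its transform
    starts with a single \<open>div_arg\<close>, which together with the adjacent summation becomes
    the entry 2 of the dual index.\<close>
  define g where "g = sum_div ((div_arg ^^ v) (star_at []))"
  define h where "h = (sum_div ^^ v) (binom_transform (\<lambda>_. 1))"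
  have g: "g = star_at [Suc v]" by (simp add: g_def star_at_sum_div)
  have h: "binom_transform g = div_arg h"
    unfolding g_def h_def by (rule ext) (simp add: binom_transform_sum_div binom_transform_div_arg_pow)
  have "sum_div (div_arg h) = star_at (2 # replicate v 1)"
    using star_at_sum_div[of 1 "replicate v 1"]
    by (simp add: numeral_2_eq_2 One_nat_def) (auto intro!: sum_div_cong simp: h_def div_arg_def star_at_ones_transform One_nat_def[symmetric])
  then have "(sum_div ^^ Suc u) (div_arg h) = star_at (replicate u 1 @ 2 # replicate v 1)"
    by (simp add: star_at_ones funpow_Suc_right del: funpow.simps(2))
  moreover have "sum_div ((div_arg ^^ u) g) = star_at [Suc u, Suc v]"
    by (simp add: g star_at_sum_div)
  moreover have "p_null p ((sum_div ^^ Suc u) (div_arg h) (p - 1) + sum_div ((div_arg ^^ u) g) (p - 1))"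
    by (rule hoffman_step[OF p _ h]) (simp add: g p_int_star_at[OF p])
  ultimately show "p_null p (mhs_star (interval_list p) (replicate u 1 @ 2 # replicate v 1)
      + mhs_star (interval_list p) [Suc u, Suc v])"
    by (simp add: star_at_interval[OF p])
qed

text \<open>The middle entry v + 2 carries v + 1 divisions. They become v + 1 summations: the v ones
  of the middle run and the summation of the second entry 2.\<close>

lemma hoffman_duality_2:
  "(\<lambda>p. mhs_star (interval_list p) (replicate u 1 @ 2 # replicate v 1 @ 2 # replicate w 1)
      + mhs_star (interval_list p) [Suc u, Suc (Suc v), Suc w]) \<in> adele_null"
proof (rule adele_nullI[of 0])
  fix p :: nat assume p: "prime p"
  define g where "g = star_at [Suc (Suc v), Suc w]"
  define h' where "h' = (sum_div ^^ w) (binom_transform (\<lambda>_. 1))"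
  define h where "h = (sum_div ^^ Suc v) (div_arg h')"
  have "g = sum_div ((div_arg ^^ Suc v) (sum_div ((div_arg ^^ w) (star_at []))))"
    unfolding g_def star_at_sum_div ..
  then have h: "binom_transform g = div_arg h"
    unfolding h_def h'_def by (simp only: binom_transform_sum_div_ext binom_transform_div_arg_pow mhs_star_simps(1))
  have "sum_div (div_arg h') = star_at (2 # replicate w 1)"
    using star_at_sum_div[of 1 "replicate w 1"]
    by (simp add: numeral_2_eq_2 One_nat_def) (auto intro!: sum_div_cong simp: h'_def div_arg_def star_at_ones_transform One_nat_def[symmetric])
  then have h2: "h = star_at (replicate v 1 @ 2 # replicate w 1)"
    by (simp add: h_def star_at_ones funpow_Suc_right del: funpow.simps(2))
  have "sum_div (div_arg h) = star_at (2 # replicate v 1 @ 2 # replicate w 1)"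
    using star_at_sum_div[of 1 "replicate v 1 @ 2 # replicate w 1"] by (simp add: numeral_2_eq_2 One_nat_def h2)
  then have "(sum_div ^^ Suc u) (div_arg h) = star_at (replicate u 1 @ 2 # replicate v 1 @ 2 # replicate w 1)"
    by (simp add: star_at_ones funpow_Suc_right del: funpow.simps(2))
  moreover have "sum_div ((div_arg ^^ u) g) = star_at [Suc u, Suc (Suc v), Suc w]"
    by (simp add: g_def star_at_sum_div[of u])
  moreover have "p_null p ((sum_div ^^ Suc u) (div_arg h) (p - 1) + sum_div ((div_arg ^^ u) g) (p - 1))"
    by (rule hoffman_step[OF p _ h]) (simp add: g_def p_int_star_at[OF p])
  ultimately show "p_null p (mhs_star (interval_list p) (replicate u 1 @ 2 # replicate v 1 @ 2 # replicate w 1)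
      + mhs_star (interval_list p) [Suc u, Suc (Suc v), Suc w])"
    by (simp add: star_at_interval[OF p])
qed

text \<open>A middle entry 1 carries no division, so in the dual two divisions become adjacent and
  merge into the entry 3.\<close>

lemma hoffman_duality_3:
  "(\<lambda>p. mhs_star (interval_list p) (replicate u 1 @ 3 # replicate w 1)
      + mhs_star (interval_list p) [Suc u, 1, Suc w]) \<in> adele_null"
proof (rule adele_nullI[of 0])
  fix p :: nat assume p: "prime p"
  define g where "g = star_at [1, Suc w]"
  define h' where "h' = (sum_div ^^ w) (binom_transform (\<lambda>_. 1))"
  define h where "h = div_arg h'"
  have "g = sum_div (sum_div ((div_arg ^^ w) (star_at [])))"
    using star_at_sum_div[of 0 "[Suc w]"] star_at_sum_div[of w "[]"] by (simp add: g_def One_nat_def)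
  then have h: "binom_transform g = div_arg h"
    unfolding h_def h'_def
    by (intro ext) (simp add: binom_transform_sum_div binom_transform_div_arg_pow div_arg_def)
  have "sum_div (div_arg h) = star_at (3 # replicate w 1)"
    using star_at_sum_div[of 2 "replicate w 1"]
    by (simp add: numeral_3_eq_3 numeral_2_eq_2 One_nat_def) (auto intro!: sum_div_cong simp: h_def h'_def div_arg_def star_at_ones_transform One_nat_def[symmetric])
  then have "(sum_div ^^ Suc u) (div_arg h) = star_at (replicate u 1 @ 3 # replicate w 1)"
    by (simp add: star_at_ones funpow_Suc_right del: funpow.simps(2))
  moreover have "sum_div ((div_arg ^^ u) g) = star_at [Suc u, 1, Suc w]"
    by (simp add: g_def star_at_sum_div[of u])
  moreover have "p_null p ((sum_div ^^ Suc u) (div_arg h) (p - 1) + sum_div ((div_arg ^^ u) g) (p - 1))"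
    by (rule hoffman_step[OF p _ h]) (simp add: g_def p_int_star_at[OF p])
  ultimately show "p_null p (mhs_star (interval_list p) (replicate u 1 @ 3 # replicate w 1)
      + mhs_star (interval_list p) [Suc u, 1, Suc w])"
    by (simp add: star_at_interval[OF p])
qed

section \<open>Depth two values modulo p\<close>

lemma p_null_cancel:
  assumes "prime p" "\<not> p dvd n" "p_null p (of_nat n * x)"
  shows "p_null p x"
proof -
  have "n \<noteq> 0" using assms(2) by (cases n) auto
  moreover have "p_null p (1 / of_nat n * (of_nat n * x))"
    using p_null_mult_left[OF assms(1) p_int_inverse[OF assms(1,2)] assms(3)] .
  ultimately show ?thesis by simp
qed

text \<open>Modulo p the upper entry is -(b + 1), and -(b + 1) over j is (-1)^j times (b + j) over
  j. The induction cancels \<open>Suc j\<close>, which is smaller than p.\<close>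

lemma choose_prime_minus:
  assumes p: "prime p" and "j + b < p"
  shows "p_null p (of_nat ((p - 1 - b) choose j) - (-1) ^ j * of_nat ((b + j) choose j))"
  using assms(2)
proof (induction j)
  case 0
  show ?case using p_null_0[OF p] by simp
next
  case (Suc j)
  define n where "n = p - 1 - b"
  have n: "of_nat n = (of_nat p - of_nat (Suc b) :: rat)" "j \<le> n" using Suc.prems by (auto simp: n_def of_nat_diff)
  have 1: "of_nat (Suc j) * of_nat (n choose Suc j) = (of_nat (n choose j) * (of_nat n - of_nat j) :: rat)"
  proof -
    have "of_nat (Suc j * (n choose Suc j)) = (of_nat ((n - j) * (n choose j)) :: rat)"
      by (metis binomial_absorb_comp binomial_absorption n(2))
    then show ?thesis using n(2) by (simp only: of_nat_mult of_nat_diff mult.commute)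
  qed
  have 2: "of_nat (Suc j) * of_nat ((b + Suc j) choose Suc j) = (of_nat (b + Suc j) * of_nat ((b + j) choose j) :: rat)"
  proof -
    have "of_nat (Suc j * (Suc (b + j) choose Suc j)) = (of_nat (Suc (b + j) * ((b + j) choose j)) :: rat)"
      by (simp only: Suc_times_binomial)
    then show ?thesis by (simp only: of_nat_mult add_Suc_right)
  qed
  have "p_null p (of_nat (n choose j) * of_nat p - (of_nat (n choose j) - (-1) ^ j * of_nat ((b + j) choose j)) * of_nat (b + Suc j))"
  proof -
    have IH: "p_null p (of_nat (n choose j) - (-1) ^ j * of_nat ((b + j) choose j))"
      using Suc by (simp add: n_def)
    show ?thesis
      by (rule p_null_diff[OF p p_null_mult_left[OF p p_int_of_nat[OF p] p_null_of_nat[OF p dvd_refl]]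
            p_null_mult[OF p IH p_int_of_nat[OF p]]])
  qed
  moreover have "of_nat (n choose j) * of_nat p - (of_nat (n choose j) - (-1) ^ j * of_nat ((b + j) choose j)) * of_nat (b + Suc j)
     = of_nat (n choose j) * (of_nat n - of_nat j) - (-1) ^ Suc j * (of_nat (b + Suc j) * of_nat ((b + j) choose j) :: rat)"
    unfolding n(1) by (simp add: algebra_simps)
  ultimately have "p_null p (of_nat (Suc j) * (of_nat (n choose Suc j) - (-1) ^ Suc j * of_nat ((b + Suc j) choose Suc j)))"
    unfolding right_diff_distrib mult.left_commute[of _ "(-1) ^ Suc j"] 1 2 by simp
  moreover have "\<not> p dvd Suc j" using Suc.prems by (auto dest: dvd_imp_le)
  ultimately show ?case unfolding n_def by (rule p_null_cancel[OF p, rotated])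
qed

text \<open>The total exponent is p - k - l: non-zero and smaller than p - 1 in absolute value, so
  the power sum vanishes modulo p whatever its sign.\<close>

lemma power_quotient_sum_null:
  assumes p: "prime p" and k: "k = a + b" "1 \<le> a" "1 \<le> b" "k + 1 < p" and l: "l \<le> p - 1 - b" "l \<noteq> p - k"
  shows "p_null p (\<Sum>m\<in>{1..<p}. of_nat m ^ (p - b - l) / of_nat m ^ a)"
proof (cases "l < p - k")
  case True
  have "of_nat m ^ (p - b - l) / of_nat m ^ a = (of_nat m ^ (p - k - l) :: rat)" if "m \<in> {1..<p}" for m
  proof -
    have "p - b - l = (p - k - l) + a" using True k by simp
    then show ?thesis using that by (simp add: power_add)
  qed
  then have "(\<Sum>m\<in>{1..<p}. of_nat m ^ (p - b - l) / of_nat m ^ a) = (\<Sum>m\<in>{1..<p}. of_nat m ^ (p - k - l) :: rat)"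
    by (intro sum.cong) auto
  moreover have "p_null p (\<Sum>m\<in>{1..<p}. of_nat m ^ (p - k - l))"
    by (rule power_sum_pos_null[OF p]) (use True k in auto)
  ultimately show ?thesis by simp
next
  case False
  have "of_nat m ^ (p - b - l) / of_nat m ^ a = (1 / of_nat m ^ (l - (p - k)) :: rat)" if "m \<in> {1..<p}" for m
  proof -
    have "a = (l - (p - k)) + (p - b - l)" using False k l by simp
    then have "of_nat m ^ a = (of_nat m ^ (l - (p - k)) * of_nat m ^ (p - b - l) :: rat)" by (metis power_add)
    then show ?thesis using that by simp
  qed
  then have "(\<Sum>m\<in>{1..<p}. of_nat m ^ (p - b - l) / of_nat m ^ a :: rat) = mhs (interval_list p) [l - (p - k)]"
    by (simp add: mhs_interval_Cons)
  moreover have "p_null p (mhs (interval_list p) [l - (p - k)])"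
    by (rule power_sum_null[OF p]) (use False k l in auto)
  ultimately show ?thesis by simp
qed

text \<open>Replace n^(-b) by n^(p-1-b) and sum over n < m by Faulhaber. Of the resulting power sums
  in m only the one with exponent 0 is not null; it belongs to l = p - k and brings in the Bernoulli
  number of that index.\<close>

lemma depth_two_bernoulli:
  assumes p: "prime p" and k: "k = a + b" "1 \<le> a" "1 \<le> b" "k + 1 < p"
  shows "p_null p (mhs (interval_list p) [a, b] - (-1) ^ a * of_nat (k choose a) * (bernoulli (p - k) / of_nat k))"
proof -
  define e where "e = p - 1 - b"
  have e: "1 \<le> e" "Suc e = p - b" using k by (auto simp: e_def)
  have ndvd: "\<not> p dvd n" if "1 \<le> n" "n < p" for n using that by (auto dest: dvd_imp_le)
  define T :: "nat \<Rightarrow> rat" where "T l = (\<Sum>m\<in>{1..<p}. of_nat m ^ (p - b - l) / of_nat m ^ a)" for l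
  define q :: "nat \<Rightarrow> rat" where "q l = 1 / of_nat (Suc e) * (of_nat (Suc e choose l) * bernoulli l)" for l
  have q: "p_int p (q l)" if "l \<le> e" for l
    unfolding q_def
    by (intro p_int_mult[OF p] p_int_inverse[OF p] p_int_of_nat[OF p] p_int_bernoulli[OF p] ndvd) (use that e k in auto)
  have 1: "p_null p (mhs (interval_list p) [a, b] - (\<Sum>m\<in>{1..<p}. (\<Sum>n<m. of_nat n ^ e) / of_nat m ^ a))"
  proof -
    have "mhs (interval_list m) [b] - (\<Sum>n<m. of_nat n ^ e) = (\<Sum>n\<in>{1..<m}. 1 / of_nat n ^ b - of_nat n ^ e :: rat)"
      if "m \<in> {1..<p}" for m
    proof -
      have "{..<m} = insert 0 {1..<m}" using that by auto
      then show ?thesis using e(1) by (simp add: mhs_interval_Cons sum_subtractf power_0_left)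
    qed
    moreover have "p_null p (\<Sum>n\<in>{1..<m}. 1 / of_nat n ^ b - of_nat n ^ e)" if "m \<in> {1..<p}" for m
      unfolding e_def by (intro p_null_sum[OF p] fermat_inverse[OF p]) (use that k in auto)
    ultimately have "p_null p (\<Sum>m\<in>{1..<p}. (mhs (interval_list m) [b] - (\<Sum>n<m. of_nat n ^ e)) * (1 / of_nat m) ^ a)"
      by (intro p_null_sum[OF p] p_null_mult[OF p] p_int_power[OF p] p_int_inverse[OF p] ndvd) auto
    moreover have "mhs (interval_list p) [a, b] = (\<Sum>m\<in>{1..<p}. mhs (interval_list m) [b] / (of_nat m ^ a :: rat))"
      by (rule mhs_interval_Cons)
    ultimately show ?thesis
      by (simp add: sum_subtractf diff_divide_distrib power_divide)
  qed
  have "(\<Sum>m\<in>{1..<p}. (\<Sum>n<m. of_nat n ^ e) / of_nat m ^ a) = (\<Sum>m\<in>{1..<p}. \<Sum>l\<le>e. q l * (of_nat m ^ (p - b - l) / of_nat m ^ a))"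
  proof (rule sum.cong)
    fix m
    have "(\<Sum>n<m. of_nat n ^ e :: rat) = 1 / of_nat (Suc e) * (of_nat (Suc e) * (\<Sum>n<m. of_nat n ^ e))"
      by (simp del: of_nat_Suc)
    also have "\<dots> = (\<Sum>l\<le>e. q l * of_nat m ^ (p - b - l))"
      unfolding faulhaber unfolding sum_distrib_left q_def e(2) by (simp only: mult.assoc)
    finally show "(\<Sum>n<m. of_nat n ^ e) / of_nat m ^ a = (\<Sum>l\<le>e. q l * (of_nat m ^ (p - b - l) / of_nat m ^ a))"
      by (simp add: sum_divide_distrib)
  qed simp
  also have "\<dots> = (\<Sum>l\<le>e. q l * T l)"
    unfolding T_def sum_distrib_left by (rule sum.swap)
  also have "\<dots> = q (p - k) * T (p - k) + (\<Sum>l\<in>{..e} - {p - k}. q l * T l)"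
    by (rule sum.remove) (use k e_def in auto)
  finally have S: "(\<Sum>m\<in>{1..<p}. (\<Sum>n<m. of_nat n ^ e) / of_nat m ^ a) = q (p - k) * T (p - k) + (\<Sum>l\<in>{..e} - {p - k}. q l * T l)" .
  have 2: "p_null p (\<Sum>l\<in>{..e} - {p - k}. q l * T l)"
    unfolding T_def
    by (intro p_null_sum[OF p] p_null_mult_left[OF p] power_quotient_sum_null[OF p k] q) (auto simp: e_def)
  \<comment> \<open>The surviving sum has p - 1 terms equal to 1, which is -1 modulo p and accounts
    for the sign.\<close>
  have Tpk: "T (p - k) = of_nat p - 1"
  proof -
    have "p - b - (p - k) = a" using k by simp
    then have "T (p - k) = (\<Sum>m\<in>{1..<p}. 1)" unfolding T_def by (intro sum.cong) auto
    then show ?thesis using k by (simp add: of_nat_diff)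
  qed
  have "q (p - k) * T (p - k) = q (p - k) * of_nat p - q (p - k)" unfolding Tpk by (simp add: algebra_simps)
  moreover have "p_null p (q (p - k) * of_nat p)"
    by (intro p_null_mult_left[OF p] p_null_of_nat[OF p] q) (use k e_def in auto)
  moreover have qpk: "q (p - k) = of_nat (e choose (a - 1)) * (1 / of_nat a * bernoulli (p - k))"
  proof -
    have "Suc e choose (p - k) = Suc e choose a"
      using binomial_symmetric[of a "Suc e"] k e by (simp add: e_def add.commute)
    moreover have "of_nat (e choose (a - 1)) / of_nat a = (of_nat (Suc e choose a) / of_nat (Suc e) :: rat)"
      using binomial_absorb[of e "a - 1"] k(2) by (simp del: of_nat_Suc binomial_Suc_Suc)
    ultimately have "q (p - k) = of_nat (e choose (a - 1)) / of_nat a * bernoulli (p - k)"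
      unfolding q_def by (simp del: of_nat_Suc binomial_Suc_Suc)
    then show ?thesis by simp
  qed
  moreover have Bk: "(-1) ^ a * of_nat (k choose a) * (bernoulli (p - k) / of_nat k) =
     - ((-1) ^ (a - 1) * of_nat ((b + (a - 1)) choose (a - 1)) * (1 / of_nat a * bernoulli (p - k)))"
  proof -
    have "Suc (b + (a - 1)) = k" "Suc (a - 1) = a" using k by auto
    then have "of_nat (k choose a) / of_nat k = (of_nat ((b + (a - 1)) choose (a - 1)) / of_nat a :: rat)"
      using binomial_absorb[of "b + (a - 1)" "a - 1"] by simp
    moreover have "(-1) ^ a = - ((-1) ^ (a - 1) :: rat)" using k(2) by (cases a) auto
    moreover have "(-1) ^ a * of_nat (k choose a) * (bernoulli (p - k) / of_nat k) = (-1) ^ a * (of_nat (k choose a) / of_nat k) * bernoulli (p - k)"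
      by simp
    ultimately show ?thesis by simp
  qed
  moreover have "p_null p ((of_nat (e choose (a - 1)) - (-1) ^ (a - 1) * of_nat ((b + (a - 1)) choose (a - 1))) * (1 / of_nat a * bernoulli (p - k)))"
    unfolding e_def
    by (intro p_null_mult[OF p] choose_prime_minus[OF p] p_int_mult[OF p] p_int_inverse[OF p] p_int_bernoulli[OF p] ndvd) (use k in auto)
  then have 3: "p_null p (of_nat (e choose (a - 1)) * (1 / of_nat a * bernoulli (p - k))
      - (-1) ^ (a - 1) * of_nat ((b + (a - 1)) choose (a - 1)) * (1 / of_nat a * bernoulli (p - k)))"
    by (simp only: left_diff_distrib)
  ultimately have "mhs (interval_list p) [a, b] - (-1) ^ a * of_nat (k choose a) * (bernoulli (p - k) / of_nat k) =
     (mhs (interval_list p) [a, b] - (\<Sum>m\<in>{1..<p}. (\<Sum>n<m. of_nat n ^ e) / of_nat m ^ a))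
     + (q (p - k) * of_nat p + (\<Sum>l\<in>{..e} - {p - k}. q l * T l))
     - (of_nat (e choose (a - 1)) * (1 / of_nat a * bernoulli (p - k))
      - (-1) ^ (a - 1) * of_nat ((b + (a - 1)) choose (a - 1)) * (1 / of_nat a * bernoulli (p - k)))"
    unfolding S Bk by simp
  moreover have "p_null p \<dots>"
    by (rule p_null_diff[OF p p_null_add[OF p 1 p_null_add[OF p \<open>p_null p (q (p - k) * of_nat p)\<close> 2]] 3])
  ultimately show ?thesis by (simp only:)
qed

section \<open>Sums over sequences and passage to the algebra A\<close>

lemma mhs_star_interval_Cons:
  "mhs_star (interval_list p) (k # ks) = (\<Sum>m\<in>{1..<p}. mhs_star (interval_list (Suc m)) ks / of_nat m ^ k)"
proof (induction p)
  case (Suc p)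
  then show ?case by (cases "p = 0") (auto simp: interval_list_def One_nat_def)
qed (simp add: interval_list_def)

lemma harmonic_term_simps:
  "harmonic_term [] [] = 1" "harmonic_term (k # ks) (m # ms) = harmonic_term ks ms / of_nat m ^ k"
  by (simp_all add: harmonic_term_def prod.lessThan_Suc_shift del: prod.lessThan_Suc)

lemma finite_bounded_lists: "finite {ms. length ms = r \<and> (\<forall>m\<in>set ms. m < (p::nat)) \<and> P ms}"
  by (rule finite_subset[OF _ finite_lists_length_eq[of "{..<p}" r]]) auto

lemma strict_seqs_eq: "{ms\<in>strict_seqs r. \<forall>m\<in>set ms. m < p} =
   {ms. length ms = r \<and> (\<forall>m\<in>set ms. m < p) \<and> (sorted_wrt (>) ms \<and> (\<forall>m\<in>set ms. 1 \<le> m))}"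
  by (auto simp: strict_seqs_def)

lemma weak_seqs_eq: "{ms\<in>weak_seqs r. \<forall>m\<in>set ms. m < p} =
   {ms. length ms = r \<and> (\<forall>m\<in>set ms. m < p) \<and> (sorted_wrt (\<ge>) ms \<and> (\<forall>m\<in>set ms. 1 \<le> m))}"
  by (auto simp: weak_seqs_def)

lemma sum_strict_seqs:
  "(\<Sum>ms\<in>{ms\<in>strict_seqs (length ks). \<forall>m\<in>set ms. m < p}. harmonic_term ks ms) = (mhs (interval_list p) ks :: 'a::field_char_0)"
proof (induction ks arbitrary: p)
  case Nil
  have "{ms \<in> strict_seqs (length []). \<forall>m\<in>set ms. m < p} = {[]}" by (auto simp: strict_seqs_def)
  then show ?case by (simp add: harmonic_term_simps)
next
  case (Cons k ks)
  let ?A = "\<lambda>m. {ms\<in>strict_seqs (length ks). \<forall>x\<in>set ms. x < m}"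
  have "{ms\<in>strict_seqs (length (k # ks)). \<forall>m\<in>set ms. m < p} = (\<Union>m\<in>{1..<p}. (#) m ` ?A m)"
  proof (intro equalityI subsetI)
    fix ms assume "ms \<in> {ms\<in>strict_seqs (length (k # ks)). \<forall>m\<in>set ms. m < p}"
    then show "ms \<in> (\<Union>m\<in>{1..<p}. (#) m ` ?A m)" by (cases ms) (auto simp: strict_seqs_def)
  next
    fix ms assume "ms \<in> (\<Union>m\<in>{1..<p}. (#) m ` ?A m)"
    then show "ms \<in> {ms\<in>strict_seqs (length (k # ks)). \<forall>m\<in>set ms. m < p}" by (auto simp: strict_seqs_def) (meson less_trans)
  qed
  then have "(\<Sum>ms\<in>{ms\<in>strict_seqs (length (k # ks)). \<forall>m\<in>set ms. m < p}. harmonic_term (k # ks) ms)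
     = (\<Sum>m\<in>{1..<p}. \<Sum>ms\<in>?A m. harmonic_term (k # ks) (m # ms) :: 'a)"
    by (simp only:) (subst sum.UNION_disjoint; auto simp: sum.reindex strict_seqs_eq finite_bounded_lists)
  also have "\<dots> = mhs (interval_list p) (k # ks)"
    unfolding mhs_interval_Cons harmonic_term_simps sum_divide_distrib[symmetric] by (simp only: Cons.IH)
  finally show ?case .
qed

lemma sum_weak_seqs:
  "(\<Sum>ms\<in>{ms\<in>weak_seqs (length ks). \<forall>m\<in>set ms. m < p}. harmonic_term ks ms) = (mhs_star (interval_list p) ks :: 'a::field_char_0)"
proof (induction ks arbitrary: p)
  case Nil
  have "{ms \<in> weak_seqs (length []). \<forall>m\<in>set ms. m < p} = {[]}" by (auto simp: weak_seqs_def)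
  then show ?case by (simp add: harmonic_term_simps)
next
  case (Cons k ks)
  let ?A = "\<lambda>m. {ms\<in>weak_seqs (length ks). \<forall>x\<in>set ms. x < Suc m}"
  have "{ms\<in>weak_seqs (length (k # ks)). \<forall>m\<in>set ms. m < p} = (\<Union>m\<in>{1..<p}. (#) m ` ?A m)"
  proof (intro equalityI subsetI)
    fix ms assume "ms \<in> {ms\<in>weak_seqs (length (k # ks)). \<forall>m\<in>set ms. m < p}"
    then show "ms \<in> (\<Union>m\<in>{1..<p}. (#) m ` ?A m)" by (cases ms) (auto simp: weak_seqs_def less_Suc_eq_le)
  next
    fix ms assume "ms \<in> (\<Union>m\<in>{1..<p}. (#) m ` ?A m)"
    then show "ms \<in> {ms\<in>weak_seqs (length (k # ks)). \<forall>m\<in>set ms. m < p}" by (auto simp: weak_seqs_def less_Suc_eq_le) (meson le_less_trans)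
  qed
  then have "(\<Sum>ms\<in>{ms\<in>weak_seqs (length (k # ks)). \<forall>m\<in>set ms. m < p}. harmonic_term (k # ks) ms)
     = (\<Sum>m\<in>{1..<p}. \<Sum>ms\<in>?A m. harmonic_term (k # ks) (m # ms) :: 'a)"
    by (simp only:) (subst sum.UNION_disjoint; auto simp: sum.reindex weak_seqs_eq finite_bounded_lists)
  also have "\<dots> = mhs_star (interval_list p) (k # ks)"
    unfolding mhs_star_interval_Cons harmonic_term_simps sum_divide_distrib[symmetric] by (simp only: Cons.IH)
  finally show ?case .
qed

text \<open>Linear on \<open>adele_integral\<close>: the identities can fail only at primes where a
  component is not integral and \<open>rat_mod\<close> is a dummy, and there are finitely many of
  these.\<close>

definition adele_of :: "(nat \<Rightarrow> rat) \<Rightarrow> finite_adele" where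
  "adele_of f = abs_finite_adele (\<lambda>p. rat_mod p (f p))"

lemma zeta_A_eq: "zeta_A ks = adele_of (\<lambda>p. mhs (interval_list p) ks)"
  by (simp add: zeta_A_def adele_of_def sum_strict_seqs)

lemma zeta_star_A_eq: "zeta_star_A ks = adele_of (\<lambda>p. mhs_star (interval_list p) ks)"
  by (simp add: zeta_star_A_def adele_of_def sum_weak_seqs)

lemma adele_of_add:
  assumes "f \<in> adele_integral" "g \<in> adele_integral"
  shows "adele_of (\<lambda>p. f p + g p) = adele_of f + adele_of g"
proof -
  have "finite ({p. prime p \<and> \<not> p_int p (f p)} \<union> {p. prime p \<and> \<not> p_int p (g p)})"
    using assms by (simp add: adele_integral_def)
  then have "finite_adele_rel (\<lambda>p. rat_mod p (f p + g p)) (\<lambda>p. rat_mod p (f p) + rat_mod p (g p))"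
    unfolding finite_adele_rel_def by (rule rev_finite_subset) (use rat_mod_add in blast)
  then show ?thesis
    unfolding adele_of_def plus_finite_adele.abs_eq by (simp add: finite_adele.abs_eq_iff)
qed

lemma adele_of_scale:
  assumes "f \<in> adele_integral"
  shows "adele_of (\<lambda>p. q * f p) = scale_finite_adele q (adele_of f)"
proof -
  have "finite ({p. prime p \<and> \<not> p_int p (f p)} \<union> {p. prime p \<and> \<not> p_int p q})"
    using assms adele_rat_integral[of q] by (simp add: adele_integral_def)
  then have "finite_adele_rel (\<lambda>p. rat_mod p (q * f p)) (\<lambda>p. rat_mod p q * rat_mod p (f p))"
    unfolding finite_adele_rel_def by (rule rev_finite_subset) (use rat_mod_mult in blast)
  then show ?thesis
    unfolding adele_of_def scale_finite_adele.abs_eq by (simp add: finite_adele.abs_eq_iff)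
qed

lemma adele_of_null:
  assumes "f \<in> adele_null"
  shows "adele_of f = 0"
proof -
  have "finite {p. prime p \<and> \<not> p_null p (f p)}"
    using assms by (simp add: adele_null_def)
  then have "finite_adele_rel (\<lambda>p. rat_mod p (f p)) (\<lambda>p. 0)"
    unfolding finite_adele_rel_def by (rule rev_finite_subset) (use rat_mod_null in blast)
  then show ?thesis
    unfolding adele_of_def zero_finite_adele_def by (simp add: finite_adele.abs_eq_iff)
qed

lemma adele_of_eqI:
  assumes "(\<lambda>p. f p - g p) \<in> adele_null" "g \<in> adele_integral"
  shows "adele_of f = adele_of g"
  using adele_of_add[OF A.N_subset[OF assms(1)] assms(2)] adele_of_null[OF assms(1)] by simp

lemma adele_of_sum:
  assumes "\<And>i. i \<in> S \<Longrightarrow> f i \<in> adele_integral"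
  shows "adele_of (\<lambda>p. \<Sum>i\<in>S. f i p) = (\<Sum>i\<in>S. adele_of (f i))"
  using assms
proof (induction S rule: infinite_finite_induct)
  case (insert x F)
  then show ?case using adele_of_add[of "f x" "\<lambda>p. \<Sum>i\<in>F. f i p"] A.I_sum[of F f] by simp
qed (use adele_of_null[OF A.N_0] in simp_all)

lemma sum_zeta_A:
  "(\<Sum>ks\<in>index_set k r i j. zeta_A ks) = adele_of (\<lambda>p. \<Sum>ks\<in>index_set k r i j. mhs (interval_list p) ks)"
  "(\<Sum>ks\<in>index_set k r i j. zeta_star_A ks) = adele_of (\<lambda>p. \<Sum>ks\<in>index_set k r i j. mhs_star (interval_list p) ks)"
  unfolding zeta_A_eq zeta_star_A_eq
  by (subst adele_of_sum; auto intro!: A.mhs_I A.mhs_star_I dest: is_index_index_set)+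

lemma sum_formula_A:
  fixes k r i j :: nat
  assumes "odd k" and "3 \<le> k" and "1 \<le> i" and "i \<le> j" and "j \<le> r" and "r \<le> k - 2"
  shows "(\<Sum>ks\<in>index_set k r i j. zeta_A ks)
           = scale_finite_adele ((-1) ^ r) (\<Sum>ks\<in>index_set k r i j. zeta_star_A ks)"
    and "(\<Sum>ks\<in>index_set k r i j. zeta_A ks)
           = scale_finite_adele (1 / 2 * of_int (N_coeff (int k) (int r) (int i) (int j))) (Zfrak_A k)"
proof -
  define z where "z p = bernoulli (p - k) / of_nat k" for p
  define S where "S p = (\<Sum>ks\<in>index_set k r i j. mhs (interval_list p) ks :: rat)" for p
  define S' where "S' p = (\<Sum>ks\<in>index_set k r i j. mhs_star (interval_list p) ks :: rat)" for p
  define c :: rat where "c = 1 / 2 * of_int (N_coeff (int k) (int r) (int i) (int j))"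
  have z: "z \<in> adele_integral"
  proof (rule adele_integralI[of "k"])
    fix p :: nat assume p: "prime p" "k < p"
    then have "\<not> p dvd k" using assms(2) by (auto dest: dvd_imp_le)
    then have "p_int p (bernoulli (p - k) * (1 / of_nat k))"
      by (intro p_int_mult[OF p(1)] p_int_bernoulli[OF p(1)] p_int_inverse[OF p(1)]) (use assms(2) p in auto)
    then show "p_int p (z p)" by (simp add: z_def)
  qed
  have SI: "S \<in> adele_integral" "S' \<in> adele_integral"
    unfolding S_def[abs_def] S'_def[abs_def] by (auto intro!: A.I_sum A.mhs_I A.mhs_star_I dest: is_index_index_set)
  have depth2: "(\<lambda>p. mhs (interval_list p) [a, b] - of_int ((-1) ^ a * int (k choose a)) * z p) \<in> adele_null"
    if "1 \<le> a" "1 \<le> b" "a + b = k" for a b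
    by (rule adele_nullI[of "k + 1"]) (use depth_two_bernoulli[of _ k a b] that in \<open>auto simp: z_def\<close>)
  have ext: "A.extremal_values k z"
    by (rule A.extremal_values_of_duality[OF assms(1) hoffman_duality_1 hoffman_duality_2 hoffman_duality_3 depth2])
  have "(\<lambda>p. S p - c * z p) \<in> adele_null"
  proof (rule A.N_half, rule A.N_eqI[OF A.value_N[OF assms ext]])
    show "2 * (S p - c * z p) = 2 * (\<Sum>ks\<in>index_set k r i j. mhs (interval_list p) ks) - of_int (N_coeff (int k) (int r) (int i) (int j)) * z p" for p
      by (simp add: S_def c_def right_diff_distrib)
  qed
  then have "adele_of S = adele_of (\<lambda>p. c * z p)"
    by (rule adele_of_eqI) (use A.I_mult[OF adele_rat_integral z] in simp)
  also have "\<dots> = scale_finite_adele c (Zfrak_A k)"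
    unfolding adele_of_scale[OF z] by (simp add: adele_of_def Zfrak_A_def z_def)
  finally show "(\<Sum>ks\<in>index_set k r i j. zeta_A ks) = scale_finite_adele (1 / 2 * of_int (N_coeff (int k) (int r) (int i) (int j))) (Zfrak_A k)"
    by (simp add: sum_zeta_A S_def[abs_def] c_def)
  have star: "(\<lambda>p. S' p - (-1) ^ r * S p) \<in> adele_null"
    unfolding S_def S'_def by (rule A.star_N[OF assms(1,3-5) A.even_N_of_duality[OF hoffman_duality_1]])
  have "(\<lambda>p. S p - (-1) ^ r * S' p) \<in> adele_null"
  \<comment> \<open>The star relation multiplied by its own sign, which is its own inverse, is
    solved for \<open>S\<close>.\<close>
  proof (rule A.N_eqI[OF A.N_scale_int[OF star, of "- ((-1) ^ r)"]])
    show "S p - (-1) ^ r * S' p = of_int (- ((-1) ^ r)) * (S' p - (-1) ^ r * S p)" for p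
      by (simp add: right_diff_distrib flip: power_mult_distrib mult.assoc)
  qed
  then have "adele_of S = adele_of (\<lambda>p. (-1) ^ r * S' p)"
    by (rule adele_of_eqI) (use A.I_mult[OF adele_rat_integral SI(2)] in simp)
  also have "\<dots> = scale_finite_adele ((-1) ^ r) (adele_of S')"
    by (rule adele_of_scale[OF SI(2)])
  finally show "(\<Sum>ks\<in>index_set k r i j. zeta_A ks) = scale_finite_adele ((-1) ^ r) (\<Sum>ks\<in>index_set k r i j. zeta_star_A ks)"
    by (simp add: sum_zeta_A S_def[abs_def] S'_def[abs_def])
qed

section \<open>Connected sums\<close>

lemma tonelli_has_sum:
  fixes f :: "'a \<Rightarrow> 'b \<Rightarrow> real"
  assumes nonneg: "\<And>a b. 0 \<le> f a b"
    and rows: "\<And>a. ((\<lambda>b. f a b) has_sum g a) UNIV"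
    and g: "(g has_sum S) UNIV"
  shows "(\<lambda>a. f a b) summable_on UNIV" "((\<lambda>b. infsum (\<lambda>a. f a b) UNIV) has_sum S) UNIV"
proof -
  have sm: "(\<lambda>(a, b). f a b) summable_on UNIV \<times> UNIV"
    by (rule summable_on_SigmaI[where g = g]) (use rows g nonneg in \<open>auto simp: summable_on_def\<close>)
  then have "((\<lambda>(a, b). f a b) has_sum S) (UNIV \<times> UNIV)"
    by (intro has_sum_SigmaI[where g = g]) (use rows g in auto)
  then have sw: "((\<lambda>(b, a). f a b) has_sum S) (UNIV \<times> UNIV)"
    by (subst has_sum_swap) (simp add: case_prod_unfold)
  then have "(\<lambda>(b, a). f a b) summable_on UNIV \<times> UNIV" by (auto simp: summable_on_def)
  then have col: "(\<lambda>a. f a b) summable_on UNIV" for b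
    by (rule summable_on_SigmaD1) auto
  show "(\<lambda>a. f a b) summable_on UNIV" by (rule col)
  show "((\<lambda>b. infsum (\<lambda>a. f a b) UNIV) has_sum S) UNIV"
    by (rule has_sum_SigmaD[OF sw]) (use col in auto)
qed

text \<open>For non-negative terms the convergent iterated sum in one order yields both the
  convergence of every column and the sum in the other order.\<close>

lemma tonelli_sums:
  fixes f :: "nat \<Rightarrow> nat \<Rightarrow> real"
  assumes nonneg: "\<And>a b. 0 \<le> f a b"
    and rows: "\<And>a. f a sums g a"
    and g: "g sums S"
  shows "summable (\<lambda>a. f a b)" "(\<lambda>b. \<Sum>a. f a b) sums S"
proof -
  have g0: "0 \<le> g a" for a
    using sums_le[OF _ sums_zero rows[of a]] nonneg by simp
  have rows': "(f a has_sum g a) UNIV" for a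
    by (rule sums_nonneg_imp_has_sum[OF rows nonneg])
  have g': "(g has_sum S) UNIV" by (rule sums_nonneg_imp_has_sum[OF g g0])
  have col: "(\<lambda>a. f a b) summable_on UNIV" for b
    by (rule tonelli_has_sum(1)[OF nonneg rows' g'])
  then show "summable (\<lambda>a. f a b)" by (rule summable_on_imp_summable)
  have "infsum (\<lambda>a. f a b) UNIV = (\<Sum>a. f a b)" for b
    using has_sum_imp_sums[OF has_sum_infsum[OF col[of b]]] by (simp add: sums_iff)
  then show "(\<lambda>b. \<Sum>a. f a b) sums S"
    using has_sum_imp_sums[OF tonelli_has_sum(2)[OF nonneg rows' g']] by simp
qed

lemma powser_zero_right:
  fixes d :: "nat \<Rightarrow> real"
  assumes d: "\<And>x. 0 < x \<Longrightarrow> x < 1 \<Longrightarrow> (\<lambda>n. d n * x ^ n) sums 0"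
  shows "d 0 = 0"
proof -
  have sm: "summable (\<lambda>n. d n * x ^ n)" if x: "norm x < 1" for x :: real
  proof -
    obtain y where y: "norm x < y" "y < 1" using dense[OF x] by auto
    have "0 < y" using norm_ge_zero[of x] y(1) by linarith
    then have "summable (\<lambda>n. d n * y ^ n)" using d[of y] y by (auto simp: sums_iff)
    moreover have "norm x < norm y" using y \<open>0 < y\<close> by simp
    ultimately show ?thesis by (rule powser_inside)
  qed
  have "((\<lambda>x. \<Sum>n. d n * x ^ n) \<longlongrightarrow> d 0) (at 0)"
    by (rule powser_limit_0[of 1]) (use sm in \<open>auto simp: summable_sums\<close>)
  then have 1: "((\<lambda>x. \<Sum>n. d n * x ^ n) \<longlongrightarrow> d 0) (at_right 0)"
    by (rule filterlim_mono) (simp_all add: at_le)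
  have "\<forall>\<^sub>F x in at_right 0. (\<Sum>n. d n * x ^ n) = 0"
    unfolding eventually_at_right_field
  proof (intro exI[of _ 1] conjI allI impI)
    fix x :: real assume "0 < x" "x < 1"
    then show "(\<Sum>n. d n * x ^ n) = 0" using d[of x] by (simp add: sums_iff)
  qed simp
  then have "((\<lambda>x. \<Sum>n. d n * x ^ n) \<longlongrightarrow> 0) (at_right 0)"
    by (rule tendsto_eventually)
  with 1 show ?thesis by (rule tendsto_unique[OF trivial_limit_at_right_real])
qed

text \<open>Only points 0 < x < 1 are available, because the interchanges of summation below rely on
  non-negative terms. The coefficients are peeled off one by one with limits from the right at
  0.\<close>

lemma powser_unique_right:
  fixes a b :: "nat \<Rightarrow> real"
  assumes "\<And>x. 0 < x \<Longrightarrow> x < 1 \<Longrightarrow> (\<lambda>n. a n * x ^ n) sums f x"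
    and "\<And>x. 0 < x \<Longrightarrow> x < 1 \<Longrightarrow> (\<lambda>n. b n * x ^ n) sums f x"
  shows "a n = b n"
proof -
  have zero: "d n = 0" if d: "\<And>x. 0 < x \<Longrightarrow> x < 1 \<Longrightarrow> (\<lambda>n. d n * x ^ n) sums 0" for d :: "nat \<Rightarrow> real" and n
    using d
  proof (induction n arbitrary: d)
    case 0
    show ?case by (rule powser_zero_right) (rule 0)
  next
    case (Suc n)
    have d0: "d 0 = 0" by (rule powser_zero_right) (rule Suc.prems)
    show ?case
    proof (rule Suc.IH[of "\<lambda>n. d (Suc n)"])
      fix x :: real assume x: "0 < x" "x < 1"
      have "(\<lambda>n. d (Suc n) * x ^ Suc n) sums 0"
        using sums_Suc_iff[of "\<lambda>n. d n * x ^ n" 0] Suc.prems[OF x] d0 by simp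
      then have "(\<lambda>n. d (Suc n) * x ^ Suc n * (1 / x)) sums (0 * (1 / x))" by (rule sums_mult2)
      then show "(\<lambda>n. d (Suc n) * x ^ n) sums 0" using x by simp
    qed
  qed
  have "(\<lambda>n. (a n - b n) * x ^ n) sums 0" if "0 < x" "x < 1" for x
    using sums_diff[OF assms(1)[OF that] assms(2)[OF that]] by (simp add: left_diff_distrib)
  then have "a n - b n = 0" by (rule zero)
  then show ?thesis by simp
qed

section \<open>Truncated sums and the connector\<close>

abbreviation zsum :: "nat \<Rightarrow> nat list \<Rightarrow> real" where
  "zsum n ks \<equiv> mhs (interval_list (Suc n)) ks"

abbreviation zsum_star :: "nat \<Rightarrow> nat list \<Rightarrow> real" where
  "zsum_star n ks \<equiv> mhs_star (interval_list (Suc n)) ks"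

lemma interval_list_Suc: "interval_list (Suc (Suc n)) = of_nat (Suc n) # interval_list (Suc n)"
  by (simp add: interval_list_def)

lemma zsum_0: "zsum 0 ks = (if ks = [] then 1 else 0)"
  by (cases ks) (simp_all add: interval_list_def)

lemma zsum_Suc: "zsum (Suc n) (k # ks) = zsum n (k # ks) + zsum n ks / real (Suc n) ^ k"
  by (simp only: interval_list_Suc mhs_simps)

lemma zsum_Cons: "zsum n (k # ks) = (\<Sum>i<n. zsum i ks / real (Suc i) ^ k)"
  by (induction n) (simp_all only: zsum_0 zsum_Suc sum.lessThan_Suc, simp)

lemma zsum_star_Suc: "zsum_star (Suc n) (k # ks) = zsum_star n (k # ks) + zsum_star (Suc n) ks / real (Suc n) ^ k"
  by (simp only: interval_list_Suc mhs_star_simps)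

lemma zsum_nonneg: "0 \<le> zsum n ks"
proof (induction ks arbitrary: n)
  case (Cons k ks)
  then show ?case unfolding zsum_Cons by (intro sum_nonneg) simp
qed simp

lemma zsum_star_nonneg: "0 \<le> zsum_star n ks"
proof (induction ks arbitrary: n)
  case (Cons k ks)
  show ?case
  proof (induction n)
    case 0 show ?case by (simp add: interval_list_def)
  next
    case (Suc n) then show ?case unfolding zsum_star_Suc using Cons[of "Suc n"] by simp
  qed
qed simp

lemma zsum_mono: "m \<le> n \<Longrightarrow> zsum m ks \<le> zsum n ks"
proof (cases ks)
  case (Cons k ls)
  assume "m \<le> n"
  then show ?thesis unfolding Cons zsum_Cons by (intro sum_mono2) (auto intro!: divide_nonneg_nonneg zsum_nonneg)
qed simp

text \<open>The connector \<open>c\<^sub>y m = m! / ((y + 1) \<cdots> (y + m))\<close> satisfies \<open>y c\<^sub>y m / m = c\<^sub>y (m - 1) - c\<^sub>y m\<close> and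
  \<open>c\<^sub>y\<^sub>+\<^sub>1 m / (y + 1) = (c\<^sub>y m - c\<^sub>y\<^sub>+\<^sub>1 m) / m\<close>.\<close>

definition connector :: "real \<Rightarrow> nat \<Rightarrow> real" where
  "connector y m = (\<Prod>q\<in>{1..m}. real q / (real q + y))"

lemma connector_0 [simp]: "connector y 0 = 1"
  by (simp add: connector_def)

lemma connector_Suc: "connector y (Suc m) = connector y m * (real (Suc m) / (real (Suc m) + y))"
  by (simp add: connector_def prod.nat_ivl_Suc')

lemma connector_pos: "-1 < y \<Longrightarrow> 0 < connector y m"
  unfolding connector_def by (intro prod_pos) auto

lemma connector_le:
  assumes "0 \<le> y" shows "connector y (Suc m) \<le> 1 / (1 + y)"
proof (induction m)
  case 0 show ?case by (simp add: connector_Suc)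
next
  case (Suc m)
  have "connector y (Suc (Suc m)) \<le> connector y (Suc m) * 1"
    unfolding connector_Suc[of y "Suc m"] using assms connector_pos[of y "Suc m"] by (intro mult_left_mono) (auto simp: divide_simps)
  with Suc show ?case by simp
qed

lemma connector_shift:
  assumes "-1 < y"
  shows "connector (y + 1) m / (y + 1) * real m = connector y m - connector (y + 1) m"
proof (induction m)
  case (Suc m)
  have y: "y + 1 \<noteq> 0" "1 + real m + y \<noteq> 0" "2 + real m + y \<noteq> 0" using assms by linarith+
  have eq: "connector y m = connector (y + 1) m * (real m + 1 + y) / (y + 1)"
    using Suc y by (simp add: field_simps)
  show ?case unfolding connector_Suc eq using y by (simp add: divide_simps) (simp add: algebra_simps)
qed simp

text \<open>The second relation of the connector, summed over y + 1, y + 2, ..., telescopes.\<close>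

lemma connector_sums:
  assumes y: "-1 < y" and m: "1 \<le> m"
  shows "(\<lambda>t. connector (y + 1 + real t) m / (y + 1 + real t)) sums (connector y m / real m)"
proof -
  have "(\<lambda>t. connector (y + real t) m) \<longlonglongrightarrow> 0"
  proof (rule tendsto_sandwich[OF _ _ tendsto_const])
    obtain m' where m': "m = Suc m'" using m by (cases m) auto
    have ev: "\<forall>\<^sub>F t in sequentially. 1 \<le> t" by (rule eventually_ge_at_top)
    show "\<forall>\<^sub>F t in sequentially. connector (y + real t) m \<le> 1 / (1 + (y + real t))"
      using ev by eventually_elim (use y m' in \<open>auto intro!: connector_le\<close>)
    show "\<forall>\<^sub>F t in sequentially. 0 \<le> connector (y + real t) m"
      by (intro always_eventually allI less_imp_le connector_pos) (use y in auto)
    show "(\<lambda>t. 1 / (1 + (y + real t))) \<longlonglongrightarrow> 0" by real_asymp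
  qed
  from telescope_sums'[OF this]
  have "(\<lambda>t. connector (y + real t) m - connector (y + real (Suc t)) m) sums (connector y m)" by simp
  then have "(\<lambda>t. (connector (y + real t) m - connector (y + real (Suc t)) m) / real m) sums (connector y m / real m)"
    by (rule sums_divide)
  moreover have "(connector (y + real t) m - connector (y + real (Suc t)) m) / real m = connector (y + 1 + real t) m / (y + 1 + real t)" for t
    using connector_shift[of "y + real t" m] y m by (simp add: add_ac divide_simps)
  ultimately show ?thesis by simp
qed

text \<open>The connector is attached to the largest variable n = i + 1 of the index
  \<open>k # ks\<close>, and y stands for the variable on the other side. Stated as a relation so
  that convergence is part of the claim.\<close>

definition connected_sums :: "real \<Rightarrow> nat \<Rightarrow> nat list \<Rightarrow> real \<Rightarrow> bool" where
  "connected_sums y k ks L \<longleftrightarrow> (\<lambda>i. connector y (Suc i) * zsum i ks / real (Suc i) ^ k) sums L"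

text \<open>Transport of a leading exponent 1: summation by parts with the first relation of the
  connector removes it at the price of a factor 1/y. An empty rest contributes the boundary value 1
  at n = 0.\<close>

lemma connected_sums_1:
  assumes y: "0 < y"
    and L: "case ls of [] \<Rightarrow> L = 1 | k # ks \<Rightarrow> connected_sums y k ks L"
  shows "connected_sums y 1 ls (L / y)"
proof -
  define f where "f i = connector y (Suc i) * zsum i ls / real (Suc i)" for i
  define B where "B n = (case ls of [] \<Rightarrow> 1 | k # ks \<Rightarrow> \<Sum>i<n. connector y (Suc i) * zsum i ks / real (Suc i) ^ k)" for n
  have c0: "0 < connector y m" for m using y by (intro connector_pos) auto
  have eq: "y * (\<Sum>i<n. f i) + connector y n * zsum n ls = B n" for n
  proof (induction n)
    case 0
    show ?case by (cases ls) (simp_all add: B_def zsum_0)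
  next
    case (Suc n)
    have s: "y * (connector y (Suc n) / real (Suc n)) = connector y n - connector y (Suc n)"
      unfolding connector_Suc using y by (simp add: divide_simps) (simp add: algebra_simps)
    have "y * f n = (connector y n - connector y (Suc n)) * zsum n ls"
      unfolding s[symmetric] f_def by simp
    moreover have "B (Suc n) = B n + (case ls of [] \<Rightarrow> 0 | k # ks \<Rightarrow> connector y (Suc n) * zsum n ks / real (Suc n) ^ k)"
      by (cases ls) (simp_all add: B_def)
    moreover have "connector y (Suc n) * zsum (Suc n) ls = connector y (Suc n) * zsum n ls
        + (case ls of [] \<Rightarrow> 0 | k # ks \<Rightarrow> connector y (Suc n) * zsum n ks / real (Suc n) ^ k)"
      by (cases ls) (simp_all add: zsum_Suc distrib_left del: of_nat_Suc)
    ultimately show ?case using Suc by (simp add: algebra_simps)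
  qed
  have BL: "B \<longlonglongrightarrow> L"
    using L by (cases ls) (simp_all add: B_def[abs_def] connected_sums_def sums_def)
  have f0: "0 \<le> f i" for i unfolding f_def using c0[of "Suc i"] zsum_nonneg[of i ls] by simp
  have "B n \<le> L" for n
  proof (cases ls)
    case Nil then show ?thesis using L by (simp add: B_def)
  next
    case (Cons k ks)
    then have "(\<lambda>i. connector y (Suc i) * zsum i ks / real (Suc i) ^ k) sums L" using L by (simp add: connected_sums_def)
    then have "summable (\<lambda>i. connector y (Suc i) * zsum i ks / real (Suc i) ^ k)" "(\<Sum>i. connector y (Suc i) * zsum i ks / real (Suc i) ^ k) = L"
      by (simp_all add: sums_iff)
    then show ?thesis unfolding B_def Cons list.case
      by (metis (no_types, lifting) sum_le_suminf finite_lessThan mult_nonneg_nonneg less_imp_le c0 zsum_nonneg divide_nonneg_nonneg of_nat_0_le_iff zero_le_power)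
  qed
  then have le: "y * (\<Sum>i<n. f i) \<le> L" for n
    using eq[of n] mult_nonneg_nonneg[OF less_imp_le[OF c0[of n]] zsum_nonneg[of n ls]] by (smt (verit))
  have "summable f"
    by (rule summableI_nonneg_bounded[where x = "L / y"]) (use f0 le y in \<open>auto simp: field_simps\<close>)
  then obtain a where a: "f sums a" by (auto simp: summable_def)
  have lim: "(\<lambda>n. connector y n * zsum n ls) \<longlonglongrightarrow> L - y * a"
  proof -
    have "(\<lambda>n. B n - y * (\<Sum>i<n. f i)) \<longlonglongrightarrow> L - y * a"
      using a by (intro tendsto_intros BL) (simp add: sums_def)
    moreover have "B n - y * (\<Sum>i<n. f i) = connector y n * zsum n ls" for n using eq[of n] by simp
    ultimately show ?thesis by simp
  qed
  \<comment> \<open>If the boundary term had a positive limit, the summable \<open>f\<close> would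
    eventually exceed a multiple of the harmonic series.\<close>
  have "L - y * a = 0"
  proof (rule ccontr)
    assume ne: "L - y * a \<noteq> 0"
    have "0 \<le> L - y * a"
      by (rule LIMSEQ_le_const[OF lim]) (use less_imp_le[OF c0] zsum_nonneg in auto)
    with ne have pos: "0 < L - y * a" by simp
    define \<epsilon> where "\<epsilon> = (L - y * a) / 2"
    have "(\<lambda>n. connector y n * zsum n ls * (real (Suc n) / (real (Suc n) + y))) \<longlonglongrightarrow> (L - y * a) * 1"
      by (intro tendsto_mult lim) real_asymp
    then have "\<forall>\<^sub>F n in sequentially. \<epsilon> < connector y n * zsum n ls * (real (Suc n) / (real (Suc n) + y))"
      by (rule order_tendstoD) (use pos \<epsilon>_def in auto)
    then have "\<forall>\<^sub>F n in sequentially. norm (\<epsilon> * inverse (real (Suc n))) \<le> f n"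
    proof eventually_elim
      case (elim n)
      have "f n = (connector y n * zsum n ls * (real (Suc n) / (real (Suc n) + y))) * inverse (real (Suc n))"
        unfolding f_def connector_Suc by (simp add: divide_simps)
      moreover have "\<epsilon> * inverse (real (Suc n)) \<le> (connector y n * zsum n ls * (real (Suc n) / (real (Suc n) + y))) * inverse (real (Suc n))"
        using elim by (intro mult_right_mono) auto
      moreover have "0 < \<epsilon>" using pos by (simp add: \<epsilon>_def)
      ultimately show ?case by simp
    qed
    from summable_comparison_test_ev[OF this \<open>summable f\<close>]
    have "summable (\<lambda>n. (1 / \<epsilon>) * (\<epsilon> * inverse (real (Suc n))))" by (rule summable_mult)
    then have "summable (\<lambda>n. inverse (real (Suc n)))" using pos by (simp add: \<epsilon>_def)
    then show False
      using summable_Suc_iff[of "\<lambda>n. inverse (real n)"] not_summable_harmonic[where 'a = real] by simp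
  qed
  then have "a = L / y" using y by (simp add: field_simps)
  with a show ?thesis by (simp add: connected_sums_def f_def[abs_def])
qed

lemma connected_sums_ones:
  assumes "0 < y"
  shows "connected_sums y 1 (replicate v 1) (1 / y ^ Suc v)"
proof (induction v)
  case 0
  show ?case using connected_sums_1[OF assms, where ls = "[]" and L = 1] by simp
next
  case (Suc v)
  then show ?case using connected_sums_1[OF assms, where ls = "replicate (Suc v) 1" and L = "1 / y ^ Suc v"] by (simp add: field_simps)
qed

lemma connected_sums_ones_append:
  assumes "0 < y" "connected_sums y k ks L"
  shows "connected_sums y 1 (replicate v 1 @ k # ks) (L / y ^ Suc v)"
proof (induction v)
  case 0
  show ?case using connected_sums_1[OF assms(1), where ls = "k # ks" and L = L] assms(2) by simp
next
  case (Suc v)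
  then show ?case using connected_sums_1[OF assms(1), where ls = "replicate (Suc v) 1 @ k # ks" and L = "L / y ^ Suc v"] by (simp add: field_simps)
qed

text \<open>Raising the leading exponent means summing over all shifts of y, by
  \<open>connector_sums\<close>. The shifts y + 1 + t are positive as soon as y > -1, so runs of
  ones can be transported at them even when y itself is negative.\<close>

lemma connected_sums_Suc:
  assumes y: "-1 < y"
    and L: "\<And>t. connected_sums (y + 1 + real t) k ks (L t)"
    and M: "(\<lambda>t. L t / (y + 1 + real t)) sums M"
  shows "connected_sums y (Suc k) ks M"
proof -
  define f where "f t i = connector (y + 1 + real t) (Suc i) * zsum i ks / real (Suc i) ^ k / (y + 1 + real t)" for t i
  have "(\<lambda>i. \<Sum>t. f t i) sums M"
  proof (rule tonelli_sums(2))
    show "0 \<le> f t i" for t i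
      unfolding f_def using y by (auto intro!: divide_nonneg_nonneg mult_nonneg_nonneg less_imp_le[OF connector_pos] zsum_nonneg)
    show "f t sums (L t / (y + 1 + real t))" for t
      using sums_divide[OF L[of t, unfolded connected_sums_def]] by (simp add: f_def[abs_def])
  qed (rule M)
  moreover have "(\<Sum>t. f t i) = connector y (Suc i) * zsum i ks / real (Suc i) ^ Suc k" for i
  proof -
    have "(\<lambda>t. connector (y + 1 + real t) (Suc i) / (y + 1 + real t) * (zsum i ks / real (Suc i) ^ k))
        sums (connector y (Suc i) / real (Suc i) * (zsum i ks / real (Suc i) ^ k))"
      by (intro sums_mult2 connector_sums y) simp
    then have "f_aux sums (connector y (Suc i) * zsum i ks / real (Suc i) ^ Suc k)"
      if "f_aux = (\<lambda>t. f t i)" for f_aux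
      unfolding that f_def[abs_def] by (simp add: mult_ac)
    then show ?thesis by (simp add: sums_iff)
  qed
  ultimately show ?thesis by (simp add: connected_sums_def)
qed

section \<open>Convergence of multiple zeta values\<close>

lemma has_sum_exhaustion:
  fixes f :: "'a \<Rightarrow> real"
  assumes nonneg: "\<And>x. x \<in> S \<Longrightarrow> 0 \<le> f x"
    and F: "\<And>n. finite (F n)" "\<And>n. F n \<subseteq> S" "\<And>m n. m \<le> n \<Longrightarrow> F m \<subseteq> F n" "\<And>x. x \<in> S \<Longrightarrow> \<exists>n. x \<in> F n"
    and lim: "(\<lambda>n. sum f (F n)) \<longlonglongrightarrow> L"
  shows "(f has_sum L) S"
proof -
  have inc: "incseq (\<lambda>n. sum f (F n))"
    unfolding incseq_def by (intro allI impI sum_mono2) (use nonneg F in blast)+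
  have le: "sum f G \<le> L" if "finite G" "G \<subseteq> S" for G
  proof -
    have "\<exists>n. G \<subseteq> F n"
      using that
    proof (induction G rule: finite_induct)
      case (insert x G)
      then obtain m where m: "G \<subseteq> F m" by auto
      obtain n where n: "x \<in> F n" using insert F(4)[of x] by auto
      from m n have "insert x G \<subseteq> F (max m n)" using F(3)[of m "max m n"] F(3)[of n "max m n"] by auto
      then show ?case by blast
    qed simp
    then obtain n where "G \<subseteq> F n" by blast
    then have "sum f G \<le> sum f (F n)" using F nonneg by (intro sum_mono2) blast+
    also have "\<dots> \<le> L" by (rule incseq_le[OF inc lim])
    finally show ?thesis .
  qed
  have sm: "f summable_on S"
    by (rule nonneg_bdd_above_summable_on) (use nonneg le in \<open>auto intro!: bdd_aboveI2[where M = L]\<close>)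
  have "infsum f S \<le> L" by (rule infsum_le_finite_sums[OF sm le])
  moreover have "L \<le> infsum f S"
  proof (rule LIMSEQ_le_const2[OF lim], intro exI allI impI)
    show "sum f (F n) \<le> infsum f S" for n
      by (rule finite_sum_le_infsum[OF sm]) (use F nonneg in blast)+
  qed
  ultimately have "infsum f S = L" by simp
  with has_sum_infsum[OF sm] show ?thesis by simp
qed

lemma zsum_le_ones: "is_index ks \<Longrightarrow> zsum n ks \<le> zsum n (replicate (length ks) 1)"
proof (induction ks arbitrary: n)
  case (Cons k ks)
  have "zsum i ks / real (Suc i) ^ k \<le> zsum i (replicate (length ks) 1) / real (Suc i) ^ 1" for i
    using Cons zsum_nonneg[of i "replicate (length ks) 1"] power_increasing[of 1 k "real (Suc i)"]
    by (intro frac_le) auto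
  then show ?case unfolding length_Cons replicate_Suc zsum_Cons by (intro sum_mono) simp
qed simp

text \<open>The connector at y = 1 is 1 / (m + 1). So the sum over 1 / ((i + 1)(i + 2)) times a
  strict sum of ones is exactly 1, and 1 / (i + 1)^2 is at most twice the weight used there.\<close>

lemma zsum_admissible_bounded:
  assumes "admissible ks"
  shows "zsum n ks \<le> 2"
proof (cases ks)
  case (Cons k ls)
  then have k: "2 \<le> k" "is_index ls" using assms by (auto simp: admissible_def)
  let ?f = "\<lambda>i. connector 1 (Suc i) * zsum i (replicate (length ls) 1) / real (Suc i) ^ 1"
  have c: "connector 1 m = 1 / real (Suc m)" for m
    by (induction m) (simp_all add: connector_Suc)
  have f: "?f sums 1"
    using connected_sums_ones[of 1 "length ls"] by (simp add: connected_sums_def)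
  have le: "zsum i ls / real (Suc i) ^ k \<le> 2 * ?f i" for i
  proof -
    have "zsum i ls / real (Suc i) ^ k \<le> zsum i (replicate (length ls) 1) / real (Suc i) ^ 2"
      using zsum_le_ones[OF k(2)] zsum_nonneg k(1) by (intro frac_le power_increasing) auto
    also have "\<dots> = zsum i (replicate (length ls) 1) * (1 / (real (Suc i) * real (Suc i)))"
      by (simp add: power2_eq_square)
    also have "\<dots> \<le> zsum i (replicate (length ls) 1) * (2 / (real (Suc i) * real (Suc (Suc i))))"
      by (intro mult_left_mono zsum_nonneg) (simp add: divide_simps)
    also have "\<dots> = 2 * ?f i" by (simp add: c mult_ac)
    finally show ?thesis .
  qed
  have "zsum n ks \<le> (\<Sum>i<n. 2 * ?f i)"
    unfolding Cons zsum_Cons by (intro sum_mono le)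
  also have "\<dots> = 2 * (\<Sum>i<n. ?f i)" by (simp add: sum_distrib_left)
  also have "(\<Sum>i<n. ?f i) \<le> 1"
  proof -
    have "(\<Sum>i<n. ?f i) \<le> (\<Sum>i. ?f i)"
      by (rule sum_le_suminf) (use f in \<open>auto simp: sums_iff c intro!: divide_nonneg_nonneg zsum_nonneg\<close>)
    then show ?thesis using f by (simp add: sums_iff)
  qed
  finally show ?thesis by simp
qed simp

lemma harmonic_term_nonneg: "0 \<le> (harmonic_term ks ms :: real)"
  unfolding harmonic_term_def by (intro prod_nonneg) auto

lemma bounded_list: "\<exists>n. \<forall>m\<in>set ms. m < Suc (n::nat)"
  by (induction ms) (auto, metis less_Suc_eq_le max.coboundedI1 max.coboundedI2 order_refl)

text \<open>Links the unordered sum over sequences with the limit of truncations, where all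
  algebraic identities live.\<close>

lemma mzv_has_sum:
  assumes "admissible ks"
  shows "(harmonic_term ks has_sum mzv ks) (strict_seqs (length ks))" "(\<lambda>n. zsum n ks) \<longlonglongrightarrow> mzv ks"
proof -
  have inc: "incseq (\<lambda>n. zsum n ks)" unfolding incseq_def using zsum_mono by blast
  obtain L where L: "(\<lambda>n. zsum n ks) \<longlonglongrightarrow> L"
    by (rule incseq_convergent[OF inc, of 2]) (use zsum_admissible_bounded[OF assms] in auto)
  have "(harmonic_term ks has_sum L) (strict_seqs (length ks))"
  proof (rule has_sum_exhaustion[where F = "\<lambda>n. {ms\<in>strict_seqs (length ks). \<forall>m\<in>set ms. m < Suc n}"])
    show "finite {ms\<in>strict_seqs (length ks). \<forall>m\<in>set ms. m < Suc n}" for n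
      unfolding strict_seqs_eq by (rule finite_bounded_lists)
    show "\<exists>n. ms \<in> {ms\<in>strict_seqs (length ks). \<forall>m\<in>set ms. m < Suc n}" if "ms \<in> strict_seqs (length ks)" for ms
      using bounded_list[of ms] that by auto
    show "(\<lambda>n. sum (harmonic_term ks) {ms\<in>strict_seqs (length ks). \<forall>m\<in>set ms. m < Suc n}) \<longlonglongrightarrow> L"
      unfolding sum_strict_seqs by (rule L)
  qed (auto simp: harmonic_term_nonneg)
  moreover from this have "mzv ks = L" unfolding mzv_def by (rule infsumI)
  ultimately show "(harmonic_term ks has_sum mzv ks) (strict_seqs (length ks))" "(\<lambda>n. zsum n ks) \<longlonglongrightarrow> mzv ks"
    using L by simp_all
qed

lemma contractions_admissible:
  assumes "admissible ks" "ls \<in> set (contractions ks)"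
  shows "admissible ls"
proof -
  have "hd ks \<le> hd ls \<and> ls \<noteq> []" if "ls \<in> set (contractions ks)" "ks \<noteq> []" for ks ls
    using that by (induction ks arbitrary: ls rule: contractions.induct) (auto, force)
  moreover have "ls = []" if "ks = []" using assms(2) that by simp
  ultimately show ?thesis
    using assms contractions_index[OF _ assms(2)] unfolding admissible_def by (cases "ks = []") (auto intro: le_trans)
qed

lemma tendsto_sum_list:
  fixes f :: "nat \<Rightarrow> 'b \<Rightarrow> real"
  assumes "\<And>x. x \<in> set xs \<Longrightarrow> (\<lambda>n. f n x) \<longlonglongrightarrow> g x"
  shows "(\<lambda>n. sum_list (map (f n) xs)) \<longlonglongrightarrow> sum_list (map g xs)"
  using assms by (induction xs) (auto intro!: tendsto_add)

lemma mzv_star_contractions: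
  assumes "admissible ks"
  shows "mzv_star ks = sum_list (map mzv (contractions ks))"
proof -
  have L: "(\<lambda>n. zsum_star n ks) \<longlonglongrightarrow> sum_list (map mzv (contractions ks))"
    unfolding mhs_star_contractions
    by (intro tendsto_sum_list mzv_has_sum(2) contractions_admissible[OF assms])
  have "(harmonic_term ks has_sum sum_list (map mzv (contractions ks))) (weak_seqs (length ks))"
  proof (rule has_sum_exhaustion[where F = "\<lambda>n. {ms\<in>weak_seqs (length ks). \<forall>m\<in>set ms. m < Suc n}"])
    show "finite {ms\<in>weak_seqs (length ks). \<forall>m\<in>set ms. m < Suc n}" for n
      unfolding weak_seqs_eq by (rule finite_bounded_lists)
    show "\<exists>n. ms \<in> {ms\<in>weak_seqs (length ks). \<forall>m\<in>set ms. m < Suc n}" if "ms \<in> weak_seqs (length ks)" for ms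
      using bounded_list[of ms] that by auto
    show "(\<lambda>n. sum (harmonic_term ks) {ms\<in>weak_seqs (length ks). \<forall>m\<in>set ms. m < Suc n}) \<longlonglongrightarrow> sum_list (map mzv (contractions ks))"
      unfolding sum_weak_seqs by (rule L)
  qed (auto simp: harmonic_term_nonneg)
  then show ?thesis unfolding mzv_star_def by (rule infsumI)
qed

lemma mzv_single_sums:
  assumes "2 \<le> k"
  shows "(\<lambda>t. 1 / real (Suc t) ^ k) sums mzv [k]"
  using mzv_has_sum(2)[of "[k]"] assms by (simp add: admissible_def zsum_Cons sums_def)

lemma mzv_double_has_sum:
  assumes "2 \<le> q" "1 \<le> p"
  shows "((\<lambda>(t, t'). 1 / real (Suc t) ^ p * (1 / real (Suc (Suc (t + t'))) ^ q)) has_sum mzv [q, p]) UNIV"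
proof -
  have "((\<lambda>(t, t'). 1 / real (Suc t) ^ p * (1 / real (Suc (Suc (t + t'))) ^ q)) has_sum mzv [q, p]) UNIV \<longleftrightarrow>
     (harmonic_term [q, p] has_sum mzv [q, p]) (strict_seqs 2)"
  proof (rule has_sum_reindex_bij_witness[of _ "\<lambda>ms. (ms ! 1 - 1, ms ! 0 - ms ! 1 - 1)" "\<lambda>(t, t'). [Suc (Suc (t + t')), Suc t]"])
    fix ms assume "ms \<in> strict_seqs 2"
    then obtain a b where "ms = [a, b]" "b < a" "1 \<le> b"
      by (auto simp: strict_seqs_def numeral_2_eq_2 length_Suc_conv)
    then show "(case (ms ! 1 - 1, ms ! 0 - ms ! 1 - 1) of (t, t') \<Rightarrow> [Suc (Suc (t + t')), Suc t]) = ms" by simp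
  next
    fix x :: "nat \<times> nat"
    show "harmonic_term [q, p] (case x of (t, t') \<Rightarrow> [Suc (Suc (t + t')), Suc t]) =
       (case x of (t, t') \<Rightarrow> 1 / real (Suc t) ^ p * (1 / real (Suc (Suc (t + t'))) ^ q))"
      by (cases x) (simp add: harmonic_term_simps)
  qed (auto simp: strict_seqs_def)
  then show ?thesis using mzv_has_sum(1)[of "[q, p]"] assms by (simp add: admissible_def numeral_2_eq_2)
qed

section \<open>Evaluation of connected sums by Hurwitz type series\<close>

lemma has_sum_finite_sum:
  fixes f :: "'a \<Rightarrow> 'b \<Rightarrow> real"
  assumes "finite I" "\<And>i. i \<in> I \<Longrightarrow> ((\<lambda>x. f x i) has_sum g i) A"
  shows "((\<lambda>x. \<Sum>i\<in>I. f x i) has_sum (\<Sum>i\<in>I. g i)) A"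
  using assms by (induction I rule: finite_induct) (auto intro!: has_sum_add)

text \<open>The Hurwitz zeta value of exponent b at y + 1.\<close>

definition rho :: "nat \<Rightarrow> real \<Rightarrow> real" where
  "rho b y = (\<Sum>t. 1 / (y + 1 + real t) ^ b)"

lemma rho_sums:
  assumes "2 \<le> b" "-1 < y"
  shows "(\<lambda>t. 1 / (y + 1 + real t) ^ b) sums rho b y"
proof -
  have "summable (\<lambda>t. 1 / (y + 1 + real (Suc t)) ^ b)"
  proof (rule summable_comparison_test)
    show "summable (\<lambda>t. 1 / real (Suc t) ^ b)" using mzv_single_sums[OF assms(1)] by (simp add: sums_iff)
    have "norm (1 / (y + 1 + real (Suc t)) ^ b) \<le> 1 / real (Suc t) ^ b" for t
      using assms by (auto intro!: frac_le power_mono)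
    then show "\<exists>N. \<forall>t\<ge>N. norm (1 / (y + 1 + real (Suc t)) ^ b) \<le> 1 / real (Suc t) ^ b" by blast
  qed
  then have "summable (\<lambda>t. 1 / (y + 1 + real t) ^ b)" by (subst (asm) summable_Suc_iff)
  then show ?thesis unfolding rho_def by (rule summable_sums)
qed

lemma rho_bound:
  assumes "2 \<le> b" "0 \<le> y"
  shows "0 \<le> rho b y" "rho b y \<le> mzv [b]"
proof -
  have s: "(\<lambda>t. 1 / (y + 1 + real t) ^ b) sums rho b y" using assms by (intro rho_sums) auto
  show "0 \<le> rho b y" by (rule sums_le[OF _ sums_zero s]) (use assms in auto)
  show "rho b y \<le> mzv [b]"
    by (rule sums_le[OF _ s mzv_single_sums[OF assms(1)]]) (use assms in \<open>auto intro!: frac_le power_mono\<close>)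
qed

text \<open>Telescoping bound; the decay in y makes the double series below converge also for a =
  1.\<close>

lemma rho_bound':
  assumes "2 \<le> b" "1 \<le> y"
  shows "rho b y \<le> 1 / y"
proof -
  have s: "(\<lambda>t. 1 / (y + 1 + real t) ^ b) sums rho b y" using assms by (intro rho_sums) auto
  have "(\<lambda>t. 1 / (y + real t)) \<longlonglongrightarrow> 0" by real_asymp
  from telescope_sums'[OF this] have t: "(\<lambda>t. 1 / (y + real t) - 1 / (y + real (Suc t))) sums (1 / y)" by simp
  show ?thesis
  proof (rule sums_le[OF _ s t])
    fix n
    have "1 / (y + 1 + real n) ^ b \<le> 1 / (y + 1 + real n) ^ 2"
      using assms by (intro frac_le power_increasing) auto
    also have "\<dots> \<le> 1 / ((y + real n) * (y + 1 + real n))"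
      unfolding power2_eq_square using assms by (intro frac_le mult_right_mono) auto
    also have "\<dots> = 1 / (y + real n) - 1 / (y + real (Suc n))"
      using assms by (simp add: divide_simps)
    finally show "1 / (y + 1 + real n) ^ b \<le> 1 / (y + real n) - 1 / (y + real (Suc n))" .
  qed
qed

text \<open>A double zeta series over the shifted integers y + 1, y + 2, ..., with exponent a at the
  smaller variable and b at the larger.\<close>

definition sigma_sum :: "nat \<Rightarrow> nat \<Rightarrow> real \<Rightarrow> real" where
  "sigma_sum a b y = (\<Sum>t. rho b (y + 1 + real t) / (y + 1 + real t) ^ a)"

lemma sigma_sum_sums:
  assumes "1 \<le> a" "2 \<le> b" "-1 < y"
  shows "(\<lambda>t. rho b (y + 1 + real t) / (y + 1 + real t) ^ a) sums sigma_sum a b y"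
proof -
  have "summable (\<lambda>t. rho b (y + 1 + real (t + 1)) / (y + 1 + real (t + 1)) ^ a)"
  proof (rule summable_comparison_test)
    show "summable (\<lambda>t. 1 / real (Suc t) ^ 2)" using mzv_single_sums[of 2] by (simp add: sums_iff)
    have "norm (rho b (y + 1 + real (t + 1)) / (y + 1 + real (t + 1)) ^ a) \<le> 1 / real (Suc t) ^ 2" for t
    proof -
      define z where "z = y + 1 + real (t + 1)"
      have z: "1 \<le> z" "real (Suc t) \<le> z" using assms by (auto simp: z_def)
      have "rho b z / z ^ a \<le> (1 / z) / z ^ 1"
        using z assms rho_bound'[of b z] rho_bound(1)[of b z] by (intro frac_le power_increasing) auto
      also have "\<dots> \<le> 1 / real (Suc t) ^ 2"
        using z by (simp add: power2_eq_square) (intro frac_le mult_mono; simp)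
      finally show ?thesis using z assms rho_bound(1)[of b z] by (simp add: z_def)
    qed
    then show "\<exists>N. \<forall>t\<ge>N. norm (rho b (y + 1 + real (t + 1)) / (y + 1 + real (t + 1)) ^ a) \<le> 1 / real (Suc t) ^ 2" by blast
  qed
  then have "summable (\<lambda>t. rho b (y + 1 + real t) / (y + 1 + real t) ^ a)"
    by (subst (asm) summable_iff_shift)
  then show ?thesis unfolding sigma_sum_def by (rule summable_sums)
qed

text \<open>The run of w ones together with the exponent 1 below the leading 2 is transported to a
  power of y; raising 1 to 2 sums this power over the shifts.\<close>

lemma connected_sums_rho:
  assumes "-1 < y"
  shows "connected_sums y 2 (replicate w 1) (rho (w + 2) y)"
proof -
  have "connected_sums y (Suc 1) (replicate w 1) (rho (w + 2) y)"
  proof (rule connected_sums_Suc[OF assms])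
    show "connected_sums (y + 1 + real t) 1 (replicate w 1) (1 / (y + 1 + real t) ^ Suc w)" for t
      by (rule connected_sums_ones) (use assms in auto)
    show "(\<lambda>t. 1 / (y + 1 + real t) ^ Suc w / (y + 1 + real t)) sums rho (w + 2) y"
      using rho_sums[of "w + 2" y] assms by (simp add: mult_ac)
  qed
  then show ?thesis by (simp add: numeral_2_eq_2 One_nat_def)
qed

lemma connected_sums_sigma2:
  assumes "-1 < y"
  shows "connected_sums y 2 (replicate v 1 @ 2 # replicate w 1) (sigma_sum (v + 2) (w + 2) y)"
proof -
  have "connected_sums y (Suc 1) (replicate v 1 @ 2 # replicate w 1) (sigma_sum (v + 2) (w + 2) y)"
  proof (rule connected_sums_Suc[OF assms])
    show "connected_sums (y + 1 + real t) 1 (replicate v 1 @ 2 # replicate w 1) (rho (w + 2) (y + 1 + real t) / (y + 1 + real t) ^ Suc v)" for t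
      by (rule connected_sums_ones_append[OF _ connected_sums_rho]) (use assms in auto)
    show "(\<lambda>t. rho (w + 2) (y + 1 + real t) / (y + 1 + real t) ^ Suc v / (y + 1 + real t)) sums sigma_sum (v + 2) (w + 2) y"
      using sigma_sum_sums[of "v + 2" "w + 2" y] assms by (simp add: mult_ac)
  qed
  then show ?thesis by (simp add: numeral_2_eq_2 One_nat_def)
qed

lemma connected_sums_sigma3:
  assumes "-1 < y"
  shows "connected_sums y 3 (replicate w 1) (sigma_sum 1 (w + 2) y)"
proof -
  have "connected_sums y (Suc 2) (replicate w 1) (sigma_sum 1 (w + 2) y)"
  proof (rule connected_sums_Suc[OF assms])
    show "connected_sums (y + 1 + real t) 2 (replicate w 1) (rho (w + 2) (y + 1 + real t))" for t
      by (rule connected_sums_rho) (use assms in auto)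
    show "(\<lambda>t. rho (w + 2) (y + 1 + real t) / (y + 1 + real t)) sums sigma_sum 1 (w + 2) y"
      using sigma_sum_sums[of 1 "w + 2" y] assms by simp
  qed
  then show ?thesis by (simp add: numeral_3_eq_3 numeral_2_eq_2)
qed

lemma negative_binomial_sums:
  assumes x: "0 \<le> x" "x < s"
  shows "(\<lambda>e. real ((a + e) choose e) / s ^ (Suc a + e) * x ^ e) sums (1 / (s - x) ^ Suc a)"
proof -
  have "0 \<le> x / s" "x / s < 1" using x by auto
  then have nx: "norm (x / s) < 1" by simp
  show ?thesis
proof (induction a)
  case 0
  have "(\<lambda>e. (x / s) ^ e * (1 / s)) sums (1 / (1 - x / s) * (1 / s))"
    by (intro sums_mult2 geometric_sums) (rule nx)
  moreover have "1 / (1 - x / s) * (1 / s) = 1 / (s - x)" using x by (simp add: field_simps)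
  ultimately show ?case using x by (simp add: power_divide mult_ac)
next
  case (Suc a)
  let ?a = "\<lambda>e. real ((a + e) choose e) / s ^ (Suc a + e) * x ^ e"
  let ?b = "\<lambda>e. (x / s) ^ e * (1 / s)"
  have b: "?b sums (1 / (s - x))"
  proof -
    have "?b sums (1 / (1 - x / s) * (1 / s))"
      by (intro sums_mult2 geometric_sums) (rule nx)
    moreover have "1 / (1 - x / s) * (1 / s) = 1 / (s - x)" using x by (simp add: field_simps)
    ultimately show ?thesis by simp
  qed
  have nn: "0 \<le> ?a e" "0 \<le> ?b e" for e using x by auto
  have "(\<lambda>k. \<Sum>i\<le>k. ?a i * ?b (k - i)) sums (suminf ?a * suminf ?b)"
  proof (rule Cauchy_product_sums)
    show "summable (\<lambda>e. norm (?a e))" unfolding real_norm_def abs_of_nonneg[OF nn(1)] using Suc by (rule sums_summable)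
    show "summable (\<lambda>e. norm (?b e))" unfolding real_norm_def abs_of_nonneg[OF nn(2)] using b by (rule sums_summable)
  qed
  moreover have "(\<Sum>i\<le>k. ?a i * ?b (k - i)) = real ((Suc a + k) choose k) / s ^ (Suc (Suc a) + k) * x ^ k" for k
  proof -
    have "?a i * ?b (k - i) = real ((a + i) choose i) * (x ^ k / s ^ (Suc (Suc a) + k))" if "i \<le> k" for i
    proof -
      have "x ^ i * x ^ (k - i) = x ^ k" "s ^ (Suc a + i) * (s ^ (k - i) * s) = s ^ (Suc (Suc a) + k)"
        using that by (simp_all flip: power_add power_Suc2)
      then have "x ^ k / s ^ (Suc (Suc a) + k) = (x ^ i * x ^ (k - i)) / (s ^ (Suc a + i) * (s ^ (k - i) * s))" by (simp only:)
      then show ?thesis by (simp only: power_divide times_divide_times_eq times_divide_eq_right times_divide_eq_left mult_1_right mult_ac divide_divide_eq_left divide_divide_eq_right)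
    qed
    then have "(\<Sum>i\<le>k. ?a i * ?b (k - i)) = (\<Sum>i\<le>k. real ((a + i) choose i) * (x ^ k / s ^ (Suc (Suc a) + k)))"
      by (intro sum.cong) auto
    also have "\<dots> = real (\<Sum>i\<le>k. (a + i) choose i) * (x ^ k / s ^ (Suc (Suc a) + k))"
      by (simp only: of_nat_sum sum_distrib_right)
    also have "(\<Sum>i\<le>k. (a + i) choose i) = (Suc a + k) choose k"
      using sum_choose_lower[of a k] by simp
    finally show ?thesis by simp
  qed
  ultimately show ?case using Suc b by (simp add: sums_iff mult_ac)
qed
qed


text \<open>At y = -x the connector is the product of 1 / (1 - x/q), the generating function of the
  complete symmetric sums of 1/q. This is the reason for going to negative y.\<close>

lemma connector_expansion:
  assumes x: "0 \<le> x" "x < 1"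
  shows "(\<lambda>u. zsum_star m (replicate u 1) * x ^ u) sums connector (-x) m"
proof (induction m)
  case 0
  have "zsum_star 0 (replicate u 1) = (if u = 0 then 1 else 0)" for u
    by (cases u) (simp_all add: interval_list_def)
  then show ?case using sums_single[of 0 "\<lambda>_. 1 :: real"] by (simp add: if_distrib[of "\<lambda>z. z * _"] cong: if_cong)
next
  case (Suc m)
  define s where "s = real (Suc m)"
  have s: "1 \<le> s" by (simp add: s_def)
  let ?a = "\<lambda>u. zsum_star m (replicate u 1) * x ^ u"
  let ?b = "\<lambda>u. (x / s) ^ u"
  have "0 \<le> x / s" "x / s < 1" using x s by auto
  then have b: "?b sums (1 / (1 - x / s))" by (intro geometric_sums) simp
  have nn: "0 \<le> ?a u" "0 \<le> ?b u" for u using x s zsum_star_nonneg by auto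
  have "(\<lambda>k. \<Sum>i\<le>k. ?a i * ?b (k - i)) sums (suminf ?a * suminf ?b)"
    by (rule Cauchy_product_sums) (use nn Suc b in \<open>auto simp: sums_iff\<close>)
  moreover have "(\<Sum>i\<le>k. ?a i * ?b (k - i)) = zsum_star (Suc m) (replicate k 1) * x ^ k" for k
  proof (induction k)
    case (Suc k)
    have "(\<Sum>i\<le>Suc k. ?a i * ?b (Suc k - i)) = (\<Sum>i\<le>k. ?a i * ?b (k - i)) * (x / s) + ?a (Suc k)"
    proof -
      have "?a i * ?b (Suc k - i) = ?a i * ?b (k - i) * (x / s)" if "i \<le> k" for i
        using that by (simp only: Suc_diff_le power_Suc mult_ac)
      then have "(\<Sum>i\<le>k. ?a i * ?b (Suc k - i)) = (\<Sum>i\<le>k. ?a i * ?b (k - i) * (x / s))"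
        by (intro sum.cong) auto
      then show ?thesis by (simp only: sum.atMost_Suc sum_distrib_right) simp
    qed
    also have "\<dots> = zsum_star (Suc m) (replicate (Suc k) 1) * x ^ Suc k"
      unfolding Suc replicate_Suc zsum_star_Suc by (simp add: s_def ring_distribs mult_ac)
    finally show ?case .
  qed simp
  moreover have "connector (-x) m * (1 / (1 - x / s)) = connector (-x) (Suc m)"
    unfolding connector_Suc s_def[symmetric] using x s by (simp add: field_simps)
  ultimately show ?case using Suc b by (simp add: sums_iff)
qed

text \<open>Expand a connected sum at y = -x in powers of x. The connector contributes the complete
  sums up to n, and comparing coefficients evaluates the series one u at a time.\<close>

lemma ohno_coefficients:
  assumes M: "\<And>x. 0 < x \<Longrightarrow> x < 1 \<Longrightarrow> connected_sums (-x) k ls (M x)"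
    and D: "\<And>x. 0 < x \<Longrightarrow> x < 1 \<Longrightarrow> (\<lambda>u. D u * x ^ u) sums M x"
  shows "(\<lambda>i. zsum_star (Suc i) (replicate u 1) * zsum i ls / real (Suc i) ^ k) sums D u"
proof -
  define f where "f i u = zsum_star (Suc i) (replicate u 1) * zsum i ls / real (Suc i) ^ k" for i u
  have ton: "summable (\<lambda>i. f i u * x ^ u)" "(\<lambda>u. \<Sum>i. f i u * x ^ u) sums M x" if x: "0 < x" "x < 1" for x u
  proof -
    have nn: "0 \<le> f i u * x ^ u" for i u
      unfolding f_def using x by (intro mult_nonneg_nonneg divide_nonneg_nonneg zsum_nonneg zsum_star_nonneg) auto
    have rows: "(\<lambda>u. f i u * x ^ u) sums (connector (-x) (Suc i) * zsum i ls / real (Suc i) ^ k)" for i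
      using sums_mult2[OF connector_expansion[of x "Suc i"], of "zsum i ls / real (Suc i) ^ k"] x by (simp add: f_def mult_ac)
    from tonelli_sums[OF nn rows M[OF x, unfolded connected_sums_def]]
    show "summable (\<lambda>i. f i u * x ^ u)" "(\<lambda>u. \<Sum>i. f i u * x ^ u) sums M x" by simp_all
  qed
  \<comment> \<open>Convergence at the point x = 1/2, rescaled to remove the power of x.\<close>
  have sm: "summable (\<lambda>i. f i u)" for u
  proof -
    have "summable (\<lambda>i. f i u * (1 / 2) ^ u * 2 ^ u)" by (intro summable_mult2 ton(1)) auto
    then show ?thesis by (simp add: power_divide)
  qed
  have "(\<Sum>i. f i u) = D u" for u
  proof (rule powser_unique_right[OF _ D])
    fix x :: real assume x: "0 < x" "x < 1"
    have "(\<Sum>i. f i u * x ^ u) = (\<Sum>i. f i u) * x ^ u" for u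
      by (rule suminf_mult2[OF sm, symmetric])
    then show "(\<lambda>u. (\<Sum>i. f i u) * x ^ u) sums M x" using ton(2)[OF x] by simp
  qed
  then show ?thesis using summable_sums[OF sm[of u]] by (simp add: f_def[abs_def])
qed

lemma ohno_1:
  "(\<lambda>i. zsum_star (Suc i) (replicate u 1) * zsum i (replicate v 1) / real (Suc i) ^ 2)
     sums (real ((v + 1 + u) choose u) * mzv [v + 2 + u])"
proof (rule ohno_coefficients[where M = "\<lambda>x. rho (v + 2) (-x)" and D = "\<lambda>u. real ((v + 1 + u) choose u) * mzv [v + 2 + u]"])
  fix x :: real assume x: "0 < x" "x < 1"
  show "connected_sums (-x) 2 (replicate v 1) (rho (v + 2) (-x))"
    by (rule connected_sums_rho) (use x in simp)
  let ?f = "\<lambda>t u. real ((v + 1 + u) choose u) / real (Suc t) ^ (Suc (v + 1) + u) * x ^ u"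
  have rows: "?f t sums (1 / (real (Suc t) - x) ^ Suc (v + 1))" for t
    by (rule negative_binomial_sums) (use x in auto)
  have g: "(\<lambda>t. 1 / (real (Suc t) - x) ^ Suc (v + 1)) sums rho (v + 2) (-x)"
  proof -
    have "- x + 1 + real t = real (Suc t) - x" "v + 2 = Suc (v + 1)" for t by simp_all
    then show ?thesis using rho_sums[of "v + 2" "-x"] x by (simp only:)
  qed
  have "(\<lambda>u. \<Sum>t. ?f t u) sums rho (v + 2) (-x)"
    by (rule tonelli_sums(2)[OF _ rows g]) (use x in simp)
  moreover have "(\<Sum>t. ?f t u) = real ((v + 1 + u) choose u) * mzv [v + 2 + u] * x ^ u" for u
  proof -
    have "(\<lambda>t. real ((v + 1 + u) choose u) * x ^ u * (1 / real (Suc t) ^ (v + 2 + u))) sums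
        (real ((v + 1 + u) choose u) * x ^ u * mzv [v + 2 + u])"
      by (intro sums_mult mzv_single_sums) simp
    moreover have "real ((v + 1 + u) choose u) * x ^ u * (1 / real (Suc t) ^ (v + 2 + u)) = ?f t u" for t
    proof -
      have "v + 2 + u = Suc (v + 1) + u" by simp
      then show ?thesis by (simp only: times_divide_eq_right times_divide_eq_left mult_1_right)
    qed
    ultimately have "(\<lambda>t. ?f t u) sums (real ((v + 1 + u) choose u) * x ^ u * mzv [v + 2 + u])" by (simp only:)
    then show ?thesis by (simp only: sums_iff mult_ac)
  qed
  ultimately show "(\<lambda>u. real ((v + 1 + u) choose u) * mzv [v + 2 + u] * x ^ u) sums rho (v + 2) (-x)" by simp
qed

text \<open>The coefficient of x^u in \<open>sigma_sum (Suc a) (Suc b) (-x)\<close>, obtained by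
  expanding both shifted variables with the negative binomial series. The shape is that of Ohno's
  relation.\<close>

definition ohno_value :: "nat \<Rightarrow> nat \<Rightarrow> nat \<Rightarrow> real" where
  "ohno_value u a b = (\<Sum>i\<le>u. real ((a + i) choose i) * real ((b + (u - i)) choose (u - i)) * mzv [Suc b + (u - i), Suc a + i])"

lemma sigma_sum_expansion:
  assumes x: "0 < x" "x < 1" and b: "1 \<le> b"
  shows "(\<lambda>u. ohno_value u a b * x ^ u) sums sigma_sum (Suc a) (Suc b) (-x)"
proof -
  define F where "F c n u = real ((c + u) choose u) / real n ^ (Suc c + u)" for c n u
  define Q where "Q = (\<lambda>(t, t') u. \<Sum>i\<le>u. F a (Suc t) i * F b (Suc (Suc (t + t'))) (u - i))"
  define P where "P = (\<lambda>(t, t'). 1 / (real (Suc t) - x) ^ Suc a * (1 / (real (Suc (Suc (t + t'))) - x) ^ Suc b))"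
  have F0: "0 \<le> F c n u" for c n u by (simp add: F_def)
  have Fs: "(\<lambda>u. F c (Suc n) u * x ^ u) sums (1 / (real (Suc n) - x) ^ Suc c)" for c n
    unfolding F_def by (rule negative_binomial_sums) (use x in auto)
  have rows: "((\<lambda>u. Q tt u * x ^ u) has_sum P tt) UNIV" for tt
  proof (rule sums_nonneg_imp_has_sum)
    obtain t t' where tt: "tt = (t, t')" by force
    show "0 \<le> Q tt u * x ^ u" for u using F0 x by (auto simp: Q_def tt intro!: mult_nonneg_nonneg sum_nonneg)
    let ?a = "\<lambda>u. F a (Suc t) u * x ^ u" and ?b = "\<lambda>u. F b (Suc (Suc (t + t'))) u * x ^ u"
    have "(\<lambda>k. \<Sum>i\<le>k. ?a i * ?b (k - i)) sums (suminf ?a * suminf ?b)"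
      by (rule Cauchy_product_sums) (use F0 x Fs in \<open>auto simp: sums_iff\<close>)
    moreover have "(\<Sum>i\<le>k. ?a i * ?b (k - i)) = Q tt k * x ^ k" for k
    proof -
      have "?a i * ?b (k - i) = F a (Suc t) i * F b (Suc (Suc (t + t'))) (k - i) * x ^ k" if "i \<le> k" for i
      proof -
        have "x ^ i * x ^ (k - i) = x ^ k" using that by (simp flip: power_add)
        then have "F a (Suc t) i * F b (Suc (Suc (t + t'))) (k - i) * x ^ k =
            F a (Suc t) i * F b (Suc (Suc (t + t'))) (k - i) * (x ^ i * x ^ (k - i))" by (simp only:)
        then show ?thesis by (simp only: mult_ac)
      qed
      then have "(\<Sum>i\<le>k. ?a i * ?b (k - i)) = (\<Sum>i\<le>k. F a (Suc t) i * F b (Suc (Suc (t + t'))) (k - i) * x ^ k)"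
        by (intro sum.cong) auto
      then show ?thesis by (simp only: Q_def tt prod.case sum_distrib_right)
    qed
    moreover have "suminf ?a * suminf ?b = P tt"
      using Fs[of a t] Fs[of b "Suc (t + t')"] by (simp add: P_def tt sums_iff)
    ultimately show "(\<lambda>u. Q tt u * x ^ u) sums P tt" by simp
  qed
  have g: "(P has_sum sigma_sum (Suc a) (Suc b) (-x)) UNIV"
  proof -
    have inner: "((\<lambda>t'. P (t, t')) has_sum (rho (Suc b) (- x + 1 + real t) / (- x + 1 + real t) ^ Suc a)) UNIV" for t
    proof (rule sums_nonneg_imp_has_sum)
      have "(\<lambda>t'. 1 / (- x + 1 + real t) ^ Suc a * (1 / (- x + 1 + real t + 1 + real t') ^ Suc b)) sums
          (1 / (- x + 1 + real t) ^ Suc a * rho (Suc b) (- x + 1 + real t))"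
        by (intro sums_mult rho_sums) (use x b in auto)
      then show "(\<lambda>t'. P (t, t')) sums (rho (Suc b) (- x + 1 + real t) / (- x + 1 + real t) ^ Suc a)"
        by (simp add: P_def algebra_simps)
      show "0 \<le> P (t, t')" for t' using x by (simp add: P_def)
    qed
    have outer: "((\<lambda>t. rho (Suc b) (- x + 1 + real t) / (- x + 1 + real t) ^ Suc a) has_sum sigma_sum (Suc a) (Suc b) (-x)) UNIV"
      by (rule sums_nonneg_imp_has_sum[OF sigma_sum_sums]) (use x b rho_bound(1) in auto)
    have sm: "P summable_on UNIV \<times> UNIV"
      by (rule summable_on_SigmaI[OF inner]) (use outer x in \<open>auto simp: summable_on_def P_def\<close>)
    then have "(P has_sum sigma_sum (Suc a) (Suc b) (-x)) (UNIV \<times> UNIV)"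
      by (rule has_sum_SigmaI[OF inner outer])
    then show ?thesis by simp
  qed
  have "((\<lambda>u. infsum (\<lambda>tt. Q tt u * x ^ u) UNIV) has_sum sigma_sum (Suc a) (Suc b) (-x)) UNIV"
    by (rule tonelli_has_sum(2)[OF _ rows g]) (use F0 x in \<open>auto simp: Q_def intro!: mult_nonneg_nonneg sum_nonneg\<close>)
  moreover have "infsum (\<lambda>tt. Q tt u * x ^ u) UNIV = ohno_value u a b * x ^ u" for u
  proof (rule infsumI)
    have "((\<lambda>tt. \<Sum>i\<le>u. real ((a + i) choose i) * real ((b + (u - i)) choose (u - i)) *
        (case tt of (t, t') \<Rightarrow> 1 / real (Suc t) ^ (Suc a + i) * (1 / real (Suc (Suc (t + t'))) ^ (Suc b + (u - i))))) has_sum ohno_value u a b) UNIV"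
      unfolding ohno_value_def by (intro has_sum_finite_sum has_sum_cmult_right mzv_double_has_sum) (use b in auto)
    then have "((\<lambda>tt. Q tt u) has_sum ohno_value u a b) UNIV"
      by (simp add: Q_def F_def case_prod_unfold)
    then show "((\<lambda>tt. Q tt u * x ^ u) has_sum ohno_value u a b * x ^ u) UNIV"
      by (rule has_sum_cmult_left)
  qed
  ultimately show ?thesis by (auto dest: has_sum_imp_sums)
qed

lemma ohno_2:
  "(\<lambda>i. zsum_star (Suc i) (replicate u 1) * zsum i (replicate v 1 @ 2 # replicate w 1) / real (Suc i) ^ 2)
     sums ohno_value u (v + 1) (w + 1)"
proof (rule ohno_coefficients[where M = "\<lambda>x. sigma_sum (v + 2) (w + 2) (-x)" and D = "\<lambda>u. ohno_value u (v + 1) (w + 1)"])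
  fix x :: real assume x: "0 < x" "x < 1"
  show "connected_sums (-x) 2 (replicate v 1 @ 2 # replicate w 1) (sigma_sum (v + 2) (w + 2) (-x))"
    by (rule connected_sums_sigma2) (use x in simp)
  show "(\<lambda>u. ohno_value u (v + 1) (w + 1) * x ^ u) sums sigma_sum (v + 2) (w + 2) (-x)"
    using sigma_sum_expansion[OF x, of "w + 1" "v + 1"] by (simp only: Suc_eq_plus1 add.assoc one_add_one)
qed

lemma ohno_3:
  "(\<lambda>i. zsum_star (Suc i) (replicate u 1) * zsum i (replicate w 1) / real (Suc i) ^ 3) sums ohno_value u 0 (w + 1)"
proof (rule ohno_coefficients[where M = "\<lambda>x. sigma_sum 1 (w + 2) (-x)" and D = "\<lambda>u. ohno_value u 0 (w + 1)"])
  fix x :: real assume x: "0 < x" "x < 1"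
  show "connected_sums (-x) 3 (replicate w 1) (sigma_sum 1 (w + 2) (-x))"
    by (rule connected_sums_sigma3) (use x in simp)
  show "(\<lambda>u. ohno_value u 0 (w + 1) * x ^ u) sums sigma_sum 1 (w + 2) (-x)"
    using sigma_sum_expansion[OF x, of "w + 1" 0] by (simp add: One_nat_def)
qed

section \<open>Double zeta values modulo \<open>\<zeta>(2)\<close>\<close>

lemma stuffle_index: "is_index ks \<Longrightarrow> is_index ls \<Longrightarrow> c \<in> set (stuffle ks ls) \<Longrightarrow> is_index c"
proof (induction ks ls arbitrary: c rule: stuffle.induct)
  case (3 k ks l ls)
  from 3(6) consider (A) d where "c = k # d" "d \<in> set (stuffle ks (l # ls))" | (B) d where "c = l # d" "d \<in> set (stuffle (k # ks) ls)"
    | (C) d where "c = (k + l) # d" "d \<in> set (stuffle ks ls)" by auto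
  then show ?case
  proof cases
    case A
    show ?thesis using 3(1)[OF _ 3(5) A(2)] 3(4,5) A(1) by (simp add: is_index_def)
  next
    case B
    show ?thesis using 3(2)[OF 3(4) _ B(2)] 3(4,5) B(1) by (simp add: is_index_def)
  next
    case C
    show ?thesis using 3(3)[OF _ _ C(2)] 3(4,5) C(1) by (simp add: is_index_def)
  qed
qed simp_all

lemma stuffle_admissible:
  assumes "admissible ks" "admissible ls" "c \<in> set (stuffle ks ls)"
  shows "admissible c"
proof -
  have "c = [] \<or> 2 \<le> hd c"
    using assms by (cases "(ks, ls)" rule: stuffle.cases) (auto simp: admissible_def)
  then show ?thesis using assms stuffle_index[of ks ls c] by (simp add: admissible_def)
qed

lemma mzv_mult:
  assumes "admissible ks" "admissible ls"
  shows "mzv ks * mzv ls = sum_list (map mzv (stuffle ks ls))"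
proof (rule LIMSEQ_unique)
  show "(\<lambda>n. zsum n ks * zsum n ls) \<longlonglongrightarrow> mzv ks * mzv ls"
    by (intro tendsto_mult mzv_has_sum(2) assms)
  show "(\<lambda>n. zsum n ks * zsum n ls) \<longlonglongrightarrow> sum_list (map mzv (stuffle ks ls))"
    unfolding mhs_stuffle by (intro tendsto_sum_list mzv_has_sum(2) stuffle_admissible[OF assms])
qed

section \<open>The algebra of multiple zeta values and the ideal of zeta(2)\<close>

lemma mzv_space_mzv: "admissible ks \<Longrightarrow> mzv ks \<in> mzv_space"
  unfolding mzv_space_def by (rule rat_real.span_base) auto

lemma mzv_Nil: "mzv [] = 1"
  using LIMSEQ_unique[OF mzv_has_sum(2)[of "[]"], of 1] by (simp add: admissible_def is_index_def)

lemma mzv_space_sum_list: "(\<And>x. x \<in> set xs \<Longrightarrow> f x \<in> mzv_space) \<Longrightarrow> sum_list (map f xs) \<in> mzv_space"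
  by (induction xs) (auto intro: mzv_space_0 mzv_space_add)

lemma mzv_space_sum: "(\<And>x. x \<in> A \<Longrightarrow> f x \<in> mzv_space) \<Longrightarrow> sum f A \<in> mzv_space"
  by (induction A rule: infinite_finite_induct) (auto intro: mzv_space_0 mzv_space_add)

lemma mzv_space_mult:
  assumes "x \<in> mzv_space" "y \<in> mzv_space"
  shows "x * y \<in> mzv_space"
proof -
  have *: "mzv ks * y \<in> mzv_space" if ks: "admissible ks" for ks
    using assms(2) unfolding mzv_space_def
  proof (induction rule: rat_real.span_induct_alt)
    case base
    then show ?case using mzv_space_0 by (simp add: mzv_space_def)
  next
    case (step c u v)
    then obtain ls where ls: "admissible ls" "u = mzv ls" by auto
    have "mzv ks * u \<in> mzv_space"
      unfolding ls mzv_mult[OF ks ls(1)]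
      by (intro mzv_space_sum_list mzv_space_mzv stuffle_admissible[OF ks ls(1)])
    then have "of_rat c * (mzv ks * u) + mzv ks * v \<in> mzv_space"
      using step by (intro mzv_space_add mzv_space_scale) (simp_all add: mzv_space_def)
    then show ?case by (simp add: mzv_space_def algebra_simps)
  qed
  show ?thesis
    using assms(1) unfolding mzv_space_def
  proof (induction rule: rat_real.span_induct_alt)
    case base
    then show ?case using mzv_space_0 by (simp add: mzv_space_def)
  next
    case (step c u v)
    then obtain ls where ls: "admissible ls" "u = mzv ls" by auto
    have "of_rat c * (u * y) + v * y \<in> mzv_space"
      using step *[OF ls(1)] ls by (intro mzv_space_add mzv_space_scale) (simp_all add: mzv_space_def)
    then show ?case by (simp add: mzv_space_def algebra_simps)
  qed
qed

lemma mzv_space_rat: "of_rat q \<in> mzv_space"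
  using mzv_space_scale[OF mzv_space_mzv[of "[]"], of q] by (simp add: mzv_Nil admissible_def is_index_def)

definition zeta2_ideal :: "real set" where
  "zeta2_ideal = (\<lambda>z. mzv [2] * z) ` mzv_space"

lemma zeta2_ideal_subset: "x \<in> zeta2_ideal \<Longrightarrow> x \<in> mzv_space"
  by (auto simp: zeta2_ideal_def admissible_def is_index_def intro!: mzv_space_mult mzv_space_mzv)

lemma zeta2_ideal_0: "0 \<in> zeta2_ideal"
  using mzv_space_0 by (force simp: zeta2_ideal_def)

lemma zeta2_ideal_add: "x \<in> zeta2_ideal \<Longrightarrow> y \<in> zeta2_ideal \<Longrightarrow> x + y \<in> zeta2_ideal"
  by (auto simp: zeta2_ideal_def image_iff intro: mzv_space_add simp flip: distrib_left)

lemma zeta2_ideal_mult: "x \<in> zeta2_ideal \<Longrightarrow> y \<in> mzv_space \<Longrightarrow> x * y \<in> zeta2_ideal"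
  by (auto simp: zeta2_ideal_def image_iff mult.assoc intro: mzv_space_mult)

lemma zeta2_ideal_mult': "x \<in> zeta2_ideal \<Longrightarrow> y \<in> mzv_space \<Longrightarrow> y * x \<in> zeta2_ideal"
  using zeta2_ideal_mult[of x y] by (simp add: mult.commute)

lemma zeta2_ideal_scale: "x \<in> zeta2_ideal \<Longrightarrow> of_rat q * x \<in> zeta2_ideal"
  by (intro zeta2_ideal_mult' mzv_space_rat)

lemma zeta2_ideal_scale_int: "x \<in> zeta2_ideal \<Longrightarrow> of_int q * x \<in> zeta2_ideal"
  using zeta2_ideal_scale[of x "of_int q"] by simp

lemma zeta2_ideal_uminus: "x \<in> zeta2_ideal \<Longrightarrow> - x \<in> zeta2_ideal"
  using zeta2_ideal_scale_int[of x "-1"] by simp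

lemma zeta2_ideal_diff: "x \<in> zeta2_ideal \<Longrightarrow> y \<in> zeta2_ideal \<Longrightarrow> x - y \<in> zeta2_ideal"
  using zeta2_ideal_add[OF _ zeta2_ideal_uminus, of x y] by simp

lemma zeta2_ideal_sum: "(\<And>x. x \<in> A \<Longrightarrow> f x \<in> zeta2_ideal) \<Longrightarrow> sum f A \<in> zeta2_ideal"
  by (induction A rule: infinite_finite_induct) (auto intro: zeta2_ideal_0 zeta2_ideal_add)

lemma zeta2_ideal_cancel_int:
  assumes "of_int m * x \<in> zeta2_ideal" "m \<noteq> 0"
  shows "x \<in> zeta2_ideal"
  using zeta2_ideal_scale[OF assms(1), of "1 / of_int m"] assms(2) by (simp add: of_rat_divide)

lemma zeta2_ideal_zeta2: "mzv [2] \<in> zeta2_ideal"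
  using mzv_space_rat[of 1] by (force simp: zeta2_ideal_def)

text \<open>A polynomial with values in the ideal has coefficients in it: \<open>p(2t) - 2\<^sup>n p(t)\<close> has lower degree.\<close>

lemma zeta2_ideal_coefficients:
  assumes "\<And>t::nat. 1 \<le> t \<Longrightarrow> (\<Sum>i\<le>n. c i * real t ^ i) \<in> zeta2_ideal" "i \<le> n"
  shows "c i \<in> zeta2_ideal"
  using assms
proof (induction n arbitrary: c i)
  case 0
  show ?case using 0(1)[of 1] 0(2) by simp
next
  case (Suc n)
  have low: "c i \<in> zeta2_ideal" if i: "i \<le> n" for i
  proof -
    have "of_int (2 ^ i - 2 ^ Suc n) * c i \<in> zeta2_ideal"
    proof (rule Suc.IH[OF _ i])
      fix t :: nat assume t: "1 \<le> t"
      have "(\<Sum>i\<le>Suc n. c i * real (2 * t) ^ i) - of_int (2 ^ Suc n) * (\<Sum>i\<le>Suc n. c i * real t ^ i) \<in> zeta2_ideal"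
        using t by (intro zeta2_ideal_diff zeta2_ideal_scale_int Suc.prems) auto
      also have "(\<Sum>i\<le>Suc n. c i * real (2 * t) ^ i) - of_int (2 ^ Suc n) * (\<Sum>i\<le>Suc n. c i * real t ^ i) =
          (\<Sum>i\<le>Suc n. of_int (2 ^ i - 2 ^ Suc n) * c i * real t ^ i)"
          unfolding sum_distrib_left sum_subtractf[symmetric]
          by (intro sum.cong refl) (simp only: of_nat_mult power_mult_distrib of_int_diff of_int_power of_int_numeral of_nat_numeral left_diff_distrib right_diff_distrib mult_ac)
      also have "\<dots> = (\<Sum>i\<le>n. of_int (2 ^ i - 2 ^ Suc n) * c i * real t ^ i)" by simp
      finally show "(\<Sum>i\<le>n. of_int (2 ^ i - 2 ^ Suc n) * c i * real t ^ i) \<in> zeta2_ideal" .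
    qed
    moreover have "(2::int) ^ i - 2 ^ Suc n \<noteq> 0"
      using i power_strict_increasing[of i "Suc n" "2::int"] by simp
    ultimately show ?thesis by (rule zeta2_ideal_cancel_int)
  qed
  show ?case
  proof (cases "i = Suc n")
    case True
    have "(\<Sum>i\<le>Suc n. c i * real 1 ^ i) - (\<Sum>i\<le>n. c i) \<in> zeta2_ideal"
      using low by (intro zeta2_ideal_diff zeta2_ideal_sum Suc.prems) auto
    then show ?thesis using True by simp
  qed (use low Suc.prems in auto)
qed

section \<open>Double shuffle relations as polynomial identities\<close>

definition complete_hom :: "nat \<Rightarrow> real \<Rightarrow> real \<Rightarrow> real" where
  "complete_hom n x y = (\<Sum>i\<le>n. x ^ i * y ^ (n - i))"

lemma complete_hom_diff: "complete_hom n x y * (x - y) = x ^ Suc n - y ^ Suc n"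
  using power_diff_sumr2[of x "Suc n" y] by (simp add: complete_hom_def lessThan_Suc_atMost mult_ac)

lemma complete_hom_diag: "complete_hom n x x = real (Suc n) * x ^ n"
  by (simp add: complete_hom_def flip: power_add)

text \<open>Partial fractions of 1 / (m^a n^b) for all a + b = N + 2 at once, with the exponents
  recorded in the variables x and y.\<close>

lemma complete_hom_partial_fraction:
  fixes m n :: real
  assumes "0 < m" "0 < n"
  shows "complete_hom N (x / m) (y / n) / (m * n) =
    complete_hom N ((x + y) / (m + n)) (y / n) / ((m + n) * n) + complete_hom N ((x + y) / (m + n)) (x / m) / ((m + n) * m)"
proof -
  define A B C where "A = x / m" and "B = y / n" and "C = (x + y) / (m + n)"
  have s: "m + n \<noteq> 0" using assms by simp
  have xy: "x = m * A" "y = n * B" using assms by (simp_all add: A_def B_def)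
  have sC: "(m + n) * C = m * A + n * B" using s by (simp add: C_def xy[symmetric])
  \<comment> \<open>C is the mean of A and B with weights m and n. Hence C - A and C - B are
    proportional to A - B, and the identity becomes one between differences of (N+1)-st
    powers.\<close>
  have "complete_hom N A B * (m + n) = complete_hom N C B * m + complete_hom N C A * n"
  proof (cases "A = B")
    case True
    then have "(m + n) * (C - A) = 0" using sC by (simp add: algebra_simps)
    then have "C = A" using s by simp
    then show ?thesis using True by (simp add: algebra_simps)
  next
    case False
    have CB: "m * (A - B) = (C - B) * (m + n)" and CA: "n * (B - A) = (C - A) * (m + n)"
      using sC by (simp_all add: algebra_simps)
    have "complete_hom N C B * m * (A - B) = complete_hom N C B * (C - B) * (m + n)"
      using CB by (simp only: mult.assoc)
    then have 1: "complete_hom N C B * m * (A - B) = (C ^ Suc N - B ^ Suc N) * (m + n)"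
      by (simp only: complete_hom_diff)
    have "complete_hom N C A * n * (B - A) = complete_hom N C A * (C - A) * (m + n)"
      using CA by (simp only: mult.assoc)
    then have 2: "complete_hom N C A * n * (B - A) = (C ^ Suc N - A ^ Suc N) * (m + n)"
      by (simp only: complete_hom_diff)
    have "(complete_hom N A B * (m + n)) * (A - B) = (A ^ Suc N - B ^ Suc N) * (m + n)"
      unfolding complete_hom_diff[of N A B, symmetric] by (simp only: mult_ac)
    also have "\<dots> = complete_hom N C B * m * (A - B) - complete_hom N C A * n * (B - A)"
      unfolding 1 2 by (simp add: algebra_simps)
    also have "\<dots> = (complete_hom N C B * m + complete_hom N C A * n) * (A - B)"
      by (simp add: algebra_simps)
    finally show ?thesis using False by simp
  qed
  then show ?thesis
    unfolding A_def[symmetric] B_def[symmetric] C_def[symmetric] using assms s by (simp add: divide_simps mult_ac)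
qed

lemma has_sum_times:
  fixes f :: "'a \<Rightarrow> real" and g :: "'b \<Rightarrow> real"
  assumes "(f has_sum a) UNIV" "(g has_sum b) UNIV" "\<And>x. 0 \<le> f x" "\<And>y. 0 \<le> g y"
  shows "((\<lambda>(x, y). f x * g y) has_sum (a * b)) UNIV"
proof -
  have i: "((\<lambda>y. f x * g y) has_sum (f x * b)) UNIV" for x
    by (intro has_sum_cmult_right assms)
  have o: "((\<lambda>x. f x * b) has_sum (a * b)) UNIV"
    by (intro has_sum_cmult_left assms)
  have "(\<lambda>(x, y). f x * g y) summable_on UNIV \<times> UNIV"
    by (rule summable_on_SigmaI[where g = "\<lambda>x. f x * b"]) (use i o assms in \<open>auto simp: summable_on_def\<close>)
  then have "((\<lambda>(x, y). f x * g y) has_sum (a * b)) (UNIV \<times> UNIV)"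
    by (intro has_sum_SigmaI[OF _ o]) (use i in auto)
  then show ?thesis by simp
qed

lemma harmonic_telescope: "(\<lambda>t. 1 / real (Suc t) - 1 / (real (Suc t) + real N)) sums zsum N [1]"
proof (induction N)
  case 0
  then show ?case by (simp add: zsum_0)
next
  case (Suc N)
  have "(\<lambda>t. 1 / (real t + real N + 1)) \<longlonglongrightarrow> 0" by real_asymp
  from telescope_sums'[OF this]
  have "(\<lambda>t. 1 / (real t + real N + 1) - 1 / (real (Suc t) + real N + 1)) sums (1 / (real N + 1))" by simp
  from sums_add[OF Suc this] show ?case
    unfolding zsum_Suc by (simp add: add_ac)
qed

text \<open>A Tornheim sum. It is the convergent remainder of the divergent boundary terms in the
  partial fraction identity; the sum over the second variable telescopes to a harmonic
  number.\<close>

lemma tornheim_boundary_has_sum: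
  assumes "1 \<le> n"
  shows "((\<lambda>(t, t'). 1 / (real (Suc t) ^ n * real (Suc t') * real (Suc (Suc (t + t'))))) has_sum (mzv [Suc n, 1] + mzv [Suc (Suc n)])) UNIV"
proof -
  let ?f = "\<lambda>(t, t'). 1 / (real (Suc t) ^ n * real (Suc t') * real (Suc (Suc (t + t'))))"
  let ?g = "\<lambda>t. zsum (Suc t) [1] / real (Suc t) ^ Suc n"
  have inner: "((\<lambda>t'. ?f (t, t')) has_sum ?g t) UNIV" for t
  proof (rule sums_nonneg_imp_has_sum)
    have "(\<lambda>t'. (1 / real (Suc t') - 1 / (real (Suc t') + real (Suc t))) * (1 / real (Suc t) ^ Suc n)) sums (zsum (Suc t) [1] * (1 / real (Suc t) ^ Suc n))"
      by (intro sums_mult2 harmonic_telescope)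
    moreover have "(1 / real (Suc t') - 1 / (real (Suc t') + real (Suc t))) * (1 / real (Suc t) ^ Suc n) = ?f (t, t')" for t'
    proof -
      define a b where "a = real (Suc t)" and "b = real (Suc t')"
      have ab: "a > 0" "b > 0" "real (Suc (Suc (t + t'))) = b + a" by (simp_all add: a_def b_def)
      have "(1 / b - 1 / (b + a)) * (1 / a ^ Suc n) = 1 / (a ^ n * b * (b + a))"
        using ab by (simp add: divide_simps)
      then show ?thesis unfolding prod.case ab(3) a_def b_def .
    qed
    ultimately show "(\<lambda>t'. ?f (t, t')) sums ?g t" by simp
  qed simp
  have outer: "(?g has_sum (mzv [Suc n, 1] + mzv [Suc (Suc n)])) UNIV"
  proof (rule sums_nonneg_imp_has_sum)
    have "(\<lambda>N. zsum N [Suc n, 1] + zsum N [Suc (Suc n)]) \<longlonglongrightarrow> mzv [Suc n, 1] + mzv [Suc (Suc n)]"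
      by (intro tendsto_add mzv_has_sum(2)) (use assms in \<open>auto simp: admissible_def is_index_def\<close>)
    moreover have "zsum N [Suc n, 1] + zsum N [Suc (Suc n)] = (\<Sum>t<N. ?g t)" for N
    proof -
      have "zsum N [Suc n, 1] + zsum N [Suc (Suc n)] = (\<Sum>t<N. zsum t [1] / real (Suc t) ^ Suc n + 1 / real (Suc t) ^ Suc (Suc n))"
        unfolding zsum_Cons[of N "Suc n"] zsum_Cons[of N "Suc (Suc n)"] by (simp add: sum.distrib)
      also have "\<dots> = (\<Sum>t<N. ?g t)"
        by (intro sum.cong refl) (simp add: zsum_Suc add_divide_distrib mult_ac del: of_nat_Suc)
      finally show ?thesis .
    qed
    ultimately show "?g sums (mzv [Suc n, 1] + mzv [Suc (Suc n)])" by (simp add: sums_def)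
  qed (intro divide_nonneg_nonneg zsum_nonneg; simp)
  have "?f summable_on UNIV \<times> UNIV"
    by (rule summable_on_SigmaI[OF inner]) (use outer in \<open>auto simp: summable_on_def\<close>)
  from has_sum_SigmaI[OF inner outer this] show ?thesis by simp
qed

text \<open>The value at \<open>a = 1\<close> is the one for which the stuffle and shuffle relations below extend to
  \<open>\<zeta>(1) = 0\<close>.\<close>

definition double_zeta :: "nat \<Rightarrow> nat \<Rightarrow> real" where
  "double_zeta a b = (if a = 1 then - mzv [b, 1] - mzv [Suc b] else mzv [a, b])"

definition double_poly :: "nat \<Rightarrow> real \<Rightarrow> real \<Rightarrow> real" where
  "double_poly n x y = (\<Sum>i\<le>n. double_zeta (Suc i) (Suc (n - i)) * (x ^ i * y ^ (n - i)))"

definition single_zeta :: "nat \<Rightarrow> real" where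
  "single_zeta k = (if k = 1 then 0 else mzv [k])"

definition single_poly :: "nat \<Rightarrow> real \<Rightarrow> real \<Rightarrow> real" where
  "single_poly n x y = (\<Sum>i\<le>n. single_zeta (Suc i) * single_zeta (Suc (n - i)) * (x ^ i * y ^ (n - i)))"

lemma sum_atMost_flip: "(\<Sum>i\<le>n. f i (n - i)) = (\<Sum>i\<le>n. f (n - i) (i::nat))"
  by (rule sum.reindex_bij_witness[of _ "\<lambda>i. n - i" "\<lambda>i. n - i"]) auto

text \<open>For 0 < i < n this is the stuffle product; at the two ends it is the convention for
  \<open>double_zeta\<close> at 1 together with zeta(1) = 0.\<close>

lemma double_poly_stuffle:
  assumes "1 \<le> n"
  shows "double_poly n x y + double_poly n y x + mzv [n + 2] * complete_hom n x y = single_poly n x y"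
proof -
  have y: "double_poly n y x = (\<Sum>i\<le>n. double_zeta (Suc (n - i)) (Suc i) * (x ^ i * y ^ (n - i)))"
    unfolding double_poly_def by (subst sum_atMost_flip) (auto intro!: sum.cong simp: mult_ac)
  have st: "double_zeta (Suc i) (Suc (n - i)) + double_zeta (Suc (n - i)) (Suc i) + mzv [n + 2] = single_zeta (Suc i) * single_zeta (Suc (n - i))"
    if i: "i \<le> n" for i
  proof -
    consider "i = 0" | "i = n" | "0 < i" "i < n" using i by linarith
    then show ?thesis
    proof cases
      case 3
      then show ?thesis using mzv_mult[of "[Suc i]" "[Suc (n - i)]"]
        by (simp add: double_zeta_def single_zeta_def admissible_def is_index_def)
    qed (use assms in \<open>auto simp: double_zeta_def single_zeta_def One_nat_def\<close>)
  qed
  have "double_poly n x y + double_poly n y x + mzv [n + 2] * complete_hom n x y =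
    (\<Sum>i\<le>n. (double_zeta (Suc i) (Suc (n - i)) + double_zeta (Suc (n - i)) (Suc i) + mzv [n + 2]) * (x ^ i * y ^ (n - i)))"
    unfolding y unfolding double_poly_def complete_hom_def by (simp only: sum_distrib_left sum.distrib distrib_right)
  also have "\<dots> = single_poly n x y"
    unfolding single_poly_def by (intro sum.cong refl) (simp only: atMost_iff st)
  finally show ?thesis .
qed

text \<open>Sum the partial fraction identity over all pairs of positive integers. The terms with an
  exponent 1 at the larger variable, and those with a factor zeta(1), diverge one by one, so they
  are moved to one side before summing.\<close>

lemma double_poly_shuffle:
  assumes n: "1 \<le> n"
  shows "double_poly n (x + y) y + double_poly n (x + y) x = single_poly n x y"
proof -
  define T where "T q p = (\<lambda>(t, t'). 1 / real (Suc t) ^ p * (1 / real (Suc (Suc (t + t'))) ^ q))" for q p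
  define B where "B u tt = (\<Sum>i\<in>{1..n}. (x + y) ^ i * u ^ (n - i) * T (Suc i) (Suc (n - i)) tt)" for u tt
  define V where "V u = (\<Sum>i\<in>{1..n}. (x + y) ^ i * u ^ (n - i) * mzv [Suc i, Suc (n - i)])" for u
  define E where "E = (\<lambda>(t, t'). 1 / (real (Suc t) ^ n * real (Suc t') * real (Suc (Suc (t + t')))))"
  define e where "e = mzv [Suc n, 1] + mzv [Suc (Suc n)]"
  \<comment> \<open>The convergent part of one summand on the right: the terms i >= 1 minus the
    regrouped boundary term \<open>E\<close>, whose sum \<open>e\<close> is minus the conventional
    value of \<open>double_zeta 1 (Suc n)\<close>.\<close>
  define H where "H u tt = B u tt - u ^ n * E tt" for u tt
  define A where "A = (\<lambda>(t, t'). \<Sum>i\<in>{1..<n}. x ^ i * y ^ (n - i) * (1 / real (Suc t') ^ Suc i * (1 / real (Suc t) ^ Suc (n - i))))"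
  have H: "(H u has_sum (V u - u ^ n * e)) UNIV" for u
  proof -
    have "(B u has_sum V u) UNIV"
      unfolding B_def[abs_def] V_def T_def by (intro has_sum_finite_sum has_sum_cmult_right mzv_double_has_sum) auto
    moreover have "((\<lambda>tt. - (u ^ n) * E tt) has_sum (- (u ^ n) * e)) UNIV"
      unfolding E_def e_def by (intro has_sum_cmult_right tornheim_boundary_has_sum n)
    ultimately show ?thesis using has_sum_add by (fastforce simp: H_def[abs_def])
  qed
  have "((\<lambda>(t, t'). H x (t', t)) has_sum (V x - x ^ n * e)) UNIV"
    using H[of x] has_sum_swap[where f = "H x" and A = UNIV and B = UNIV] by simp
  from has_sum_add[OF H[of y] this]
  have R: "((\<lambda>tt. H y tt + H x (snd tt, fst tt)) has_sum (V y - y ^ n * e + (V x - x ^ n * e))) UNIV"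
    by (simp add: case_prod_unfold)
  have one: "((\<lambda>t. 1 / real (Suc t) ^ q) has_sum mzv [q]) UNIV" if "2 \<le> q" for q
    by (rule sums_nonneg_imp_has_sum[OF mzv_single_sums[OF that]]) simp
  have "(A has_sum (\<Sum>i\<in>{1..<n}. x ^ i * y ^ (n - i) * (mzv [Suc i] * mzv [Suc (n - i)]))) UNIV"
  proof -
    have "((\<lambda>tt. \<Sum>i\<in>{1..<n}. x ^ i * y ^ (n - i) * (case tt of (t', t) \<Rightarrow> 1 / real (Suc t') ^ Suc i * (1 / real (Suc t) ^ Suc (n - i))))
       has_sum (\<Sum>i\<in>{1..<n}. x ^ i * y ^ (n - i) * (mzv [Suc i] * mzv [Suc (n - i)]))) UNIV"
      by (intro has_sum_finite_sum has_sum_cmult_right has_sum_times one) auto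
    then show ?thesis
      using has_sum_swap[where f = A and A = UNIV and B = UNIV] by (simp add: A_def case_prod_unfold)
  qed
  moreover have "(\<Sum>i\<in>{1..<n}. x ^ i * y ^ (n - i) * (mzv [Suc i] * mzv [Suc (n - i)])) = single_poly n x y"
  proof -
    have "(\<Sum>i\<in>{1..<n}. x ^ i * y ^ (n - i) * (mzv [Suc i] * mzv [Suc (n - i)])) =
       (\<Sum>i\<in>{1..<n}. single_zeta (Suc i) * single_zeta (Suc (n - i)) * (x ^ i * y ^ (n - i)))"
      by (intro sum.cong) (auto simp: single_zeta_def One_nat_def)
    also have "\<dots> = single_poly n x y"
      unfolding single_poly_def by (rule sum.mono_neutral_left) (use n in \<open>auto simp: single_zeta_def One_nat_def Suc_le_eq\<close>)
    finally show ?thesis .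
  qed
  moreover have "A tt = H y tt + H x (snd tt, fst tt)" for tt
  proof -
    obtain t t' where tt: "tt = (t, t')" by force
    define m m' where "m = real (Suc t')" and "m' = real (Suc t)"
    have m: "0 < m" "0 < m'" by (simp_all add: m_def m'_def)
    have s: "real (Suc (Suc (t + t'))) = m + m'" "real (Suc (Suc (t' + t))) = m + m'" by (simp_all add: m_def m'_def)
    have exp: "complete_hom n (a / c) (b / d) / (c * d) = (\<Sum>i\<le>n. a ^ i * b ^ (n - i) * (1 / d ^ Suc (n - i) * (1 / c ^ Suc i)))" for a b c d
      unfolding complete_hom_def by (simp add: sum_divide_distrib power_divide mult_ac)
    have set: "{..n} = insert 0 {1..n}" "{..n} = insert 0 (insert n {1..<n})" using n by auto
    have low: "complete_hom n (a / c) (b / d) / (c * d) = b ^ n / (d ^ Suc n * c) + (\<Sum>i\<in>{1..n}. a ^ i * b ^ (n - i) * (1 / d ^ Suc (n - i) * (1 / c ^ Suc i)))" for a b c d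
      unfolding exp set(1) by (simp add: mult_ac)
    have both: "complete_hom n (a / c) (b / d) / (c * d) = b ^ n / (d ^ Suc n * c) + a ^ n / (c ^ Suc n * d) + (\<Sum>i\<in>{1..<n}. a ^ i * b ^ (n - i) * (1 / d ^ Suc (n - i) * (1 / c ^ Suc i)))" for a b c d
      unfolding exp set(2) using n by (simp add: mult_ac)
    \<comment> \<open>The only place where divergent boundary terms meet: each pair differs by a
      term of a convergent Tornheim sum.\<close>
    have E1: "1 / (m' ^ Suc n * m) - 1 / (m' ^ Suc n * (m + m')) = 1 / (m' ^ n * m * (m + m'))"
      and E2: "1 / (m ^ Suc n * m') - 1 / (m ^ Suc n * (m + m')) = 1 / (m ^ n * m' * (m + m'))"
      using m by (simp_all add: divide_simps)
    have "A tt = (\<Sum>i\<in>{1..<n}. x ^ i * y ^ (n - i) * (1 / m' ^ Suc (n - i) * (1 / m ^ Suc i)))"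
      by (simp only: A_def tt prod.case m_def m'_def mult_ac)
    also have "\<dots> = complete_hom n (x / m) (y / m') / (m * m') - y ^ n / (m' ^ Suc n * m) - x ^ n / (m ^ Suc n * m')"
      unfolding both by simp
    also have "complete_hom n (x / m) (y / m') / (m * m') =
       (y ^ n / (m' ^ Suc n * (m + m')) + B y tt) + (x ^ n / (m ^ Suc n * (m + m')) + B x (snd tt, fst tt))"
      unfolding complete_hom_partial_fraction[OF m] low B_def T_def tt prod.case fst_conv snd_conv s m_def[symmetric] m'_def[symmetric] ..
    also have "(y ^ n / (m' ^ Suc n * (m + m')) + B y tt) + (x ^ n / (m ^ Suc n * (m + m')) + B x (snd tt, fst tt))
        - y ^ n / (m' ^ Suc n * m) - x ^ n / (m ^ Suc n * m') =
       (B y tt - y ^ n * (1 / (m' ^ Suc n * m) - 1 / (m' ^ Suc n * (m + m')))) +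
       (B x (snd tt, fst tt) - x ^ n * (1 / (m ^ Suc n * m') - 1 / (m ^ Suc n * (m + m'))))"
      by (simp add: right_diff_distrib)
    also have "\<dots> = H y tt + H x (snd tt, fst tt)"
      unfolding E1 E2 H_def E_def tt prod.case fst_conv snd_conv s m_def[symmetric] m'_def[symmetric] ..
    finally show ?thesis .
  qed
  then have "A = (\<lambda>tt. H y tt + H x (snd tt, fst tt))" by (rule ext)
  ultimately have "V y - y ^ n * e + (V x - x ^ n * e) = single_poly n x y"
    using has_sum_unique[OF R] by simp
  moreover have "double_poly n (x + y) u = V u - u ^ n * e" for u
  proof -
    have "{..n} = insert 0 {1..n}" by auto
    then have "double_poly n (x + y) u = double_zeta 1 (Suc n) * u ^ n + (\<Sum>i\<in>{1..n}. double_zeta (Suc i) (Suc (n - i)) * ((x + y) ^ i * u ^ (n - i)))"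
      unfolding double_poly_def by (simp add: One_nat_def)
    also have "(\<Sum>i\<in>{1..n}. double_zeta (Suc i) (Suc (n - i)) * ((x + y) ^ i * u ^ (n - i))) = V u"
      unfolding V_def by (intro sum.cong) (auto simp: double_zeta_def One_nat_def)
    finally show ?thesis by (simp add: double_zeta_def e_def algebra_simps)
  qed
  ultimately show ?thesis by simp
qed

lemma double_poly_left_0: "double_poly n 0 y = double_zeta 1 (Suc n) * y ^ n"
  unfolding double_poly_def by (subst sum.remove[of _ 0]) (auto simp: One_nat_def intro!: sum.neutral)

lemma double_poly_right_0: "double_poly n x 0 = double_zeta (Suc n) 1 * x ^ n"
  unfolding double_poly_def by (subst sum.remove[of _ n]) (auto simp: One_nat_def intro!: sum.neutral)

lemma single_poly_0: "1 \<le> n \<Longrightarrow> single_poly n 0 y = 0" "1 \<le> n \<Longrightarrow> single_poly n x 0 = 0"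
proof -
  have "single_zeta (Suc i) * single_zeta (Suc (n - i)) * (x ^ i * 0 ^ (n - i)) = 0" if "i \<le> n" "1 \<le> n" for i x
    using that by (cases "i = n") (auto simp: single_zeta_def One_nat_def)
  then show "1 \<le> n \<Longrightarrow> single_poly n x 0 = 0" unfolding single_poly_def by (intro sum.neutral) simp
  have "single_zeta (Suc i) * single_zeta (Suc (n - i)) * (0 ^ i * y ^ (n - i)) = 0" if "i \<le> n" for i y
    by (cases "i = 0") (auto simp: single_zeta_def One_nat_def)
  then show "1 \<le> n \<Longrightarrow> single_poly n 0 y = 0" unfolding single_poly_def by (intro sum.neutral) simp
qed

text \<open>Euler's convolution formula for even zeta values, by eliminating the double zeta values
  from the shuffle relation at (1, -1) and (1, 0) and the stuffle relation at (1, 1) and (0,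
  1).\<close>

lemma euler_even:
  assumes "even n" "2 \<le> n"
  shows "2 * (\<Sum>i\<le>n. if odd i then mzv [Suc i] * mzv [Suc (n - i)] else 0) = real (n + 3) * mzv [n + 2]"
proof -
  have n: "1 \<le> n" using assms by simp
  have 1: "2 * double_zeta 1 (Suc n) = single_poly n 1 (-1)"
    using double_poly_shuffle[OF n, of 1 "-1"] assms by (simp add: double_poly_left_0)
  have 2: "double_zeta (Suc n) 1 + double_poly n 1 1 = 0"
    using double_poly_shuffle[OF n, of 1 0] n by (simp add: double_poly_right_0 single_poly_0)
  have 3: "2 * double_poly n 1 1 + real (n + 1) * mzv [n + 2] = single_poly n 1 1"
    using double_poly_stuffle[OF n, of 1 1] by (simp add: complete_hom_diag algebra_simps)
  have 4: "double_zeta 1 (Suc n) + double_zeta (Suc n) 1 + mzv [n + 2] = 0"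
  proof -
    have "complete_hom n 0 1 = 1"
      unfolding complete_hom_def by (subst sum.remove[of _ 0]) (auto intro!: sum.neutral)
    then show ?thesis
      using double_poly_stuffle[OF n, of 0 1] n by (simp add: double_poly_left_0 double_poly_right_0 single_poly_0)
  qed
  have "single_poly n 1 1 - single_poly n 1 (-1) = (\<Sum>i\<le>n. 2 * (if odd i then mzv [Suc i] * mzv [Suc (n - i)] else 0))"
    unfolding single_poly_def sum_subtractf[symmetric]
  proof (intro sum.cong refl)
    fix i assume "i \<in> {..n}"
    then have i: "i \<le> n" by simp
    have "(-1::real) ^ (n - i) = (if odd i then -1 else 1)" using i assms by (auto simp: minus_one_power_iff)
    moreover have "single_zeta (Suc i) = mzv [Suc i]" "single_zeta (Suc (n - i)) = mzv [Suc (n - i)]" if "odd i"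
      using that i assms by (auto simp: single_zeta_def One_nat_def elim!: oddE)
    ultimately show "single_zeta (Suc i) * single_zeta (Suc (n - i)) * (1 ^ i * 1 ^ (n - i)) -
         single_zeta (Suc i) * single_zeta (Suc (n - i)) * (1 ^ i * (- 1) ^ (n - i)) =
         2 * (if odd i then mzv [Suc i] * mzv [Suc (n - i)] else 0)" by simp
  qed
  then show ?thesis using 1 2 3 4 by (simp add: sum_distrib_left algebra_simps)
qed

text \<open>Euler's formula expresses the value by products of smaller even zeta values, which lie
  in the ideal by induction.\<close>

lemma mzv_even:
  assumes "even k" "2 \<le> k"
  shows "mzv [k] \<in> zeta2_ideal"
  using assms
proof (induction k rule: less_induct)
  case (less k)
  show ?case
  proof (cases "k = 2")
    case True then show ?thesis by (simp add: zeta2_ideal_zeta2)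
  next
    case False
    define n where "n = k - 2"
    have k: "k = n + 2" and n: "even n" "2 \<le> n" using less False by (auto simp: n_def elim!: evenE)
    have "(\<Sum>i\<le>n. if odd i then mzv [Suc i] * mzv [Suc (n - i)] else 0) \<in> zeta2_ideal"
    proof (intro zeta2_ideal_sum)
      fix i assume "i \<in> {..n}"
      show "(if odd i then mzv [Suc i] * mzv [Suc (n - i)] else 0) \<in> zeta2_ideal"
      proof (cases "odd i")
        case True
        have "1 \<le> i" using True by (cases i) auto
        moreover have "i \<noteq> n" using True n by auto
        ultimately have i: "1 \<le> i" "i < n" "odd (n - i)" using True \<open>i \<in> {..n}\<close> n by auto
        have "mzv [Suc i] \<in> zeta2_ideal" "mzv [Suc (n - i)] \<in> zeta2_ideal"
          using i True by (auto intro!: less.IH simp: k)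
        then show ?thesis using True zeta2_ideal_subset by (simp add: zeta2_ideal_mult)
      qed (simp add: zeta2_ideal_0)
    qed
    from zeta2_ideal_scale_int[OF this, of 2]
    have "of_int (int (n + 3)) * mzv [k] \<in> zeta2_ideal"
      using euler_even[OF n] by (simp add: k)
    then show ?thesis by (rule zeta2_ideal_cancel_int) simp
  qed
qed

lemma double_poly_uminus: "odd n \<Longrightarrow> double_poly n (-x) (-y) = - double_poly n x y"
proof -
  assume n: "odd n"
  have "(- x) ^ i * (- y) ^ (n - i) = - (x ^ i * y ^ (n - i))" if "i \<le> n" for i
  proof -
    have "(- x) ^ i * (- y) ^ (n - i) = (-1) ^ (i + (n - i)) * (x ^ i * y ^ (n - i))"
      unfolding power_add power_minus[of x] power_minus[of y] by (simp only: mult_ac)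
    then show ?thesis using n that by simp
  qed
  then show ?thesis unfolding double_poly_def by (simp flip: sum_negf)
qed

text \<open>In odd weight the products \<open>\<zeta>(a) \<zeta>(b)\<close> vanish modulo \<open>\<zeta>(2)\<close>. Going around the six transformations
  generated by \<open>(x, y) \<mapsto> (y, x)\<close> and \<open>(x, y) \<mapsto> (x, x - y)\<close> then determines \<open>2 D(x, y)\<close>.\<close>

lemma double_zeta_mod:
  assumes a: "2 \<le> a" "1 \<le> b" "odd (a + b)"
  shows "2 * mzv [a, b] - ((-1) ^ a * real ((a + b) choose a) - 1) * mzv [a + b] \<in> zeta2_ideal"
proof -
  define n where "n = a + b - 2"
  have n: "odd n" "1 \<le> n" "a + b = n + 2" using a by (auto simp: n_def)
  define z where "z = mzv [n + 2]"
  have P: "single_poly n (of_int x) (of_int y) \<in> zeta2_ideal" for x y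
    unfolding single_poly_def
  proof (intro zeta2_ideal_sum)
    fix i assume "i \<in> {..n}"
    have sp: "single_zeta k \<in> mzv_space" if "1 \<le> k" for k
      using that by (auto simp: single_zeta_def admissible_def is_index_def intro!: mzv_space_0 mzv_space_mzv)
    have ev: "single_zeta k \<in> zeta2_ideal" if "even k" "1 \<le> k" for k
      using that by (auto simp: single_zeta_def One_nat_def elim!: evenE intro!: zeta2_ideal_0 mzv_even)
    have "single_zeta (Suc i) * single_zeta (Suc (n - i)) \<in> zeta2_ideal"
    proof (cases "odd i")
      case True then show ?thesis by (intro zeta2_ideal_mult ev sp) auto
    next
      case False then show ?thesis using n \<open>i \<in> {..n}\<close> by (intro zeta2_ideal_mult' ev sp) auto
    qed
    from zeta2_ideal_scale_int[OF this, of "x ^ i * y ^ (n - i)"]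
    show "single_zeta (Suc i) * single_zeta (Suc (n - i)) * (of_int x ^ i * of_int y ^ (n - i)) \<in> zeta2_ideal"
      by (simp add: mult_ac)
  qed
  have sh: "double_poly n (of_int (x + y)) (of_int y) + double_poly n (of_int (x + y)) (of_int x) \<in> zeta2_ideal" for x y
    using P[of x y] double_poly_shuffle[OF n(2), of "of_int x" "of_int y"] by simp
  have st: "double_poly n (of_int x) (of_int y) + double_poly n (of_int y) (of_int x) + z * complete_hom n (of_int x) (of_int y) \<in> zeta2_ideal" for x y
    using P[of x y] double_poly_stuffle[OF n(2), of "of_int x" "of_int y"] by (simp add: z_def)
  \<comment> \<open>Twice the coefficients of \<open>double_poly n t 1\<close> minus their expected
    values. It suffices that the polynomial in t lies in the ideal at every positive
    integer.\<close>
  define c where "c i = 2 * double_zeta (Suc i) (Suc (n - i)) - z * ((-1) ^ Suc i * real ((n + 2) choose Suc i) - 1)" for i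
  have "(\<Sum>i\<le>n. c i * real t ^ i) \<in> zeta2_ideal" if t: "1 \<le> t" for t :: nat
  proof -
    define x where "x = int t"
    let ?D = "\<lambda>x y. double_poly n (of_int x) (of_int y)"
    let ?h = "\<lambda>x y. complete_hom n (of_int x) (of_int y)"
    have s1: "?D x 1 + ?D x (x - 1) \<in> zeta2_ideal" using sh[of "x - 1" 1] by simp
    have s2: "?D x (x - 1) + ?D (x - 1) x + z * ?h x (x - 1) \<in> zeta2_ideal" by (rule st)
    have s3: "?D (x - 1) (-1) + ?D (x - 1) x \<in> zeta2_ideal" using sh[of x "-1"] by simp
    have s4: "?D (x - 1) (-1) + ?D (-1) (x - 1) + z * ?h (x - 1) (-1) \<in> zeta2_ideal" by (rule st)
    have s5: "?D (-1) (x - 1) + ?D (-1) (-x) \<in> zeta2_ideal" using sh[of "-x" "x - 1"] by simp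
    have s6: "?D 1 x + ?D x 1 + z * ?h x 1 \<in> zeta2_ideal" using st[of x 1] by (simp add: add_ac)
    have s7: "?D (-1) (-x) = - ?D 1 x" using double_poly_uminus[OF n(1), of 1 "of_int x"] by simp
    \<comment> \<open>Alternating sums of the six relations telescope to 2 D(x, 1). The seventh
      relation, oddness of D in odd degree, closes the circle.\<close>
    have alg: "(a + b) - (b + c + z * h1) + (d + c) - (d + e + z * h2) + (e + - f) + (f + a + z * h3) = 2 * a - z * (h1 + h2 - h3)" for a b c d e f h1 h2 h3 :: real
      by (simp add: algebra_simps)
    have Em: "(?D x 1 + ?D x (x - 1)) - (?D x (x - 1) + ?D (x - 1) x + z * ?h x (x - 1))
        + (?D (x - 1) (-1) + ?D (x - 1) x) - (?D (x - 1) (-1) + ?D (-1) (x - 1) + z * ?h (x - 1) (-1))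
        + (?D (-1) (x - 1) + ?D (-1) (-x)) + (?D 1 x + ?D x 1 + z * ?h x 1) \<in> zeta2_ideal" (is "?E \<in> _")
      by (rule zeta2_ideal_add[OF zeta2_ideal_add[OF zeta2_ideal_diff[OF zeta2_ideal_add[OF zeta2_ideal_diff[OF s1 s2] s3] s4] s5] s6])
    have Ee: "?E = 2 * ?D x 1 - z * (?h x (x - 1) + ?h (x - 1) (-1) - ?h x 1)"
      unfolding s7 by (rule alg)
    \<comment> \<open>The two complete sums add up to (t^(n+2) - (t - 1)^(n+2) - 1) / t, whose
      binomial expansion gives the coefficients C(n + 2, i + 1).\<close>
    have hh: "?h x (x - 1) + ?h (x - 1) (-1) = (\<Sum>i\<le>n. (-1) ^ Suc i * real ((n + 2) choose Suc i) * real t ^ i)"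
    proof -
      have x1: "of_int (x - 1) = real t - 1" "of_int x = real t" "of_int (-1) = (-1 :: real)" by (simp_all add: x_def)
      have e1: "?h x (x - 1) = real t ^ Suc n - (real t - 1) ^ Suc n"
        using complete_hom_diff[of n "real t" "real t - 1"] unfolding x1 by simp
      have e2: "?h (x - 1) (-1) * real t = (real t - 1) ^ Suc n - 1"
        using complete_hom_diff[of n "real t - 1" "-1"] n unfolding x1 by simp
      have "(real t - 1) ^ (n + 2) = (\<Sum>j\<le>n + 2. real ((n + 2) choose j) * real t ^ j * (-1) ^ (n + 2 - j))"
        using binomial_ring[of "real t" "-1" "n + 2"] by simp
      also have "\<dots> = (\<Sum>j\<le>Suc (Suc n). - ((-1) ^ j * real ((n + 2) choose j) * real t ^ j))"
      proof (intro sum.cong)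
        fix j assume "j \<in> {..Suc (Suc n)}"
        then have "(-1::real) ^ (n + 2 - j) = - ((-1) ^ j)" using n(1) by (auto simp: minus_one_power_iff)
        then show "real ((n + 2) choose j) * real t ^ j * (-1) ^ (n + 2 - j) = - ((-1) ^ j * real ((n + 2) choose j) * real t ^ j)"
          by (simp only: mult_ac mult_minus_left mult_minus_right)
      qed simp
      also have "\<dots> = - 1 + real t ^ (n + 2) - (\<Sum>i\<le>n. (-1) ^ Suc i * real ((n + 2) choose Suc i) * real t ^ Suc i)"
        using n(1) by (subst sum.atMost_Suc_shift, subst sum.atMost_Suc) (simp add: sum_negf)
      finally have b: "(real t - 1) ^ (n + 2) = - 1 + real t ^ (n + 2) - (\<Sum>i\<le>n. (-1) ^ Suc i * real ((n + 2) choose Suc i) * real t ^ Suc i)" .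
      have "(?h x (x - 1) + ?h (x - 1) (-1)) * real t = real t ^ (n + 2) - (real t - 1) ^ (n + 2) - 1"
        unfolding distrib_right e2 unfolding e1 by (simp add: algebra_simps)
      also have "\<dots> = (\<Sum>i\<le>n. (-1) ^ Suc i * real ((n + 2) choose Suc i) * real t ^ i) * real t"
      proof -
        have "(\<Sum>i\<le>n. (-1) ^ Suc i * real ((n + 2) choose Suc i) * real t ^ Suc i) = (\<Sum>i\<le>n. (-1) ^ Suc i * real ((n + 2) choose Suc i) * real t ^ i) * real t"
          unfolding sum_distrib_right by (intro sum.cong refl) (simp only: power_Suc mult_ac)
        then show ?thesis unfolding b by linarith
      qed
      finally show ?thesis using t by simp
    qed
    have h1: "?h x 1 = (\<Sum>i\<le>n. real t ^ i)" by (simp add: complete_hom_def x_def)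
    have D1: "?D x 1 = (\<Sum>i\<le>n. double_zeta (Suc i) (Suc (n - i)) * real t ^ i)" by (simp add: double_poly_def x_def)
    have F: "(\<Sum>i\<le>n. c i * real t ^ i) = 2 * ?D x 1 - z * (?h x (x - 1) + ?h (x - 1) (-1) - ?h x 1)"
      unfolding hh h1 D1 c_def sum_subtractf[symmetric] sum_distrib_left
      by (intro sum.cong refl) (simp add: algebra_simps del: power_Suc binomial_Suc_Suc)
    show ?thesis unfolding F Ee[symmetric] by (rule Em)
  qed
  from zeta2_ideal_coefficients[where n = n and c = c and i = "a - 1", OF this]
  have "c (a - 1) \<in> zeta2_ideal" using a by (simp add: n_def)
  moreover have "Suc (a - 1) = a" "Suc (n - (a - 1)) = b" "a \<noteq> 1" using a by (auto simp: n_def)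
  ultimately show ?thesis by (simp add: c_def double_zeta_def z_def n(3) mult_ac)
qed

section \<open>The harmonic regularisation\<close>

lemma mhs_bound_const:
  fixes X :: "real list"
  assumes "\<And>x. x \<in> set X \<Longrightarrow> \<bar>x\<bar> = c" "0 < c"
  shows "\<bar>mhs X ks\<bar> \<le> real (length X) ^ length ks / c ^ sum_list ks"
  using assms(1)
proof (induction X arbitrary: ks)
  case Nil
  show ?case using assms(2) by (cases ks) auto
next
  case (Cons x X)
  show ?case
  proof (cases ks)
    case Nil then show ?thesis by simp
  next
    case ks: (Cons k ls)
    define n where "n = real (length X)"
    have n: "0 \<le> n" by (simp add: n_def)
    have IH: "\<bar>mhs X js\<bar> \<le> n ^ length js / c ^ sum_list js" for js
      unfolding n_def by (rule Cons.IH) (use Cons.prems in auto)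
    have "\<bar>mhs (x # X) ks\<bar> \<le> \<bar>mhs X ks\<bar> + \<bar>mhs X ls / x ^ k\<bar>"
      unfolding ks mhs_simps by (rule abs_triangle_ineq)
    also have "\<bar>mhs X ls / x ^ k\<bar> = \<bar>mhs X ls\<bar> / c ^ k"
      using Cons.prems[of x] by (simp add: abs_divide power_abs)
    also have "\<bar>mhs X ks\<bar> + \<bar>mhs X ls\<bar> / c ^ k \<le> n ^ length ks / c ^ sum_list ks + n ^ length ls / c ^ sum_list ls / c ^ k"
      using assms(2) by (intro add_mono divide_right_mono IH) simp
    also have "\<dots> = (n ^ Suc (length ls) + n ^ length ls) / c ^ sum_list ks"
      by (simp add: ks add_divide_distrib power_add mult_ac)
    also have "\<dots> \<le> (n + 1) ^ Suc (length ls) / c ^ sum_list ks"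
    proof (rule divide_right_mono)
      have "n ^ Suc (length ls) + n ^ length ls = (n + 1) * n ^ length ls" by (simp add: algebra_simps)
      also have "\<dots> \<le> (n + 1) * (n + 1) ^ length ls" using n by (intro mult_left_mono power_mono) auto
      finally show "n ^ Suc (length ls) + n ^ length ls \<le> (n + 1) ^ Suc (length ls)" by simp
    qed (use assms(2) in simp)
    finally show ?thesis by (simp add: ks n_def add_ac)
  qed
qed

lemma zsum_bound: "is_index ks \<Longrightarrow> zsum n ks \<le> zsum n [1] ^ length ks"
proof (induction ks arbitrary: n)
  case (Cons k ks)
  have "zsum n (k # ks) = (\<Sum>i<n. zsum i ks / real (Suc i) ^ k)" by (rule zsum_Cons)
  also have "\<dots> \<le> (\<Sum>i<n. zsum n [1] ^ length ks * (1 / real (Suc i)))"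
  proof (rule sum_mono)
    fix i assume "i \<in> {..<n}"
    have "zsum i ks \<le> zsum i [1] ^ length ks" using Cons by auto
    also have "\<dots> \<le> zsum n [1] ^ length ks"
      using \<open>i \<in> {..<n}\<close> by (intro power_mono zsum_mono zsum_nonneg) auto
    finally have "zsum i ks / real (Suc i) ^ k \<le> zsum n [1] ^ length ks / real (Suc i) ^ 1"
      using Cons.prems zsum_nonneg[of n "[1]"] by (intro frac_le power_increasing) auto
    then show "zsum i ks / real (Suc i) ^ k \<le> zsum n [1] ^ length ks * (1 / real (Suc i))" by simp
  qed
  also have "\<dots> = zsum n [1] ^ length (k # ks)"
    unfolding sum_distrib_left[symmetric] by (simp add: zsum_Cons[of n 1 "[]"] mult_ac)
  finally show ?case .
qed simp

lemma zsum_one_ge: "1 \<le> zsum (Suc n) [1]"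
  using zsum_mono[of 1 "Suc n" "[1]"] zsum_Suc[of 0 1 "[]"] by (simp add: zsum_0 One_nat_def)

lemma zsum_one_le_ln: "zsum (Suc n) [1] \<le> 1 + ln (real (Suc n))"
proof (induction n)
  case 0
  then show ?case using zsum_Suc[of 0 1 "[]"] by (simp add: zsum_0)
next
  case (Suc n)
  define a where "a = real (Suc n)"
  have a: "0 < a" by (simp add: a_def)
  have "ln (a / (a + 1)) \<le> a / (a + 1) - 1" using a by (intro ln_le_minus_one) simp
  moreover have "ln (a / (a + 1)) = ln a - ln (a + 1)" using a by (simp add: ln_divide_pos)
  moreover have "a / (a + 1) - 1 = - (1 / (a + 1))" using a by (simp add: field_simps)
  ultimately have "1 / (a + 1) \<le> ln (a + 1) - ln a" by linarith
  then show ?case using Suc zsum_Suc[of "Suc n" 1 "[]"] by (simp add: a_def add_ac)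
qed

lemma harmonic_power_over_tendsto: "(\<lambda>n. zsum (Suc n) [1] ^ m / real (Suc n)) \<longlonglongrightarrow> 0"
proof -
  \<comment> \<open>Distributing 1/n over m + 1 equal factors reduces the claim to the decay of ln n
    / n^s.\<close>
  define s where "s = 1 / real (Suc m)"
  have s: "0 < s" by (simp add: s_def)
  have "(\<lambda>n. (ln (real n) / real n powr s + 1 / real n powr s) ^ Suc m) \<longlonglongrightarrow> (0 + 0) ^ Suc m"
  proof (intro tendsto_power tendsto_add)
    show "(\<lambda>n. ln (real n) / real n powr s) \<longlonglongrightarrow> 0" by (rule lim_ln_over_power[OF s])
    have "(\<lambda>n. real n powr - s) \<longlonglongrightarrow> 0" by (intro tendsto_neg_powr filterlim_real_sequentially) (use s in simp)
    then show "(\<lambda>n. 1 / real n powr s) \<longlonglongrightarrow> 0" by (simp add: powr_minus divide_simps)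
  qed
  then have "(\<lambda>n. (ln (real (Suc n)) / real (Suc n) powr s + 1 / real (Suc n) powr s) ^ Suc m) \<longlonglongrightarrow> 0"
    by (intro LIMSEQ_Suc) simp
  moreover have "(ln (real (Suc n)) / real (Suc n) powr s + 1 / real (Suc n) powr s) ^ Suc m = (1 + ln (real (Suc n))) ^ Suc m / real (Suc n)" for n
  proof -
    have "(real (Suc n) powr s) ^ Suc m = real (Suc n)"
      by (simp only: powr_realpow[symmetric] powr_gt_zero of_nat_0_less_iff zero_less_Suc powr_powr) (simp add: s_def)
    then show ?thesis by (simp only: add_divide_distrib[symmetric] power_divide add.commute[of "ln _"])
  qed
  ultimately have lim: "(\<lambda>n. (1 + ln (real (Suc n))) ^ Suc m / real (Suc n)) \<longlonglongrightarrow> 0" by simp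
  show ?thesis
  proof (rule tendsto_sandwich[OF _ _ tendsto_const lim]; intro always_eventually allI)
    fix n
    have "zsum (Suc n) [1] ^ m \<le> zsum (Suc n) [1] ^ Suc m" using zsum_one_ge[of n] by (intro power_increasing) auto
    also have "\<dots> \<le> (1 + ln (real (Suc n))) ^ Suc m"
      by (intro power_mono zsum_one_le_ln zsum_nonneg)
    finally show "zsum (Suc n) [1] ^ m / real (Suc n) \<le> (1 + ln (real (Suc n))) ^ Suc m / real (Suc n)"
      by (rule divide_right_mono) simp
    show "0 \<le> zsum (Suc n) [1] ^ m / real (Suc n)" using zsum_nonneg by simp
  qed
qed

text \<open>Growth is measured in powers of the harmonic number, the natural bound for truncated
  sums. The argument is \<open>Suc n\<close> because the harmonic number at 0 vanishes.\<close>

definition polylog :: "(nat \<Rightarrow> real) \<Rightarrow> bool" where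
  "polylog f \<longleftrightarrow> (\<exists>m C. \<forall>n. \<bar>f (Suc n)\<bar> \<le> C * zsum (Suc n) [1] ^ m)"

definition decaying :: "(nat \<Rightarrow> real) \<Rightarrow> bool" where
  "decaying f \<longleftrightarrow> (\<exists>m C. \<forall>n. \<bar>f (Suc n)\<bar> \<le> C * zsum (Suc n) [1] ^ m / real (Suc n))"

lemma polylogI: "(\<And>n. \<bar>f (Suc n)\<bar> \<le> C * zsum (Suc n) [1] ^ m) \<Longrightarrow> polylog f"
  unfolding polylog_def by blast

lemma decayingI: "(\<And>n. \<bar>f (Suc n)\<bar> \<le> C * zsum (Suc n) [1] ^ m / real (Suc n)) \<Longrightarrow> decaying f"
  unfolding decaying_def by blast

lemma decaying_mult: 
  assumes "decaying f" "polylog g"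
  shows "decaying (\<lambda>n. f n * g n)"
proof -
  obtain m C m' C' where f: "\<And>n. \<bar>f (Suc n)\<bar> \<le> C * zsum (Suc n) [1] ^ m / real (Suc n)"
    and g: "\<And>n. \<bar>g (Suc n)\<bar> \<le> C' * zsum (Suc n) [1] ^ m'"
    using assms unfolding decaying_def polylog_def by blast
  show ?thesis
  proof (rule decayingI[where C = "C * C'" and m = "m + m'"])
    fix n
    have "\<bar>f (Suc n) * g (Suc n)\<bar> \<le> (C * zsum (Suc n) [1] ^ m / real (Suc n)) * (C' * zsum (Suc n) [1] ^ m')"
      unfolding abs_mult using f g by (intro mult_mono order_trans[OF abs_ge_zero f]) auto
    then show "\<bar>f (Suc n) * g (Suc n)\<bar> \<le> C * C' * zsum (Suc n) [1] ^ (m + m') / real (Suc n)"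
      by (simp only: power_add times_divide_eq_left times_divide_eq_right mult_ac)
  qed
qed

lemma decaying_tendsto:
  assumes "decaying f"
  shows "f \<longlonglongrightarrow> 0"
proof -
  obtain m C where f: "\<And>n. \<bar>f (Suc n)\<bar> \<le> C * zsum (Suc n) [1] ^ m / real (Suc n)"
    using assms unfolding decaying_def by blast
  have "(\<lambda>n. C * (zsum (Suc n) [1] ^ m / real (Suc n))) \<longlonglongrightarrow> C * 0"
    by (intro tendsto_mult tendsto_const harmonic_power_over_tendsto)
  then have "(\<lambda>n. f (Suc n)) \<longlonglongrightarrow> 0"
    by (intro Lim_null_comparison[of "\<lambda>n. f (Suc n)"]) (use f in \<open>auto simp del: of_nat_Suc\<close>)
  then show ?thesis by (rule LIMSEQ_imp_Suc)
qed

lemma polylog_zsum: "is_index ks \<Longrightarrow> polylog (\<lambda>n. zsum n ks)"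
  by (rule polylogI[where C = 1 and m = "length ks"]) (use zsum_bound zsum_nonneg in auto)

lemma sum_list_index_ge: "is_index ks \<Longrightarrow> length ks \<le> sum_list ks"
proof (induction ks)
  case (Cons k ks)
  then have "1 \<le> k" "length ks \<le> sum_list ks" by (auto simp: is_index_def)
  then show ?case by simp
qed simp

text \<open>At most 2n entries of size n / H contribute at most (2n)^depth (H / n)^weight, which
  decays once the weight exceeds the depth.\<close>

lemma decaying_const:
  assumes X: "\<And>n x. x \<in> set (X n) \<Longrightarrow> \<bar>x\<bar> = real n / zsum n [1]" "\<And>n. length (X n) \<le> 2 * n"
    and ks: "is_index ks" "length ks < sum_list ks"
  shows "decaying (\<lambda>n. mhs (X n) ks)"
proof (rule decayingI[where C = "2 ^ length ks" and m = "sum_list ks"])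
  fix n
  define N H where "N = real (Suc n)" and "H = zsum (Suc n) [1]"
  have N: "1 \<le> N" "1 \<le> H" using zsum_one_ge by (auto simp: N_def H_def)
  obtain e where e: "sum_list ks = length ks + Suc e"
    using ks(2) by (metis add_Suc_right less_natE)
  have "\<bar>mhs (X (Suc n)) ks\<bar> \<le> real (length (X (Suc n))) ^ length ks / (N / H) ^ sum_list ks"
    by (rule mhs_bound_const) (use X(1) N in \<open>auto simp: N_def H_def\<close>)
  also have "\<dots> \<le> (2 * N) ^ length ks / (N / H) ^ sum_list ks"
    using X(2)[of "Suc n"] N by (intro divide_right_mono power_mono) (auto simp: N_def)
  also have "\<dots> = 2 ^ length ks * H ^ sum_list ks / N ^ Suc e"
    using N by (simp add: e power_divide power_mult_distrib power_add divide_simps)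
  also have "\<dots> \<le> 2 ^ length ks * H ^ sum_list ks / N ^ 1"
    using N by (intro divide_left_mono power_increasing mult_nonneg_nonneg) auto
  finally show "\<bar>mhs (X (Suc n)) ks\<bar> \<le> 2 ^ length ks * zsum (Suc n) [1] ^ sum_list ks / real (Suc n)"
    by (simp add: N_def H_def)
qed

section \<open>Existence and uniqueness of the regularisation\<close>

definition leading_ones :: "nat list \<Rightarrow> nat" where
  "leading_ones ks = length (takeWhile (\<lambda>k. k = 1) ks)"

lemma leading_ones_Cons: "leading_ones (k # ks) = (if k = 1 then Suc (leading_ones ks) else 0)"
  by (simp add: leading_ones_def)

lemma admissible_leading_ones: "is_index ks \<Longrightarrow> leading_ones ks = 0 \<Longrightarrow> admissible ks"
  by (cases ks) (auto simp: admissible_def leading_ones_Cons is_index_def split: if_splits)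

text \<open>In the product of [1] with \<open>ks\<close> the index \<open>1 # ks\<close> occurs once
  more than \<open>ks\<close> has leading ones, and all other terms have no more leading ones than
  \<open>ks\<close>. So a value of [1] determines the values at all indices recursively; the list
  \<open>cs\<close> is the same for every f.\<close>

lemma stuffle_one:
  assumes "is_index ks"
  shows "\<exists>cs. (\<forall>c\<in>set cs. is_index c \<and> leading_ones c \<le> leading_ones ks) \<and>
    (\<forall>f :: nat list \<Rightarrow> real. sum_list (map f (stuffle [1] ks)) = real (Suc (leading_ones ks)) * f (1 # ks) + sum_list (map f cs))"
  using assms
proof (induction ks)
  case Nil
  show ?case by (rule exI[of _ "[]"]) (simp add: leading_ones_def)
next
  case (Cons k ks)
  have ix: "is_index ks" "1 \<le> k" using Cons.prems by (auto simp: is_index_def)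
  have st: "stuffle [1] (k # ks) = (1 # k # ks) # map ((#) k) (stuffle [1] ks) @ [(1 + k) # ks]" by simp
  show ?case
  proof (cases "k = 1")
    case True
    obtain cs where cs: "\<And>c. c \<in> set cs \<Longrightarrow> is_index c \<and> leading_ones c \<le> leading_ones ks"
      and f: "\<And>f :: nat list \<Rightarrow> real. sum_list (map f (stuffle [1] ks)) = real (Suc (leading_ones ks)) * f (1 # ks) + sum_list (map f cs)"
      using Cons.IH[OF ix(1)] by blast
    show ?thesis
    proof (rule exI[of _ "map ((#) 1) cs @ [2 # ks]"], intro conjI ballI allI)
      fix c assume "c \<in> set (map ((#) 1) cs @ [2 # ks])"
      then show "is_index c" "leading_ones c \<le> leading_ones (k # ks)"
        using cs ix True by (auto simp: leading_ones_Cons is_index_def)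
    next
      fix g :: "nat list \<Rightarrow> real"
      have "sum_list (map g (map ((#) 1) (stuffle [1] ks))) = real (Suc (leading_ones ks)) * g (1 # 1 # ks) + sum_list (map g (map ((#) 1) cs))"
        using f[of "g \<circ> (#) 1"] by (simp add: o_def)
      then show "sum_list (map g (stuffle [1] (k # ks))) = real (Suc (leading_ones (k # ks))) * g (1 # k # ks) + sum_list (map g (map ((#) 1) cs @ [2 # ks]))"
        unfolding st True by (simp add: leading_ones_Cons algebra_simps)
    qed
  next
    case False
    show ?thesis
    proof (rule exI[of _ "map ((#) k) (stuffle [1] ks) @ [(1 + k) # ks]"], intro conjI ballI allI)
      fix c assume "c \<in> set (map ((#) k) (stuffle [1] ks) @ [(1 + k) # ks])"
      moreover have "is_index d" if "d \<in> set (stuffle [1] ks)" for d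
        by (rule stuffle_index[OF _ ix(1) that]) (simp add: is_index_def)
      ultimately show "is_index c" "leading_ones c \<le> leading_ones (k # ks)"
        using ix False by (auto simp: leading_ones_Cons is_index_def)
    next
      fix g :: "nat list \<Rightarrow> real"
      show "sum_list (map g (stuffle [1] (k # ks))) = real (Suc (leading_ones (k # ks))) * g (1 # k # ks) + sum_list (map g (map ((#) k) (stuffle [1] ks) @ [(1 + k) # ks]))"
        unfolding st using False by (simp add: leading_ones_Cons)
    qed
  qed
qed

lemma leading_ones_Suc:
  assumes "leading_ones ks = Suc m"
  obtains ls where "ks = 1 # ls" "leading_ones ls = m"
  using assms by (cases ks) (auto simp: leading_ones_Cons leading_ones_def split: if_splits)

text \<open>Adding \<open>N\<close> copies of \<open>- N / H\<^sub>N\<close> to \<open>{1, \<dots>, N}\<close> kills the first power sum and does not change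
  the limits of the convergent sums; the limits are the harmonic regularisation.\<close>

definition reg_list :: "nat \<Rightarrow> real list" where
  "reg_list n = replicate n (- (real n / zsum n [1])) @ interval_list (Suc n)"

lemma mhs_replicate_one: "mhs (replicate n x) [1] = real n / (x :: real)"
  by (induction n) (auto simp: add_divide_distrib)

lemma reg_list_one: "mhs (reg_list n) [1] = 0"
proof (cases n)
  case 0 then show ?thesis by (simp add: reg_list_def interval_list_def)
next
  case (Suc m)
  have "mhs (reg_list n) [1] = mhs (replicate n (- (real n / zsum n [1]))) [1] + zsum n [1]"
    by (simp add: reg_list_def mhs_append One_nat_def)
  then show ?thesis unfolding mhs_replicate_one using Suc by simp
qed

text \<open>A non-empty part of the index falling on the constant block contains the leading entry,
  which is at least 2. Its weight exceeds its depth, so it decays faster than the remaining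
  truncated sum can grow.\<close>

lemma reg_list_admissible:
  assumes "admissible ks"
  shows "(\<lambda>n. mhs (reg_list n) ks) \<longlonglongrightarrow> mzv ks"
proof -
  let ?R = "\<lambda>n. replicate n (- (real n / zsum n [1]))"
  have ix: "is_index ks" using assms by (simp add: admissible_def)
  have "(\<lambda>n. mhs (?R n) (take (Suc j) ks) * zsum n (drop (Suc j) ks)) \<longlonglongrightarrow> 0" if j: "j < length ks" for j
  proof (rule decaying_tendsto, rule decaying_mult)
    obtain k ls where ks: "ks = k # ls" using j by (cases ks) auto
    have k: "2 \<le> k" "is_index ls" using assms by (auto simp: ks admissible_def is_index_def)
    have "length (take j ls) \<le> sum_list (take j ls)"
      by (rule sum_list_index_ge) (use k in \<open>simp add: is_index_take_drop\<close>)
    then have "length (take (Suc j) ks) < sum_list (take (Suc j) ks)" using k by (simp add: ks)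
    moreover have "is_index (take (Suc j) ks)" using ix by (simp add: is_index_take_drop)
    ultimately show "decaying (\<lambda>n. mhs (?R n) (take (Suc j) ks))"
      by (intro decaying_const) (auto simp: zsum_nonneg abs_of_nonneg)
    show "polylog (\<lambda>n. zsum n (drop (Suc j) ks))"
      by (rule polylog_zsum) (use ix in \<open>simp add: is_index_take_drop\<close>)
  qed
  then have "(\<lambda>n. zsum n ks + (\<Sum>j<length ks. mhs (?R n) (take (Suc j) ks) * zsum n (drop (Suc j) ks))) \<longlonglongrightarrow> mzv ks + (\<Sum>j<length ks. 0)"
    by (intro tendsto_add tendsto_sum mzv_has_sum(2)[OF assms]) auto
  moreover have "mhs (reg_list n) ks = zsum n ks + (\<Sum>j<length ks. mhs (?R n) (take (Suc j) ks) * zsum n (drop (Suc j) ks))" for n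
    unfolding reg_list_def mhs_append lessThan_Suc_atMost[symmetric]
    by (subst sum.lessThan_Suc_shift) simp
  ultimately show ?thesis by simp
qed

text \<open>The sum for [1] is exactly 0, so \<open>stuffle_one\<close> expresses the sum at an
  index through sums with fewer leading ones, down to the admissible case. The same recursion keeps
  the limit in Z.\<close>

lemma reg_list_converges:
  assumes "is_index ks"
  shows "\<exists>l\<in>mzv_space. (\<lambda>n. mhs (reg_list n) ks) \<longlonglongrightarrow> l"
  using assms
proof (induction "leading_ones ks" arbitrary: ks rule: less_induct)
  case less
  show ?case
  proof (cases "leading_ones ks")
    case 0
    then have "admissible ks" using less.prems by (rule admissible_leading_ones[rotated])
    then show ?thesis using reg_list_admissible mzv_space_mzv by blast
  next
    case (Suc m)
    then obtain ls where ls: "ks = 1 # ls" "leading_ones ls = m" by (rule leading_ones_Suc)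
    have "is_index ls" using less.prems by (simp add: ls is_index_def)
    from stuffle_one[OF this] obtain cs
      where cs: "\<And>c. c \<in> set cs \<Longrightarrow> is_index c \<and> leading_ones c \<le> m"
      and f: "\<And>f :: nat list \<Rightarrow> real. sum_list (map f (stuffle [1] ls)) = real (Suc m) * f ks + sum_list (map f cs)"
      unfolding ls by blast
    have "\<forall>c. \<exists>l. c \<in> set cs \<longrightarrow> l \<in> mzv_space \<and> (\<lambda>n. mhs (reg_list n) c) \<longlonglongrightarrow> l"
    proof (intro allI)
      fix c show "\<exists>l. c \<in> set cs \<longrightarrow> l \<in> mzv_space \<and> (\<lambda>n. mhs (reg_list n) c) \<longlonglongrightarrow> l"
        using less.hyps[of c] cs[of c] Suc by (cases "c \<in> set cs") auto
    qed
    then obtain g where g: "\<And>c. c \<in> set cs \<Longrightarrow> g c \<in> mzv_space" "\<And>c. c \<in> set cs \<Longrightarrow> (\<lambda>n. mhs (reg_list n) c) \<longlonglongrightarrow> g c"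
      by metis
    have eq: "mhs (reg_list n) ks = of_rat (- 1 / of_nat (Suc m)) * sum_list (map (mhs (reg_list n)) cs)" for n
    proof -
      have 1: "real (Suc m) * mhs (reg_list n) ks + sum_list (map (mhs (reg_list n)) cs) = 0"
        using mhs_stuffle[of "reg_list n" "[1]" ls] f[of "mhs (reg_list n)"] by (simp only: reg_list_one mult_zero_left)
      have 2: "(of_rat (- 1 / of_nat (Suc m)) :: real) = - 1 / real (Suc m)"
        by (simp only: of_rat_divide of_rat_minus of_rat_1 of_rat_of_nat_eq)
      from 1 have "sum_list (map (mhs (reg_list n)) cs) = - (real (Suc m) * mhs (reg_list n) ks)" by linarith
      then show ?thesis unfolding 2 by (simp del: of_nat_Suc)
    qed
    have "(\<lambda>n. mhs (reg_list n) ks) \<longlonglongrightarrow> of_rat (- 1 / of_nat (Suc m)) * sum_list (map g cs)"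
      unfolding eq by (intro tendsto_mult tendsto_const tendsto_sum_list g)
    moreover have "of_rat (- 1 / of_nat (Suc m)) * sum_list (map g cs) \<in> mzv_space"
      by (intro mzv_space_scale mzv_space_sum_list g)
    ultimately show ?thesis by blast
  qed
qed

lemma harmonic_regularisation_unique:
  assumes f: "is_harmonic_regularisation f" and g: "is_harmonic_regularisation g"
  shows "f = g"
proof
  fix ks
  have "f ks = g ks" if "is_index ks"
    using that
  proof (induction "leading_ones ks" arbitrary: ks rule: less_induct)
    case less
    show ?case
    proof (cases "leading_ones ks")
      case 0
      then have "admissible ks" using less.prems by (rule admissible_leading_ones[rotated])
      then show ?thesis using f g unfolding is_harmonic_regularisation_def by simp
    next
      case (Suc m)
      then obtain ls where ls: "ks = 1 # ls" "leading_ones ls = m" by (rule leading_ones_Suc)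
      have ix: "is_index ls" using less.prems by (simp add: ls is_index_def)
      from stuffle_one[OF this] obtain cs
        where cs: "\<And>c. c \<in> set cs \<Longrightarrow> is_index c \<and> leading_ones c \<le> m"
        and st: "\<And>f :: nat list \<Rightarrow> real. sum_list (map f (stuffle [1] ls)) = real (Suc m) * f ks + sum_list (map f cs)"
        unfolding ls by blast
      have index_one: "is_index [1]" by (simp add: is_index_def)
      have "real (Suc m) * h ks + sum_list (map h cs) = 0" if h: "is_harmonic_regularisation h" for h
      proof -
        have "h [1] * h ls = sum_list (map h (stuffle [1] ls))" "h [1] = 0"
          using h ix index_one unfolding is_harmonic_regularisation_def by blast+
        then show ?thesis unfolding st by simp
      qed
      from this[OF f] this[OF g] have "real (Suc m) * f ks + sum_list (map f cs) = real (Suc m) * g ks + sum_list (map g cs)" by simp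
      moreover have "map f cs = map g cs"
        by (intro map_cong refl less.hyps) (use cs Suc in \<open>auto simp: less_Suc_eq_le\<close>)
      ultimately show ?thesis by simp
    qed
  qed
  then show "f ks = g ks"
    using f g unfolding is_harmonic_regularisation_def by (cases "is_index ks") auto
qed

text \<open>The limits satisfy all conditions of a harmonic regularisation, since the stuffle
  product is exact for each finite list; uniqueness identifies them with the values chosen by
  \<open>THE\<close>.\<close>

lemma mzv_reg_limit:
  assumes "is_index ks"
  shows "(\<lambda>n. mhs (reg_list n) ks) \<longlonglongrightarrow> mzv_reg ks"
proof -
  define f where "f ks = (if is_index ks then lim (\<lambda>n. mhs (reg_list n) ks) else 0)" for ks
  have lim: "(\<lambda>n. mhs (reg_list n) ls) \<longlonglongrightarrow> f ls" if "is_index ls" for ls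
    using reg_list_converges[OF that] that by (auto simp: f_def limI)
  have "is_harmonic_regularisation f"
    unfolding is_harmonic_regularisation_def
  proof (intro conjI allI impI)
    show "f ls = 0" if "\<not> is_index ls" for ls using that by (simp add: f_def)
    show "f ls = mzv ls" if "admissible ls" for ls
      using LIMSEQ_unique[OF lim reg_list_admissible[OF that]] that by (simp add: admissible_def)
    show "f [1] = 0"
      using LIMSEQ_unique[OF lim[of "[1]"], of 0] by (simp add: reg_list_one is_index_def)
    show "f ls * f js = sum_list (map f (stuffle ls js))" if "is_index ls" "is_index js" for ls js
    proof (rule LIMSEQ_unique)
      show "(\<lambda>n. mhs (reg_list n) ls * mhs (reg_list n) js) \<longlonglongrightarrow> f ls * f js"
        by (intro tendsto_mult lim that)
      show "(\<lambda>n. mhs (reg_list n) ls * mhs (reg_list n) js) \<longlonglongrightarrow> sum_list (map f (stuffle ls js))"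
        unfolding mhs_stuffle by (intro tendsto_sum_list lim stuffle_index[OF that])
    qed
  qed
  then have "mzv_reg = f"
    unfolding mzv_reg_def by (intro the_equality harmonic_regularisation_unique)
  then show ?thesis using lim[OF assms] by simp
qed

lemma mzv_reg_space:
  assumes "is_index ks"
  shows "mzv_reg ks \<in> mzv_space"
proof -
  obtain l where l: "l \<in> mzv_space" "(\<lambda>n. mhs (reg_list n) ks) \<longlonglongrightarrow> l"
    using reg_list_converges[OF assms] by blast
  have "mzv_reg ks = l" by (rule LIMSEQ_unique[OF mzv_reg_limit[OF assms] l(2)])
  then show ?thesis using l(1) by simp
qed

lemma mzv_reg_admissible:
  assumes "admissible ks"
  shows "mzv_reg ks = mzv ks"
proof (rule LIMSEQ_unique[OF mzv_reg_limit reg_list_admissible[OF assms]])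
  show "is_index ks" using assms by (simp add: admissible_def)
qed

lemma mzv_star_reg_contractions:
  assumes "is_index ks"
  shows "mzv_star_reg ks = sum_list (map mzv_reg (contractions ks))"
proof (cases "admissible ks")
  case True
  have eq: "map mzv (contractions ks) = map mzv_reg (contractions ks)"
    using contractions_admissible[OF True] by (intro map_cong) (auto simp: mzv_reg_admissible)
  show ?thesis unfolding mzv_star_reg_def mzv_star_contractions[OF True] eq using True by simp
qed (simp add: mzv_star_reg_def)

lemma mzv_star_reg_limit:
  assumes "is_index ks"
  shows "(\<lambda>n. mhs_star (reg_list n) ks) \<longlonglongrightarrow> mzv_star_reg ks"
  unfolding mzv_star_reg_contractions[OF assms] mhs_star_contractions
  by (intro tendsto_sum_list mzv_reg_limit contractions_index[OF assms])

lemma mzv_star_reg_space: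
  assumes "is_index ks"
  shows "mzv_star_reg ks \<in> mzv_space"
  unfolding mzv_star_reg_contractions[OF assms]
  by (intro mzv_space_sum_list mzv_reg_space contractions_index[OF assms])

section \<open>Symmetric values as limits\<close>

lemma weak_sum_single_snoc: "weak_sum [x] (fs @ [f]) = weak_sum [x] fs * f x"
  by (induction fs) (simp_all add: mult_ac)

lemma weak_sum_snoc: "weak_sum (X @ [x]) (fs @ [f]) = weak_sum X (fs @ [f]) + f x * weak_sum (X @ [x]) fs"
proof -
  have "(\<Sum>j\<le>length fs. weak_sum X (take j (fs @ [f])) * weak_sum [x] (drop j (fs @ [f]))) =
      (\<Sum>j\<le>length fs. f x * (weak_sum X (take j fs) * weak_sum [x] (drop j fs)))"
    by (intro sum.cong refl) (simp add: weak_sum_single_snoc mult_ac)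
  then show ?thesis
    unfolding weak_sum_append by (simp add: sum_distrib_left)
qed

lemma weak_sum_rev: "weak_sum (rev X) (rev fs) = weak_sum X fs"
proof (induction X arbitrary: fs)
  case Nil
  show ?case by (simp add: weak_sum_Nil)
next
  case (Cons x X)
  show ?case
  proof (induction fs)
    case (Cons f fs)
    then show ?case using Cons.IH \<open>\<And>fs. weak_sum (rev X) (rev fs) = weak_sum X fs\<close>[of "f # fs"]
      by (simp add: weak_sum_snoc)
  qed simp
qed

lemma mhs_star_rev: "mhs_star (rev X) ks = mhs_star X (rev ks)"
  using weak_sum_rev[of X "map (\<lambda>k x. 1 / x ^ k) (rev ks)"] by (simp add: mhs_star_def rev_map)

lemma mhs_star_uminus: "mhs_star (map uminus X) ks = (-1) ^ sum_list ks * mhs_star X ks"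
proof (induction X arbitrary: ks)
  case Nil
  show ?case by (cases ks) auto
next
  case (Cons x X)
  show ?case
  proof (induction ks)
    case (Cons k ks)
    have "(- x) ^ k = (-1) ^ k * x ^ k" by (rule power_minus)
    moreover have "inverse ((-1) ^ k :: 'a) = (-1) ^ k" by (simp add: power_inverse[symmetric])
    ultimately have i: "y / (- x) ^ k = (-1) ^ k * (y / x ^ k)" for y
      by (simp add: divide_inverse mult_ac)
    show ?case
      using Cons \<open>\<And>ks. mhs_star (map uminus X) ks = (-1) ^ sum_list ks * mhs_star X ks\<close>[of "k # ks"]
      by (simp add: i power_add algebra_simps)
  qed simp
qed

text \<open>Cutting an index between -n and n gives the sum over j in the definition of symmetric
  values: the negative half accounts for the reversal and for the sign.\<close>

definition sym_list :: "nat \<Rightarrow> real list" where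
  "sym_list n = map uminus (rev (interval_list (Suc n))) @ interval_list (Suc n)"

lemma mhs_uminus_rev: "mhs (map uminus (rev X)) ks = (-1) ^ sum_list ks * mhs X (rev ks)"
  by (simp only: mhs_uminus mhs_rev)

text \<open>The generating function of these elementary symmetric sums is (1 - T^2 / c^2)^n: odd
  coefficients vanish and the coefficient of T^(2s) is at most (n / c^2)^s in absolute
  value.\<close>

lemma balanced_ones:
  fixes c :: real
  assumes c: "0 < c"
  shows "odd r \<Longrightarrow> mhs (replicate n c @ replicate n (- c)) (replicate r 1) = 0"
    and "\<bar>mhs (replicate n c @ replicate n (- c)) (replicate (2 * s) 1)\<bar> \<le> (real n / c\<^sup>2) ^ s"
proof -
  define e where "e n r = mhs (replicate n c @ replicate n (- c)) (replicate r 1)" for n r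
  have snoc: "mhs (X @ [x]) (replicate (Suc r) 1) = mhs X (replicate (Suc r) 1) + mhs X (replicate r 1) / x" for X r and x :: real
  proof -
    have "mhs (X @ [x]) (replicate (Suc r) 1) = mhs (rev (x # rev X)) (replicate (Suc r) 1)" by simp
    also have "\<dots> = mhs (x # rev X) (replicate (Suc r) 1)" by (simp only: mhs_rev rev_replicate)
    also have "\<dots> = mhs (rev X) (replicate (Suc r) 1) + mhs (rev X) (replicate r 1) / x" by simp
    finally show ?thesis by (simp only: mhs_rev rev_replicate)
  qed
  have step: "e (Suc n) (Suc (Suc r)) = e n (Suc (Suc r)) - e n r / c\<^sup>2" for n r
  proof -
    let ?W = "replicate n c @ replicate n (- c)"
    have "replicate (Suc n) c @ replicate (Suc n) (- c) = c # (?W @ [- c])"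
      by (simp add: replicate_append_same)
    then have "e (Suc n) (Suc (Suc r)) = mhs (?W @ [- c]) (replicate (Suc (Suc r)) 1) + mhs (?W @ [- c]) (replicate (Suc r) 1) / c"
      unfolding e_def by simp
    also have "\<dots> = (e n (Suc (Suc r)) - e n (Suc r) / c) + (e n (Suc r) - e n r / c) / c"
      unfolding snoc e_def by simp
    finally show ?thesis by (simp add: diff_divide_distrib power2_eq_square)
  qed
  have e0: "e n 0 = 1" "e 0 (Suc r) = 0" for n r by (simp_all add: e_def)
  have e1: "e n 1 = 0" for n
  proof -
    have "mhs (X @ Y) [1] = mhs X [1] + mhs Y [1]" for X Y :: "real list"
      by (simp add: mhs_append One_nat_def)
    moreover have "replicate 1 (1::nat) = [1]" by (simp add: One_nat_def)
    ultimately show ?thesis unfolding e_def by (simp add: mhs_replicate_one)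
  qed
  have "e n (2 * s + 1) = 0" for n s
  proof (induction s arbitrary: n)
    case 0 then show ?case by (simp add: e1)
  next
    case (Suc s)
    show ?case
    proof (induction n)
      case 0 then show ?case by (simp add: e0)
    next
      case (Suc n)
      then show ?case using step[of n "2 * s + 1"] \<open>\<And>n. e n (2 * s + 1) = 0\<close>[of n] by simp
    qed
  qed
  then show "odd r \<Longrightarrow> mhs (replicate n c @ replicate n (- c)) (replicate r 1) = 0"
    unfolding e_def by (auto elim!: oddE)
  have "\<bar>e n (2 * s)\<bar> \<le> (real n / c\<^sup>2) ^ s" for n s
  proof (induction s arbitrary: n)
    case 0 then show ?case by (simp add: e0)
  next
    case (Suc s)
    show ?case
    proof (induction n)
      case 0 then show ?case by (simp add: e0)
    next
      case (Suc n)
      define b where "b = real n / c\<^sup>2"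
      define d where "d = 1 / c\<^sup>2"
      have bd: "0 \<le> b" "0 \<le> d" "real (Suc n) / c\<^sup>2 = b + d" by (simp_all add: b_def d_def add_divide_distrib)
      have "e (Suc n) (2 * Suc s) = e n (2 * Suc s) - e n (2 * s) * d"
        using step[of n "2 * s"] by (simp add: d_def)
      then have "\<bar>e (Suc n) (2 * Suc s)\<bar> \<le> \<bar>e n (2 * Suc s)\<bar> + \<bar>e n (2 * s)\<bar> * d"
        using abs_triangle_ineq4[of "e n (2 * Suc s)" "e n (2 * s) * d"] bd by (simp add: abs_mult)
      also have "\<dots> \<le> b ^ Suc s + b ^ s * d"
        using Suc \<open>\<And>n. \<bar>e n (2 * s)\<bar> \<le> (real n / c\<^sup>2) ^ s\<close>[of n] bd
        by (intro add_mono mult_right_mono) (auto simp: b_def)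
      also have "\<dots> = b ^ s * (b + d)" by (simp add: algebra_simps)
      also have "\<dots> \<le> (b + d) ^ s * (b + d)" using bd by (intro mult_right_mono power_mono) auto
      finally show ?case unfolding bd(3) by (simp add: mult_ac)
    qed
  qed
  then show "\<bar>mhs (replicate n c @ replicate n (- c)) (replicate (2 * s) 1)\<bar> \<le> (real n / c\<^sup>2) ^ s"
    unfolding e_def .
qed

lemma index_ones: "is_index ks \<Longrightarrow> sum_list ks = length ks \<Longrightarrow> ks = replicate (length ks) 1"
proof (induction ks)
  case (Cons k ks)
  have "length ks \<le> sum_list ks" "1 \<le> k" using Cons.prems sum_list_index_ge by (auto simp: is_index_def)
  then show ?case using Cons by (auto simp: is_index_def One_nat_def)
qed simp

text \<open>When the weight exceeds the depth the size bound is enough. For a run of ones it is not,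
  and the cancellation between the two signs supplies a bound by powers of H^2 / n.\<close>

lemma decaying_balanced:
  assumes "is_index ks" "ks \<noteq> []"
  shows "decaying (\<lambda>n. mhs (replicate n (real n / zsum n [1]) @ replicate n (- (real n / zsum n [1]))) ks)"
proof (cases "length ks < sum_list ks")
  case True
  then show ?thesis using assms by (intro decaying_const) (auto simp: zsum_nonneg abs_of_nonneg)
next
  case False
  define r where "r = length ks"
  have "sum_list ks = length ks" using False sum_list_index_ge[OF assms(1)] by simp
  then have ks: "ks = replicate r 1" unfolding r_def by (rule index_ones[OF assms(1)])
  show ?thesis
  proof (rule decayingI[where C = 1 and m = r])
    fix n
    define N H where "N = real (Suc n)" and "H = zsum (Suc n) [1]"
    have N: "1 \<le> N" "1 \<le> H" "0 < N / H" using zsum_one_ge[of n] by (auto simp: N_def H_def)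
    let ?L = "mhs (replicate (Suc n) (N / H) @ replicate (Suc n) (- (N / H))) ks"
    have "\<bar>?L\<bar> \<le> H ^ r / N"
    proof (cases "odd r")
      case True
      have "?L = 0" unfolding ks by (rule balanced_ones(1)[OF N(3) True])
      then show ?thesis using N by simp
    next
      case False
      then obtain s where s: "r = 2 * s" by blast
      then have s1: "1 \<le> s" using assms(2) r_def by (cases s) auto
      have "\<bar>?L\<bar> \<le> (real (Suc n) / (N / H)\<^sup>2) ^ s" unfolding ks s by (rule balanced_ones(2)[OF N(3)])
      also have "real (Suc n) / (N / H)\<^sup>2 = H\<^sup>2 / N"
        unfolding N_def[symmetric] using N by (simp add: power2_eq_square)
      also have "(H\<^sup>2 / N) ^ s = H ^ r / N ^ s" by (simp add: power_divide s power_mult)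
      also have "\<dots> \<le> H ^ r / N ^ 1" using N s1 by (intro divide_left_mono power_increasing) auto
      finally show ?thesis by simp
    qed
    then show "\<bar>mhs (replicate (Suc n) (real (Suc n) / zsum (Suc n) [1]) @ replicate (Suc n) (- (real (Suc n) / zsum (Suc n) [1]))) ks\<bar>
        \<le> 1 * zsum (Suc n) [1] ^ r / real (Suc n)" by (simp only: N_def H_def mult_1)
  qed
qed

lemma sym_reg_list: "map uminus (rev (reg_list n)) @ reg_list n =
    map uminus (rev (interval_list (Suc n))) @ (replicate n (real n / zsum n [1]) @ replicate n (- (real n / zsum n [1]))) @ interval_list (Suc n)"
  by (simp add: reg_list_def)

text \<open>Joining the two regularised halves brings their constant blocks together in the middle
  as a balanced block. Every contribution that meets this block decays, so the plain symmetric list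
  has the same limits.\<close>

lemma sym_list_reg_diff:
  assumes ks: "is_index ks"
  shows "(\<lambda>n. mhs (map uminus (rev (reg_list n)) @ reg_list n) ks - mhs (sym_list n) ks) \<longlonglongrightarrow> 0"
proof -
  define A where "A n = (map uminus (rev (interval_list (Suc n))) :: real list)" for n
  define R where "R n = replicate n (real n / zsum n [1]) @ replicate n (- (real n / zsum n [1]))" for n
  \<comment> \<open>The contribution with i entries in the negative half and j + 1 entries, hence at
    least one, in the constant block.\<close>
  define T where "T i j n = mhs (R n) (take (Suc j) (drop i ks)) * (mhs (A n) (take i ks) * zsum n (drop (Suc j) (drop i ks)))" for i j n
  have eq: "mhs (map uminus (rev (reg_list n)) @ reg_list n) ks - mhs (sym_list n) ks =
      (\<Sum>i\<le>length ks. \<Sum>j<length ks - i. T i j n)" for n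
  proof -
    have RB: "mhs (R n @ interval_list (Suc n)) ls = zsum n ls + (\<Sum>j<length ls. mhs (R n) (take (Suc j) ls) * zsum n (drop (Suc j) ls))" for ls
      unfolding mhs_append[of "R n"] lessThan_Suc_atMost[symmetric] by (subst sum.lessThan_Suc_shift) simp
    show ?thesis
      unfolding sym_reg_list sym_list_def A_def[symmetric] R_def[symmetric] mhs_append[of "A n"] RB T_def
      by (simp add: sum_subtractf[symmetric] distrib_left sum_distrib_left mult_ac)
  qed
  have "T i j \<longlonglongrightarrow> 0" if i: "i \<le> length ks" "j < length ks - i" for i j
  proof (rule decaying_tendsto)
    have ix: "is_index (take (Suc j) (drop i ks))" "is_index (take i ks)" "is_index (drop (Suc j) (drop i ks))" "is_index (rev (take i ks))"
      using ks by (auto simp: is_index_take_drop is_index_def dest: in_set_takeD in_set_dropD)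
    have "polylog (\<lambda>n. mhs (A n) (take i ks))"
      by (rule polylogI[where C = 1 and m = "length (rev (take i ks))"])
        (use zsum_bound[OF ix(4)] zsum_nonneg in \<open>simp add: A_def mhs_uminus_rev abs_mult power_abs\<close>)
    then have "decaying (\<lambda>n. mhs (R n) (take (Suc j) (drop i ks)) * mhs (A n) (take i ks) * zsum n (drop (Suc j) (drop i ks)))"
      unfolding R_def using ix i by (intro decaying_mult decaying_balanced polylog_zsum) auto
    then show "decaying (T i j)" by (simp add: T_def[abs_def] mult_ac)
  qed
  then have "(\<lambda>n. \<Sum>i\<le>length ks. \<Sum>j<length ks - i. T i j n) \<longlonglongrightarrow> (\<Sum>i\<le>length ks. \<Sum>j<length ks - i. 0)"
    by (intro tendsto_sum) auto
  then show ?thesis unfolding eq by simp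
qed

lemma sym_list_limit:
  assumes ks: "is_index ks"
  shows "(\<lambda>n. mhs (sym_list n) ks) \<longlonglongrightarrow>
    (\<Sum>j\<le>length ks. (-1) ^ sum_list (take j ks) * mzv_reg (rev (take j ks)) * mzv_reg (drop j ks))"
proof -
  have ix: "is_index (rev (take j ks))" "is_index (drop j ks)" for j
    using ks by (auto simp: is_index_def dest: in_set_takeD in_set_dropD)
  have "(\<lambda>n. mhs (map uminus (rev (reg_list n)) @ reg_list n) ks) \<longlonglongrightarrow>
    (\<Sum>j\<le>length ks. (-1) ^ sum_list (take j ks) * mzv_reg (rev (take j ks)) * mzv_reg (drop j ks))"
    unfolding mhs_append mhs_uminus_rev by (intro tendsto_sum tendsto_mult tendsto_const mzv_reg_limit ix)
  from tendsto_diff[OF this sym_list_reg_diff[OF ks]] show ?thesis by simp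
qed

lemma sym_list_star_limit:
  assumes ks: "is_index ks"
  shows "(\<lambda>n. mhs_star (sym_list n) ks) \<longlonglongrightarrow>
    (\<Sum>j\<le>length ks. (-1) ^ sum_list (take j ks) * mzv_star_reg (rev (take j ks)) * mzv_star_reg (drop j ks))"
proof -
  have ix: "is_index (rev (take j ks))" "is_index (drop j ks)" for j
    using ks by (auto simp: is_index_def dest: in_set_takeD in_set_dropD)
  have star: "mhs_star (map uminus (rev X)) ls = (-1) ^ sum_list ls * mhs_star X (rev ls)" for X :: "real list" and ls
    by (simp only: mhs_star_uminus mhs_star_rev)
  have 1: "(\<lambda>n. mhs_star (map uminus (rev (reg_list n)) @ reg_list n) ks) \<longlonglongrightarrow>
    (\<Sum>j\<le>length ks. (-1) ^ sum_list (take j ks) * mzv_star_reg (rev (take j ks)) * mzv_star_reg (drop j ks))"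
    unfolding mhs_star_append star by (intro tendsto_sum tendsto_mult tendsto_const mzv_star_reg_limit ix)
  have "(\<lambda>n. sum_list (map (\<lambda>c. mhs (map uminus (rev (reg_list n)) @ reg_list n) c - mhs (sym_list n) c) (contractions ks))) \<longlonglongrightarrow> sum_list (map (\<lambda>_. 0) (contractions ks))"
    by (intro tendsto_sum_list sym_list_reg_diff contractions_index[OF ks])
  then have "(\<lambda>n. mhs_star (map uminus (rev (reg_list n)) @ reg_list n) ks - mhs_star (sym_list n) ks) \<longlonglongrightarrow> 0"
    by (simp add: mhs_star_contractions sum_list_subtractf)
  from tendsto_diff[OF 1 this] show ?thesis by simp
qed

section \<open>The symmetric case\<close>

text \<open>The complete factor may repeat x whereas the strict factor starts behind it. Over 1,
  ..., n these are the partial sums of the series evaluated by connected sums.\<close>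

fun reduced_sum :: "nat \<Rightarrow> nat \<Rightarrow> nat list \<Rightarrow> 'a::field list \<Rightarrow> 'a" where
  "reduced_sum i k ls [] = 0"
| "reduced_sum i k ls (x # X) = reduced_sum i k ls X + mhs_star (x # X) (replicate i 1) * mhs X ls / x ^ k"

text \<open>The relation E(t) H(-t) = 1 between elementary and complete symmetric functions.\<close>

lemma antipode_ones:
  fixes X :: "'a::field list"
  shows "(\<Sum>i\<le>l. (-1) ^ i * mhs X (replicate (l - i) 1) * mhs_star X (replicate i 1)) = (if l = 0 then 1 else 0)"
proof (cases "l = 0")
  case False
  have "(\<Sum>i\<le>l. (-1) ^ i * mhs X (replicate (l - i) 1) * mhs_star X (replicate i 1)) =
      (\<Sum>j\<le>l. (-1) ^ l * ((-1) ^ j * mhs X (replicate j 1) * mhs_star X (replicate (l - j) 1)) :: 'a)"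
  proof (rule sum.reindex_bij_witness[of _ "\<lambda>j. l - j" "\<lambda>i. l - i"])
    fix i assume "i \<in> {..l}"
    then have "(-1::'a) ^ i = (-1) ^ l * (-1) ^ (l - i)" "l - (l - i) = i"
      by (auto simp: minus_one_power_iff)
    then show "(-1) ^ l * ((-1) ^ (l - i) * mhs X (replicate (l - i) 1) * mhs_star X (replicate (l - (l - i)) 1)) =
        ((-1) ^ i * mhs X (replicate (l - i) 1) * mhs_star X (replicate i 1) :: 'a)" by (simp only: mult_ac)
  qed auto
  also have "\<dots> = (-1) ^ l * (\<Sum>j\<le>l. (-1) ^ j * mhs X (replicate j 1) * mhs_star X (replicate (l - j) 1))"
    by (simp only: sum_distrib_left)
  also have "(\<Sum>j\<le>l. (-1) ^ j * mhs X (replicate j 1) * mhs_star X (replicate (l - j) 1)) = (0 :: 'a)"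
  proof -
    have "(\<Sum>j\<le>l. (-1) ^ j * mhs X (replicate j 1) * mhs_star X (replicate (l - j) 1)) =
        (\<Sum>j\<le>length (replicate l (1::nat)). (-1) ^ j * mhs X (rev (take j (replicate l 1))) * mhs_star X (drop j (replicate l 1)))"
      by (intro sum.cong) (auto simp: min_def)
    also have "\<dots> = 0" by (rule mhs_antipode) (use False in auto)
    finally show ?thesis .
  qed
  finally show ?thesis using False by simp
qed simp

text \<open>The elementary symmetric sum over the entries in front of \<open>x\<close> is the coefficient of
  \<open>E\<^sub>L(t) / E\<^bsub>x#R\<^esub>(t) = E\<^sub>L(t) H\<^bsub>x#R\<^esub>(-t)\<close>, where \<open>E\<close> and \<open>H\<close> generate elementary and complete sums.\<close>

lemma mhs_ones_reduced:
  fixes X :: "'a::field list"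
  shows "mhs X (replicate l 1 @ k # ls) = (\<Sum>i\<le>l. (-1) ^ i * reduced_sum i k ls X * mhs X (replicate (l - i) 1))"
proof (induction X arbitrary: l)
  case Nil
  show ?case by (cases l) simp_all
next
  case (Cons x X)
  let ?K = "\<lambda>i. reduced_sum i k ls X"
  have split: "(\<Sum>i\<le>l. (-1) ^ i * reduced_sum i k ls (x # X) * mhs (x # X) (replicate (l - i) 1)) =
     (\<Sum>i\<le>l. (-1) ^ i * ?K i * mhs (x # X) (replicate (l - i) 1)) + (if l = 0 then 1 else 0) * (mhs X ls / x ^ k)"
    unfolding antipode_ones[where l = l and X = "x # X", symmetric] sum_distrib_right sum.distrib[symmetric]
    by (intro sum.cong refl) (simp add: distrib_left distrib_right mult_ac del: mhs_simps(3) mhs_star_simps(3))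
  show ?case
  proof (cases l)
    case 0
    show ?thesis unfolding split using Cons[of 0] by (simp add: 0)
  next
    case (Suc m)
    have "(\<Sum>i\<le>l. (-1) ^ i * ?K i * mhs (x # X) (replicate (l - i) 1)) =
        (\<Sum>i\<le>m. (-1) ^ i * ?K i * mhs X (replicate (l - i) 1) + (-1) ^ i * ?K i * mhs X (replicate (m - i) 1) / x) + (-1) ^ l * ?K l"
    proof -
      have "(\<Sum>i\<le>m. (-1) ^ i * ?K i * mhs (x # X) (replicate (Suc m - i) 1)) =
          (\<Sum>i\<le>m. (-1) ^ i * ?K i * mhs X (replicate (Suc m - i) 1) + (-1) ^ i * ?K i * mhs X (replicate (m - i) 1) / x)"
        by (intro sum.cong refl) (simp add: Suc_diff_le distrib_left)
      then show ?thesis unfolding Suc sum.atMost_Suc by simp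
    qed
    also have "\<dots> = (\<Sum>i\<le>l. (-1) ^ i * ?K i * mhs X (replicate (l - i) 1)) + (\<Sum>i\<le>m. (-1) ^ i * ?K i * mhs X (replicate (m - i) 1)) / x"
      by (simp add: Suc sum.distrib sum_divide_distrib)
    finally show ?thesis unfolding split using Cons[of l, symmetric] Cons[of m, symmetric] by (simp add: Suc)
  qed
qed

lemma sum_atMost_triangle: "(\<Sum>m\<le>n. \<Sum>b\<le>n - m. g m b) = (\<Sum>b\<le>n. \<Sum>m\<le>n - b. g m (b::nat) :: 'a::comm_monoid_add)"
  unfolding sum.Sigma[OF finite_atMost, OF ballI, OF finite_atMost]
  by (rule sum.reindex_bij_witness[of _ prod.swap prod.swap]) auto

text \<open>A convolution against an index with a leading run of ones is reduced to convolutions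
  against plain runs, weighted by \<open>reduced_sum\<close>. For a run on the negative half these
  are elementary symmetric sums of the whole list.\<close>

lemma reduced_convolution:
  fixes X :: "'a::field list"
  shows "(\<Sum>m\<le>v. a m * mhs X (replicate (v - m) 1 @ k # ls)) =
    (\<Sum>b\<le>v. (-1) ^ b * reduced_sum b k ls X * (\<Sum>m\<le>v - b. a m * mhs X (replicate (v - b - m) 1)))"
proof -
  have "(\<Sum>m\<le>v. a m * mhs X (replicate (v - m) 1 @ k # ls)) =
      (\<Sum>m\<le>v. \<Sum>b\<le>v - m. (-1) ^ b * reduced_sum b k ls X * (a m * mhs X (replicate (v - b - m) 1)))"
    unfolding mhs_ones_reduced sum_distrib_left
    by (intro sum.cong refl) (simp add: add.commute mult_ac)
  also have "\<dots> = (\<Sum>b\<le>v. \<Sum>m\<le>v - b. (-1) ^ b * reduced_sum b k ls X * (a m * mhs X (replicate (v - b - m) 1)))"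
    by (rule sum_atMost_triangle)
  finally show ?thesis by (simp only: sum_distrib_left)
qed

lemma sum_lessThan_add: "(\<Sum>j<a + b. f j) = (\<Sum>j<a. f j) + (\<Sum>j<b. f (a + (j::nat)) :: 'a::comm_monoid_add)"
  by (induction b) (simp_all add: add_ac)

text \<open>Sorts the cuts of an index by whether the letter k falls into the second or into the
  first part.\<close>

lemma deconcatenation_split:
  "(\<Sum>j\<le>length (ys @ k # ls). f (take j (ys @ k # ls)) (drop j (ys @ k # ls))) =
    (\<Sum>j\<le>length ys. f (take j ys) (drop j ys @ k # ls)) + (\<Sum>m\<le>length ls. f (ys @ k # take m ls) (drop m ls) :: 'a::comm_monoid_add)"
proof -
  have "Suc (length (ys @ k # ls)) = Suc (length ys) + Suc (length ls)" by simp
  then show ?thesis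
    unfolding lessThan_Suc_atMost[symmetric] by (simp only: sum_lessThan_add) (simp add: less_Suc_eq_le cong: sum.cong_simp)
qed

lemma deconcatenation_ones:
  "(\<Sum>j\<le>length (replicate u (1::nat)). f (take j (replicate u 1)) (drop j (replicate u 1) @ ls)) =
    (\<Sum>j\<le>u. f (replicate j 1) (replicate (u - j) 1 @ ls) :: 'a::comm_monoid_add)"
  by (intro sum.cong) (auto simp: min_def)

lemma deconcatenation_ones_only:
  "(\<Sum>j\<le>length (replicate u (1::nat)). f (take j (replicate u 1)) (drop j (replicate u 1))) =
    (\<Sum>j\<le>u. f (replicate j 1) (replicate (u - j) 1) :: 'a::comm_monoid_add)"
  by (intro sum.cong) (auto simp: min_def)

section \<open>Convergent and null sequences for S\<close>

definition sym_conv :: "(nat \<Rightarrow> real) set" where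
  "sym_conv = {a. \<exists>l\<in>mzv_space. a \<longlonglongrightarrow> l}"

definition sym_null :: "(nat \<Rightarrow> real) set" where
  "sym_null = {a. \<exists>l\<in>zeta2_ideal. a \<longlonglongrightarrow> l}"

lemma sym_convI: "a \<longlonglongrightarrow> l \<Longrightarrow> l \<in> mzv_space \<Longrightarrow> a \<in> sym_conv"
  by (auto simp: sym_conv_def)

lemma sym_nullI: "a \<longlonglongrightarrow> l \<Longrightarrow> l \<in> zeta2_ideal \<Longrightarrow> a \<in> sym_null"
  by (auto simp: sym_null_def)

definition sym_value :: "nat list \<Rightarrow> real" where
  "sym_value ks = (\<Sum>j\<le>length ks. (-1) ^ sum_list (take j ks) * mzv_reg (rev (take j ks)) * mzv_reg (drop j ks))"

definition sym_star_value :: "nat list \<Rightarrow> real" where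
  "sym_star_value ks = (\<Sum>j\<le>length ks. (-1) ^ sum_list (take j ks) * mzv_star_reg (rev (take j ks)) * mzv_star_reg (drop j ks))"

lemma mzv_space_sign: "x \<in> mzv_space \<Longrightarrow> (-1) ^ n * x \<in> mzv_space"
  using mzv_space_scale[of x "(-1) ^ n"] by (simp add: of_rat_power of_rat_minus)

lemma sym_value_space:
  assumes "is_index ks"
  shows "sym_value ks \<in> mzv_space" "sym_star_value ks \<in> mzv_space"
  unfolding sym_value_def sym_star_value_def
  by (intro mzv_space_sum mzv_space_mult mzv_space_sign mzv_reg_space mzv_star_reg_space; simp add: is_index_take_drop assms)+

abbreviation neg_list :: "nat \<Rightarrow> real list" where
  "neg_list n \<equiv> map uminus (rev (interval_list (Suc n)))"

abbreviation pos_list :: "nat \<Rightarrow> real list" where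
  "pos_list n \<equiv> interval_list (Suc n)"

text \<open>Odd power sums cancel between the halves and even ones tend to twice an even zeta value,
  which lies in the ideal. Reversal holds exactly, since the reversed list is the negated
  one.\<close>

global_interpretation S: mhs_family sym_list sym_conv sym_null
proof
  show "0 \<notin> set (sym_list n)" for n
    by (auto simp: sym_list_def interval_list_def)
  show "a \<in> sym_conv" if "a \<in> sym_null" for a
    using that zeta2_ideal_subset by (auto simp: sym_null_def sym_conv_def)
  show "(\<lambda>n. a n + b n) \<in> sym_conv" if "a \<in> sym_conv" "b \<in> sym_conv" for a b
    using that unfolding sym_conv_def by (auto intro: tendsto_add mzv_space_add)
  show "(\<lambda>n. a n * b n) \<in> sym_conv" if "a \<in> sym_conv" "b \<in> sym_conv" for a b
    using that unfolding sym_conv_def by (auto intro: tendsto_mult mzv_space_mult)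
  show "(\<lambda>n. of_rat q) \<in> sym_conv" for q
    by (rule sym_convI[OF tendsto_const mzv_space_rat])
  show "(\<lambda>n. a n + b n) \<in> sym_null" if "a \<in> sym_null" "b \<in> sym_null" for a b
    using that unfolding sym_null_def by (auto intro: tendsto_add zeta2_ideal_add)
  show "(\<lambda>n. a n * b n) \<in> sym_null" if "a \<in> sym_null" "b \<in> sym_conv" for a b
    using that unfolding sym_null_def sym_conv_def by (auto intro: tendsto_mult zeta2_ideal_mult)
  show "(\<lambda>n. mhs (sym_list n) ks) \<in> sym_conv" if "is_index ks" for ks
    by (rule sym_convI[OF sym_list_limit[OF that]]) (use sym_value_space[OF that] in \<open>simp add: sym_value_def\<close>)
  show "(\<lambda>n. mhs (sym_list n) [k]) \<in> sym_null" if k: "1 \<le> k" for k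
  proof -
    have eq: "mhs (sym_list n) [k] = ((-1) ^ k + 1) * zsum n [k]" for n
    proof -
      have "mhs (X @ Y) [k] = mhs X [k] + mhs Y [k]" for X Y :: "real list" by (simp add: mhs_append)
      then show ?thesis unfolding sym_list_def by (simp only: mhs_uminus_rev) (simp add: algebra_simps)
    qed
    show ?thesis
    proof (cases "even k")
      case True
      then have k2: "2 \<le> k" using k by (cases "k = 1") auto
      have "(\<lambda>n. ((-1) ^ k + 1) * zsum n [k]) \<longlonglongrightarrow> ((-1) ^ k + 1) * mzv [k]"
        by (intro tendsto_mult tendsto_const mzv_has_sum(2)) (use k2 in \<open>simp add: admissible_def\<close>)
      moreover have "((-1) ^ k + 1) * mzv [k] \<in> zeta2_ideal"
        using zeta2_ideal_scale_int[OF mzv_even[OF True k2], of 2] True by simp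
      ultimately show ?thesis unfolding eq by (rule sym_nullI)
    next
      case False
      then show ?thesis unfolding eq by (auto intro: sym_nullI[OF tendsto_const zeta2_ideal_0])
    qed
  qed
  show "(\<lambda>n. mhs (sym_list n) (rev ks) - (-1) ^ sum_list ks * mhs (sym_list n) ks) \<in> sym_null" for ks
  proof -
    have "rev (sym_list n) = map uminus (sym_list n)" for n
      by (simp add: sym_list_def rev_map o_def)
    then have "mhs (sym_list n) (rev ks) = (-1) ^ sum_list ks * mhs (sym_list n) ks" for n
      by (simp only: mhs_rev[symmetric] mhs_uminus)
    then show ?thesis by (auto intro: sym_nullI[OF tendsto_const zeta2_ideal_0])
  qed
qed

section \<open>Splitting symmetric sums at the marked letters\<close>

lemma reduced_sum_interval:
  "reduced_sum i k ls (pos_list n) = (\<Sum>j<n. zsum_star (Suc j) (replicate i 1) * zsum j ls / real (Suc j) ^ k)"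
proof (induction n)
  case 0
  show ?case by (simp add: interval_list_def)
next
  case (Suc n)
  then show ?case unfolding interval_list_Suc reduced_sum.simps by (simp del: of_nat_Suc)
qed

lemma reduced_sum_limits:
  "(\<lambda>n. reduced_sum u 2 (replicate v 1) (pos_list n)) \<longlonglongrightarrow> real ((v + 1 + u) choose u) * mzv [v + 2 + u]"
  "(\<lambda>n. reduced_sum u 2 (replicate v 1 @ 2 # replicate w 1) (pos_list n)) \<longlonglongrightarrow> ohno_value u (v + 1) (w + 1)"
  "(\<lambda>n. reduced_sum u 3 (replicate w 1) (pos_list n)) \<longlonglongrightarrow> ohno_value u 0 (w + 1)"
  using ohno_1 ohno_2 ohno_3 unfolding reduced_sum_interval sums_def by blast+

lemma mzv_space_nat: "x \<in> mzv_space \<Longrightarrow> real n * x \<in> mzv_space"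
  using mzv_space_scale[of x "of_nat n"] by simp

lemma ohno_value_space: "1 \<le> b \<Longrightarrow> ohno_value u a b \<in> mzv_space"
  unfolding ohno_value_def mult.assoc
  by (intro mzv_space_sum mzv_space_nat mzv_space_mzv) (simp add: admissible_def)

lemma reduced_sum_conv:
  "(\<lambda>n. reduced_sum u 2 (replicate v 1) (pos_list n)) \<in> sym_conv"
  "(\<lambda>n. reduced_sum u 2 (replicate v 1 @ 2 # replicate w 1) (pos_list n)) \<in> sym_conv"
  "(\<lambda>n. reduced_sum u 3 (replicate w 1) (pos_list n)) \<in> sym_conv"
  by (rule sym_convI[OF reduced_sum_limits(1)], intro mzv_space_nat mzv_space_mzv, simp add: admissible_def)
    (rule sym_convI[OF reduced_sum_limits(2)] sym_convI[OF reduced_sum_limits(3)], intro ohno_value_space, simp)+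

text \<open>The part of the symmetric sum in which the marked letter k falls into the positive half,
  while the run of u ones before it is spread over both halves.\<close>

definition front_sum :: "nat \<Rightarrow> nat \<Rightarrow> nat \<Rightarrow> nat list \<Rightarrow> real" where
  "front_sum n u k ls = (\<Sum>m\<le>u. mhs (neg_list n) (replicate m 1) * mhs (pos_list n) (replicate (u - m) 1 @ k # ls))"

text \<open>After \<open>reduced_convolution\<close> the inner sums are elementary symmetric sums
  over the full symmetric list. They are null except for the empty one, which belongs to b =
  u.\<close>

lemma front_sum_null:
  assumes "\<And>i. (\<lambda>n. reduced_sum i k ls (pos_list n)) \<in> sym_conv"
  shows "(\<lambda>n. front_sum n u k ls - (-1) ^ u * reduced_sum u k ls (pos_list n)) \<in> sym_null"
proof -
  have eq: "front_sum n u k ls - (-1) ^ u * reduced_sum u k ls (pos_list n) =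
      (\<Sum>b<u. (-1) ^ b * reduced_sum b k ls (pos_list n) * mhs (sym_list n) (replicate (u - b) 1))" for n
  proof -
    have "(\<Sum>m\<le>l. mhs (neg_list n) (replicate m 1) * mhs (pos_list n) (replicate (l - m) 1)) = mhs (sym_list n) (replicate l 1)" for l
      unfolding sym_list_def mhs_append by (rule deconcatenation_ones_only[where f = "\<lambda>a b. mhs (neg_list n) a * mhs (pos_list n) b", symmetric])
    then have "front_sum n u k ls = (\<Sum>b\<le>u. (-1) ^ b * reduced_sum b k ls (pos_list n) * mhs (sym_list n) (replicate (u - b) 1))"
      unfolding front_sum_def reduced_convolution by (simp only:)
    then show ?thesis by (simp add: lessThan_Suc_atMost[symmetric])
  qed
  have "(\<lambda>n. of_int ((-1) ^ b) * reduced_sum b k ls (pos_list n) * mhs (sym_list n) (replicate (u - b) 1)) \<in> sym_null" if "b < u" for b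
    by (rule S.N_mult_left[OF S.I_mult[OF S.I_int assms] S.ones_N]) (use that in simp)
  then have "(\<lambda>n. \<Sum>b<u. of_int ((-1) ^ b) * reduced_sum b k ls (pos_list n) * mhs (sym_list n) (replicate (u - b) 1)) \<in> sym_null"
    by (intro S.N_sum) auto
  then show ?thesis unfolding eq by simp
qed

text \<open>The reflection x -> -x reverses the list and exchanges the two halves, so a marked
  letter in the negative half gives a front sum again, up to sign.\<close>

lemma back_sum:
  "(\<Sum>m\<le>v. mhs (neg_list n) (rev ls @ k # replicate m 1) * mhs (pos_list n) (replicate (v - m) 1)) =
    (-1) ^ (sum_list ls + k + v) * front_sum n v k ls"
proof -
  have "(\<Sum>m\<le>v. mhs (neg_list n) (rev ls @ k # replicate m 1) * mhs (pos_list n) (replicate (v - m) 1)) =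
    (\<Sum>m\<le>v. (-1) ^ (sum_list ls + k + v) * (mhs (neg_list n) (replicate m 1) * mhs (pos_list n) (replicate (v - m) 1 @ k # ls)))"
  proof (rule sum.reindex_bij_witness[of _ "\<lambda>m. v - m" "\<lambda>m. v - m"])
    fix m assume "m \<in> {..v}"
    then have m: "m \<le> v" by simp
    have 1: "mhs (neg_list n) (rev ls @ k # replicate m 1) = (-1) ^ (sum_list ls + k + m) * mhs (pos_list n) (replicate m 1 @ k # ls)"
      unfolding mhs_uminus_rev by (simp add: sum_list_replicate add_ac)
    have 2: "mhs (neg_list n) (replicate (v - m) 1) = (-1) ^ (v - m) * mhs (pos_list n) (replicate (v - m) 1)"
      unfolding mhs_uminus_rev by (simp add: sum_list_replicate)
    have 3: "(-1 :: real) ^ (sum_list ls + k + m) = (-1) ^ (sum_list ls + k + v) * (-1) ^ (v - m)"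
      using m by (auto simp: minus_one_power_iff)
    have 4: "v - (v - m) = m" using m by simp
    show "(-1) ^ (sum_list ls + k + v) * (mhs (neg_list n) (replicate (v - m) 1) * mhs (pos_list n) (replicate (v - (v - m)) 1 @ k # ls)) =
        mhs (neg_list n) (rev ls @ k # replicate m 1) * mhs (pos_list n) (replicate (v - m) 1)"
      unfolding 1 2 3 4 by (simp only: mult_ac)
  qed auto
  then show ?thesis by (simp only: front_sum_def sum_distrib_left)
qed

lemma sym_single_split:
  "mhs (sym_list n) (replicate u 1 @ k # replicate v 1) = front_sum n u k (replicate v 1) + (-1) ^ (u + k + v) * front_sum n v k (replicate u 1)"
  unfolding sym_list_def mhs_append front_sum_def[of n u]
    deconcatenation_split[where f = "\<lambda>a b. mhs (neg_list n) a * mhs (pos_list n) b"]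
    deconcatenation_ones[where f = "\<lambda>a b. mhs (neg_list n) a * mhs (pos_list n) b"]
    deconcatenation_ones_only[where f = "\<lambda>a b. mhs (neg_list n) (replicate u 1 @ k # a) * mhs (pos_list n) b"]
  using back_sum[where v = v and n = n and ls = "replicate u 1" and k = k] by (simp add: sum_list_replicate)

text \<open>The three summands have both entries 2 in the positive half, one in each half, and both
  in the negative half. In the mixed case the middle run is spread over both halves and is resolved
  by \<open>reduced_convolution\<close>.\<close>

lemma sym_double_split:
  "mhs (sym_list n) (replicate u 1 @ 2 # replicate v 1 @ 2 # replicate w 1) =
     front_sum n u 2 (replicate v 1 @ 2 # replicate w 1) +
     (\<Sum>b\<le>v. (-1) ^ b * reduced_sum b 2 (replicate w 1) (pos_list n) * ((-1) ^ (u + 2 + (v - b)) * front_sum n (v - b) 2 (replicate u 1))) +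
     (-1) ^ (u + v + w) * front_sum n w 2 (replicate v 1 @ 2 # replicate u 1)"
proof -
  let ?r = "replicate v 1 @ 2 # replicate w 1 :: nat list"
  let ?h = "\<lambda>a b. mhs (neg_list n) a * mhs (pos_list n) b"
  let ?f = "\<lambda>a b. mhs (neg_list n) (replicate u 1 @ 2 # a) * mhs (pos_list n) b"
  let ?g = "\<lambda>a b. mhs (neg_list n) (replicate u 1 @ 2 # replicate v 1 @ 2 # a) * mhs (pos_list n) b"
  have "mhs (sym_list n) (replicate u 1 @ 2 # replicate v 1 @ 2 # replicate w 1) =
      front_sum n u 2 (replicate v 1 @ 2 # replicate w 1) +
      (\<Sum>m\<le>length ?r. ?f (take m ?r) (drop m ?r))"
    unfolding sym_list_def mhs_append deconcatenation_split[where f = ?h and ys = "replicate u 1"] deconcatenation_ones[where f = ?h] front_sum_def ..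
  also have "(\<Sum>m\<le>length ?r. ?f (take m ?r) (drop m ?r)) =
      (\<Sum>m\<le>v. ?f (replicate m 1) (replicate (v - m) 1 @ 2 # replicate w 1)) +
      (\<Sum>m\<le>w. ?g (replicate m 1) (replicate (w - m) 1))"
    unfolding deconcatenation_split[where f = ?f] deconcatenation_ones[where f = ?f] deconcatenation_ones_only[where f = ?g] ..
  also have "(\<Sum>m\<le>w. ?g (replicate m 1) (replicate (w - m) 1)) = (-1) ^ (u + v + w) * front_sum n w 2 (replicate v 1 @ 2 # replicate u 1)"
    using back_sum[where v = w and n = n and ls = "replicate v 1 @ 2 # replicate u 1" and k = 2] by (simp add: sum_list_replicate power_add mult_ac)
  also have "(\<Sum>m\<le>v. ?f (replicate m 1) (replicate (v - m) 1 @ 2 # replicate w 1)) =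
      (\<Sum>b\<le>v. (-1) ^ b * reduced_sum b 2 (replicate w 1) (pos_list n) * ((-1) ^ (u + 2 + (v - b)) * front_sum n (v - b) 2 (replicate u 1)))"
  proof -
    have "(\<Sum>m\<le>t. mhs (neg_list n) (replicate u 1 @ 2 # replicate m 1) * mhs (pos_list n) (replicate (t - m) 1)) = (-1) ^ (u + 2 + t) * front_sum n t 2 (replicate u 1)" for t
      using back_sum[where v = t and n = n and ls = "replicate u 1" and k = 2] by (simp add: sum_list_replicate)
    then show ?thesis unfolding reduced_convolution by (simp only:)
  qed
  finally show ?thesis by (simp only: add.assoc)
qed

section \<open>Extremal values modulo zeta(2)\<close>

lemma ohno_binomial_sum:
  "(\<Sum>i\<le>u. ((a + i) choose i) * ((b + (u - i)) choose (u - i))) = (a + b + u + 1) choose u"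
proof -
  have "(\<Sum>i\<le>u. ((a + i) choose i) * ((b + (u - i)) choose (u - i))) = (\<Sum>v\<in>{a..a + u}. (v choose a) * ((a + b + u - v) choose b))"
  proof (rule sum.reindex_bij_witness[of _ "\<lambda>v. v - a" "\<lambda>i. a + i"])
    fix i assume "i \<in> {..u}"
    then have "a + b + u - (a + i) = b + (u - i)" by simp
    then show "((a + i) choose a) * ((a + b + u - (a + i)) choose b) = ((a + i) choose i) * ((b + (u - i)) choose (u - i))"
      using binomial_symmetric[of i "a + i"] binomial_symmetric[of "u - i" "b + (u - i)"] by simp
  qed auto
  also have "\<dots> = (\<Sum>v\<le>a + b + u. (v choose a) * ((a + b + u - v) choose b))"
    by (rule sum.mono_neutral_left) (auto simp: binomial_eq_0)
  also have "\<dots> = Suc (a + b + u) choose Suc (a + b)" by (rule sum_choose_convolution)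
  also have "\<dots> = (a + b + u + 1) choose u"
  proof -
    have "Suc (a + b + u) choose u = Suc (a + b + u) choose (Suc (a + b + u) - u)" by (rule binomial_symmetric) simp
    moreover have "Suc (a + b + u) - u = Suc (a + b)" by simp
    ultimately show ?thesis by (simp only: Suc_eq_plus1)
  qed
  finally show ?thesis .
qed

text \<open>Again a vanishing k-th difference, with x = -1 and y = k - 1. Only m = 0 and m = k have
  a negative argument and give the right-hand side; of the others, those outside b + 1, ..., b + 1 +
  u contain a zero binomial.\<close>

lemma ohno_alternating_sum:
  assumes k: "k = a + b + u + 2" "odd k"
  shows "(\<Sum>i\<le>u. real ((a + i) choose i) * real ((b + (u - i)) choose (u - i)) * ((-1) ^ (Suc b + (u - i)) * real (k choose (Suc b + (u - i))))) =
    (-1) ^ Suc b * real ((k - 1) choose a) + (-1) ^ a * real ((k - 1) choose b)"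
proof -
  define T where "T m = (-1) ^ m * real (k choose m) * ((-1 + real m) gchoose b) * ((real (k - 1) - real m) gchoose a)" for m
  define U where "U m = (-1) ^ m * real (k choose m) * real ((m - 1) choose b) * real ((k - 1 - m) choose a)" for m
  have T0: "T 0 = (-1) ^ b * real ((k - 1) choose a)"
    by (simp add: T_def gchoose_minus_one binomial_gbinomial)
  have Tk: "T k = - ((-1) ^ a * real ((k - 1) choose b))"
  proof -
    have e: "-1 + real k = real (k - 1)" "real (k - 1) - real k = -1" using k by simp_all
    have "T k = (-1) ^ k * real (k choose k) * (real (k - 1) gchoose b) * ((-1) gchoose a)" unfolding T_def e ..
    then show ?thesis using k(2) by (simp add: gchoose_minus_one binomial_gbinomial)
  qed
  have TU: "T m = U m" if "m \<in> {1..k - 1}" for m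
  proof -
    have "-1 + real m = real (m - 1)" "real (k - 1) - real m = real (k - 1 - m)" using that by (auto simp: of_nat_diff)
    then show ?thesis by (simp only: T_def U_def binomial_gbinomial)
  qed
  have set: "{..k} = insert 0 (insert k {1..k - 1})" "0 \<notin> insert k {1..k - 1}" "k \<notin> {1..k - 1}" using k by auto
  have "(\<Sum>m\<le>k. T m) = 0"
    unfolding T_def by (rule alternating_sum_gchoose) (use k in simp)
  moreover have "(\<Sum>m\<le>k. T m) = T 0 + (T k + sum T {1..k - 1})"
    unfolding set(1) using set(2,3) by (simp only: sum.insert finite_insert finite_atLeastAtMost not_False_eq_True simp_thms)
  moreover have "sum T {1..k - 1} = sum U {1..k - 1}" by (rule sum.cong[OF refl TU])
  ultimately have "sum U {1..k - 1} = - T 0 - T k" by linarith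
  then have sum: "sum U {1..k - 1} = (-1) ^ Suc b * real ((k - 1) choose a) + (-1) ^ a * real ((k - 1) choose b)"
    unfolding T0 Tk by simp
  have "(\<Sum>i\<le>u. real ((a + i) choose i) * real ((b + (u - i)) choose (u - i)) * ((-1) ^ (Suc b + (u - i)) * real (k choose (Suc b + (u - i))))) =
      sum U {Suc b..Suc b + u}"
  proof (rule sum.reindex_bij_witness[of _ "\<lambda>m. Suc b + u - m" "\<lambda>i. Suc b + (u - i)"])
    fix i assume "i \<in> {..u}"
    then have e: "k - 1 - (Suc b + (u - i)) = a + i" "Suc b + (u - i) - 1 = b + (u - i)" using k by auto
    have c: "(a + i) choose i = (a + i) choose a" "(b + (u - i)) choose (u - i) = (b + (u - i)) choose b"
      using binomial_symmetric[of i "a + i"] binomial_symmetric[of "u - i" "b + (u - i)"] by simp_all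
    show "U (Suc b + (u - i)) = real ((a + i) choose i) * real ((b + (u - i)) choose (u - i)) * ((-1) ^ (Suc b + (u - i)) * real (k choose (Suc b + (u - i))))"
      unfolding U_def e c by (simp only: mult_ac)
  qed auto
  also have "\<dots> = sum U {1..k - 1}"
  proof (rule sum.mono_neutral_left)
    show "{Suc b..Suc b + u} \<subseteq> {1..k - 1}" using k(1) by auto
    show "\<forall>m\<in>{1..k - 1} - {Suc b..Suc b + u}. U m = 0"
    proof
      fix m assume "m \<in> {1..k - 1} - {Suc b..Suc b + u}"
      then have "m - 1 < b \<or> k - 1 - m < a" using k(1) by auto
      then show "U m = 0" by (auto simp: U_def binomial_eq_0)
    qed
  qed simp
  finally show ?thesis unfolding sum .
qed

text \<open>Insert the double zeta values modulo zeta(2): the alternating coefficient produces two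
  binomials, the constant -1 the third.\<close>

lemma ohno_value_mod:
  assumes k: "k = a + b + u + 2" "odd k" and b: "1 \<le> b"
  shows "2 * ohno_value u a b - ((-1) ^ Suc b * real ((k - 1) choose a) + (-1) ^ a * real ((k - 1) choose b) - real ((k - 1) choose u)) * mzv [k] \<in> zeta2_ideal"
proof -
  define c where "c i = ((a + i) choose i) * ((b + (u - i)) choose (u - i))" for i
  define q where "q i = (-1) ^ (Suc b + (u - i)) * real (k choose (Suc b + (u - i)))" for i
  have "(\<Sum>i\<le>u. of_int (int (c i)) * (2 * mzv [Suc b + (u - i), Suc a + i] - (q i - 1) * mzv [k])) \<in> zeta2_ideal"
  proof (intro zeta2_ideal_sum zeta2_ideal_scale_int)
    fix i assume "i \<in> {..u}"
    then have "Suc b + (u - i) + (Suc a + i) = k" using k by simp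
    then show "2 * mzv [Suc b + (u - i), Suc a + i] - (q i - 1) * mzv [k] \<in> zeta2_ideal"
      using double_zeta_mod[of "Suc b + (u - i)" "Suc a + i"] b k(2) by (simp add: q_def)
  qed
  also have "(\<Sum>i\<le>u. of_int (int (c i)) * (2 * mzv [Suc b + (u - i), Suc a + i] - (q i - 1) * mzv [k])) =
      2 * (\<Sum>i\<le>u. real (c i) * mzv [Suc b + (u - i), Suc a + i]) - ((\<Sum>i\<le>u. real (c i) * q i) - real (\<Sum>i\<le>u. c i)) * mzv [k]"
    by (simp add: sum_distrib_left sum_distrib_right sum_subtractf left_diff_distrib right_diff_distrib mult_ac)
  also have "(\<Sum>i\<le>u. c i) = (k - 1) choose u"
  proof -
    have "k - 1 = a + b + u + 1" using k(1) by simp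
    then show ?thesis unfolding c_def by (simp only: ohno_binomial_sum)
  qed
  also have "(\<Sum>i\<le>u. real (c i) * q i) = (-1) ^ Suc b * real ((k - 1) choose a) + (-1) ^ a * real ((k - 1) choose b)"
    using ohno_alternating_sum[OF k] by (simp only: c_def q_def of_nat_mult)
  also have "(\<Sum>i\<le>u. real (c i) * mzv [Suc b + (u - i), Suc a + i]) = ohno_value u a b"
    by (simp only: c_def ohno_value_def of_nat_mult)
  finally show ?thesis .
qed

text \<open>In even weight the reduced sums tend to integer multiples of even zeta values.\<close>

lemma sym_even_N:
  assumes "even (u + v)"
  shows "(\<lambda>n. mhs (sym_list n) (replicate u 1 @ 2 # replicate v 1)) \<in> sym_null"
proof -
  have K: "(\<lambda>n. reduced_sum x 2 (replicate y 1) (pos_list n)) \<in> sym_null" if "even (x + y)" for x y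
  proof (rule sym_nullI[OF reduced_sum_limits(1)])
    have "mzv [y + 2 + x] \<in> zeta2_ideal" using that by (intro mzv_even) (auto simp: add.commute)
    from zeta2_ideal_scale_int[OF this, of "int ((y + 1 + x) choose x)"]
    show "real ((y + 1 + x) choose x) * mzv [y + 2 + x] \<in> zeta2_ideal" by simp
  qed
  have F: "(\<lambda>n. front_sum n x 2 (replicate y 1)) \<in> sym_null" if "even (x + y)" for x y
  proof (rule S.N_eqI)
    show "(\<lambda>n. (front_sum n x 2 (replicate y 1) - (-1) ^ x * reduced_sum x 2 (replicate y 1) (pos_list n)) + of_int ((-1) ^ x) * reduced_sum x 2 (replicate y 1) (pos_list n)) \<in> sym_null"
      by (rule S.N_add[OF front_sum_null[OF reduced_sum_conv(1)] S.N_scale_int[OF K[OF that]]])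
  qed simp
  have "(\<lambda>n. front_sum n u 2 (replicate v 1) + of_int ((-1) ^ (u + 2 + v)) * front_sum n v 2 (replicate u 1)) \<in> sym_null"
    using assms by (intro S.N_add S.N_scale_int F) (auto simp: add.commute)
  then show ?thesis unfolding sym_single_split by simp
qed

lemma binomial_pascal: "1 \<le> k \<Longrightarrow> real (k choose Suc m) = real ((k - 1) choose m) + real ((k - 1) choose Suc m)"
  by (cases k) simp_all

lemma double_reduced_value:
  assumes k: "k = u + v + w + 4" "odd k"
  shows "(\<lambda>n. 2 * reduced_sum u 2 (replicate v 1 @ 2 # replicate w 1) (pos_list n) -
     ((-1) ^ w * real ((k - 1) choose Suc v) - (-1) ^ v * real ((k - 1) choose Suc w) - real ((k - 1) choose u)) * mzv [k]) \<in> sym_null"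
proof (rule sym_nullI)
  show "(\<lambda>n. 2 * reduced_sum u 2 (replicate v 1 @ 2 # replicate w 1) (pos_list n) -
     ((-1) ^ w * real ((k - 1) choose Suc v) - (-1) ^ v * real ((k - 1) choose Suc w) - real ((k - 1) choose u)) * mzv [k]) \<longlonglongrightarrow>
     2 * ohno_value u (v + 1) (w + 1) -
     ((-1) ^ w * real ((k - 1) choose Suc v) - (-1) ^ v * real ((k - 1) choose Suc w) - real ((k - 1) choose u)) * mzv [k]"
    by (intro tendsto_diff tendsto_mult tendsto_const reduced_sum_limits)
  show "2 * ohno_value u (v + 1) (w + 1) -
     ((-1) ^ w * real ((k - 1) choose Suc v) - (-1) ^ v * real ((k - 1) choose Suc w) - real ((k - 1) choose u)) * mzv [k] \<in> zeta2_ideal"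
  proof -
    have "(-1) ^ Suc (w + 1) * real ((k - 1) choose (v + 1)) + (-1) ^ (v + 1) * real ((k - 1) choose (w + 1)) - real ((k - 1) choose u) =
       (-1) ^ w * real ((k - 1) choose Suc v) - (-1) ^ v * real ((k - 1) choose Suc w) - real ((k - 1) choose u)"
      by (simp only: Suc_eq_plus1[symmetric]) simp
    moreover have "k = (v + 1) + (w + 1) + u + 2" using k by simp
    moreover from this have "2 * ohno_value u (v + 1) (w + 1) - ((-1) ^ Suc (w + 1) * real ((k - 1) choose (v + 1)) + (-1) ^ (v + 1) * real ((k - 1) choose (w + 1)) - real ((k - 1) choose u)) * mzv [k] \<in> zeta2_ideal"
      by (rule ohno_value_mod) (use k in auto)
    ultimately show ?thesis by metis
  qed
qed

lemma single_reduced_value: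
  assumes k: "k = u + w + 3" "odd k"
  shows "(\<lambda>n. 2 * reduced_sum u 3 (replicate w 1) (pos_list n) -
     ((-1) ^ w + real ((k - 1) choose Suc w) - real ((k - 1) choose u)) * mzv [k]) \<in> sym_null"
proof (rule sym_nullI)
  show "(\<lambda>n. 2 * reduced_sum u 3 (replicate w 1) (pos_list n) -
     ((-1) ^ w + real ((k - 1) choose Suc w) - real ((k - 1) choose u)) * mzv [k]) \<longlonglongrightarrow>
     2 * ohno_value u 0 (w + 1) - ((-1) ^ w + real ((k - 1) choose Suc w) - real ((k - 1) choose u)) * mzv [k]"
    by (intro tendsto_diff tendsto_mult tendsto_const reduced_sum_limits)
  show "2 * ohno_value u 0 (w + 1) - ((-1) ^ w + real ((k - 1) choose Suc w) - real ((k - 1) choose u)) * mzv [k] \<in> zeta2_ideal"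
  proof -
    have "(-1) ^ Suc (w + 1) * real ((k - 1) choose 0) + (-1) ^ 0 * real ((k - 1) choose (w + 1)) - real ((k - 1) choose u) =
       (-1) ^ w + real ((k - 1) choose Suc w) - real ((k - 1) choose u)"
      by (simp only: Suc_eq_plus1[symmetric]) simp
    moreover have "2 * ohno_value u 0 (w + 1) - ((-1) ^ Suc (w + 1) * real ((k - 1) choose 0) + (-1) ^ 0 * real ((k - 1) choose (w + 1)) - real ((k - 1) choose u)) * mzv [k] \<in> zeta2_ideal"
      by (rule ohno_value_mod) (use k in auto)
    ultimately show ?thesis by (simp only:)
  qed
qed

text \<open>Each term is, up to null sequences, a product of two sums that tend to multiples of
  single zeta values. Their weights add up to an odd number, so one of them is even and the product
  lies in the ideal.\<close>

lemma middle_sum_null: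
  assumes "odd (u + v + w)"
  shows "(\<lambda>n. \<Sum>b\<le>v. (-1) ^ b * reduced_sum b 2 (replicate w 1) (pos_list n) * ((-1) ^ (u + 2 + (v - b)) * front_sum n (v - b) 2 (replicate u 1))) \<in> sym_null"
proof (intro S.N_sum)
  fix b assume "b \<in> {..v}"
  then have b: "b \<le> v" by simp
  let ?K = "\<lambda>n. reduced_sum b 2 (replicate w 1) (pos_list n)"
  let ?L = "\<lambda>n. reduced_sum (v - b) 2 (replicate u 1) (pos_list n)"
  let ?F = "\<lambda>n. front_sum n (v - b) 2 (replicate u 1)"
  define s where "s = (-1 :: int) ^ b * (-1) ^ (u + 2 + (v - b))"
  have KL: "(\<lambda>n. ?K n * ?L n) \<in> sym_null"
  proof (rule sym_nullI)
    show "(\<lambda>n. ?K n * ?L n) \<longlonglongrightarrow> (real ((w + 1 + b) choose b) * mzv [w + 2 + b]) * (real ((u + 1 + (v - b)) choose (v - b)) * mzv [u + 2 + (v - b)])"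
      by (intro tendsto_mult reduced_sum_limits)
    have mem: "real c * mzv [x] \<in> mzv_space" if "2 \<le> x" for c x
      using that by (intro mzv_space_nat mzv_space_mzv) (simp add: admissible_def)
    have ev: "real c * mzv [x] \<in> zeta2_ideal" if "2 \<le> x" "even x" for c x
      using zeta2_ideal_scale_int[OF mzv_even[OF that(2,1)], of "int c"] by simp
    show "(real ((w + 1 + b) choose b) * mzv [w + 2 + b]) * (real ((u + 1 + (v - b)) choose (v - b)) * mzv [u + 2 + (v - b)]) \<in> zeta2_ideal"
    proof (cases "even (w + 2 + b)")
      case True
      then show ?thesis by (intro zeta2_ideal_mult ev mem) auto
    next
      case False
      then have "even (u + 2 + (v - b))" using assms b by auto
      then show ?thesis by (intro zeta2_ideal_mult' ev mem) auto
    qed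
  qed
  have "(\<lambda>n. of_int s * (?K n * (?F n - (-1) ^ (v - b) * ?L n) + of_int ((-1) ^ (v - b)) * (?K n * ?L n))) \<in> sym_null"
    by (intro S.N_scale_int S.N_add S.N_mult_left KL front_sum_null reduced_sum_conv)
  then show "(\<lambda>n. (-1) ^ b * ?K n * ((-1) ^ (u + 2 + (v - b)) * ?F n)) \<in> sym_null"
    by (rule S.N_eqI) (simp add: s_def algebra_simps)
qed

lemma sym_extremal_values:
  assumes k: "odd k"
  shows "S.extremal_values k (\<lambda>_. mzv [k])"
  unfolding S.extremal_values_def
proof (intro conjI allI impI)
  fix u v w assume s: "u + v + w + 4 = k"
  let ?A = "\<lambda>n. reduced_sum u 2 (replicate v 1 @ 2 # replicate w 1) (pos_list n)"
  let ?B = "\<lambda>n. reduced_sum w 2 (replicate v 1 @ 2 # replicate u 1) (pos_list n)"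
  let ?F = "\<lambda>n. front_sum n u 2 (replicate v 1 @ 2 # replicate w 1)"
  let ?G = "\<lambda>n. front_sum n w 2 (replicate v 1 @ 2 # replicate u 1)"
  let ?M = "\<lambda>n. \<Sum>b\<le>v. (-1) ^ b * reduced_sum b 2 (replicate w 1) (pos_list n) * ((-1) ^ (u + 2 + (v - b)) * front_sum n (v - b) 2 (replicate u 1))"
  let ?c = "\<lambda>m. real ((k - 1) choose m)"
  define a where "a = (-1) ^ w * ?c (Suc v) - (-1) ^ v * ?c (Suc w) - ?c u"
  define b where "b = (-1) ^ u * ?c (Suc v) - (-1) ^ v * ?c (Suc u) - ?c w"
  have k1: "k = u + v + w + 4" "k = w + v + u + 4" "odd (u + v + w)" using s k by auto
  have A: "(\<lambda>n. 2 * ?A n - a * mzv [k]) \<in> sym_null" unfolding a_def by (rule double_reduced_value[OF k1(1) k])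
  have B: "(\<lambda>n. 2 * ?B n - b * mzv [k]) \<in> sym_null" unfolding b_def by (rule double_reduced_value[OF k1(2) k])
  have F: "(\<lambda>n. ?F n - (-1) ^ u * ?A n) \<in> sym_null" and G: "(\<lambda>n. ?G n - (-1) ^ w * ?B n) \<in> sym_null"
    by (intro front_sum_null reduced_sum_conv)+
  have M: "?M \<in> sym_null" by (rule middle_sum_null[OF k1(3)])
  have N: "(\<lambda>n. of_int 2 * (?F n - (-1) ^ u * ?A n) + of_int ((-1) ^ u) * (2 * ?A n - a * mzv [k]) + of_int 2 * ?M n
      + of_int (2 * (-1) ^ (u + v + w)) * (?G n - (-1) ^ w * ?B n) + of_int ((-1) ^ (u + v)) * (2 * ?B n - b * mzv [k])) \<in> sym_null"
    by (intro S.N_add S.N_scale_int A B F G M)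
  \<comment> \<open>The binomials with \<open>Suc v\<close> cancel between \<open>a\<close> and
    \<open>b\<close>, so the middle run drops out; Pascal's rule joins the others.\<close>
  have coef: "(-1) ^ u * a + (-1) ^ (u + v) * b = (-1) ^ w * real (k choose Suc w) - (-1) ^ u * real (k choose Suc u)"
  proof -
    have p: "real (k choose Suc m) = ?c m + ?c (Suc m)" for m using s by (intro binomial_pascal) simp
    have sg: "(-1::real) ^ u * (-1) ^ w = - ((-1) ^ v)" "(-1::real) ^ u * (-1) ^ v = - ((-1) ^ w)" "(-1::real) ^ (u + v) * (-1) ^ u = (-1) ^ v"
      "(-1::real) ^ (u + v) * (-1) ^ v = (-1) ^ u" "(-1::real) ^ (u + v) = - ((-1) ^ w)"
      using k1(3) by (auto simp: minus_one_power_iff)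
    have "(-1) ^ u * a + (-1) ^ (u + v) * b = ((-1) ^ u * (-1) ^ w) * ?c (Suc v) - ((-1) ^ u * (-1) ^ v) * ?c (Suc w) - (-1) ^ u * ?c u
        + ((-1) ^ (u + v) * (-1) ^ u) * ?c (Suc v) - ((-1) ^ (u + v) * (-1) ^ v) * ?c (Suc u) - (-1) ^ (u + v) * ?c w"
      unfolding a_def b_def by (simp only: right_diff_distrib mult.assoc)
    also have "\<dots> = (-1) ^ w * real (k choose Suc w) - (-1) ^ u * real (k choose Suc u)"
      unfolding sg(1-4) unfolding sg(5) p by (simp add: algebra_simps)
    finally show ?thesis .
  qed
  have sq: "(-1::real) ^ (u + v + w) * (-1) ^ w = (-1) ^ (u + v)" by (auto simp: minus_one_power_iff)
  show "(\<lambda>n. 2 * mhs (sym_list n) (replicate u 1 @ 2 # replicate v 1 @ 2 # replicate w 1)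
       - of_int ((-1) ^ w * int (k choose Suc w) - (-1) ^ u * int (k choose Suc u)) * mzv [k]) \<in> sym_null"
  proof (rule S.N_eqI[OF N])
    fix n
    have c: "of_int ((-1) ^ w * int (k choose Suc w) - (-1) ^ u * int (k choose Suc u)) = (-1) ^ u * a + (-1) ^ (u + v) * b"
      unfolding coef by simp
    have alg: "2 * (F + M + e * G) - (x * a + y * b) * z =
        2 * (F - x * A) + x * (2 * A - a * z) + 2 * M + 2 * e * (G - t * B) + y * (2 * B - b * z)"
      if "e * t = y" for F M e G x y t A B z :: real
      using that[symmetric] by (simp add: algebra_simps)
    show "2 * mhs (sym_list n) (replicate u 1 @ 2 # replicate v 1 @ 2 # replicate w 1)
       - of_int ((-1) ^ w * int (k choose Suc w) - (-1) ^ u * int (k choose Suc u)) * mzv [k] =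
       of_int 2 * (?F n - (-1) ^ u * ?A n) + of_int ((-1) ^ u) * (2 * ?A n - a * mzv [k]) + of_int 2 * ?M n
      + of_int (2 * (-1) ^ (u + v + w)) * (?G n - (-1) ^ w * ?B n) + of_int ((-1) ^ (u + v)) * (2 * ?B n - b * mzv [k])"
      unfolding c sym_double_split of_int_mult of_int_power of_int_minus of_int_1 of_int_numeral
      by (rule alg[OF sq])
  qed
next
  fix u w assume s: "u + w + 3 = k"
  let ?A = "\<lambda>n. reduced_sum u 3 (replicate w 1) (pos_list n)"
  let ?B = "\<lambda>n. reduced_sum w 3 (replicate u 1) (pos_list n)"
  let ?F = "\<lambda>n. front_sum n u 3 (replicate w 1)"
  let ?G = "\<lambda>n. front_sum n w 3 (replicate u 1)"
  let ?c = "\<lambda>m. real ((k - 1) choose m)"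
  define a where "a = (-1) ^ w + ?c (Suc w) - ?c u"
  define b where "b = (-1) ^ u + ?c (Suc u) - ?c w"
  have k1: "k = u + w + 3" "k = w + u + 3" "even (u + w)" using s k by auto
  have A: "(\<lambda>n. 2 * ?A n - a * mzv [k]) \<in> sym_null" unfolding a_def by (rule single_reduced_value[OF k1(1) k])
  have B: "(\<lambda>n. 2 * ?B n - b * mzv [k]) \<in> sym_null" unfolding b_def by (rule single_reduced_value[OF k1(2) k])
  have F: "(\<lambda>n. ?F n - (-1) ^ u * ?A n) \<in> sym_null" and G: "(\<lambda>n. ?G n - (-1) ^ w * ?B n) \<in> sym_null"
    by (intro front_sum_null reduced_sum_conv)+
  have N: "(\<lambda>n. of_int 2 * (?F n - (-1) ^ u * ?A n) + of_int ((-1) ^ u) * (2 * ?A n - a * mzv [k])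
      + of_int (2 * (-1) ^ (u + 3 + w)) * (?G n - (-1) ^ w * ?B n) + of_int ((-1) ^ (u + 1)) * (2 * ?B n - b * mzv [k])) \<in> sym_null"
    by (intro S.N_add S.N_scale_int A B F G)
  \<comment> \<open>Here u and w have the same parity, and the constants (-1)^w and (-1)^u
    cancel.\<close>
  have coef: "(-1) ^ u * a + (-1) ^ (u + 1) * b = (-1) ^ w * real (k choose Suc w) - (-1) ^ u * real (k choose Suc u)"
  proof -
    have p: "real (k choose Suc m) = ?c m + ?c (Suc m)" for m using s by (intro binomial_pascal) simp
    have sg: "(-1::real) ^ (u + 1) = - ((-1) ^ u)" "(-1::real) ^ w = (-1) ^ u"
      using k1(3) by (auto simp: minus_one_power_iff)
    show ?thesis unfolding a_def b_def sg p by (simp add: algebra_simps)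
  qed
  have sq: "(-1::real) ^ (u + 3 + w) * (-1) ^ w = (-1) ^ (u + 1)" by (auto simp: minus_one_power_iff)
  show "(\<lambda>n. 2 * mhs (sym_list n) (replicate u 1 @ 3 # replicate w 1)
       - of_int ((-1) ^ w * int (k choose Suc w) - (-1) ^ u * int (k choose Suc u)) * mzv [k]) \<in> sym_null"
  proof (rule S.N_eqI[OF N])
    fix n
    have c: "of_int ((-1) ^ w * int (k choose Suc w) - (-1) ^ u * int (k choose Suc u)) = (-1) ^ u * a + (-1) ^ (u + 1) * b"
      unfolding coef by simp
    have alg: "2 * (F + e * G) - (x * a + y * b) * z =
        2 * (F - x * A) + x * (2 * A - a * z) + 2 * e * (G - t * B) + y * (2 * B - b * z)"
      if "e * t = y" for F e G x y t A B z :: real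
      using that[symmetric] by (simp add: algebra_simps)
    show "2 * mhs (sym_list n) (replicate u 1 @ 3 # replicate w 1)
       - of_int ((-1) ^ w * int (k choose Suc w) - (-1) ^ u * int (k choose Suc u)) * mzv [k] =
       of_int 2 * (?F n - (-1) ^ u * ?A n) + of_int ((-1) ^ u) * (2 * ?A n - a * mzv [k])
      + of_int (2 * (-1) ^ (u + 3 + w)) * (?G n - (-1) ^ w * ?B n) + of_int ((-1) ^ (u + 1)) * (2 * ?B n - b * mzv [k])"
      unfolding c sym_single_split of_int_mult of_int_power of_int_minus of_int_1 of_int_numeral
      by (rule alg[OF sq])
  qed
qed

section \<open>Passage to the quotient by zeta(2)\<close>

lemma mzv_quot_relI: "x \<in> mzv_space \<Longrightarrow> y \<in> mzv_space \<Longrightarrow> x - y \<in> zeta2_ideal \<Longrightarrow> mzv_quot_rel x y"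
  by (auto simp: mzv_quot_rel_def zeta2_ideal_def)

lemma mod_zeta2_eqI: "x \<in> mzv_space \<Longrightarrow> y \<in> mzv_space \<Longrightarrow> x - y \<in> zeta2_ideal \<Longrightarrow> mod_zeta2 x = mod_zeta2 y"
  by (rule Quotient_rel_abs[OF Quotient_mzv_quot mzv_quot_relI])

lemma mod_zeta2_sum:
  assumes "finite A" "\<And>x. x \<in> A \<Longrightarrow> f x \<in> mzv_space"
  shows "(\<Sum>x\<in>A. mod_zeta2 (f x)) = mod_zeta2 (\<Sum>x\<in>A. f x)"
  using assms
proof (induction A rule: finite_induct)
  case empty
  show ?case by (simp add: zero_mzv_quot_def)
next
  case (insert x A)
  then show ?case
    using plus_mzv_quot.abs_eq[OF mzv_quot_rel_refl mzv_quot_rel_refl, of "f x" "sum f A"] by (simp add: mzv_space_sum)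
qed

lemma scale_mod_zeta2: "x \<in> mzv_space \<Longrightarrow> scale_mzv_quot q (mod_zeta2 x) = mod_zeta2 (of_rat q * x)"
  by (rule scale_mzv_quot.abs_eq[OF mzv_quot_rel_refl])

lemma sum_formula_S:
  fixes k r i j :: nat
  assumes "odd k" and "3 \<le> k" and "1 \<le> i" and "i \<le> j" and "j \<le> r" and "r \<le> k - 2"
  shows "(\<Sum>ks\<in>index_set k r i j. zeta_S ks)
           = scale_mzv_quot ((-1) ^ r) (\<Sum>ks\<in>index_set k r i j. zeta_star_S ks)"
    and "(\<Sum>ks\<in>index_set k r i j. zeta_S ks)
           = scale_mzv_quot (1 / 2 * of_int (N_coeff (int k) (int r) (int i) (int j))) (Zfrak_S k)"
proof -
  let ?I = "index_set k r i j"
  define V where "V = (\<Sum>ks\<in>?I. sym_value ks)"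
  define V' where "V' = (\<Sum>ks\<in>?I. sym_star_value ks)"
  define c where "c = N_coeff (int k) (int r) (int i) (int j)"
  have fin: "finite ?I" by (rule finite_index_set[OF assms(3-5)])
  have sp: "sym_value ks \<in> mzv_space" "sym_star_value ks \<in> mzv_space" if "ks \<in> ?I" for ks
    using sym_value_space is_index_index_set[OF that] by blast+
  have V: "V \<in> mzv_space" "V' \<in> mzv_space"
    unfolding V_def V'_def using sp by (auto intro: mzv_space_sum)
  have z: "mzv [k] \<in> mzv_space" using assms by (intro mzv_space_mzv) (simp add: admissible_def)
  have ZS: "(\<Sum>ks\<in>?I. zeta_S ks) = mod_zeta2 V" "(\<Sum>ks\<in>?I. zeta_star_S ks) = mod_zeta2 V'"
    unfolding zeta_S_def zeta_star_S_def sym_value_def[symmetric] sym_star_value_def[symmetric] V_def V'_def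
    by (intro mod_zeta2_sum fin sp; simp)+
  have lim: "(\<lambda>n. \<Sum>ks\<in>?I. mhs (sym_list n) ks) \<longlonglongrightarrow> V" "(\<lambda>n. \<Sum>ks\<in>?I. mhs_star (sym_list n) ks) \<longlonglongrightarrow> V'"
    unfolding V_def V'_def sym_value_def sym_star_value_def
    by (intro tendsto_sum sym_list_limit sym_list_star_limit is_index_index_set; assumption)+
  \<comment> \<open>Uniqueness of limits turns membership in \<open>sym_null\<close> into a
    congruence between the limits themselves.\<close>
  have null: "l \<in> zeta2_ideal" if "a \<in> sym_null" "a \<longlonglongrightarrow> l" for a l
    using that LIMSEQ_unique unfolding sym_null_def by blast
  have "(\<lambda>n. (\<Sum>ks\<in>?I. mhs_star (sym_list n) ks) - (-1) ^ r * (\<Sum>ks\<in>?I. mhs (sym_list n) ks)) \<in> sym_null"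
    by (rule S.star_N[OF assms(1,3,4,5) sym_even_N])
  then have 1: "V' - (-1) ^ r * V \<in> zeta2_ideal"
    by (rule null) (intro tendsto_diff tendsto_mult tendsto_const lim)
  have "(\<lambda>n. 2 * (\<Sum>ks\<in>?I. mhs (sym_list n) ks) - of_int c * mzv [k]) \<in> sym_null"
    unfolding c_def by (rule S.value_N[OF assms sym_extremal_values[OF assms(1)]])
  then have 2: "2 * V - of_int c * mzv [k] \<in> zeta2_ideal"
    by (rule null) (intro tendsto_diff tendsto_mult tendsto_const lim)
  have sgn: "(of_rat ((-1) ^ r) :: real) = (-1) ^ r" by (simp add: of_rat_power of_rat_minus)
  have "V - of_rat ((-1) ^ r) * V' \<in> zeta2_ideal"
  proof -
    have "of_int (- ((-1) ^ r)) * (V' - (-1) ^ r * V) \<in> zeta2_ideal" by (rule zeta2_ideal_scale_int[OF 1])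
    moreover have "of_int (- ((-1) ^ r)) * (V' - (-1) ^ r * V) = V - of_rat ((-1) ^ r) * V'"
      unfolding sgn by (simp add: right_diff_distrib mult.assoc[symmetric] power_mult_distrib[symmetric])
    ultimately show ?thesis by simp
  qed
  then show "(\<Sum>ks\<in>?I. zeta_S ks) = scale_mzv_quot ((-1) ^ r) (\<Sum>ks\<in>?I. zeta_star_S ks)"
    unfolding ZS scale_mod_zeta2[OF V(2)] by (intro mod_zeta2_eqI V mzv_space_scale)
  have q: "(of_rat (1 / 2 * of_int c) :: real) = 1 / 2 * of_int c"
    by (simp add: of_rat_mult of_rat_divide)
  have "V - of_rat (1 / 2 * of_int c) * mzv [k] \<in> zeta2_ideal"
  proof -
    have "of_rat (1 / 2) * (2 * V - of_int c * mzv [k]) \<in> zeta2_ideal" by (rule zeta2_ideal_scale[OF 2])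
    moreover have "of_rat (1 / 2) * (2 * V - of_int c * mzv [k]) = V - of_rat (1 / 2 * of_int c) * mzv [k]"
      unfolding q by (simp add: of_rat_divide algebra_simps)
    ultimately show ?thesis by simp
  qed
  then show "(\<Sum>ks\<in>?I. zeta_S ks) = scale_mzv_quot (1 / 2 * of_int (N_coeff (int k) (int r) (int i) (int j))) (Zfrak_S k)"
    unfolding ZS Zfrak_S_def scale_mod_zeta2[OF z] c_def[symmetric] by (intro mod_zeta2_eqI V z mzv_space_scale)
qed

theorem theorem3p1:
  fixes k r i j :: nat
  assumes "odd k" and "3 \<le> k"
    and "1 \<le> i" and "i \<le> j" and "j \<le> r" and "r \<le> k - 2"
  shows "(\<Sum>ks\<in>index_set k r i j. zeta_A ks)
           = scale_finite_adele ((-1) ^ r) (\<Sum>ks\<in>index_set k r i j. zeta_star_A ks)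
       \<and> (\<Sum>ks\<in>index_set k r i j. zeta_A ks)
           = scale_finite_adele (1 / 2 * of_int (N_coeff (int k) (int r) (int i) (int j))) (Zfrak_A k)
       \<and> (\<Sum>ks\<in>index_set k r i j. zeta_S ks)
           = scale_mzv_quot ((-1) ^ r) (\<Sum>ks\<in>index_set k r i j. zeta_star_S ks)
       \<and> (\<Sum>ks\<in>index_set k r i j. zeta_S ks)
           = scale_mzv_quot (1 / 2 * of_int (N_coeff (int k) (int r) (int i) (int j))) (Zfrak_S k)"
  using sum_formula_A[OF assms] sum_formula_S[OF assms] by (intro conjI)

end
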